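(* Let $(L,A)$ be a Lie pair with decomposition $L\cong A\oplus B$, $B=L/A$. Then the subspace $$\mathrm{Der}(L,A):=\ker\kappa=\{\delta\in\mathrm{Der}(L)\mid\delta\,\Gamma(A)\subset\Gamma(A)\}$$ is a Lie algebra, and it acts by derivation on the graded Lie algebra $H\big(\Omega_A^\bullet(B),[\cdot]_1=d_A^{\mathrm{Bott}}\big)=H_{\mathrm{CE}}(A;B)$, via $\delta\triangleright\overline X=\overline{\delta\triangleright X}$ for $d_A^{\mathrm{Bott}}$-closed $X$; that is, this is a well-defined Lie algebra action and $\delta\triangleright[\overline X_1,\overline X_2]=[\delta\triangleright\overline X_1,\overline X_2]+[\overline X_1,\delta\triangleright\overline X_2]$ for all $\delta\in\mathrm{Der}(L,A)$ and all classes $\overline X_1,\overline X_2$.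
   Context: $\mathbb K$ is $\mathbb R$ or $\mathbb C$. A Lie algebroid over a smooth manifold $M$ is a $\mathbb K$-vector bundle $E\to M$ with anchor $\rho_E:E\to TM\otimes_{\mathbb R}\mathbb K$ and a $\mathbb K$-Lie bracket $[\cdot,\cdot]_E$ on $\Gamma(E)$ such that $\rho_E$ is a Lie algebra homomorphism on sections and $[u,fv]_E=(\rho_E(u)f)v+f[u,v]_E$. A Lie pair $(L,A)$ is a Lie algebroid $L$ with a Lie subalgebroid $A$ over the same base. Choosing a complement, identify $B=L/A$ with a subbundle of $L$, $L\cong A\oplus B$, with projections $\mathrm{pr}_A,\mathrm{pr}_B$. For $a\in\Gamma(A)$, $b,b'\in\Gamma(B)$ set $\nabla_ab=\mathrm{pr}_B[a,b]_L$, $\eth_ba=\mathrm{pr}_A[b,a]_L$, $[b,b']_B=\mathrm{pr}_B[b,b']_L$. $\eth_b$ acts on $\Gamma(A^\vee)$ by $\langle\eth_bu,a\rangle=\rho_L(b)\langle u,a\rangle-\langle u,\eth_ba\rangle$, on functions by $\rho_L(b)$, and extends as a derivation to $\Gamma(\Lambda^\bullet A^\vee)$. $\Omega_A^k=\Gamma(\Lambda^kA^\vee)$, $\Omega_A^k(B)=\Gamma(\Lambda^kA^\vee\otimes B)$ (degree $k$), with $\omega\cdot(\lambda\otimes b)=(\omega\wedge\lambda)\otimes b$. $\Omega^\bullet_A(B)$ is an $L_\infty$ algebra (with brackets $[\cdot]_1,[\cdot,\cdot]_2,[\cdot,\cdot,\cdot]_3$) whose unary bracket is $(d_A^{\mathrm{Bott}}X)(a_1,\dots,a_{k+1})=\sum_i(-1)^{i+1}\nabla_{a_i}(X(\dots,\hat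 a_i,\dots))+\sum_{i<j}(-1)^{i+j}X([a_i,a_j]_A,\dots,\hat a_i,\dots,\hat a_j,\dots)$ and whose binary bracket is graded skew-symmetric and generated by $[b,b']_2=[b,b']_B$ and $[X,\omega\cdot Y]_2=(\rho_1(X)\omega)\cdot Y+(-1)^{|\omega||X|}\omega\cdot[X,Y]_2$ with $\rho_1(\lambda\otimes b)\omega=\lambda\wedge\eth_b\omega$. The cohomology $H_{\mathrm{CE}}(A;B)$ of $d_A^{\mathrm{Bott}}$ is a graded Lie algebra with bracket $[\cdot,\cdot]$ induced from $[\cdot,\cdot]_2$; $\overline X$ denotes the class of $X$. A derivation of $L$ is an operator $\delta:\Gamma(L)\to\Gamma(L)$ with a symbol $s\in\mathscr X(M)\otimes\mathbb K$ such that $\delta(fu)=s(f)u+f\delta(u)$, $[s,\rho_L(u)]=\rho_L(\delta(u))$, $\delta[u,v]_L=[\delta(u),v]_L+[u,\delta(v)]_L$. $\mathrm{Der}(L)$ is the Lie algebra of derivations under the commutator. Set $\kappa:\mathrm{Der}(L)\to\Omega^1_A(B)$, $\kappa(\delta)(a)=-\mathrm{pr}_B\delta(a)$, and for $X\in\Omega_A^k(B)$ (including $k=0$) $(\delta\triangleright X)(a_1,\dots,a_k)=-\sum_{j=1}^kX(a_1,\dots,\mathrm{pr}_A\delta(a_j),\dots,a_k)+\mathrm{pr}_B\delta(X(a_1,\dots,a_k))$. *)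

theory Defs
  imports "HOL-Analysis.Analysis" "HOL-Library.Function_Algebras"
begin

text \<open>
  The ground field is a type \<open>'k\<close> of sort \<open>{real_normed_field, euclidean_space}\<close>: a
  finite-dimensional field extension of the reals, i.e. the reals or the complex numbers (both types
  are instances). A manifold is a whole type \<open>'m\<close> with its class topology and an atlas with values
  in \<open>R^n\<close>, realised inside \<open>nat \<Rightarrow> real\<close> so that the dimension \<open>n = 0\<close> is included. The fibres of
  a vector bundle are subspaces of one (arbitrary, possibly infinite-dimensional) vector space.
  Functions are added pointwise (Function_Algebras).
\<close>

section \<open>Smooth manifolds\<close>

definition Rn :: "nat \<Rightarrow> (nat \<Rightarrow> real) set" where
  "Rn n = {x. \<forall>i\<ge>n. x i = 0}"

definition partial :: "nat \<Rightarrow> ((nat \<Rightarrow> real) \<Rightarrow> 'k::real_normed_vector) \<Rightarrow> (nat \<Rightarrow> real) \<Rightarrow> 'k" where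
  "partial i g x = vector_derivative (\<lambda>t. g (x(i := t))) (at (x i))"

text \<open>\<open>W\<close> is meant to be a (relatively) open subset of \<open>Rn n\<close>.\<close>

primrec Ck_on :: "nat \<Rightarrow> nat \<Rightarrow> (nat \<Rightarrow> real) set \<Rightarrow> ((nat \<Rightarrow> real) \<Rightarrow> 'k::real_normed_vector) \<Rightarrow> bool" where
  "Ck_on 0 n W g \<longleftrightarrow> continuous_on W g"
| "Ck_on (Suc k) n W g \<longleftrightarrow> continuous_on W g \<and>
     (\<forall>i<n. (\<forall>x\<in>W. (\<lambda>t. g (x(i := t))) differentiable (at (x i))) \<and> Ck_on k n W (partial i g))"

definition Cinf_on :: "nat \<Rightarrow> (nat \<Rightarrow> real) set \<Rightarrow> ((nat \<Rightarrow> real) \<Rightarrow> 'k::real_normed_vector) \<Rightarrow> bool" where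
  "Cinf_on n W g \<longleftrightarrow> (\<forall>k. Ck_on k n W g)"

record 'm manifold =
  mdim :: nat
  atlas :: "('m set \<times> ('m \<Rightarrow> nat \<Rightarrow> real)) set"

definition smooth_manifold ::
  "('m::{t2_space, second_countable_topology}, 'z) manifold_scheme \<Rightarrow> bool" where
  "smooth_manifold M \<longleftrightarrow>
     \<Union> (fst ` atlas M) = UNIV \<and>
     (\<forall>(U, \<phi>)\<in>atlas M. open U \<and> openin (top_of_set (Rn (mdim M))) (\<phi> ` U) \<and>
        homeomorphism U (\<phi> ` U) \<phi> (inv_into U \<phi>)) \<and>
     (\<forall>(U, \<phi>)\<in>atlas M. \<forall>(V, \<psi>)\<in>atlas M. \<forall>i<mdim M.
        Cinf_on (mdim M) (\<phi> ` (U \<inter> V)) (\<lambda>x. \<psi> (inv_into U \<phi> x) i))"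

definition smooth_fun_on ::
  "('m::topological_space, 'z) manifold_scheme \<Rightarrow> 'm set \<Rightarrow> ('m \<Rightarrow> 'k::real_normed_vector) \<Rightarrow> bool" where
  "smooth_fun_on M S f \<longleftrightarrow>
     (\<forall>(U, \<phi>)\<in>atlas M. Cinf_on (mdim M) (\<phi> ` (U \<inter> S)) (\<lambda>x. f (inv_into U \<phi> x)))"

definition smooth_funs ::
  "('m::topological_space, 'z) manifold_scheme \<Rightarrow> ('m \<Rightarrow> 'k::real_normed_vector) set" where
  "smooth_funs M = {f. smooth_fun_on M UNIV f}"

text \<open>The fibre of \<open>TM \<otimes> K\<close> at \<open>p\<close>: \<open>K\<close>-linear derivations at \<open>p\<close> of the \<open>K\<close>-valued smooth functions.
  Only the values on smooth functions matter.\<close>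

definition tangent ::
  "('m::topological_space, 'z) manifold_scheme \<Rightarrow> 'm \<Rightarrow> (('m \<Rightarrow> 'k::real_normed_field) \<Rightarrow> 'k) set" where
  "tangent M p = {v. \<forall>f\<in>smooth_funs M. \<forall>g\<in>smooth_funs M.
      v (\<lambda>x. f x + g x) = v f + v g \<and> (\<forall>c. v (\<lambda>x. c * f x) = c * v f) \<and>
      v (\<lambda>x. f x * g x) = f p * v g + v f * g p}"

definition vector_fields ::
  "('m::topological_space, 'z) manifold_scheme \<Rightarrow> ('m \<Rightarrow> ('m \<Rightarrow> 'k::real_normed_field) \<Rightarrow> 'k) set" where
  "vector_fields M =
     {s. (\<forall>p. s p \<in> tangent M p) \<and> (\<forall>f\<in>smooth_funs M. (\<lambda>p. s p f) \<in> smooth_funs M)}"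

text \<open>The action \<open>s(f)\<close> of a vector field on a function.\<close>

definition vf_app :: "('m \<Rightarrow> ('m \<Rightarrow> 'k) \<Rightarrow> 'k) \<Rightarrow> ('m \<Rightarrow> 'k) \<Rightarrow> 'm \<Rightarrow> 'k" where
  "vf_app s f = (\<lambda>p. s p f)"

section \<open>Vector bundles\<close>

text \<open>A local trivialisation \<open>(U, r, \<tau>)\<close> consists of linear isomorphisms \<open>\<tau> p\<close> from the fibre at \<open>p\<close>
  to \<open>K^r\<close>, for \<open>p \<in> U\<close>.\<close>

record ('m, 'k, 'v) vbundle = "'m manifold" +
  scl :: "'k \<Rightarrow> 'v \<Rightarrow> 'v"
  fib :: "'m \<Rightarrow> 'v set"
  trivs :: "('m set \<times> nat \<times> ('m \<Rightarrow> 'v \<Rightarrow> nat \<Rightarrow> 'k)) set"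

definition Kn :: "nat \<Rightarrow> (nat \<Rightarrow> 'k::zero) set" where
  "Kn r = {c. \<forall>i\<ge>r. c i = 0}"

definition local_triv ::
  "('m::topological_space, 'k::real_normed_field, 'v::ab_group_add, 'z) vbundle_scheme
   \<Rightarrow> 'm set \<Rightarrow> nat \<Rightarrow> ('m \<Rightarrow> 'v \<Rightarrow> nat \<Rightarrow> 'k) \<Rightarrow> bool" where
  "local_triv E U r \<tau> \<longleftrightarrow> open U \<and>
     (\<forall>p\<in>U. bij_betw (\<tau> p) (fib E p) (Kn r) \<and>
        (\<forall>v\<in>fib E p. \<forall>w\<in>fib E p. \<forall>i. \<tau> p (v + w) i = \<tau> p v i + \<tau> p w i) \<and>
        (\<forall>c. \<forall>v\<in>fib E p. \<forall>i. \<tau> p (scl E c v) i = c * \<tau> p v i))"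

text \<open>Smoothness of the matrix entries of \<open>\<sigma> p \<circ> (\<tau> p)\<^sup>-\<^sup>1 : K^r \<rightarrow> K^s\<close>.\<close>

definition smooth_transition ::
  "('m::topological_space, 'k::real_normed_field, 'v::ab_group_add, 'z) vbundle_scheme
   \<Rightarrow> 'm set \<Rightarrow> nat \<Rightarrow> ('m \<Rightarrow> 'v \<Rightarrow> nat \<Rightarrow> 'k) \<Rightarrow> 'm set \<Rightarrow> nat \<Rightarrow> ('m \<Rightarrow> 'v \<Rightarrow> nat \<Rightarrow> 'k) \<Rightarrow> bool" where
  "smooth_transition E U r \<tau> V s \<sigma> \<longleftrightarrow>
     (\<forall>i<s. \<forall>j<r. smooth_fun_on E (U \<inter> V)
        (\<lambda>p. \<sigma> p (inv_into (fib E p) (\<tau> p) (\<lambda>l. if l = j then 1 else 0)) i))"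

definition vector_bundle ::
  "('m::{t2_space, second_countable_topology}, 'k::real_normed_field, 'v::ab_group_add, 'z) vbundle_scheme
   \<Rightarrow> bool" where
  "vector_bundle E \<longleftrightarrow> smooth_manifold E \<and> vector_space (scl E) \<and>
     (\<forall>p. module.subspace (scl E) (fib E p)) \<and>
     \<Union> (fst ` trivs E) = UNIV \<and>
     (\<forall>(U, r, \<tau>)\<in>trivs E. local_triv E U r \<tau>) \<and>
     (\<forall>(U, r, \<tau>)\<in>trivs E. \<forall>(V, s, \<sigma>)\<in>trivs E. smooth_transition E U r \<tau> V s \<sigma>)"

definition sections ::
  "('m::topological_space, 'k::real_normed_field, 'v::ab_group_add, 'z) vbundle_scheme
   \<Rightarrow> ('m \<Rightarrow> 'v) set" where
  "sections E = {u. (\<forall>p. u p \<in> fib E p) \<and>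
     (\<forall>(U, r, \<tau>)\<in>trivs E. \<forall>i<r. smooth_fun_on E U (\<lambda>p. \<tau> p (u p) i))}"

definition fmul ::
  "('m, 'k, 'v, 'z) vbundle_scheme \<Rightarrow> ('m \<Rightarrow> 'k) \<Rightarrow> ('m \<Rightarrow> 'v) \<Rightarrow> 'm \<Rightarrow> 'v" where
  "fmul E f u = (\<lambda>p. scl E (f p) (u p))"

abbreviation cmul ::
  "('m, 'k, 'v, 'z) vbundle_scheme \<Rightarrow> 'k \<Rightarrow> ('m \<Rightarrow> 'v) \<Rightarrow> 'm \<Rightarrow> 'v" where
  "cmul E c \<equiv> fmul E (\<lambda>_. c)"

text \<open>Around each point, the bundle has a trivialisation, compatible with the given ones,
  which maps the subbundle onto \<open>K^s \<subseteq> K^r\<close>.\<close>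

definition subbundle ::
  "('m::topological_space, 'k::real_normed_field, 'v::ab_group_add, 'z) vbundle_scheme
   \<Rightarrow> ('m \<Rightarrow> 'v set) \<Rightarrow> bool" where
  "subbundle E A \<longleftrightarrow>
     (\<forall>p. A p \<subseteq> fib E p \<and> module.subspace (scl E) (A p)) \<and>
     (\<forall>p\<^sub>0. \<exists>U r \<tau> s. p\<^sub>0 \<in> U \<and> local_triv E U r \<tau> \<and>
        (\<forall>(V, q, \<sigma>)\<in>trivs E. smooth_transition E U r \<tau> V q \<sigma> \<and> smooth_transition E V q \<sigma> U r \<tau>) \<and>
        (\<forall>p\<in>U. \<tau> p ` A p = Kn s))"

definition subsections ::
  "('m::topological_space, 'k::real_normed_field, 'v::ab_group_add, 'z) vbundle_scheme
   \<Rightarrow> ('m \<Rightarrow> 'v set) \<Rightarrow> ('m \<Rightarrow> 'v) set" where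
  "subsections E A = {u\<in>sections E. \<forall>p. u p \<in> A p}"

section \<open>Lie algebroids and Lie pairs\<close>

definition lie_algebra_on ::
  "('k::field \<Rightarrow> 'a \<Rightarrow> 'a) \<Rightarrow> 'a set \<Rightarrow> ('a \<Rightarrow> 'a \<Rightarrow> 'a::ab_group_add) \<Rightarrow> bool" where
  "lie_algebra_on sc S br \<longleftrightarrow> vector_space sc \<and> module.subspace sc S \<and>
     (\<forall>x\<in>S. \<forall>y\<in>S. br x y \<in> S) \<and>
     (\<forall>x\<in>S. \<forall>y\<in>S. \<forall>z\<in>S. br (x + y) z = br x z + br y z \<and> br x (y + z) = br x y + br x z) \<and>
     (\<forall>c. \<forall>x\<in>S. \<forall>y\<in>S. br (sc c x) y = sc c (br x y) \<and> br x (sc c y) = sc c (br x y)) \<and>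
     (\<forall>x\<in>S. br x x = 0) \<and>
     (\<forall>x\<in>S. \<forall>y\<in>S. \<forall>z\<in>S. br x (br y z) + br y (br z x) + br z (br x y) = 0)"

text \<open>The anchor is a family of maps \<open>fib p \<rightarrow> (TM \<otimes> K) p\<close>; the bracket is only relevant on sections.\<close>

record ('m, 'k, 'v) algebroid = "('m, 'k, 'v) vbundle" +
  anchor :: "'m \<Rightarrow> 'v \<Rightarrow> ('m \<Rightarrow> 'k) \<Rightarrow> 'k"
  lbr :: "('m \<Rightarrow> 'v) \<Rightarrow> ('m \<Rightarrow> 'v) \<Rightarrow> 'm \<Rightarrow> 'v"

text \<open>\<open>rho E u f\<close> is the function \<open>\<rho>(u)f\<close>, for a section \<open>u\<close>.\<close>

definition rho ::
  "('m, 'k, 'v, 'z) algebroid_scheme \<Rightarrow> ('m \<Rightarrow> 'v) \<Rightarrow> ('m \<Rightarrow> 'k) \<Rightarrow> 'm \<Rightarrow> 'k" where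
  "rho E u f = (\<lambda>p. anchor E p (u p) f)"

definition lie_algebroid ::
  "('m::{t2_space, second_countable_topology}, 'k::real_normed_field, 'v::ab_group_add, 'z) algebroid_scheme
   \<Rightarrow> bool" where
  "lie_algebroid E \<longleftrightarrow> vector_bundle E \<and>
     (\<forall>p. \<forall>v\<in>fib E p. anchor E p v \<in> tangent E p) \<and>
     (\<forall>p. \<forall>v\<in>fib E p. \<forall>w\<in>fib E p. \<forall>f\<in>smooth_funs E.
        anchor E p (v + w) f = anchor E p v f + anchor E p w f) \<and>
     (\<forall>p c. \<forall>v\<in>fib E p. \<forall>f\<in>smooth_funs E. anchor E p (scl E c v) f = c * anchor E p v f) \<and>
     (\<forall>u\<in>sections E. \<forall>f\<in>smooth_funs E. rho E u f \<in> smooth_funs E) \<and>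
     lie_algebra_on (cmul E) (sections E) (lbr E) \<and>
     (\<forall>u\<in>sections E. \<forall>v\<in>sections E. \<forall>f\<in>smooth_funs E.
        rho E (lbr E u v) f = rho E u (rho E v f) - rho E v (rho E u f)) \<and>
     (\<forall>u\<in>sections E. \<forall>v\<in>sections E. \<forall>f\<in>smooth_funs E.
        lbr E u (fmul E f v) = fmul E (rho E u f) v + fmul E f (lbr E u v))"

text \<open>A Lie pair \<open>(L, A)\<close> together with a complement \<open>B\<close> of \<open>A\<close> in \<open>L\<close>, i.e. an isomorphism
  \<open>L \<cong> A \<oplus> B\<close> of vector bundles identifying \<open>L/A\<close> with the subbundle \<open>B\<close>.\<close>

record ('m, 'k, 'v) lie_pair = "('m, 'k, 'v) algebroid" +
  subA :: "'m \<Rightarrow> 'v set"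
  subB :: "'m \<Rightarrow> 'v set"

abbreviation secA ::
  "('m::topological_space, 'k::real_normed_field, 'v::ab_group_add, 'z) lie_pair_scheme \<Rightarrow> ('m \<Rightarrow> 'v) set" where
  "secA P \<equiv> subsections P (subA P)"

abbreviation secB ::
  "('m::topological_space, 'k::real_normed_field, 'v::ab_group_add, 'z) lie_pair_scheme \<Rightarrow> ('m \<Rightarrow> 'v) set" where
  "secB P \<equiv> subsections P (subB P)"

definition prA ::
  "('m, 'k, 'v::ab_group_add, 'z) lie_pair_scheme \<Rightarrow> ('m \<Rightarrow> 'v) \<Rightarrow> 'm \<Rightarrow> 'v" where
  "prA P u = (\<lambda>p. THE a. a \<in> subA P p \<and> (\<exists>b\<in>subB P p. u p = a + b))"

definition prB ::
  "('m, 'k, 'v::ab_group_add, 'z) lie_pair_scheme \<Rightarrow> ('m \<Rightarrow> 'v) \<Rightarrow> 'm \<Rightarrow> 'v" where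
  "prB P u = (\<lambda>p. THE b. b \<in> subB P p \<and> (\<exists>a\<in>subA P p. u p = a + b))"

definition split_lie_pair ::
  "('m::{t2_space, second_countable_topology}, 'k::real_normed_field, 'v::ab_group_add, 'z) lie_pair_scheme
   \<Rightarrow> bool" where
  "split_lie_pair P \<longleftrightarrow> lie_algebroid P \<and>
     subbundle P (subA P) \<and> (\<forall>a\<in>secA P. \<forall>a'\<in>secA P. lbr P a a' \<in> secA P) \<and>
     subbundle P (subB P) \<and>
     (\<forall>p. subA P p \<inter> subB P p = {0} \<and> fib P p = {a + b | a b. a \<in> subA P p \<and> b \<in> subB P p}) \<and>
     (\<forall>u\<in>sections P. prA P u \<in> sections P \<and> prB P u \<in> sections P)"

definition nabla ::
  "('m, 'k, 'v::ab_group_add, 'z) lie_pair_scheme \<Rightarrow> ('m \<Rightarrow> 'v) \<Rightarrow> ('m \<Rightarrow> 'v) \<Rightarrow> 'm \<Rightarrow> 'v" where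
  "nabla P a b = prB P (lbr P a b)"

definition eth ::
  "('m, 'k, 'v::ab_group_add, 'z) lie_pair_scheme \<Rightarrow> ('m \<Rightarrow> 'v) \<Rightarrow> ('m \<Rightarrow> 'v) \<Rightarrow> 'm \<Rightarrow> 'v" where
  "eth P b a = prA P (lbr P b a)"

definition brB ::
  "('m, 'k, 'v::ab_group_add, 'z) lie_pair_scheme \<Rightarrow> ('m \<Rightarrow> 'v) \<Rightarrow> ('m \<Rightarrow> 'v) \<Rightarrow> 'm \<Rightarrow> 'v" where
  "brB P b b' = prB P (lbr P b b')"

section \<open>Forms on A\<close>

definition alt_multilinear ::
  "('k \<Rightarrow> 'v \<Rightarrow> 'v::ab_group_add) \<Rightarrow> ('k \<Rightarrow> 'w \<Rightarrow> 'w::ab_group_add) \<Rightarrow> 'v set \<Rightarrow> 'w set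
   \<Rightarrow> nat \<Rightarrow> ('v list \<Rightarrow> 'w) \<Rightarrow> bool" where
  "alt_multilinear sV sW V W k h \<longleftrightarrow> (\<forall>vs. length vs = k \<and> set vs \<subseteq> V \<longrightarrow>
     h vs \<in> W \<and>
     (\<forall>i<k. \<forall>v\<in>V. \<forall>w\<in>V. h (vs[i := v + w]) = h (vs[i := v]) + h (vs[i := w])) \<and>
     (\<forall>i<k. \<forall>c. \<forall>v\<in>V. h (vs[i := sV c v]) = sW c (h (vs[i := v]))) \<and>
     (\<forall>i<k. \<forall>j<k. i \<noteq> j \<and> vs ! i = vs ! j \<longrightarrow> h vs = 0))"

text \<open>
  Sections of \<open>\<Lambda>^k A\<^sup>\<or> \<otimes> F\<close>, where \<open>F p \<subseteq> 'w\<close> are the fibres of a bundle with smooth sections \<open>\<Gamma>\<close>: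
  families \<open>\<xi> p\<close> of alternating \<open>k\<close>-linear maps from \<open>A p\<close> to \<open>F p\<close> that are smooth in \<open>p\<close>.
  Such a section is represented by the operator \<open>X\<close> it induces on lists of \<open>k\<close> sections of \<open>A\<close>.
  All other lists are mapped to \<open>0\<close>, hence the degree need not be recorded in the operations below.
\<close>

definition forms ::
  "('m::topological_space, 'k::real_normed_field, 'v::ab_group_add, 'z) lie_pair_scheme
   \<Rightarrow> ('k \<Rightarrow> 'w \<Rightarrow> 'w) \<Rightarrow> ('m \<Rightarrow> 'w set) \<Rightarrow> ('m \<Rightarrow> 'w::ab_group_add) set \<Rightarrow> nat
   \<Rightarrow> (('m \<Rightarrow> 'v) list \<Rightarrow> 'm \<Rightarrow> 'w) set" where
  "forms P sW F \<Gamma> k = {X.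
     (\<forall>as. \<not> (length as = k \<and> set as \<subseteq> secA P) \<longrightarrow> X as = 0) \<and>
     (\<forall>as. length as = k \<and> set as \<subseteq> secA P \<longrightarrow> X as \<in> \<Gamma>) \<and>
     (\<exists>\<xi>. (\<forall>p. alt_multilinear (scl P) sW (subA P p) (F p) k (\<xi> p)) \<and>
        (\<forall>as p. length as = k \<and> set as \<subseteq> secA P \<longrightarrow> X as p = \<xi> p (map (\<lambda>a. a p) as)))}"

definition Omega ::
  "('m::topological_space, 'k::real_normed_field, 'v::ab_group_add, 'z) lie_pair_scheme
   \<Rightarrow> nat \<Rightarrow> (('m \<Rightarrow> 'v) list \<Rightarrow> 'm \<Rightarrow> 'k) set" where
  "Omega P k = forms P (*) (\<lambda>p. UNIV) (smooth_funs P) k"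

definition OmegaB ::
  "('m::topological_space, 'k::real_normed_field, 'v::ab_group_add, 'z) lie_pair_scheme
   \<Rightarrow> nat \<Rightarrow> (('m \<Rightarrow> 'v) list \<Rightarrow> 'm \<Rightarrow> 'v) set" where
  "OmegaB P k = forms P (scl P) (subB P) (secB P) k"

text \<open>The functions, respectively sections of \<open>B\<close>, as forms of degree \<open>0\<close>.\<close>

definition form0 :: "('m \<Rightarrow> 'w) \<Rightarrow> ('m \<Rightarrow> 'v) list \<Rightarrow> 'm \<Rightarrow> 'w::zero" where
  "form0 b as = (if as = [] then b else 0)"

text \<open>
  Wedge product as a signed sum over shuffles, without factorials (the normalisation for which
  the formula for the differential below is a derivation). A shuffle is given by the set \<open>S\<close> of
  indices of the arguments of \<open>\<omega>\<close>; terms with the wrong number of arguments vanish.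
\<close>

definition shuffle_sign :: "nat \<Rightarrow> nat set \<Rightarrow> 'k::ring_1" where
  "shuffle_sign n S = (-1) ^ card {(i, j). i \<in> S \<and> j \<in> {..<n} - S \<and> j < i}"

definition wedge ::
  "('k \<Rightarrow> 'w \<Rightarrow> 'w) \<Rightarrow> (('m \<Rightarrow> 'v) list \<Rightarrow> 'm \<Rightarrow> 'k::ring_1) \<Rightarrow> (('m \<Rightarrow> 'v) list \<Rightarrow> 'm \<Rightarrow> 'w)
   \<Rightarrow> ('m \<Rightarrow> 'v) list \<Rightarrow> 'm \<Rightarrow> 'w::ab_group_add" where
  "wedge m \<omega> X as = (\<lambda>p. \<Sum>S\<in>Pow {..<length as}.
     m (shuffle_sign (length as) S) (m (\<omega> (nths as S) p) (X (nths as (- S)) p)))"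

abbreviation wedgeK ::
  "(('m \<Rightarrow> 'v) list \<Rightarrow> 'm \<Rightarrow> 'k::ring_1) \<Rightarrow> (('m \<Rightarrow> 'v) list \<Rightarrow> 'm \<Rightarrow> 'k)
   \<Rightarrow> ('m \<Rightarrow> 'v) list \<Rightarrow> 'm \<Rightarrow> 'k" where
  "wedgeK \<equiv> wedge (*)"

abbreviation wedgeB ::
  "('m, 'k::ring_1, 'v::ab_group_add, 'z) lie_pair_scheme \<Rightarrow> (('m \<Rightarrow> 'v) list \<Rightarrow> 'm \<Rightarrow> 'k)
   \<Rightarrow> (('m \<Rightarrow> 'v) list \<Rightarrow> 'm \<Rightarrow> 'v) \<Rightarrow> ('m \<Rightarrow> 'v) list \<Rightarrow> 'm \<Rightarrow> 'v" where
  "wedgeB P \<equiv> wedge (scl P)"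

text \<open>Multiplication of \<open>B\<close>-valued forms by constants.\<close>

definition cmulB ::
  "('m, 'k, 'v, 'z) lie_pair_scheme \<Rightarrow> 'k \<Rightarrow> (('m \<Rightarrow> 'v) list \<Rightarrow> 'm \<Rightarrow> 'v)
   \<Rightarrow> ('m \<Rightarrow> 'v) list \<Rightarrow> 'm \<Rightarrow> 'v" where
  "cmulB P c X = (\<lambda>as. cmul P c (X as))"

definition del :: "nat \<Rightarrow> 'a list \<Rightarrow> 'a list" where
  "del i xs = take i xs @ drop (Suc i) xs"

text \<open>Indices of arguments start at \<open>0\<close> here, so the sign of the \<open>i\<close>-th summand of the first sum
  is \<open>(-1)^i\<close>.\<close>

definition dBott ::
  "('m::topological_space, 'k::real_normed_field, 'v::ab_group_add, 'z) lie_pair_scheme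
   \<Rightarrow> (('m \<Rightarrow> 'v) list \<Rightarrow> 'm \<Rightarrow> 'v) \<Rightarrow> ('m \<Rightarrow> 'v) list \<Rightarrow> 'm \<Rightarrow> 'v" where
  "dBott P X as = (if set as \<subseteq> secA P then
     (\<Sum>i<length as. cmul P ((-1) ^ i) (nabla P (as ! i) (X (del i as)))) +
     (\<Sum>(i, j)\<in>{(i, j). i < j \<and> j < length as}.
        cmul P ((-1) ^ (i + j)) (X (lbr P (as ! i) (as ! j) # del i (del j as))))
   else 0)"

text \<open>The extension of \<open>\<eth>\<^sub>b\<close> to forms as a derivation: for functions it is \<open>\<rho>(b)\<close>, for \<open>1\<close>-forms the
  dual of \<open>\<eth>\<^sub>b\<close> on sections of \<open>A\<close>. In higher degree the derivation is given by the Leibniz rule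
  for \<open>\<rho>(b)\<close> applied to the function \<open>\<omega>(a\<^sub>1, \<dots>, a\<^sub>k)\<close>.\<close>

definition eth_form ::
  "('m::topological_space, 'k::real_normed_field, 'v::ab_group_add, 'z) lie_pair_scheme
   \<Rightarrow> ('m \<Rightarrow> 'v) \<Rightarrow> (('m \<Rightarrow> 'v) list \<Rightarrow> 'm \<Rightarrow> 'k) \<Rightarrow> ('m \<Rightarrow> 'v) list \<Rightarrow> 'm \<Rightarrow> 'k" where
  "eth_form P b \<omega> as = (if set as \<subseteq> secA P then
     rho P b (\<omega> as) - (\<Sum>j<length as. \<omega> (as[j := eth P b (as ! j)])) else 0)"

text \<open>
  \<open>\<rho>\<^sub>1\<close> is the \<open>C\<^sup>\<infinity>(M)\<close>-linear extension of its values on the generators \<open>\<mu> \<otimes> b = \<mu> \<cdot> b\<close>.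
  The binary bracket \<open>br\<close> of \<open>\<Omega>\<^sub>A(B)\<close> is the \<open>K\<close>-bilinear graded skew-symmetric operation of degree \<open>0\<close>
  generated by the last two clauses (bilinearity in the first argument follows by skew-symmetry);
  \<open>b \<in> \<Gamma>(B)\<close> is viewed as the \<open>0\<close>-form \<open>form0 b\<close>.
\<close>

definition is_rho1 ::
  "('m::topological_space, 'k::real_normed_field, 'v::ab_group_add, 'z) lie_pair_scheme
   \<Rightarrow> ((('m \<Rightarrow> 'v) list \<Rightarrow> 'm \<Rightarrow> 'v) \<Rightarrow> (('m \<Rightarrow> 'v) list \<Rightarrow> 'm \<Rightarrow> 'k) \<Rightarrow> ('m \<Rightarrow> 'v) list \<Rightarrow> 'm \<Rightarrow> 'k)
   \<Rightarrow> bool" where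
  "is_rho1 P \<rho>\<^sub>1 \<longleftrightarrow>
     (\<forall>k l. \<forall>X\<in>OmegaB P k. \<forall>\<omega>\<in>Omega P l. \<rho>\<^sub>1 X \<omega> \<in> Omega P (k + l)) \<and>
     (\<forall>k l. \<forall>X\<in>OmegaB P k. \<forall>Y\<in>OmegaB P k. \<forall>\<omega>\<in>Omega P l. \<rho>\<^sub>1 (X + Y) \<omega> = \<rho>\<^sub>1 X \<omega> + \<rho>\<^sub>1 Y \<omega>) \<and>
     (\<forall>k l. \<forall>f\<in>smooth_funs P. \<forall>X\<in>OmegaB P k. \<forall>\<omega>\<in>Omega P l.
        \<rho>\<^sub>1 (wedgeB P (form0 f) X) \<omega> = wedgeK (form0 f) (\<rho>\<^sub>1 X \<omega>)) \<and>
     (\<forall>k l. \<forall>\<mu>\<in>Omega P k. \<forall>b\<in>secB P. \<forall>\<omega>\<in>Omega P l.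
        \<rho>\<^sub>1 (wedgeB P \<mu> (form0 b)) \<omega> = wedgeK \<mu> (eth_form P b \<omega>))"

definition is_binary_bracket ::
  "('m::topological_space, 'k::real_normed_field, 'v::ab_group_add, 'z) lie_pair_scheme
   \<Rightarrow> ((('m \<Rightarrow> 'v) list \<Rightarrow> 'm \<Rightarrow> 'v) \<Rightarrow> (('m \<Rightarrow> 'v) list \<Rightarrow> 'm \<Rightarrow> 'k) \<Rightarrow> ('m \<Rightarrow> 'v) list \<Rightarrow> 'm \<Rightarrow> 'k)
   \<Rightarrow> ((('m \<Rightarrow> 'v) list \<Rightarrow> 'm \<Rightarrow> 'v) \<Rightarrow> (('m \<Rightarrow> 'v) list \<Rightarrow> 'm \<Rightarrow> 'v) \<Rightarrow> ('m \<Rightarrow> 'v) list \<Rightarrow> 'm \<Rightarrow> 'v)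
   \<Rightarrow> bool" where
  "is_binary_bracket P \<rho>\<^sub>1 br \<longleftrightarrow>
     (\<forall>k l. \<forall>X\<in>OmegaB P k. \<forall>Y\<in>OmegaB P l. br X Y \<in> OmegaB P (k + l)) \<and>
     (\<forall>k l. \<forall>X\<in>OmegaB P k. \<forall>Y\<in>OmegaB P l. \<forall>Z\<in>OmegaB P l. br X (Y + Z) = br X Y + br X Z) \<and>
     (\<forall>k l c. \<forall>X\<in>OmegaB P k. \<forall>Y\<in>OmegaB P l. br X (cmulB P c Y) = cmulB P c (br X Y)) \<and>
     (\<forall>k l. \<forall>X\<in>OmegaB P k. \<forall>Y\<in>OmegaB P l. br X Y = cmulB P (- ((-1) ^ (k * l))) (br Y X)) \<and>
     (\<forall>b\<in>secB P. \<forall>b'\<in>secB P. br (form0 b) (form0 b') = form0 (brB P b b')) \<and>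
     (\<forall>k l m. \<forall>X\<in>OmegaB P k. \<forall>\<omega>\<in>Omega P l. \<forall>Y\<in>OmegaB P m.
        br X (wedgeB P \<omega> Y) =
          wedgeB P (\<rho>\<^sub>1 X \<omega>) Y + cmulB P ((-1) ^ (l * k)) (wedgeB P \<omega> (br X Y)))"

section \<open>Cohomology\<close>

definition closed_forms ::
  "('m::topological_space, 'k::real_normed_field, 'v::ab_group_add, 'z) lie_pair_scheme
   \<Rightarrow> nat \<Rightarrow> (('m \<Rightarrow> 'v) list \<Rightarrow> 'm \<Rightarrow> 'v) set" where
  "closed_forms P k = {X\<in>OmegaB P k. dBott P X = 0}"

definition exact_forms ::
  "('m::topological_space, 'k::real_normed_field, 'v::ab_group_add, 'z) lie_pair_scheme
   \<Rightarrow> nat \<Rightarrow> (('m \<Rightarrow> 'v) list \<Rightarrow> 'm \<Rightarrow> 'v) set" where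
  "exact_forms P k = (case k of 0 \<Rightarrow> {0} | Suc l \<Rightarrow> dBott P ` OmegaB P l)"

definition cls ::
  "('m::topological_space, 'k::real_normed_field, 'v::ab_group_add, 'z) lie_pair_scheme
   \<Rightarrow> nat \<Rightarrow> (('m \<Rightarrow> 'v) list \<Rightarrow> 'm \<Rightarrow> 'v) \<Rightarrow> (('m \<Rightarrow> 'v) list \<Rightarrow> 'm \<Rightarrow> 'v) set" where
  "cls P k X = {Y\<in>OmegaB P k. Y - X \<in> exact_forms P k}"

definition HCE ::
  "('m::topological_space, 'k::real_normed_field, 'v::ab_group_add, 'z) lie_pair_scheme
   \<Rightarrow> nat \<Rightarrow> (('m \<Rightarrow> 'v) list \<Rightarrow> 'm \<Rightarrow> 'v) set set" where
  "HCE P k = cls P k ` closed_forms P k"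

text \<open>Operations on cohomology classes induced from operations on representatives.\<close>

definition rep :: "'a set \<Rightarrow> 'a" where
  "rep c = (SOME X. X \<in> c)"

definition cls_add ::
  "('m::topological_space, 'k::real_normed_field, 'v::ab_group_add, 'z) lie_pair_scheme \<Rightarrow> nat
   \<Rightarrow> (('m \<Rightarrow> 'v) list \<Rightarrow> 'm \<Rightarrow> 'v) set \<Rightarrow> (('m \<Rightarrow> 'v) list \<Rightarrow> 'm \<Rightarrow> 'v) set
   \<Rightarrow> (('m \<Rightarrow> 'v) list \<Rightarrow> 'm \<Rightarrow> 'v) set" where
  "cls_add P k c c' = cls P k (rep c + rep c')"

definition cls_scale ::
  "('m::topological_space, 'k::real_normed_field, 'v::ab_group_add, 'z) lie_pair_scheme \<Rightarrow> nat
   \<Rightarrow> 'k \<Rightarrow> (('m \<Rightarrow> 'v) list \<Rightarrow> 'm \<Rightarrow> 'v) set \<Rightarrow> (('m \<Rightarrow> 'v) list \<Rightarrow> 'm \<Rightarrow> 'v) set" where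
  "cls_scale P k z c = cls P k (cmulB P z (rep c))"

definition cls_br ::
  "('m::topological_space, 'k::real_normed_field, 'v::ab_group_add, 'z) lie_pair_scheme
   \<Rightarrow> ((('m \<Rightarrow> 'v) list \<Rightarrow> 'm \<Rightarrow> 'v) \<Rightarrow> (('m \<Rightarrow> 'v) list \<Rightarrow> 'm \<Rightarrow> 'v) \<Rightarrow> ('m \<Rightarrow> 'v) list \<Rightarrow> 'm \<Rightarrow> 'v)
   \<Rightarrow> nat \<Rightarrow> nat \<Rightarrow> (('m \<Rightarrow> 'v) list \<Rightarrow> 'm \<Rightarrow> 'v) set \<Rightarrow> (('m \<Rightarrow> 'v) list \<Rightarrow> 'm \<Rightarrow> 'v) set
   \<Rightarrow> (('m \<Rightarrow> 'v) list \<Rightarrow> 'm \<Rightarrow> 'v) set" where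
  "cls_br P br k l c c' = cls P (k + l) (br (rep c) (rep c'))"

section \<open>Derivations\<close>

text \<open>Operators on \<open>\<Gamma>(L)\<close> are represented by functions that vanish off \<open>\<Gamma>(L)\<close>.\<close>

definition Der ::
  "('m::topological_space, 'k::real_normed_field, 'v::ab_group_add, 'z) lie_pair_scheme
   \<Rightarrow> (('m \<Rightarrow> 'v) \<Rightarrow> 'm \<Rightarrow> 'v) set" where
  "Der P = {\<delta>.
     (\<forall>u. u \<notin> sections P \<longrightarrow> \<delta> u = 0) \<and> (\<forall>u\<in>sections P. \<delta> u \<in> sections P) \<and>
     (\<forall>u\<in>sections P. \<forall>v\<in>sections P. \<delta> (u + v) = \<delta> u + \<delta> v) \<and>
     (\<forall>c. \<forall>u\<in>sections P. \<delta> (cmul P c u) = cmul P c (\<delta> u)) \<and>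
     (\<exists>s\<in>vector_fields P.
        (\<forall>f\<in>smooth_funs P. \<forall>u\<in>sections P. \<delta> (fmul P f u) = fmul P (vf_app s f) u + fmul P f (\<delta> u)) \<and>
        (\<forall>u\<in>sections P. \<forall>f\<in>smooth_funs P.
           vf_app s (rho P u f) - rho P u (vf_app s f) = rho P (\<delta> u) f)) \<and>
     (\<forall>u\<in>sections P. \<forall>v\<in>sections P. \<delta> (lbr P u v) = lbr P (\<delta> u) v + lbr P u (\<delta> v))}"

definition commutator ::
  "('a \<Rightarrow> 'a) \<Rightarrow> ('a \<Rightarrow> 'a) \<Rightarrow> 'a \<Rightarrow> 'a::ab_group_add" where
  "commutator \<delta> \<delta>' = (\<lambda>u. \<delta> (\<delta>' u) - \<delta>' (\<delta> u))"

definition op_scale ::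
  "('m, 'k, 'v, 'z) lie_pair_scheme \<Rightarrow> 'k \<Rightarrow> (('m \<Rightarrow> 'v) \<Rightarrow> 'm \<Rightarrow> 'v) \<Rightarrow> ('m \<Rightarrow> 'v) \<Rightarrow> 'm \<Rightarrow> 'v" where
  "op_scale P c \<delta> = (\<lambda>u. cmul P c (\<delta> u))"

definition kappa ::
  "('m::topological_space, 'k::real_normed_field, 'v::ab_group_add, 'z) lie_pair_scheme
   \<Rightarrow> (('m \<Rightarrow> 'v) \<Rightarrow> 'm \<Rightarrow> 'v) \<Rightarrow> ('m \<Rightarrow> 'v) list \<Rightarrow> 'm \<Rightarrow> 'v" where
  "kappa P \<delta> as = (if length as = 1 \<and> set as \<subseteq> secA P then - prB P (\<delta> (as ! 0)) else 0)"

definition DerLA ::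
  "('m::topological_space, 'k::real_normed_field, 'v::ab_group_add, 'z) lie_pair_scheme
   \<Rightarrow> (('m \<Rightarrow> 'v) \<Rightarrow> 'm \<Rightarrow> 'v) set" where
  "DerLA P = {\<delta>\<in>Der P. kappa P \<delta> = 0}"

definition act ::
  "('m::topological_space, 'k::real_normed_field, 'v::ab_group_add, 'z) lie_pair_scheme
   \<Rightarrow> (('m \<Rightarrow> 'v) \<Rightarrow> 'm \<Rightarrow> 'v) \<Rightarrow> (('m \<Rightarrow> 'v) list \<Rightarrow> 'm \<Rightarrow> 'v) \<Rightarrow> ('m \<Rightarrow> 'v) list \<Rightarrow> 'm \<Rightarrow> 'v" where
  "act P \<delta> X as = (if set as \<subseteq> secA P then
     - (\<Sum>j<length as. X (as[j := prA P (\<delta> (as ! j))])) + prB P (\<delta> (X as)) else 0)"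

definition cls_act ::
  "('m::topological_space, 'k::real_normed_field, 'v::ab_group_add, 'z) lie_pair_scheme
   \<Rightarrow> nat \<Rightarrow> (('m \<Rightarrow> 'v) \<Rightarrow> 'm \<Rightarrow> 'v) \<Rightarrow> (('m \<Rightarrow> 'v) list \<Rightarrow> 'm \<Rightarrow> 'v) set
   \<Rightarrow> (('m \<Rightarrow> 'v) list \<Rightarrow> 'm \<Rightarrow> 'v) set" where
  "cls_act P k \<delta> c = cls P k (act P \<delta> (rep c))"

end

(* For a in A the Lie derivative on cochains is L_a = i_a d + d i_a, where i_a inserts a as the
   first argument.  Every identity between cochains is checked by induction on the degree: insert a
   and commute i_a past the operators.

   Identities that are linear over functions need only be checked on products mu.b: bump functions
   give, at each point p, a finite dual basis of the sections of B modulo functions vanishing at p.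
   For the same reason the rules for rho_1 and the binary bracket determine both operations.

   Let delta preserve A and let h be the restriction of pr_A o delta to B.  Then delta |> _ commutes
   with d, but fails to be a derivation of the bracket of forms X, Y of degrees k, l:
     delta |> [X, Y] - [delta |> X, Y] - [X, delta |> Y] = D(X, Y) - (-1)^{kl} D(Y, X),
   where D comes from h and, with j_X the insertion of the A-valued form h o X, satisfies
     d (j_X Y) = j_{dX} Y + (-1)^k (D(X, Y) - j_X (d Y)).
   So D(X, Y) is exact for closed X and Y. *)
theory Submission
  imports Defs
begin

text \<open>The differential sees B only as the A-module L/A, while \<open>eth\<close> and the
  bracket use B as a complement of A in L. A derivation that preserves A respects the former
  structure, but moves the complement: h is the infinitesimal displacement of B into A, and the
  defect D measures its effect on the bracket. Explicitly, D(X, Y) is the shuffle sum over X of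
  \<open>MB v Y\<close>, where \<open>MB v\<close> is L_{h v} plus the insertion of a |-> h (nabla_a
  v). Neither summand need be linear over functions in v, but the sum is, because L_{f a} = f L_a +
  df . i_a.

  The bracket is given by rules only. \<open>rho1\<close> gets a closed formula, while the bracket
  is made explicit only when its first argument is a section of B. An identity for it is proved by
  showing that its defect is additive, skew and, up to sign, linear under products with forms, so
  that pairs of sections of B decide.

  Shuffles and differentials are recursions on the argument list, so that contraction with the first
  argument comes for free. The price is a comparison with the pointwise definition of forms, made
  through the dual bases.\<close>

section \<open>Smooth functions and smooth vector bundles\<close>

lemma eventually_update_in:
  assumes "openin (top_of_set (Rn n)) W" "x \<in> W" "i < n"
  shows "eventually (\<lambda>t. x(i := t) \<in> W) (nhds (x i))"
proof -
  obtain T where T: "open T" "W = Rn n \<inter> T"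
    using assms(1) by (auto simp: openin_open)
  have "continuous_on UNIV (\<lambda>t. x(i := t))"
  proof (rule continuous_on_coordinatewise_then_product)
    show "continuous_on UNIV (\<lambda>t. (x(i := t)) j)" for j
      by (cases "j = i") (auto intro: continuous_intros)
  qed
  hence "open ((\<lambda>t. x(i := t)) -` T)"
    using T(1) by (simp add: continuous_on_open_vimage)
  moreover have "x i \<in> (\<lambda>t. x(i := t)) -` T"
    using assms(2) T by simp
  ultimately have "eventually (\<lambda>t. t \<in> (\<lambda>t. x(i := t)) -` T) (nhds (x i))"
    by (rule eventually_nhds_in_open)
  moreover have "x(i := t) \<in> Rn n" for t
    using assms T by (auto simp: Rn_def)
  ultimately show ?thesis
    using T(2) by (auto elim: eventually_mono)
qed

lemma Ck_on_SucI:
  assumes "continuous_on W g"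
    and "\<And>i x. i < n \<Longrightarrow> x \<in> W \<Longrightarrow> ((\<lambda>t. g (x(i := t))) has_vector_derivative g' i x) (at (x i))"
    and "\<And>i. i < n \<Longrightarrow> Ck_on k n W (partial i g)"
  shows "Ck_on (Suc k) n W g"
  using assms by (auto simp: differentiable_def has_vector_derivative_def)

lemma Ck_on_has_vector_derivative:
  assumes "Ck_on (Suc k) n W g" "i < n" "x \<in> W"
  shows "((\<lambda>t. g (x(i := t))) has_vector_derivative partial i g x) (at (x i))"
  using assms by (simp add: partial_def vector_derivative_works[symmetric])

lemma partial_eqI:
  "((\<lambda>t. g (x(i := t))) has_vector_derivative d) (at (x i)) \<Longrightarrow> partial i g x = d"
  by (simp add: partial_def vector_derivative_at)

text \<open>Derivatives are two-sided along coordinate lines. By openness a short segment of each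
  such line stays inside \<open>W\<close>, so the values on \<open>W\<close> determine them.\<close>

lemma Ck_on_cong:
  assumes "Ck_on k n W g" "openin (top_of_set (Rn n)) W" "\<And>x. x \<in> W \<Longrightarrow> g x = h x"
  shows "Ck_on k n W h"
  using assms
proof (induction k arbitrary: g h)
  case 0
  then show ?case by (simp cong: continuous_on_cong)
next
  case (Suc k)
  have d: "((\<lambda>t. h (x(i := t))) has_vector_derivative partial i g x) (at (x i))"
    if "i < n" "x \<in> W" for i x
  proof (rule has_vector_derivative_cong_ev[THEN iffD1])
    show "((\<lambda>t. g (x(i := t))) has_vector_derivative partial i g x) (at (x i))"
      using Suc.prems(1) that by (rule Ck_on_has_vector_derivative)
    show "\<forall>\<^sub>F t in nhds (x i). t \<in> UNIV \<longrightarrow> g (x(i := t)) = h (x(i := t))"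
      using eventually_update_in[OF Suc.prems(2) that(2,1)]
      by eventually_elim (use Suc.prems(3) in blast)
  qed (use that Suc.prems in simp)
  show ?case
  proof (rule Ck_on_SucI)
    show "continuous_on W h"
      using Suc.prems by (simp cong: continuous_on_cong)
    show "Ck_on k n W (partial i h)" if "i < n" for i
    proof (rule Suc.IH[OF _ Suc.prems(2)])
      show "Ck_on k n W (partial i g)" using Suc.prems(1) that by simp
      show "partial i g x = partial i h x" if "x \<in> W" for x
        using partial_eqI[OF d[OF \<open>i < n\<close> that]] by simp
    qed
  qed (use d in blast)
qed

text \<open>The partial derivatives need only be known on \<open>W\<close>, because \<open>W\<close> is open.\<close>

lemma Ck_on_SucI_deriv:
  assumes "continuous_on W g" "openin (top_of_set (Rn n)) W"
    and "\<And>i x. i < n \<Longrightarrow> x \<in> W \<Longrightarrow> ((\<lambda>t. g (x(i := t))) has_vector_derivative g' i x) (at (x i))"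
    and "\<And>i. i < n \<Longrightarrow> Ck_on k n W (g' i)"
  shows "Ck_on (Suc k) n W g"
  using assms(1) assms(3)
proof (rule Ck_on_SucI)
  fix i assume i: "i < n"
  have "g' i x = partial i g x" if "x \<in> W" for x
    using partial_eqI[OF assms(3)[OF i that]] by simp
  then show "Ck_on k n W (partial i g)"
    by (rule Ck_on_cong[OF assms(4)[OF i] assms(2)])
qed

lemma Ck_on_continuous: "Ck_on k n W g \<Longrightarrow> continuous_on W g"
  by (cases k) auto

lemma Ck_on_Suc_lower: "Ck_on (Suc k) n W g \<Longrightarrow> Ck_on k n W g"
proof (induction k arbitrary: g)
  case 0
  then show ?case by simp
next
  case (Suc k)
  have "Ck_on k n W (partial i g)" if "i < n" for i
    using Suc.prems that by (intro Suc.IH) simp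
  then show ?case
    using Suc.prems by simp
qed

lemma Ck_on_subset: "Ck_on k n W g \<Longrightarrow> V \<subseteq> W \<Longrightarrow> Ck_on k n V g"
proof (induction k arbitrary: g)
  case 0
  then show ?case using continuous_on_subset by simp
next
  case (Suc k)
  then show ?case using continuous_on_subset[of W g V] by (simp add: subset_iff)
qed

lemma Ck_on_local:
  assumes "\<And>x. x \<in> W \<Longrightarrow> \<exists>V. openin (top_of_set (Rn n)) V \<and> x \<in> V \<and> V \<subseteq> W \<and> Ck_on k n V g"
    and W: "W \<subseteq> Rn n"
  shows "Ck_on k n W g"
  using assms(1)
proof (induction k arbitrary: g)
  case 0
  show ?case
    unfolding Ck_on.simps continuous_on_eq_continuous_within
  proof
    fix x assume "x \<in> W"
    then obtain V where V: "openin (top_of_set (Rn n)) V" "x \<in> V" "V \<subseteq> W" "continuous_on V g"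
      using 0[OF \<open>x \<in> W\<close>] by auto
    obtain T where T: "open T" "V = Rn n \<inter> T" using V(1) by (auto simp: openin_open)
    \<comment> \<open>Relative openness of \<open>V\<close> makes continuity within \<open>V\<close>
      and within \<open>W\<close> the same condition at \<open>x\<close>.\<close>
    have "at x within W = at x within V"
      using V W T by (intro at_within_nhd[of x T]) auto
    then show "continuous (at x within W) g"
      using V by (simp add: continuous_on_eq_continuous_within)
  qed
next
  case (Suc k)
  have *: "Ck_on k n W (partial i g)" if "i < n" for i
  proof (rule Suc.IH)
    fix x assume "x \<in> W"
    from Suc.prems[OF this]
    show "\<exists>V. openin (top_of_set (Rn n)) V \<and> x \<in> V \<and> V \<subseteq> W \<and> Ck_on k n V (partial i g)"
      using that by auto
  qed
  have "continuous_on W g"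
  proof (rule Ck_on_continuous, rule Suc.IH)
    fix x assume "x \<in> W"
    from Suc.prems[OF this]
    show "\<exists>V. openin (top_of_set (Rn n)) V \<and> x \<in> V \<and> V \<subseteq> W \<and> Ck_on k n V g"
      using Ck_on_Suc_lower by metis
  qed
  moreover have "(\<lambda>t. g (x(i := t))) differentiable at (x i)" if "i < n" "x \<in> W" for i x
    using Suc.prems[OF that(2)] that(1) by auto
  ultimately show ?case using * by simp
qed

lemma Ck_on_const:
  assumes "openin (top_of_set (Rn n)) W"
  shows "Ck_on k n W (\<lambda>_. c)"
proof (induction k arbitrary: c)
  case (Suc k)
  show ?case
    by (rule Ck_on_SucI_deriv[OF _ assms, where g' = "\<lambda>_ _. 0"]) (auto simp: Suc)
qed simp

lemma Ck_on_add:
  assumes "Ck_on k n W f" "Ck_on k n W g" "openin (top_of_set (Rn n)) W"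
  shows "Ck_on k n W (\<lambda>x. f x + g x)"
  using assms(1,2)
proof (induction k arbitrary: f g)
  case (Suc k)
  show ?case
  proof (rule Ck_on_SucI_deriv[OF _ assms(3), where g' = "\<lambda>i x. partial i f x + partial i g x"])
    show "continuous_on W (\<lambda>x. f x + g x)"
      using Suc.prems by (auto intro: continuous_intros)
    show "((\<lambda>t. f (x(i := t)) + g (x(i := t))) has_vector_derivative partial i f x + partial i g x) (at (x i))"
      if "i < n" "x \<in> W" for i x
      using Suc.prems that by (intro has_vector_derivative_add Ck_on_has_vector_derivative)
    show "Ck_on k n W (\<lambda>x. partial i f x + partial i g x)" if "i < n" for i
      using Suc.prems that by (intro Suc.IH) auto
  qed
qed (auto intro: continuous_intros)

lemma Ck_on_mult:
  fixes f g :: "(nat \<Rightarrow> real) \<Rightarrow> 'k::real_normed_algebra"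
  assumes "Ck_on k n W f" "Ck_on k n W g" "openin (top_of_set (Rn n)) W"
  shows "Ck_on k n W (\<lambda>x. f x * g x)"
  using assms(1,2)
proof (induction k arbitrary: f g)
  case (Suc k)
  show ?case
  proof (rule Ck_on_SucI_deriv[OF _ assms(3), where g' = "\<lambda>i x. f x * partial i g x + partial i f x * g x"])
    show "continuous_on W (\<lambda>x. f x * g x)"
      using Suc.prems by (auto intro: continuous_intros)
    show "((\<lambda>t. f (x(i := t)) * g (x(i := t))) has_vector_derivative
        f x * partial i g x + partial i f x * g x) (at (x i))"
      if "i < n" "x \<in> W" for i x
      using has_vector_derivative_mult[OF Ck_on_has_vector_derivative[OF Suc.prems(1) that]
          Ck_on_has_vector_derivative[OF Suc.prems(2) that]]
      unfolding fun_upd_triv .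
    show "Ck_on k n W (\<lambda>x. f x * partial i g x + partial i f x * g x)" if "i < n" for i
      using Suc.prems that Ck_on_Suc_lower[OF Suc.prems(1)] Ck_on_Suc_lower[OF Suc.prems(2)]
      by (intro Ck_on_add Suc.IH assms(3)) auto
  qed
qed (auto intro: continuous_intros)

lemma Ck_on_prod:
  fixes f :: "'i \<Rightarrow> (nat \<Rightarrow> real) \<Rightarrow> 'k::real_normed_field"
  assumes "\<And>i. i \<in> I \<Longrightarrow> Ck_on k n W (f i)" "openin (top_of_set (Rn n)) W"
  shows "Ck_on k n W (\<lambda>x. \<Prod>i\<in>I. f i x)"
  using assms(1)
  by (induction I rule: infinite_finite_induct) (auto intro: Ck_on_const Ck_on_mult assms(2))

lemma Ck_on_of_real:
  assumes "Ck_on k n W g" "openin (top_of_set (Rn n)) W"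
  shows "Ck_on k n W (\<lambda>x. of_real (g x) :: 'k::real_normed_field)"
  using assms(1)
proof (induction k arbitrary: g)
  case (Suc k)
  show ?case
  proof (rule Ck_on_SucI_deriv[OF _ assms(2), where g' = "\<lambda>i x. of_real (partial i g x)"])
    show "continuous_on W (\<lambda>x. of_real (g x) :: 'k)"
      using Suc.prems by (auto intro: continuous_intros)
    show "((\<lambda>t. of_real (g (x(i := t))) :: 'k) has_vector_derivative of_real (partial i g x)) (at (x i))"
      if "i < n" "x \<in> W" for i x
      by (rule bounded_linear.has_vector_derivative[OF bounded_linear_of_real
          Ck_on_has_vector_derivative[OF Suc.prems that]])
    show "Ck_on k n W (\<lambda>x. of_real (partial i g x) :: 'k)" if "i < n" for i
      using Suc.prems that by (intro Suc.IH) auto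
  qed
qed (auto intro: continuous_intros)

text \<open>The chain rule replaces \<open>h\<close> by its derivative, so the induction has to run
  over a whole family closed under derivation instead of one function.\<close>

lemma Ck_on_compose:
  fixes H :: "(real \<Rightarrow> real) set"
  assumes H: "\<And>h. h \<in> H \<Longrightarrow> \<exists>h'\<in>H. \<forall>t. (h has_real_derivative h' t) (at t)"
    and "Ck_on k n W g" "openin (top_of_set (Rn n)) W" "h \<in> H"
  shows "Ck_on k n W (\<lambda>x. h (g x))"
  using assms(2,4)
proof (induction k arbitrary: h)
  case 0
  then obtain h' where "\<And>t. (h has_real_derivative h' t) (at t)" using H by blast
  hence "continuous_on UNIV h" 
    by (intro continuous_at_imp_continuous_on ballI) (rule DERIV_isCont)
  then show ?case
    using continuous_on_compose2[of UNIV h W g] 0 by simp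
next
  case (Suc k)
  obtain h' where h': "h' \<in> H" "\<And>t. (h has_real_derivative h' t) (at t)" using H Suc.prems by blast
  hence "continuous_on UNIV h" 
    by (intro continuous_at_imp_continuous_on ballI) (rule DERIV_isCont)
  show ?case
  proof (rule Ck_on_SucI_deriv[OF _ assms(3), where g' = "\<lambda>i x. h' (g x) * partial i g x"])
    show "continuous_on W (\<lambda>x. h (g x))"
      using continuous_on_compose2[of UNIV h W g] Suc.prems \<open>continuous_on UNIV h\<close> by simp
    show "((\<lambda>t. h (g (x(i := t)))) has_vector_derivative h' (g x) * partial i g x) (at (x i))"
      if "i < n" "x \<in> W" for i x
    proof -
      have 1: "((\<lambda>t. g (x(i := t))) has_real_derivative partial i g x) (at (x i))"
        using Ck_on_has_vector_derivative[OF Suc.prems(1) that]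
        unfolding has_real_derivative_iff_has_vector_derivative .
      have 2: "(h has_real_derivative h' (g x)) (at (g (x(i := x i))))"
        unfolding fun_upd_triv by (rule h'(2))
      show ?thesis
        using DERIV_chain2[of h "h' (g x)" "\<lambda>t. g (x(i := t))" "x i", OF 2 1]
        unfolding has_real_derivative_iff_has_vector_derivative .
    qed
    show "Ck_on k n W (\<lambda>x. h' (g x) * partial i g x)" if "i < n" for i
    proof (rule Ck_on_mult[OF _ _ assms(3)])
      show "Ck_on k n W (\<lambda>x. h' (g x))"
        using Ck_on_Suc_lower[OF Suc.prems(1)] h'(1) by (rule Suc.IH)
      show "Ck_on k n W (partial i g)"
        using Suc.prems(1) that by simp
    qed
  qed
qed

text \<open>The family of functions \<open>p (1/t) exp (-1/t)\<close>, extended by zero, is closed under derivation.\<close>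

definition flat :: "real poly \<Rightarrow> real \<Rightarrow> real" where
  "flat p t = (if t > 0 then poly p (1 / t) * exp (- (1 / t)) else 0)"

lemma tendsto_poly_exp: "((\<lambda>y. poly p y * exp (- y)) \<longlongrightarrow> 0) (at_top :: real filter)"
proof -
  have "((\<lambda>y. \<Sum>i\<le>degree p. coeff p i * (y ^ i / exp y)) \<longlongrightarrow> (\<Sum>i\<le>degree p. coeff p i * 0)) at_top"
    by (intro tendsto_sum tendsto_mult tendsto_const tendsto_power_div_exp_0)
  moreover have "(\<Sum>i\<le>degree p. coeff p i * (y ^ i / exp y)) = poly p y * exp (- y)" for y
    by (simp add: poly_altdef sum_distrib_right exp_minus divide_inverse mult.assoc)
  ultimately show ?thesis by simp
qed

lemma flat_tendsto: "(flat p \<longlongrightarrow> 0) (at 0)"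
proof -
  have "((\<lambda>t. poly p (1 / t) * exp (- (1 / t))) \<longlongrightarrow> 0) (at_right 0)"
    using filterlim_compose[OF tendsto_poly_exp filterlim_inverse_at_top_right]
    by (simp add: inverse_eq_divide)
  hence "(flat p \<longlongrightarrow> 0) (at_right 0)"
    by (rule Lim_transform_eventually) (auto simp: eventually_at_filter flat_def)
  moreover have "(flat p \<longlongrightarrow> 0) (at_left 0)"
    by (rule Lim_transform_eventually[OF tendsto_const]) (auto simp: eventually_at_filter flat_def)
  ultimately show ?thesis by (simp add: filterlim_split_at)
qed

text \<open>Differentiating p(1/t) exp(-1/t) gives (p - p')(1/t) exp(-1/t) / t^2. The two
  \<open>pCons 0\<close> multiply by X^2, which accounts for the factor 1 / t^2.\<close>

lemma flat_derivative:
  "(flat p has_real_derivative flat (pCons 0 (pCons 0 (p - pderiv p))) t) (at t)"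
proof -
  consider "t > 0" | "t < 0" | "t = 0" by linarith
  then show ?thesis
  proof cases
    case 1
    have "((\<lambda>t. poly p (1 / t) * exp (- (1 / t))) has_real_derivative
       poly p (1 / t) * (exp (- (1 / t)) * (1 / t^2)) + (poly (pderiv p) (1 / t) * (- (1 / t^2))) * exp (- (1 / t))) (at t)"
      using 1 by (auto intro!: derivative_eq_intros DERIV_chain2[OF poly_DERIV] simp: power2_eq_square)
    moreover have "poly p (1 / t) * (exp (- (1 / t)) * (1 / t^2)) + (poly (pderiv p) (1 / t) * (- (1 / t^2))) * exp (- (1 / t))
       = flat (pCons 0 (pCons 0 (p - pderiv p))) t"
      using 1 by (simp add: flat_def power2_eq_square field_simps)
    ultimately have "((\<lambda>t. poly p (1 / t) * exp (- (1 / t))) has_real_derivative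
        flat (pCons 0 (pCons 0 (p - pderiv p))) t) (at t)"
      by simp
    then show ?thesis
      by (rule has_field_derivative_transform_within_open[of _ _ _ "{0<..}"]) (use 1 in \<open>auto simp: flat_def\<close>)
  next
    case 2
    have "((\<lambda>_. 0) has_real_derivative 0) (at t)" by simp
    then have "(flat p has_real_derivative 0) (at t)"
      by (rule has_field_derivative_transform_within_open[of _ _ _ "{..<0}"]) (use 2 in \<open>auto simp: flat_def\<close>)
    then show ?thesis using 2 by (simp add: flat_def)
  next
    case 3
    \<comment> \<open>At 0 the difference quotient of \<open>flat p\<close> is \<open>flat\<close>
      of X p, which tends to 0.\<close>
    have "((\<lambda>h. (flat p (0 + h) - flat p 0) / h) \<longlongrightarrow> 0) (at 0)"
      by (rule Lim_transform_eventually[OF flat_tendsto[of "pCons 0 p"]])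
        (auto simp: flat_def eventually_at_filter)
    then show ?thesis
      using 3 by (simp add: DERIV_def flat_def)
  qed
qed

lemma flat_one_pos: "t > 0 \<Longrightarrow> flat 1 t > 0"
  by (simp add: flat_def)

lemma Ck_on_flat:
  assumes "Ck_on k n W g" "openin (top_of_set (Rn n)) W"
  shows "Ck_on k n W (\<lambda>x. flat p (g x))"
proof (rule Ck_on_compose[where H = "range flat", OF _ assms])
  show "\<exists>h'\<in>range flat. \<forall>t. (h has_real_derivative h' t) (at t)" if "h \<in> range flat" for h
    using that flat_derivative by auto
qed simp

section \<open>Smooth functions on a manifold\<close>

locale smooth_mfd =
  fixes M :: "('m::{t2_space, second_countable_topology}, 'z) manifold_scheme"
  assumes manifold: "smooth_manifold M"
begin

lemma chart_homeomorphism: "(U, \<phi>) \<in> atlas M \<Longrightarrow> homeomorphism U (\<phi> ` U) \<phi> (inv_into U \<phi>)"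
  and chart_open: "(U, \<phi>) \<in> atlas M \<Longrightarrow> open U"
  and chart_image_openin: "(U, \<phi>) \<in> atlas M \<Longrightarrow> openin (top_of_set (Rn (mdim M))) (\<phi> ` U)"
  using manifold by (auto simp: smooth_manifold_def)

lemma chart_inv: "(U, \<phi>) \<in> atlas M \<Longrightarrow> q \<in> U \<Longrightarrow> inv_into U \<phi> (\<phi> q) = q"
  using chart_homeomorphism by (rule homeomorphism_apply1)

lemma chart_image_openin_Int:
  assumes "(U, \<phi>) \<in> atlas M" "open S"
  shows "openin (top_of_set (Rn (mdim M))) (\<phi> ` (U \<inter> S))"
proof -
  have "openin (top_of_set (\<phi> ` U)) (\<phi> ` (U \<inter> S))"
    by (rule homeomorphism_imp_open_map[OF chart_homeomorphism[OF assms(1)]])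
      (simp add: assms(2) openin_open_Int)
  then show ?thesis
    using chart_image_openin[OF assms(1)] by (rule openin_trans)
qed

lemma chart_exists: "\<exists>U \<phi>. (U, \<phi>) \<in> atlas M \<and> q \<in> U"
proof -
  have "q \<in> \<Union> (fst ` atlas M)"
    using manifold by (simp add: smooth_manifold_def)
  then show ?thesis by force
qed

lemma chart_transition:
  assumes "(U, \<phi>) \<in> atlas M" "(V, \<psi>) \<in> atlas M" "i < mdim M"
  shows "Ck_on k (mdim M) (\<phi> ` (U \<inter> V)) (\<lambda>x. \<psi> (inv_into U \<phi> x) i)"
proof -
  have "\<forall>(U, \<phi>)\<in>atlas M. \<forall>(V, \<psi>)\<in>atlas M. \<forall>i<mdim M.
        Cinf_on (mdim M) (\<phi> ` (U \<inter> V)) (\<lambda>x. \<psi> (inv_into U \<phi> x) i)"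
    using manifold by (simp add: smooth_manifold_def)
  from bspec[OF this assms(1)] have "\<forall>(V, \<psi>)\<in>atlas M. \<forall>i<mdim M.
        Cinf_on (mdim M) (\<phi> ` (U \<inter> V)) (\<lambda>x. \<psi> (inv_into U \<phi> x) i)" by simp
  from bspec[OF this assms(2)] assms(3) show ?thesis by (simp add: Cinf_on_def)
qed

lemma smooth_fun_onI:
  "(\<And>U \<phi> k. (U, \<phi>) \<in> atlas M \<Longrightarrow> Ck_on k (mdim M) (\<phi> ` (U \<inter> S)) (\<lambda>x. f (inv_into U \<phi> x)))
    \<Longrightarrow> smooth_fun_on M S f"
  by (auto simp: smooth_fun_on_def Cinf_on_def)

lemma smooth_fun_onD:
  "smooth_fun_on M S f \<Longrightarrow> (U, \<phi>) \<in> atlas M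
    \<Longrightarrow> Ck_on k (mdim M) (\<phi> ` (U \<inter> S)) (\<lambda>x. f (inv_into U \<phi> x))"
  by (auto simp: smooth_fun_on_def Cinf_on_def)

lemma smooth_fun_on_subset:
  assumes "smooth_fun_on M S f" "T \<subseteq> S"
  shows "smooth_fun_on M T f"
proof (rule smooth_fun_onI)
  fix U \<phi> k assume "(U, \<phi>) \<in> atlas M"
  from smooth_fun_onD[OF assms(1) this]
  show "Ck_on k (mdim M) (\<phi> ` (U \<inter> T)) (\<lambda>x. f (inv_into U \<phi> x))"
    by (rule Ck_on_subset) (use assms(2) in blast)
qed

lemma smooth_fun_on_cong:
  assumes "smooth_fun_on M S f" "open S" "\<And>q. q \<in> S \<Longrightarrow> f q = g q"
  shows "smooth_fun_on M S g"
proof (rule smooth_fun_onI)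
  fix U \<phi> k assume U: "(U, \<phi>) \<in> atlas M"
  from smooth_fun_onD[OF assms(1) U] chart_image_openin_Int[OF U assms(2)]
  show "Ck_on k (mdim M) (\<phi> ` (U \<inter> S)) (\<lambda>x. g (inv_into U \<phi> x))"
    by (rule Ck_on_cong) (auto simp: chart_inv[OF U] assms(3))
qed

lemma smooth_fun_on_local:
  assumes "\<And>q. q \<in> S \<Longrightarrow> \<exists>T. open T \<and> q \<in> T \<and> smooth_fun_on M (S \<inter> T) f" "open S"
  shows "smooth_fun_on M S f"
proof (rule smooth_fun_onI)
  fix U \<phi> k assume U: "(U, \<phi>) \<in> atlas M"
  show "Ck_on k (mdim M) (\<phi> ` (U \<inter> S)) (\<lambda>x. f (inv_into U \<phi> x))"
  proof (rule Ck_on_local)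
    show "\<phi> ` (U \<inter> S) \<subseteq> Rn (mdim M)"
      using chart_image_openin[OF U] by (auto simp: openin_open)
    fix x assume "x \<in> \<phi> ` (U \<inter> S)"
    then obtain q where q: "q \<in> U" "q \<in> S" "x = \<phi> q" by auto
    then obtain T where T: "open T" "q \<in> T" "smooth_fun_on M (S \<inter> T) f"
      using assms(1)[OF q(2)] by auto
    show "\<exists>V. openin (top_of_set (Rn (mdim M))) V \<and> x \<in> V \<and> V \<subseteq> \<phi> ` (U \<inter> S) \<and>
          Ck_on k (mdim M) V (\<lambda>x. f (inv_into U \<phi> x))"
      using chart_image_openin_Int[OF U open_Int[OF assms(2) T(1)]] q T smooth_fun_onD[OF T(3) U]
      by (intro exI[of _ "\<phi> ` (U \<inter> (S \<inter> T))"]) auto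
  qed
qed

lemma smooth_fun_on_const: "open S \<Longrightarrow> smooth_fun_on M S (\<lambda>_. c)"
  by (rule smooth_fun_onI) (intro Ck_on_const chart_image_openin_Int)

lemma smooth_fun_on_add:
  "smooth_fun_on M S f \<Longrightarrow> smooth_fun_on M S g \<Longrightarrow> open S \<Longrightarrow> smooth_fun_on M S (\<lambda>q. f q + g q)"
  by (rule smooth_fun_onI) (intro Ck_on_add chart_image_openin_Int smooth_fun_onD)

lemma smooth_fun_on_mult:
  fixes f g :: "'m \<Rightarrow> 'k::real_normed_algebra"
  shows "smooth_fun_on M S f \<Longrightarrow> smooth_fun_on M S g \<Longrightarrow> open S \<Longrightarrow> smooth_fun_on M S (\<lambda>q. f q * g q)"
  by (rule smooth_fun_onI) (intro Ck_on_mult chart_image_openin_Int smooth_fun_onD)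

lemma smooth_fun_on_sum:
  assumes "\<And>i. i \<in> I \<Longrightarrow> smooth_fun_on M S (f i)" "open S"
  shows "smooth_fun_on M S (\<lambda>q. \<Sum>i\<in>I. f i q)"
  using assms(1)
  by (induction I rule: infinite_finite_induct) (simp_all add: smooth_fun_on_const smooth_fun_on_add assms(2))

text \<open>\<open>S\<close> is covered by the open sets \<open>S \<inter> T\<close>, where the
  function is a product of smooth ones, and \<open>S \<inter> - C\<close>, where it
  vanishes.\<close>

lemma smooth_fun_on_extend_zero:
  fixes f :: "'m \<Rightarrow> 'k::real_normed_algebra"
  assumes "smooth_fun_on M UNIV \<theta>" "closed C" "C \<subseteq> T" "open T" "open S"
    and "\<And>q. q \<notin> C \<Longrightarrow> \<theta> q = 0" "smooth_fun_on M (S \<inter> T) f"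
  shows "smooth_fun_on M S (\<lambda>q. if q \<in> T then \<theta> q * f q else 0)"
proof (rule smooth_fun_on_local[OF _ assms(5)])
  fix q assume "q \<in> S"
  show "\<exists>V. open V \<and> q \<in> V \<and> smooth_fun_on M (S \<inter> V) (\<lambda>q. if q \<in> T then \<theta> q * f q else 0)"
  proof (cases "q \<in> T")
    case True
    have "smooth_fun_on M (S \<inter> T) (\<lambda>q. \<theta> q * f q)"
      using assms by (intro smooth_fun_on_mult smooth_fun_on_subset[OF assms(1)]) auto
    then have "smooth_fun_on M (S \<inter> T) (\<lambda>q. if q \<in> T then \<theta> q * f q else 0)"
      by (rule smooth_fun_on_cong) (use assms in auto)
    then show ?thesis using True assms(4) by blast
  next
    case False
    have "open (- C)" using assms(2) by (simp add: open_Compl)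
    have "smooth_fun_on M (S \<inter> - C) (\<lambda>q. 0 :: 'k)"
      using assms(5) \<open>open (- C)\<close> by (intro smooth_fun_on_const) auto
    then have "smooth_fun_on M (S \<inter> - C) (\<lambda>q. if q \<in> T then \<theta> q * f q else 0)"
      by (rule smooth_fun_on_cong) (use assms(5,6) \<open>open (- C)\<close> in auto)
    then show ?thesis using False assms(3) \<open>open (- C)\<close> by blast
  qed
qed

end

section \<open>Bump functions\<close>

text \<open>A basic neighbourhood of the product topology puts an open condition on each coordinate.
  On \<open>Rn n\<close> all coordinates from \<open>n\<close> on are 0, so only finitely many radii
  count and their minimum is positive.\<close>

lemma Rn_box_subset:
  assumes "openin (top_of_set (Rn n)) W" "c \<in> W"
  shows "\<exists>\<epsilon>>0. {x \<in> Rn n. \<forall>i<n. \<bar>x i - c i\<bar> \<le> \<epsilon>} \<subseteq> W"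
proof -
  obtain T where T: "open T" "W = Rn n \<inter> T"
    using assms(1) by (auto simp: openin_open)
  have "openin (product_topology (\<lambda>i. euclidean) UNIV) T" using T(1) open_fun_def by metis
  from product_topology_open_contains_basis[OF this, of c] assms(2) T(2)
  obtain X where X: "c \<in> Pi\<^sub>E UNIV X" "\<And>i. open (X i)" "Pi\<^sub>E UNIV X \<subseteq> T"
    by (auto simp flip: open_openin)
  have "\<exists>e>0. cball (c i) e \<subseteq> X i" for i
    using X(1,2) open_contains_cball[of "X i"] by (auto simp: PiE_def)
  then obtain e where e: "\<And>i. e i > 0" "\<And>i. cball (c i) (e i) \<subseteq> X i" by metis
  \<comment> \<open>The element 1 keeps the minimum meaningful for n = 0.\<close>
  define \<epsilon> where "\<epsilon> = Min (insert 1 (e ` {..<n}))"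
  have "\<epsilon> > 0" using e(1) by (simp add: \<epsilon>_def)
  moreover have "x \<in> W" if x: "x \<in> Rn n" "\<forall>i<n. \<bar>x i - c i\<bar> \<le> \<epsilon>" for x
  proof -
    have "x i \<in> cball (c i) (e i)" for i
    proof (cases "i < n")
      case True
      then have "\<epsilon> \<le> e i" unfolding \<epsilon>_def by (intro Min_le) auto
      then show ?thesis using x(2) True by (auto simp: dist_real_def abs_minus_commute intro: order_trans)
    next
      case False
      then have "x i = c i" using x(1) assms(2) T(2) by (simp add: Rn_def)
      then show ?thesis using e(1)[of i] by simp
    qed
    then have "x i \<in> X i" for i using e(2) by blast
    then have "x \<in> Pi\<^sub>E UNIV X" by (simp add: PiE_def)
    then show ?thesis using X(3) T(2) x(1) by auto
  qed
  ultimately show ?thesis by auto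
qed

text \<open>Tychonoff: the box is a product of intervals and, from index \<open>n\<close> on, of
  singletons.\<close>

lemma compact_Rn_box: "compact {x \<in> Rn n. \<forall>i<n. \<bar>x i - c i\<bar> \<le> \<epsilon>}"
proof -
  define C where "C i = (if i < n then {c i - \<epsilon>..c i + \<epsilon>} else {0})" for i
  have "compactin (product_topology (\<lambda>i. euclidean) UNIV) (Pi\<^sub>E UNIV C)"
    unfolding compactin_PiE by (auto simp: C_def)
  then have "compact (Pi\<^sub>E UNIV C)" by (simp add: euclidean_product_topology)
  moreover have "x i \<in> C i \<longleftrightarrow> (if i < n then \<bar>x i - c i\<bar> \<le> \<epsilon> else x i = 0)" for x i
    by (auto simp: C_def abs_le_iff)
  then have "Pi\<^sub>E UNIV C = {x \<in> Rn n. \<forall>i<n. \<bar>x i - c i\<bar> \<le> \<epsilon>}"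
    unfolding PiE_UNIV_domain Pi_def Rn_def by (auto simp: not_less)
  ultimately show ?thesis by simp
qed

context smooth_mfd
begin

text \<open>The support lies in the chart preimage \<open>C\<close> of a coordinate box. Compactness
  of the box makes \<open>C\<close> closed in the whole Hausdorff space and not only in the chart
  domain, which is what extension by zero requires.\<close>

lemma bump_exists:
  assumes "open T" "p \<in> T"
  shows "\<exists>\<theta> :: 'm \<Rightarrow> 'k::real_normed_field. \<exists>C. smooth_fun_on M UNIV \<theta> \<and> \<theta> p = 1 \<and>
    closed C \<and> C \<subseteq> T \<and> (\<forall>q. q \<notin> C \<longrightarrow> \<theta> q = 0)"
proof -
  let ?n = "mdim M"
  obtain U \<phi> where U: "(U, \<phi>) \<in> atlas M" "p \<in> U" using chart_exists by blast
  obtain \<epsilon> where \<epsilon>: "\<epsilon> > 0" "{x \<in> Rn ?n. \<forall>i<?n. \<bar>x i - \<phi> p i\<bar> \<le> \<epsilon>} \<subseteq> \<phi> ` (U \<inter> T)"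
    using Rn_box_subset[OF chart_image_openin_Int[OF U(1) assms(1)], of "\<phi> p"] U(2) assms(2) by auto
  define K where "K = {x \<in> Rn ?n. \<forall>i<?n. \<bar>x i - \<phi> p i\<bar> \<le> \<epsilon>}"
  define C where "C = inv_into U \<phi> ` K"
  have "K \<subseteq> \<phi> ` U" using \<epsilon>(2) by (auto simp: K_def)
  then have "continuous_on K (inv_into U \<phi>)"
    using chart_homeomorphism[OF U(1)] by (meson continuous_on_subset homeomorphism_def)
  then have "compact C"
    unfolding C_def K_def by (intro compact_continuous_image compact_Rn_box)
  then have "closed C" by (rule compact_imp_closed)
  have "C \<subseteq> T"
    using \<epsilon>(2) chart_inv[OF U(1)] by (auto simp: C_def K_def)
  have "C \<subseteq> U"
    using \<epsilon>(2) chart_inv[OF U(1)] by (auto simp: C_def K_def)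
  \<comment> \<open>With y the offset of coordinate i from the centre, the first two factors are
    both nonzero exactly for |y| < \<open>\<epsilon>\<close>; the third one normalises the product
    at \<open>p\<close>. Differences are written with sums and products, the operations for which
    closure of C^k functions is available.\<close>
  define \<beta> where "\<beta> x = (\<Prod>i<?n. flat 1 (\<epsilon> + (x i + - \<phi> p i)) * flat 1 (\<epsilon> + (-1) * (x i + - \<phi> p i)) * inverse (flat 1 \<epsilon> ^ 2))" for x
  define \<theta> where "\<theta> q = (if q \<in> U then of_real (\<beta> (\<phi> q)) else 0 :: 'k)" for q
  have "\<theta> p = 1"
  proof -
    have "\<beta> (\<phi> p) = 1"
      unfolding \<beta>_def using flat_one_pos[OF \<epsilon>(1)] by (intro prod.neutral) (simp add: power2_eq_square field_simps)
    then show ?thesis using U(2) by (simp add: \<theta>_def)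
  qed
  have \<theta>0: "\<theta> q = 0" if "q \<notin> C" for q
  proof (cases "q \<in> U")
    case True
    have "\<phi> q \<notin> K"
      using that chart_inv[OF U(1) True] unfolding C_def by (metis imageI)
    moreover have "\<phi> q \<in> Rn ?n"
      using True chart_image_openin[OF U(1)] by (auto simp: openin_open)
    ultimately obtain i where i: "i < ?n" "\<bar>\<phi> q i - \<phi> p i\<bar> > \<epsilon>"
      by (auto simp: K_def not_le)
    then have "flat 1 (\<epsilon> + (\<phi> q i + - \<phi> p i)) = 0 \<or> flat 1 (\<epsilon> + (-1) * (\<phi> q i + - \<phi> p i)) = 0"
      by (auto simp: flat_def abs_if split: if_splits)
    then have "\<beta> (\<phi> q) = 0" using i(1) unfolding \<beta>_def by (intro prod_zero) auto
    then show ?thesis by (simp add: \<theta>_def)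
  qed (simp add: \<theta>_def)
  have "smooth_fun_on M UNIV \<theta>"
  proof (rule smooth_fun_on_local)
    fix q :: 'm
    show "\<exists>V. open V \<and> q \<in> V \<and> smooth_fun_on M (UNIV \<inter> V) \<theta>"
    proof (cases "q \<in> U")
      case True
      have "smooth_fun_on M U (\<lambda>q. of_real (\<beta> (\<phi> q)) :: 'k)"
      proof (rule smooth_fun_onI)
        fix V \<psi> k assume V: "(V, \<psi>) \<in> atlas M"
        have o: "openin (top_of_set (Rn ?n)) (\<psi> ` (V \<inter> U))"
          by (rule chart_image_openin_Int[OF V chart_open[OF U(1)]])
        show "Ck_on k ?n (\<psi> ` (V \<inter> U)) (\<lambda>x. of_real (\<beta> (\<phi> (inv_into V \<psi> x))) :: 'k)"
          unfolding \<beta>_def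
          by (rule Ck_on_of_real[OF Ck_on_prod o])
            (intro Ck_on_mult Ck_on_flat Ck_on_add Ck_on_const chart_transition[OF V U(1)] o | simp)+
      qed
      then have "smooth_fun_on M U \<theta>"
        by (rule smooth_fun_on_cong) (auto simp: \<theta>_def chart_open[OF U(1)])
      then show ?thesis using True chart_open[OF U(1)] by auto
    next
      case False
      have "open (- C)" using \<open>closed C\<close> by (simp add: open_Compl)
      have "smooth_fun_on M (- C) \<theta>"
        by (rule smooth_fun_on_cong[OF smooth_fun_on_const]) (use \<theta>0 \<open>open (- C)\<close> in auto)
      then show ?thesis using False \<open>open (- C)\<close> \<open>C \<subseteq> U\<close> by auto
    qed
  qed simp
  then show ?thesis
    using \<open>\<theta> p = 1\<close> \<open>closed C\<close> \<open>C \<subseteq> T\<close> \<theta>0 by blast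
qed

end

lemma sum_fun_apply: "(\<Sum>i\<in>I. f i) x = (\<Sum>i\<in>I. f i x)" for f :: "'i \<Rightarrow> 'a \<Rightarrow> 'b::comm_monoid_add"
  by (induction I rule: infinite_finite_induct) simp_all

section \<open>Vector bundles and local frames\<close>

locale smooth_bundle =
  fixes E :: "('m::{t2_space, second_countable_topology}, 'k::real_normed_field, 'v::ab_group_add, 'z) vbundle_scheme"
  assumes vec_bundle: "vector_bundle E"

sublocale smooth_bundle \<subseteq> smooth_mfd E
  using vec_bundle by unfold_locales (simp add: vector_bundle_def)

sublocale smooth_bundle \<subseteq> vs: vector_space "scl E"
  using vec_bundle by (simp add: vector_bundle_def)

text \<open>The local frame of a trivialisation. The term is the one that occurs in
  \<open>smooth_transition\<close>, whose entries are therefore the coordinates of frame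
  vectors.\<close>

definition frame where
  "frame E \<tau> q j = inv_into (fib E q) (\<tau> q) (\<lambda>l. if l = j then 1 else 0)"

context smooth_bundle
begin

lemma fib_subspace: "vs.subspace (fib E q)"
  using vec_bundle by (simp add: vector_bundle_def)

lemma triv_local_triv: "(U, r, \<tau>) \<in> trivs E \<Longrightarrow> local_triv E U r \<tau>"
  using vec_bundle by (auto simp: vector_bundle_def)

lemma triv_exists: "\<exists>U r \<tau>. (U, r, \<tau>) \<in> trivs E \<and> q \<in> U"
proof -
  have "q \<in> \<Union> (fst ` trivs E)"
    using vec_bundle by (simp add: vector_bundle_def)
  then show ?thesis by force
qed

context
  fixes U r \<tau>
  assumes triv: "local_triv E U r \<tau>"
begin

lemma local_triv_open: "open U"
  using triv by (simp add: local_triv_def)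

context
  fixes q assumes q: "q \<in> U"
begin

lemma local_triv_bij: "bij_betw (\<tau> q) (fib E q) (Kn r)"
  and local_triv_add: "v \<in> fib E q \<Longrightarrow> w \<in> fib E q \<Longrightarrow> \<tau> q (v + w) i = \<tau> q v i + \<tau> q w i"
  and local_triv_scl: "v \<in> fib E q \<Longrightarrow> \<tau> q (scl E c v) i = c * \<tau> q v i"
  using triv q by (auto simp: local_triv_def)

lemma local_triv_zero: "\<tau> q 0 i = 0"
  using local_triv_scl[of 0 0 i] vs.subspace_0[OF fib_subspace] by simp

lemma local_triv_sum:
  assumes "\<And>j. j \<in> J \<Longrightarrow> f j \<in> fib E q"
  shows "\<tau> q (\<Sum>j\<in>J. scl E (c j) (f j)) i = (\<Sum>j\<in>J. c j * \<tau> q (f j) i)"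
  using assms
proof (induction J rule: infinite_finite_induct)
  case (insert j J)
  have "(\<Sum>j\<in>J. scl E (c j) (f j)) \<in> fib E q"
    using insert.prems by (intro vs.subspace_sum[OF fib_subspace] vs.subspace_scale[OF fib_subspace]) auto
  then show ?case
    using insert by (simp add: local_triv_add local_triv_scl vs.subspace_scale[OF fib_subspace])
qed (simp_all add: local_triv_zero)

lemma frame_in_fib: "j < r \<Longrightarrow> frame E \<tau> q j \<in> fib E q"
  and local_triv_frame: "j < r \<Longrightarrow> \<tau> q (frame E \<tau> q j) = (\<lambda>l. if l = j then 1 else 0)"
proof -
  assume "j < r"
  then have *: "(\<lambda>l. if l = j then 1 else 0) \<in> \<tau> q ` fib E q"
    using local_triv_bij by (auto simp: bij_betw_def Kn_def)
  show "frame E \<tau> q j \<in> fib E q" "\<tau> q (frame E \<tau> q j) = (\<lambda>l. if l = j then 1 else 0)"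
    unfolding frame_def using inv_into_into[OF *] f_inv_into_f[OF *] by simp_all
qed

text \<open>The bound \<open>s\<close> below the rank serves subbundles, whose vectors have only
  their first \<open>s\<close> coordinates nonzero in an adapted trivialisation.\<close>

lemma frame_expansion:
  assumes "v \<in> fib E q" "\<tau> q v \<in> Kn s" "s \<le> r"
  shows "v = (\<Sum>j<s. scl E (\<tau> q v j) (frame E \<tau> q j))"
proof (rule inj_onD[OF bij_betw_imp_inj_on[OF local_triv_bij] _ assms(1)])
  show "(\<Sum>j<s. scl E (\<tau> q v j) (frame E \<tau> q j)) \<in> fib E q"
    using assms(3) by (intro vs.subspace_sum[OF fib_subspace] vs.subspace_scale[OF fib_subspace] frame_in_fib) simp
  show "\<tau> q v = \<tau> q (\<Sum>j<s. scl E (\<tau> q v j) (frame E \<tau> q j))"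
  proof
    fix i
    have "\<tau> q (\<Sum>j<s. scl E (\<tau> q v j) (frame E \<tau> q j)) i = (\<Sum>j<s. \<tau> q v j * (if i = j then 1 else 0))"
      using assms(3) by (subst local_triv_sum) (auto simp: local_triv_frame frame_in_fib)
    also have "\<dots> = \<tau> q v i"
      using assms(2) by (auto simp: Kn_def if_distrib[of "\<lambda>x. _ * x"] cong: if_cong)
    finally show "\<tau> q v i = \<tau> q (\<Sum>j<s. scl E (\<tau> q v j) (frame E \<tau> q j)) i" ..
  qed
qed

end

end

lemma section_in_fib: "u \<in> sections E \<Longrightarrow> u q \<in> fib E q"
  by (simp add: sections_def)

lemma sections_coord: "u \<in> sections E \<Longrightarrow> (U, r, \<tau>) \<in> trivs E \<Longrightarrow> i < r \<Longrightarrow> smooth_fun_on E U (\<lambda>q. \<tau> q (u q) i)"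
  by (auto simp: sections_def)

lemma sectionsI:
  "(\<And>q. u q \<in> fib E q) \<Longrightarrow> (\<And>U r \<tau> i. (U, r, \<tau>) \<in> trivs E \<Longrightarrow> i < r \<Longrightarrow> smooth_fun_on E U (\<lambda>q. \<tau> q (u q) i))
    \<Longrightarrow> u \<in> sections E"
  by (auto simp: sections_def)

lemma sections_add:
  assumes "u \<in> sections E" "v \<in> sections E"
  shows "u + v \<in> sections E"
proof (rule sectionsI)
  show "(u + v) q \<in> fib E q" for q
    using assms by (simp add: section_in_fib vs.subspace_add[OF fib_subspace])
  fix U r \<tau> i assume U: "(U, r, \<tau>) \<in> trivs E" "i < r"
  note o = local_triv_open[OF triv_local_triv[OF U(1)]]
  show "smooth_fun_on E U (\<lambda>q. \<tau> q ((u + v) q) i)"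
    by (rule smooth_fun_on_cong[OF smooth_fun_on_add[OF sections_coord[OF assms(1) U] sections_coord[OF assms(2) U] o] o])
      (simp add: local_triv_add[OF triv_local_triv[OF U(1)]] section_in_fib assms)
qed

lemma sections_fmul:
  assumes "f \<in> smooth_funs E" "u \<in> sections E"
  shows "fmul E f u \<in> sections E"
proof (rule sectionsI)
  show "fmul E f u q \<in> fib E q" for q
    using assms by (simp add: fmul_def section_in_fib vs.subspace_scale[OF fib_subspace])
  fix U r \<tau> i assume U: "(U, r, \<tau>) \<in> trivs E" "i < r"
  note o = local_triv_open[OF triv_local_triv[OF U(1)]]
  have "smooth_fun_on E U f"
    using assms(1) unfolding smooth_funs_def by (auto intro: smooth_fun_on_subset)
  from smooth_fun_on_mult[OF this sections_coord[OF assms(2) U] o]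
  show "smooth_fun_on E U (\<lambda>q. \<tau> q (fmul E f u q) i)"
    by (rule smooth_fun_on_cong)
      (simp_all add: o fmul_def local_triv_scl[OF triv_local_triv[OF U(1)]] section_in_fib assms)
qed

lemma sections_zero: "0 \<in> sections E"
proof (rule sectionsI)
  show "0 q \<in> fib E q" for q by (simp add: vs.subspace_0[OF fib_subspace])
  fix U r \<tau> i assume U: "(U, r, \<tau>) \<in> trivs E" "i < r"
  note o = local_triv_open[OF triv_local_triv[OF U(1)]]
  show "smooth_fun_on E U (\<lambda>q. \<tau> q (0 q) i)"
    by (rule smooth_fun_on_cong[OF smooth_fun_on_const[OF o] o])
      (simp add: local_triv_zero[OF triv_local_triv[OF U(1)]])
qed

context
  fixes F :: "'m \<Rightarrow> 'v set" assumes F: "\<And>q. vs.subspace (F q)"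
begin

lemma subsections_zero: "0 \<in> subsections E F"
  using sections_zero vs.subspace_0[OF F] unfolding subsections_def by simp

lemma subsections_add:
  "u \<in> subsections E F \<Longrightarrow> v \<in> subsections E F \<Longrightarrow> u + v \<in> subsections E F"
  using sections_add[of u v] vs.subspace_add[OF F] unfolding subsections_def mem_Collect_eq plus_fun_apply
  by blast

lemma subsections_fmul:
  "f \<in> smooth_funs E \<Longrightarrow> u \<in> subsections E F \<Longrightarrow> fmul E f u \<in> subsections E F"
  using sections_fmul[of f u] vs.subspace_scale[OF F] unfolding subsections_def by (simp add: fmul_def)

end

text \<open>Sections are tested only in the given trivialisations. In a compatible one the
  coordinates are, locally, combinations of the given coordinates with transition entries as
  coefficients.\<close>

lemma coord_smooth:
  assumes "local_triv E U r \<tau>" "u \<in> sections E" "i < r"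
    and trans: "\<And>V l \<sigma>. (V, l, \<sigma>) \<in> trivs E \<Longrightarrow> smooth_transition E V l \<sigma> U r \<tau>"
  shows "smooth_fun_on E U (\<lambda>q. \<tau> q (u q) i)"
proof (rule smooth_fun_on_local)
  fix q assume "q \<in> U"
  obtain V l \<sigma> where V: "(V, l, \<sigma>) \<in> trivs E" "q \<in> V" using triv_exists by blast
  note tV = triv_local_triv[OF V(1)]
  have o: "open (U \<inter> V)"
    using local_triv_open[OF assms(1)] local_triv_open[OF tV] by (rule open_Int)
  have "smooth_fun_on E (U \<inter> V) (\<lambda>q. \<Sum>j<l. \<sigma> q (u q) j * \<tau> q (frame E \<sigma> q j) i)"
  proof (rule smooth_fun_on_sum[OF smooth_fun_on_mult[OF _ _ o] o])
    fix j assume "j \<in> {..<l}"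
    then show "smooth_fun_on E (U \<inter> V) (\<lambda>q. \<sigma> q (u q) j)"
      using sections_coord[OF assms(2) V(1)] by (auto intro: smooth_fun_on_subset)
    show "smooth_fun_on E (U \<inter> V) (\<lambda>q. \<tau> q (frame E \<sigma> q j) i)"
      using trans[OF V(1)] \<open>j \<in> {..<l}\<close> assms(3)
      by (simp add: smooth_transition_def frame_def Int_commute)
  qed
  moreover have "(\<Sum>j<l. \<sigma> x (u x) j * \<tau> x (frame E \<sigma> x j) i) = \<tau> x (u x) i" if "x \<in> U \<inter> V" for x
  proof -
    have "u x \<in> fib E x" using assms(2) by (rule section_in_fib)
    moreover have "\<sigma> x (u x) \<in> Kn l"
      using bij_betw_apply[OF local_triv_bij[OF tV]] that \<open>u x \<in> fib E x\<close> by simp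
    ultimately have "u x = (\<Sum>j<l. scl E (\<sigma> x (u x) j) (frame E \<sigma> x j))"
      using frame_expansion[OF tV] that by simp
    then have "\<tau> x (u x) i = \<tau> x (\<Sum>j<l. scl E (\<sigma> x (u x) j) (frame E \<sigma> x j)) i" by simp
    also have "\<dots> = (\<Sum>j<l. \<sigma> x (u x) j * \<tau> x (frame E \<sigma> x j) i)"
      using that by (intro local_triv_sum[OF assms(1)] frame_in_fib[OF tV]) auto
    finally show ?thesis ..
  qed
  ultimately have "smooth_fun_on E (U \<inter> V) (\<lambda>q. \<tau> q (u q) i)"
    using o by (auto intro: smooth_fun_on_cong)
  then show "\<exists>T. open T \<and> q \<in> T \<and> smooth_fun_on E (U \<inter> T) (\<lambda>q. \<tau> q (u q) i)"
    using V(2) local_triv_open[OF tV] by blast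
qed (rule local_triv_open[OF assms(1)])

text \<open>In any given trivialisation the coordinates are the cutoff times transition entries, and
  the cutoff makes them extend by zero.\<close>

lemma frame_section:
  assumes "local_triv E U r \<tau>" "j < r"
    and trans: "\<And>V l \<sigma>. (V, l, \<sigma>) \<in> trivs E \<Longrightarrow> smooth_transition E U r \<tau> V l \<sigma>"
    and \<theta>: "smooth_fun_on E UNIV \<theta>" "closed C" "C \<subseteq> U" "\<And>q. q \<notin> C \<Longrightarrow> \<theta> q = 0"
  shows "(\<lambda>q. if q \<in> U then scl E (\<theta> q) (frame E \<tau> q j) else 0) \<in> sections E"
proof (rule sectionsI)
  show "(if q \<in> U then scl E (\<theta> q) (frame E \<tau> q j) else 0) \<in> fib E q" for q
    using frame_in_fib[OF assms(1)] assms(2)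
    by (auto intro: vs.subspace_0[OF fib_subspace] vs.subspace_scale[OF fib_subspace])
  fix V l \<sigma> i assume V: "(V, l, \<sigma>) \<in> trivs E" "i < l"
  note tV = triv_local_triv[OF V(1)]
  have "smooth_fun_on E (V \<inter> U) (\<lambda>q. \<sigma> q (frame E \<tau> q j) i)"
    using trans[OF V(1)] assms(2) V(2) by (simp add: smooth_transition_def frame_def Int_commute)
  with \<theta> have "smooth_fun_on E V (\<lambda>q. if q \<in> U then \<theta> q * \<sigma> q (frame E \<tau> q j) i else 0)"
    by (intro smooth_fun_on_extend_zero[of \<theta> C] local_triv_open[OF tV] local_triv_open[OF assms(1)])
  then show "smooth_fun_on E V (\<lambda>q. \<sigma> q (if q \<in> U then scl E (\<theta> q) (frame E \<tau> q j) else 0) i)"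
    by (rule smooth_fun_on_cong)
      (auto simp: local_triv_open[OF tV] local_triv_zero[OF tV] local_triv_scl[OF tV] frame_in_fib[OF assms(1)] assms(2))
qed

end

text \<open>A dual basis of \<open>\<Gamma>(F)\<close> modulo functions vanishing at \<open>p\<close>: localising with a bump function
  replaces global finite generation, and turns \<open>C\<^sup>\<infinity>\<close>-linearity into a pointwise property.\<close>

lemma (in smooth_bundle) dual_basis_at:
  assumes "subbundle E F"
  obtains n :: nat and e c g where
    "\<And>i. i < n \<Longrightarrow> e i \<in> subsections E F"
    "g \<in> smooth_funs E" "g p = 0"
    "\<And>i u. i < n \<Longrightarrow> u \<in> subsections E F \<Longrightarrow> c i u \<in> smooth_funs E"
    "\<And>u. u \<in> subsections E F \<Longrightarrow> u = (\<Sum>i<n. fmul E (c i u) (e i)) + fmul E g u"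
    "\<And>i u v. i < n \<Longrightarrow> u \<in> subsections E F \<Longrightarrow> v \<in> subsections E F \<Longrightarrow> c i (u + v) = c i u + c i v"
    "\<And>i f u. i < n \<Longrightarrow> u \<in> subsections E F \<Longrightarrow> c i (fmul E f u) = f * c i u"
    "\<And>i u. i < n \<Longrightarrow> u p = 0 \<Longrightarrow> c i u p = 0"
    "\<And>v. v \<in> F p \<Longrightarrow> \<exists>u\<in>subsections E F. u p = v"
proof -
  from assms obtain U r \<tau> s where U: "p \<in> U" "local_triv E U r \<tau>"
    "\<forall>(V, l, \<sigma>)\<in>trivs E. smooth_transition E U r \<tau> V l \<sigma> \<and> smooth_transition E V l \<sigma> U r \<tau>"
    "\<forall>q\<in>U. \<tau> q ` F q = Kn s"
    unfolding subbundle_def by meson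
  then have p: "p \<in> U" and t: "local_triv E U r \<tau>"
    and trans: "\<And>V l \<sigma>. (V, l, \<sigma>) \<in> trivs E \<Longrightarrow> smooth_transition E U r \<tau> V l \<sigma>"
      "\<And>V l \<sigma>. (V, l, \<sigma>) \<in> trivs E \<Longrightarrow> smooth_transition E V l \<sigma> U r \<tau>"
    and F: "\<And>q. q \<in> U \<Longrightarrow> \<tau> q ` F q = Kn s"
    by auto
  have F_sub: "F q \<subseteq> fib E q" "vs.subspace (F q)" for q
    using assms by (auto simp: subbundle_def)
  have "s \<le> r"
  proof (rule ccontr)
    assume "\<not> s \<le> r"
    have "Kn s \<subseteq> (Kn r :: (nat \<Rightarrow> 'k) set)"
      using F[OF p] F_sub(1) bij_betw_imp_surj_on[OF local_triv_bij[OF t p]] by blast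
    moreover have "(\<lambda>l. if l = r then 1 else 0) \<in> (Kn s :: (nat \<Rightarrow> 'k) set)"
      using \<open>\<not> s \<le> r\<close> by (auto simp: Kn_def)
    ultimately have "(\<lambda>l. if l = r then 1 else 0) \<in> (Kn r :: (nat \<Rightarrow> 'k) set)"
      by (rule subsetD)
    then show False by (auto simp: Kn_def dest: spec[of _ r])
  qed
  have frame_F: "frame E \<tau> q j \<in> F q" if "q \<in> U" "j < s" for q j
  proof -
    have "(\<lambda>l. if l = j then 1 else 0) \<in> \<tau> q ` F q"
      using that by (simp add: F Kn_def)
    then obtain v where v: "v \<in> F q" "\<tau> q v = (\<lambda>l. if l = j then 1 else 0)" by auto
    then have "v = frame E \<tau> q j"
      using that \<open>s \<le> r\<close> F_sub(1)[of q]
      by (intro inj_onD[OF bij_betw_imp_inj_on[OF local_triv_bij[OF t that(1)]]])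
        (auto simp: local_triv_frame[OF t] frame_in_fib[OF t])
    then show ?thesis using v(1) by simp
  qed
  obtain \<theta> C where \<theta>: "smooth_fun_on E UNIV (\<theta> :: 'm \<Rightarrow> 'k)" "\<theta> p = 1" "closed C" "C \<subseteq> U"
      "\<And>q. q \<notin> C \<Longrightarrow> \<theta> q = 0"
    using bump_exists[OF local_triv_open[OF t] p] by blast
  \<comment> \<open>The cutoff is used once in \<open>e\<close> and once in \<open>c\<close>,
    because both must be globally smooth. The expansion therefore recovers \<open>\<theta>\<close>
    squared times \<open>u\<close>, and \<open>g\<close> is the coefficient of the
    remainder.\<close>
  define e where "e j q = (if q \<in> U then scl E (\<theta> q) (frame E \<tau> q j) else 0)" for j q
  define c where "c j u q = (if q \<in> U then \<theta> q * \<tau> q (u q) j else 0)" for j u q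
  define g where "g q = 1 + (-1) * (\<theta> q * \<theta> q)" for q
  have e: "e j \<in> subsections E F" if "j < s" for j
    unfolding subsections_def
  proof safe
    have "j < r" using that \<open>s \<le> r\<close> by simp
    show "e j \<in> sections E"
      unfolding e_def by (rule frame_section[OF t \<open>j < r\<close> trans(1) \<theta>(1,3,4,5)])
    show "e j q \<in> F q" for q
      using frame_F that by (auto simp: e_def intro: vs.subspace_0 vs.subspace_scale F_sub(2))
  qed
  have exp: "u q = (\<Sum>j<s. scl E (\<tau> q (u q) j) (frame E \<tau> q j))" if "u \<in> subsections E F" "q \<in> U" for u q
  proof (rule frame_expansion[OF t that(2) _ _ \<open>s \<le> r\<close>])
    have "u q \<in> F q" using that(1) by (simp add: subsections_def)
    then show "u q \<in> fib E q" "\<tau> q (u q) \<in> Kn s" using F_sub(1) F[OF that(2)] by auto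
  qed
  show thesis
  proof
    show "\<And>i. i < s \<Longrightarrow> e i \<in> subsections E F" by (rule e)
    show "g \<in> smooth_funs E"
      unfolding smooth_funs_def g_def
      by (simp only: mem_Collect_eq)
        (intro smooth_fun_on_add smooth_fun_on_const smooth_fun_on_mult \<theta>(1) open_UNIV)
    show "g p = 0" by (simp add: g_def \<theta>(2))
    show "c i u \<in> smooth_funs E" if "i < s" "u \<in> subsections E F" for i u
    proof -
      have "smooth_fun_on E U (\<lambda>q. \<tau> q (u q) i)"
        using that \<open>s \<le> r\<close> by (intro coord_smooth[OF t _ _ trans(2)]) (auto simp: subsections_def)
      then have "smooth_fun_on E UNIV (\<lambda>q. if q \<in> U then \<theta> q * \<tau> q (u q) i else 0)"
        using smooth_fun_on_extend_zero[OF \<theta>(1,3,4) local_triv_open[OF t] open_UNIV \<theta>(5)]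
        unfolding Int_UNIV_left by blast
      then show ?thesis unfolding smooth_funs_def by (simp add: c_def[abs_def])
    qed
    show "u = (\<Sum>i<s. fmul E (c i u) (e i)) + fmul E g u" if u: "u \<in> subsections E F" for u
    proof
      fix q
      show "u q = ((\<Sum>i<s. fmul E (c i u) (e i)) + fmul E g u) q"
      proof (cases "q \<in> U")
        case True
        have "(\<Sum>i<s. fmul E (c i u) (e i)) q = scl E (\<theta> q * \<theta> q) (\<Sum>j<s. scl E (\<tau> q (u q) j) (frame E \<tau> q j))"
          unfolding vs.scale_sum_right sum_fun_apply using True
          by (simp add: fmul_def c_def e_def mult_ac)
        also have "\<dots> = scl E (\<theta> q * \<theta> q) (u q)" using exp[OF u True] by simp
        finally show ?thesis
          by (simp add: fmul_def g_def vs.scale_left_diff_distrib)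
      next
        case False
        then have "\<theta> q = 0" using \<theta>(4,5) by blast
        then show ?thesis
          using False by (simp add: fmul_def g_def sum_fun_apply c_def)
      qed
    qed
    show "c i (u + v) = c i u + c i v" if "i < s" "u \<in> subsections E F" "v \<in> subsections E F" for i u v
      using that by (auto simp: c_def fun_eq_iff subsections_def section_in_fib local_triv_add[OF t] distrib_left)
    show "c i (fmul E f u) = f * c i u" if "i < s" "u \<in> subsections E F" for i f u
      using that by (auto simp: c_def fun_eq_iff subsections_def section_in_fib fmul_def local_triv_scl[OF t])
    show "c i u p = 0" if "u p = 0" for i u
      using that by (simp add: c_def local_triv_zero[OF t])
    show "\<exists>u\<in>subsections E F. u p = v" if "v \<in> F p" for v
    proof -
      \<comment> \<open>Only the value at \<open>p\<close> is prescribed, and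
        \<open>\<theta>\<close> is 1 there, so constant coefficients suffice.\<close>
      define u where "u = (\<Sum>j<s. fmul E (\<lambda>_. \<tau> p v j) (e j))"
      have "v = (\<Sum>j<s. scl E (\<tau> p v j) (frame E \<tau> p j))"
        using that F_sub(1) F[OF p] by (intro frame_expansion[OF t p _ _ \<open>s \<le> r\<close>]) auto
      then have "u p = v"
        by (simp add: u_def sum_fun_apply fmul_def e_def p \<theta>(2))
      have "(\<Sum>j\<in>J. fmul E (\<lambda>_. \<tau> p v j) (e j)) \<in> subsections E F" if "J \<subseteq> {..<s}" for J
      proof -
        have "finite J" using that finite_subset by blast
        then show ?thesis using that
        proof (induction J rule: finite_induct)
          case (insert j J)
          have "fmul E (\<lambda>_. \<tau> p v j) (e j) \<in> subsections E F"
            using e[of j] insert.prems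
            by (intro subsections_fmul[OF F_sub(2)]) (auto simp: smooth_funs_def smooth_fun_on_const)
          moreover have "(\<Sum>j\<in>J. fmul E (\<lambda>_. \<tau> p v j) (e j)) \<in> subsections E F"
            using insert by simp
          ultimately show ?case
            unfolding sum.insert[OF insert.hyps] by (rule subsections_add[OF F_sub(2)])
        qed (simp only: sum.empty subsections_zero[OF F_sub(2)])
      qed
      from this[OF order_refl] have "u \<in> subsections E F" unfolding u_def .
      with \<open>u p = v\<close> show ?thesis by blast
    qed
  qed
qed

section \<open>Operators on cochains\<close>

declare plus_fun_apply [simp del] zero_fun_apply [simp del] times_fun_apply [simp del]
  minus_apply [simp del] uminus_apply [simp del] one_fun_apply [simp del]

text \<open>Evaluation of pointwise operations, only for functions of lists: values, which are functions
  themselves, are left alone.\<close>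

lemma list_fun_apply:
  fixes X Y :: "'x list \<Rightarrow> 'b::ab_group_add"
  shows "(X + Y) as = X as + Y as" "(X - Y) as = X as - Y as" "(- X) as = - X as" "(0 :: 'x list \<Rightarrow> 'b) as = 0"
  by (simp_all add: plus_fun_apply zero_fun_apply minus_apply uminus_apply)

section \<open>Signs, additive subgroups and additive maps\<close>

text \<open>The scalar (-1)^k, for values in a bare additive group that carries no scalar
  multiplication.\<close>

definition sg :: "nat \<Rightarrow> 'b::ab_group_add \<Rightarrow> 'b" where
  "sg k x = (if even k then x else - x)"

lemma sg_simps [simp]:
  "sg k (0 :: 'b::ab_group_add) = 0" "sg 0 x = x" "sg (Suc k) x = - sg k x" "sg k (- x) = - sg k x"
  "sg k (x + y) = sg k x + sg k y" "sg k (x - y) = sg k x - sg k y" "sg k (sg l x) = sg (k + l) x"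
  for x y :: "'b::ab_group_add"
  by (auto simp: sg_def)

lemma sg_cancel [simp]: "sg (k + k) x = x" "sg (k + (k + l)) x = sg l x"
  by (auto simp: sg_def)

lemma sg_apply: "sg k X (as :: 'x list) = sg k (X as)"
  by (simp add: sg_def list_fun_apply)

lemmas fa = list_fun_apply sg_apply

definition subgrp :: "'b::ab_group_add set \<Rightarrow> bool" where
  "subgrp A \<longleftrightarrow> 0 \<in> A \<and> (\<forall>x\<in>A. \<forall>y\<in>A. x - y \<in> A)"

lemma subgrpD:
  assumes "subgrp A"
  shows "0 \<in> A" "x \<in> A \<Longrightarrow> y \<in> A \<Longrightarrow> x - y \<in> A" "x \<in> A \<Longrightarrow> - x \<in> A"
    "x \<in> A \<Longrightarrow> y \<in> A \<Longrightarrow> x + y \<in> A" "x \<in> A \<Longrightarrow> sg k x \<in> A"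
proof -
  show 0: "0 \<in> A" and d: "x \<in> A \<Longrightarrow> y \<in> A \<Longrightarrow> x - y \<in> A" for x y
    using assms by (auto simp: subgrp_def)
  show m: "x \<in> A \<Longrightarrow> - x \<in> A" for x
    using d[OF 0, of x] by simp
  show "x \<in> A \<Longrightarrow> y \<in> A \<Longrightarrow> x + y \<in> A"
    using d[of x "- y"] m by simp
  show "x \<in> A \<Longrightarrow> sg k x \<in> A"
    using m by (simp add: sg_def)
qed

lemma subgrp_sum: "subgrp A \<Longrightarrow> (\<And>i. i \<in> I \<Longrightarrow> f i \<in> A) \<Longrightarrow> sum f I \<in> A"
  by (induction I rule: infinite_finite_induct) (auto intro: subgrpD)

definition hom :: "'a::ab_group_add set \<Rightarrow> 'b::ab_group_add set \<Rightarrow> ('a \<Rightarrow> 'b) \<Rightarrow> bool" where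
  "hom A B F \<longleftrightarrow> (\<forall>x\<in>A. F x \<in> B) \<and> (\<forall>x\<in>A. \<forall>y\<in>A. F (x + y) = F x + F y)"

lemma homI: "(\<And>x. x \<in> A \<Longrightarrow> F x \<in> B) \<Longrightarrow> (\<And>x y. x \<in> A \<Longrightarrow> y \<in> A \<Longrightarrow> F (x + y) = F x + F y) \<Longrightarrow> hom A B F"
  by (simp add: hom_def)

lemma hom_in: "hom A B F \<Longrightarrow> x \<in> A \<Longrightarrow> F x \<in> B"
  and hom_plus: "hom A B F \<Longrightarrow> x \<in> A \<Longrightarrow> y \<in> A \<Longrightarrow> F (x + y) = F x + F y"
  by (auto simp: hom_def)

lemma
  assumes "hom A B F" "subgrp A"
  shows hom_0: "F 0 = 0"
    and hom_minus: "x \<in> A \<Longrightarrow> F (- x) = - F x"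
    and hom_diff: "x \<in> A \<Longrightarrow> y \<in> A \<Longrightarrow> F (x - y) = F x - F y"
    and hom_sg: "x \<in> A \<Longrightarrow> F (sg k x) = sg k (F x)"
proof -
  show 0: "F 0 = 0"
    using hom_plus[OF assms(1), of 0 0] subgrpD[OF assms(2)] by simp
  show m: "F (- x) = - F x" if "x \<in> A" for x
    using hom_plus[OF assms(1), of x "- x"] subgrpD(3)[OF assms(2) that] that 0
    by (simp add: eq_neg_iff_add_eq_0 add.commute)
  show "x \<in> A \<Longrightarrow> y \<in> A \<Longrightarrow> F (x - y) = F x - F y"
    using hom_plus[OF assms(1), of x "- y"] subgrpD(3)[OF assms(2), of y] m by simp
  show "x \<in> A \<Longrightarrow> F (sg k x) = sg k (F x)"
    using m by (simp add: sg_def)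
qed

lemma hom_sum:
  assumes "hom A B F" "subgrp A" "\<And>i. i \<in> I \<Longrightarrow> f i \<in> A"
  shows "F (sum f I) = (\<Sum>i\<in>I. F (f i))"
  using assms(3)
  by (induction I rule: infinite_finite_induct)
    (simp_all add: hom_0[OF assms(1,2)] hom_plus[OF assms(1)] subgrp_sum[OF assms(2)])

lemma hom_comp: "hom A B F \<Longrightarrow> hom B C G \<Longrightarrow> hom A C (\<lambda>x. G (F x))"
  by (simp add: hom_def)

lemma hom_op_add: "hom A B F \<Longrightarrow> hom A B G \<Longrightarrow> subgrp B \<Longrightarrow> hom A B (\<lambda>x. F x + G x)"
  by (simp add: hom_def subgrpD add_ac)

lemma hom_op_diff: "hom A B F \<Longrightarrow> hom A B G \<Longrightarrow> subgrp B \<Longrightarrow> hom A B (\<lambda>x. F x - G x)"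
  by (simp add: hom_def subgrpD)

section \<open>Cochains, contraction and Lie operators\<close>

text \<open>The ambient class of cochains: no degree, no linearity and no symmetry is imposed. It is
  stable under contraction, so inductions on the argument list stay inside it.\<close>

definition VF :: "'a set \<Rightarrow> 'b::ab_group_add set \<Rightarrow> ('a list \<Rightarrow> 'b) set" where
  "VF SA \<Gamma> = {X. (\<forall>as. X as \<in> \<Gamma>) \<and> (\<forall>as. \<not> set as \<subseteq> SA \<longrightarrow> X as = 0)}"

lemma VF_in: "X \<in> VF SA \<Gamma> \<Longrightarrow> X as \<in> \<Gamma>"
  and VF_out: "X \<in> VF SA \<Gamma> \<Longrightarrow> \<not> set as \<subseteq> SA \<Longrightarrow> X as = 0"
  by (auto simp: VF_def)

lemma subgrp_VF: "subgrp \<Gamma> \<Longrightarrow> subgrp (VF SA \<Gamma>)"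
  by (auto simp: subgrp_def VF_def fa)

definition ins :: "'a \<Rightarrow> ('a list \<Rightarrow> 'b) \<Rightarrow> 'a list \<Rightarrow> 'b" where
  "ins a X = (\<lambda>as. X (a # as))"

lemma ins_apply: "ins a X as = X (a # as)"
  by (simp add: ins_def)

lemma ins_simps [simp]:
  fixes X Y :: "'a list \<Rightarrow> 'b::ab_group_add"
  shows "ins a (X + Y) = ins a X + ins a Y" "ins a (X - Y) = ins a X - ins a Y"
    "ins a (- X) = - ins a X" "ins a (sg k X) = sg k (ins a X)" "ins a 0 = (0 :: 'a list \<Rightarrow> 'b)"
  by (rule ext, simp add: ins_def fa sg_def zero_fun_def)+

lemma ins_VF: "X \<in> VF SA \<Gamma> \<Longrightarrow> ins a X \<in> VF SA \<Gamma>"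
  by (auto simp: VF_def ins_apply)

lemma ins_form0 [simp]: "ins a (form0 v) = 0"
  by (rule ext) (simp add: ins_apply form0_def zero_fun_def)

lemma form0_VF: "subgrp \<Gamma> \<Longrightarrow> v \<in> \<Gamma> \<Longrightarrow> form0 v \<in> VF SA \<Gamma>"
  by (auto simp: VF_def form0_def subgrpD)

lemma form0_Nil [simp]: "form0 v [] = v"
  by (simp add: form0_def)

text \<open>One operator for every Lie-type derivative, with \<open>T\<close> acting on arguments
  and \<open>D\<close> on values: L_a, the action of \<open>eth\<close> on forms and the action of a
  derivation of L are all of this shape.\<close>

definition lie :: "'a set \<Rightarrow> ('a \<Rightarrow> 'a) \<Rightarrow> ('b \<Rightarrow> 'b) \<Rightarrow> ('a list \<Rightarrow> 'b::ab_group_add) \<Rightarrow> 'a list \<Rightarrow> 'b" where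
  "lie SA T D X as = (if set as \<subseteq> SA then D (X as) - (\<Sum>j<length as. X (as[j := T (as ! j)])) else 0)"

lemma lie_Nil [simp]: "lie SA T D X [] = D (X [])"
  by (simp add: lie_def)

lemma lie_out: "\<not> set as \<subseteq> SA \<Longrightarrow> lie SA T D X as = 0"
  by (simp add: lie_def)

text \<open>The commutator of contraction and Lie operator: in the sum over slots, the term of the
  first slot is the contraction with \<open>T a\<close>.\<close>

lemma ins_lie:
  assumes "X \<in> VF SA \<Gamma>" "a \<in> SA"
  shows "ins a (lie SA T D X) = lie SA T D (ins a X) - ins (T a) X"
proof
  fix as
  show "ins a (lie SA T D X) as = (lie SA T D (ins a X) - ins (T a) X) as"
  proof (cases "set as \<subseteq> SA")
    case True
    then show ?thesis
      using assms
      by (simp add: ins_apply fa lie_def sum.lessThan_Suc_shift algebra_simps del: sum.lessThan_Suc)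
  next
    case False
    then show ?thesis
      using VF_out[OF assms(1), of "T a # as"] by (simp add: ins_apply fa lie_def)
  qed
qed

lemma hom_lie:
  assumes "hom \<Gamma> \<Gamma>' D" "\<Gamma> \<subseteq> \<Gamma>'" "subgrp \<Gamma>'"
  shows "hom (VF SA \<Gamma>) (VF SA \<Gamma>') (lie SA T D)"
proof (rule homI)
  fix X Y assume X: "X \<in> VF SA \<Gamma>" and Y: "Y \<in> VF SA \<Gamma>"
  have "lie SA T D X as \<in> \<Gamma>'" for as
    using assms VF_in[OF X] unfolding lie_def
    by (auto intro!: subgrpD[OF assms(3)] subgrp_sum[OF assms(3)] hom_in[OF assms(1)])
  then show "lie SA T D X \<in> VF SA \<Gamma>'" by (auto simp: VF_def lie_def)
  show "lie SA T D (X + Y) = lie SA T D X + lie SA T D Y"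
    using VF_in[OF X] VF_in[OF Y]
    by (simp add: fun_eq_iff lie_def fa hom_plus[OF assms(1)] sum.distrib)
qed

lemmas hom_lie' = hom_lie[OF _ order_refl]

lemma lie_form0:
  assumes "D 0 = 0"
  shows "lie SA T D (form0 v) = form0 (D v)"
proof
  fix as show "lie SA T D (form0 v) as = form0 (D v) as"
    using assms
    by (cases as) (simp_all add: lie_def form0_def sum.lessThan_Suc_shift del: sum.lessThan_Suc)
qed

section \<open>Shuffle products\<close>

text \<open>\<open>shuf k X \<Phi>\<close> is the signed sum of \<open>\<Phi> (X as\<^sub>S) as\<^sub>T\<close> over all shuffles \<open>(S, T)\<close>, for \<open>X\<close> of degree
  \<open>k\<close>; only the parity of \<open>k\<close> matters. Wedge products and insertion operators are special cases.\<close>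

primrec shuf :: "nat \<Rightarrow> ('a list \<Rightarrow> 'b) \<Rightarrow> ('b \<Rightarrow> 'a list \<Rightarrow> 'c::ab_group_add) \<Rightarrow> 'a list \<Rightarrow> 'c" where
  "shuf k X \<Phi> [] = \<Phi> (X []) []"
| "shuf k X \<Phi> (a # as) = shuf (Suc k) (ins a X) \<Phi> as + sg k (shuf k X (\<lambda>v. ins a (\<Phi> v)) as)"

lemma ins_shuf: "ins a (shuf k X \<Phi>) = shuf (Suc k) (ins a X) \<Phi> + sg k (shuf k X (\<lambda>v. ins a (\<Phi> v)))"
  by (simp add: fun_eq_iff ins_apply fa)

text \<open>In the recursion the contracted cochain has degree k - 1 but is passed
  \<open>Suc k\<close>. The parity is the same, and truncated subtraction at k = 0 is
  avoided.\<close>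

lemma shuf_parity: "even k = even k' \<Longrightarrow> shuf k X \<Phi> = shuf k' X \<Phi>"
proof
  fix as show "even k = even k' \<Longrightarrow> shuf k X \<Phi> as = shuf k' X \<Phi> as"
  proof (induction as arbitrary: k k' X \<Phi>)
    case (Cons a as)
    show ?case
      using Cons.IH[of "Suc k" "Suc k'"] Cons.IH[of k k'] Cons.prems by (simp add: sg_def)
  qed simp
qed

lemma shuf_Suc_Suc [simp]: "shuf (Suc (Suc k)) X \<Phi> = shuf k X \<Phi>"
  by (rule shuf_parity) simp

lemma shuf_op:
  fixes \<Phi> \<Psi> :: "'b \<Rightarrow> 'a list \<Rightarrow> 'c::ab_group_add"
  shows shuf_op_add: "shuf k X (\<lambda>v. \<Phi> v + \<Psi> v) = shuf k X \<Phi> + shuf k X \<Psi>"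
    and shuf_op_diff: "shuf k X (\<lambda>v. \<Phi> v - \<Psi> v) = shuf k X \<Phi> - shuf k X \<Psi>"
    and shuf_op_minus: "shuf k X (\<lambda>v. - \<Phi> v) = - shuf k X \<Phi>"
    and shuf_op_sg: "shuf k X (\<lambda>v. sg l (\<Phi> v)) = sg l (shuf k X \<Phi>)"
proof -
  have "shuf k X (\<lambda>v. \<Phi> v + \<Psi> v) as = shuf k X \<Phi> as + shuf k X \<Psi> as" for as
    by (induction as arbitrary: k X \<Phi> \<Psi>) (simp_all add: fa)
  then show "shuf k X (\<lambda>v. \<Phi> v + \<Psi> v) = shuf k X \<Phi> + shuf k X \<Psi>"
    by (simp add: fun_eq_iff fa)
  have m: "shuf k X (\<lambda>v. - \<Phi> v) as = - shuf k X \<Phi> as" for as and \<Phi> :: "'b \<Rightarrow> 'a list \<Rightarrow> 'c"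
    by (induction as arbitrary: k X \<Phi>) (simp_all add: fa)
  then show m': "shuf k X (\<lambda>v. - \<Phi> v) = - shuf k X \<Phi>" for \<Phi> :: "'b \<Rightarrow> 'a list \<Rightarrow> 'c"
    by (simp add: fun_eq_iff fa)
  have "shuf k X (\<lambda>v. \<Phi> v - \<Psi> v) as = shuf k X \<Phi> as - shuf k X \<Psi> as" for as
    by (induction as arbitrary: k X \<Phi> \<Psi>) (simp_all add: fa)
  then show "shuf k X (\<lambda>v. \<Phi> v - \<Psi> v) = shuf k X \<Phi> - shuf k X \<Psi>"
    by (simp add: fun_eq_iff fa)
  show "shuf k X (\<lambda>v. sg l (\<Phi> v)) = sg l (shuf k X \<Phi>)"
    using m' by (simp add: sg_def)
qed

lemma hom_ins_op: "hom \<Gamma> (VF SA \<Gamma>') \<Phi> \<Longrightarrow> hom \<Gamma> (VF SA \<Gamma>') (\<lambda>v. ins a (\<Phi> v))"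
  by (simp add: hom_def ins_VF)

lemma hom_VF_apply_0: "hom \<Gamma> (VF SA \<Gamma>') \<Phi> \<Longrightarrow> subgrp \<Gamma> \<Longrightarrow> \<Phi> 0 as = 0"
  by (simp add: hom_0 fa)

lemma shuf_zero:
  assumes "subgrp \<Gamma>" "hom \<Gamma> (VF SA \<Gamma>') \<Phi>"
  shows "shuf k 0 \<Phi> = 0"
proof
  fix as show "shuf k 0 \<Phi> as = 0 as"
    using assms(2)
    by (induction as arbitrary: k \<Phi>) (simp_all add: fa hom_VF_apply_0[OF _ assms(1)] hom_ins_op)
qed

lemma shuf_cong:
  assumes "X \<in> VF SA \<Gamma>" "\<And>v. v \<in> \<Gamma> \<Longrightarrow> \<Phi> v = \<Psi> v"
  shows "shuf k X \<Phi> = shuf k X \<Psi>"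
proof
  fix as show "shuf k X \<Phi> as = shuf k X \<Psi> as"
    using assms
  proof (induction as arbitrary: k X \<Phi> \<Psi>)
    case Nil
    then show ?case by (simp add: VF_in)
  next
    case (Cons a as)
    show ?case
      using Cons.IH[OF ins_VF[OF Cons.prems(1)], of \<Phi> \<Psi>] Cons.IH[OF Cons.prems(1), of "\<lambda>v. ins a (\<Phi> v)" "\<lambda>v. ins a (\<Psi> v)"]
        Cons.prems(2) by simp
  qed
qed

lemma shuf_op_zero: "shuf k X (\<lambda>v. 0) = (0 :: 'a list \<Rightarrow> 'c::ab_group_add)"
proof
  fix as show "shuf k X (\<lambda>v. 0) as = (0 :: 'a list \<Rightarrow> 'c::ab_group_add) as"
    by (induction as arbitrary: k X) (simp_all add: fa)
qed

lemma hom_shuf: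
  assumes "subgrp \<Gamma>" "subgrp \<Gamma>'" "hom \<Gamma> (VF SA \<Gamma>') \<Phi>"
  shows "hom (VF SA \<Gamma>) (VF SA \<Gamma>') (\<lambda>X. shuf k X \<Phi>)"
proof (rule homI)
  fix X assume X: "X \<in> VF SA \<Gamma>"
  have "shuf k X \<Phi> as \<in> \<Gamma>'" for as
    using assms(3) X
  proof (induction as arbitrary: k X \<Phi>)
    case Nil
    then show ?case by (auto intro: VF_in hom_in)
  next
    case (Cons a as)
    show ?case
      using Cons.IH[OF Cons.prems(1) ins_VF[OF Cons.prems(2)]] Cons.IH[OF hom_ins_op[OF Cons.prems(1)] Cons.prems(2)]
      by (simp add: subgrpD[OF assms(2)])
  qed
  moreover have "shuf k X \<Phi> as = 0" if "\<not> set as \<subseteq> SA" for as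
    using that assms(3) X
  proof (induction as arbitrary: k X \<Phi>)
    case (Cons a as)
    show ?case
    proof (cases "set as \<subseteq> SA")
      case False
      then show ?thesis
        using Cons.IH[OF False Cons.prems(2) ins_VF[OF Cons.prems(3)]]
          Cons.IH[OF False hom_ins_op[OF Cons.prems(2)] Cons.prems(3)] by simp
    next
      case True
      then have a: "a \<notin> SA" using Cons.prems by auto
      have "ins a X = 0"
        using VF_out[OF Cons.prems(3)] a by (simp add: fun_eq_iff ins_apply fa)
      moreover have "ins a (\<Phi> v) = 0" if "v \<in> \<Gamma>" for v
        using VF_out[OF hom_in[OF Cons.prems(2) that]] a by (simp add: fun_eq_iff ins_apply fa)
      then have "shuf k X (\<lambda>v. ins a (\<Phi> v)) = shuf k X (\<lambda>v. 0)"
        by (rule shuf_cong[OF Cons.prems(3)])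
      ultimately show ?thesis
        using shuf_zero[OF assms(1) Cons.prems(2)] by (simp add: shuf_op_zero fa)
    qed
  qed simp
  ultimately show "shuf k X \<Phi> \<in> VF SA \<Gamma>'" by (simp add: VF_def)
next
  fix X Y assume X: "X \<in> VF SA \<Gamma>" and Y: "Y \<in> VF SA \<Gamma>"
  show "shuf k (X + Y) \<Phi> = shuf k X \<Phi> + shuf k Y \<Phi>"
  proof
    fix as show "shuf k (X + Y) \<Phi> as = (shuf k X \<Phi> + shuf k Y \<Phi>) as"
      using assms(3) X Y
    proof (induction as arbitrary: k X Y \<Phi>)
      case Nil
      then show ?case by (simp add: fa hom_plus VF_in)
    next
      case (Cons a as)
      show ?case
        using Cons.IH[OF Cons.prems(1) ins_VF[OF Cons.prems(2)] ins_VF[OF Cons.prems(3)]]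
          Cons.IH[OF hom_ins_op[OF Cons.prems(1)] Cons.prems(2,3)]
        by (simp add: fa[where as = as] fa[where as = "a # as"] add_ac)
    qed
  qed
qed
lemma shuf_form0:
  assumes "subgrp \<Gamma>" "hom \<Gamma> (VF SA \<Gamma>') \<Phi>"
  shows "shuf 0 (form0 v) \<Phi> = \<Phi> v"
proof
  fix as show "shuf 0 (form0 v) \<Phi> as = \<Phi> v as"
    using assms(2)
  proof (induction as arbitrary: \<Phi>)
    case (Cons a as)
    show ?case
      using Cons.IH[OF hom_ins_op[OF Cons.prems]] shuf_zero[OF assms(1) Cons.prems]
      by (simp add: fa[where as = as] ins_apply[where as = as])
  qed simp
qed

text \<open>Contraction with an argument falls on \<open>X\<close>, on \<open>\<Psi>\<close> or on
  \<open>\<Phi>\<close>; these are the three uses of the induction hypothesis.\<close>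

lemma shuf_assoc:
  assumes "subgrp \<Gamma>" "subgrp \<Gamma>'" "subgrp \<Gamma>''"
    and "X \<in> VF SA \<Gamma>" "hom \<Gamma> (VF SA \<Gamma>') \<Psi>" "hom \<Gamma>' (VF SA \<Gamma>'') \<Phi>"
  shows "shuf (k + l) (shuf k X \<Psi>) \<Phi> = shuf k X (\<lambda>v. shuf l (\<Psi> v) \<Phi>)"
proof
  fix as show "shuf (k + l) (shuf k X \<Psi>) \<Phi> as = shuf k X (\<lambda>v. shuf l (\<Psi> v) \<Phi>) as"
    using assms(4-)
  proof (induction as arbitrary: k l X \<Psi> \<Phi>)
    case (Cons a as)
    note VF = hom_in[OF hom_shuf[OF assms(1,2)]]
    note h = hom_shuf[OF assms(2,3) Cons.prems(3)]
    have "shuf (Suc (k + l)) (ins a (shuf k X \<Psi>)) \<Phi>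
      = shuf (Suc k + l) (shuf (Suc k) (ins a X) \<Psi>) \<Phi>
        + sg k (shuf (k + Suc l) (shuf k X (\<lambda>v. ins a (\<Psi> v))) \<Phi>)"
      using VF[OF Cons.prems(2) ins_VF[OF Cons.prems(1)]] VF[OF hom_ins_op[OF Cons.prems(2)] Cons.prems(1)]
      by (simp add: ins_shuf hom_plus[OF h] hom_sg[OF h] subgrp_VF assms subgrpD(5))
    then show ?case
      using Cons.IH[OF ins_VF[OF Cons.prems(1)] Cons.prems(2,3), of "Suc k" l]
        Cons.IH[OF Cons.prems(1) hom_ins_op[OF Cons.prems(2)] Cons.prems(3), of k "Suc l"]
        Cons.IH[OF Cons.prems(1,2) hom_ins_op[OF Cons.prems(3)], of k l]
      by (simp add: fa[where as = as] ins_shuf shuf_op_add shuf_op_sg)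
  qed simp
qed

text \<open>Graded commutativity. At the empty list the sign is visible only if \<open>k\<close> and
  \<open>l\<close> are both odd, and then \<open>X []\<close> is 0 and kills both sides. Hence a
  parity condition on \<open>X\<close> alone suffices.\<close>

lemma shuf_swap:
  assumes "\<And>v w. v = 0 \<Longrightarrow> \<Omega> v w = 0" "\<And>as. odd k \<Longrightarrow> even (length as) \<Longrightarrow> X as = 0" "\<And>as. even k \<Longrightarrow> odd (length as) \<Longrightarrow> X as = 0"
  shows "shuf k X (\<lambda>v. shuf l Z (\<lambda>w. \<Omega> v w)) = sg (k * l) (shuf l Z (\<lambda>w. shuf k X (\<lambda>v. \<Omega> v w)))"
proof
  fix as show "shuf k X (\<lambda>v. shuf l Z (\<lambda>w. \<Omega> v w)) as = sg (k * l) (shuf l Z (\<lambda>w. shuf k X (\<lambda>v. \<Omega> v w))) as"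
    using assms
  proof (induction as arbitrary: k l X Z \<Omega>)
    case Nil
    then show ?case by (auto simp: fa sg_def)
  next
    case (Cons a as)
    have 1: "shuf (Suc k) (ins a X) (\<lambda>v. shuf l Z (\<Omega> v)) as
      = sg (Suc k * l) (shuf l Z (\<lambda>w. shuf (Suc k) (ins a X) (\<lambda>v. \<Omega> v w))) as"
      by (rule Cons.IH) (simp_all add: Cons.prems ins_apply)
    have 2: "shuf k X (\<lambda>v. shuf (Suc l) (ins a Z) (\<Omega> v)) as
      = sg (k * Suc l) (shuf (Suc l) (ins a Z) (\<lambda>w. shuf k X (\<lambda>v. \<Omega> v w))) as"
      by (rule Cons.IH) (simp_all add: Cons.prems)
    have 3: "shuf k X (\<lambda>v. shuf l Z (\<lambda>w. ins a (\<Omega> v w))) as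
      = sg (k * l) (shuf l Z (\<lambda>w. shuf k X (\<lambda>v. ins a (\<Omega> v w)))) as"
      by (rule Cons.IH) (simp_all add: Cons.prems)
    show ?case
      using 1 2 3
      by (auto simp add: fa[where as = as] fa[where as = "a # as"] ins_shuf shuf_op_add shuf_op_diff
          shuf_op_minus sg_def)
  qed
qed

lemma lie_VF: "hom \<Gamma> \<Gamma> D \<Longrightarrow> subgrp \<Gamma> \<Longrightarrow> X \<in> VF SA \<Gamma> \<Longrightarrow> lie SA T D X \<in> VF SA \<Gamma>"
  using hom_in[OF hom_lie'] .

text \<open>A Leibniz rule in which \<open>\<Phi>\<close> need not intertwine the two Lie operators:
  its defect stands where the operator would act on the second factor. Products, \<open>rho1\<close>
  and the action of a derivation differ only in the value of this defect.\<close>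

lemma lie_shuf:
  assumes \<Gamma>: "subgrp \<Gamma>" "subgrp \<Gamma>'" and D: "hom \<Gamma> \<Gamma> D0" "hom \<Gamma>' \<Gamma>' D"
    and "X \<in> VF SA \<Gamma>" "hom \<Gamma> (VF SA \<Gamma>') \<Phi>"
  shows "lie SA T D (shuf k X \<Phi>)
    = shuf k (lie SA T D0 X) \<Phi> + shuf k X (\<lambda>v. lie SA T D (\<Phi> v) - \<Phi> (D0 v))"
proof
  fix as
  show "lie SA T D (shuf k X \<Phi>) as
    = (shuf k (lie SA T D0 X) \<Phi> + shuf k X (\<lambda>v. lie SA T D (\<Phi> v) - \<Phi> (D0 v))) as"
    using assms(5-)
  proof (induction as arbitrary: k X \<Phi>)
    case Nil
    then show ?case by (simp add: fa)
  next
    case (Cons a as)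
    let ?L = "lie SA T D" and ?M = "lie SA T D0"
    let ?P = "\<lambda>\<Phi> v. ?L (\<Phi> v) - \<Phi> (D0 v)"
    note X = Cons.prems(1) and \<Phi> = Cons.prems(2)
    note homL = hom_lie'[OF D(2) \<Gamma>(2), of SA T]
    have P: "hom \<Gamma> (VF SA \<Gamma>') (?P \<Phi>)" if "hom \<Gamma> (VF SA \<Gamma>') \<Phi>" for \<Phi>
      by (rule hom_op_diff[OF hom_comp[OF that homL] hom_comp[OF D(1) that] subgrp_VF[OF \<Gamma>(2)]])
    note sh = hom_shuf[OF \<Gamma> \<Phi>] and sh' = hom_shuf[OF \<Gamma> hom_ins_op[OF \<Phi>]]
    show ?case
    proof (cases "a \<in> SA")
      case True
      \<comment> \<open>Contracting the defect gives the defect of the contracted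
        \<open>\<Phi>\<close> and a term in \<open>T a\<close>; the latter is the part of the
        contraction with \<open>T a\<close> that falls on \<open>\<Phi>\<close>.\<close>
      have ins\<Phi>: "shuf k X (\<lambda>v. ins a (?P \<Phi> v))
        = shuf k X (?P (\<lambda>v. ins a (\<Phi> v))) - shuf k X (\<lambda>v. ins (T a) (\<Phi> v))"
        unfolding shuf_op_diff[symmetric]
        by (rule shuf_cong[OF X]) (simp add: ins_lie[OF hom_in[OF \<Phi>] True] algebra_simps)
      have "ins a (?L (shuf k X \<Phi>)) = ?L (ins a (shuf k X \<Phi>)) - ins (T a) (shuf k X \<Phi>)"
        by (rule ins_lie[OF hom_in[OF sh X] True])
      also have "?L (ins a (shuf k X \<Phi>)) = ?L (shuf (Suc k) (ins a X) \<Phi>) + sg k (?L (shuf k X (\<lambda>v. ins a (\<Phi> v))))"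
        using hom_in[OF sh ins_VF[OF X]] hom_in[OF sh' X]
        by (simp add: ins_shuf hom_plus[OF homL] hom_sg[OF homL subgrp_VF[OF \<Gamma>(2)]] subgrpD(5)[OF subgrp_VF[OF \<Gamma>(2)]])
      finally have "ins a (?L (shuf k X \<Phi>)) as = ?L (shuf (Suc k) (ins a X) \<Phi>) as
          + sg k (?L (shuf k X (\<lambda>v. ins a (\<Phi> v))) as) - ins (T a) (shuf k X \<Phi>) as"
        by (simp add: fa[where as = as])
      also have "\<dots> = (shuf (Suc k) (?M (ins a X) - ins (T a) X) \<Phi> + sg k (shuf k (?M X) (\<lambda>v. ins a (\<Phi> v)))
          + shuf (Suc k) (ins a X) (?P \<Phi>) + sg k (shuf k X (\<lambda>v. ins a (?P \<Phi> v)))) as"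
        using Cons.IH[OF ins_VF[OF X] \<Phi>, of "Suc k" a] Cons.IH[OF X hom_ins_op[OF \<Phi>], of k a]
          hom_diff[OF sh subgrp_VF[OF \<Gamma>(1)] lie_VF[OF D(1) \<Gamma>(1) ins_VF[OF X]] ins_VF[OF X]]
        unfolding ins\<Phi> ins_shuf
        by (simp add: fa[where as = as])
      also have "\<dots> = ins a (shuf k (?M X) \<Phi> + shuf k X (?P \<Phi>)) as"
        by (simp add: fa[where as = as] ins_shuf ins_lie[OF X True])
      finally show ?thesis by (simp only: ins_apply)
    next
      case False
      have "shuf k (?M X) \<Phi> + shuf k X (?P \<Phi>) \<in> VF SA \<Gamma>'"
        using hom_in[OF sh lie_VF[OF D(1) \<Gamma>(1) X]] hom_in[OF hom_shuf[OF \<Gamma> P[OF \<Phi>]] X]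
        by (rule subgrpD(4)[OF subgrp_VF[OF \<Gamma>(2)]])
      from VF_out[OF this, of "a # as"] show ?thesis using False by (simp add: lie_out)
    qed
  qed
qed

section \<open>The Chevalley-Eilenberg differential\<close>

text \<open>Cartan's formula i_a d = L_a - d i_a read as a recursion on the argument list. On forms
  it agrees with the explicit alternating sums (\<open>dBott_eq\<close>).\<close>

primrec ce :: "'a set \<Rightarrow> ('a \<Rightarrow> 'a \<Rightarrow> 'a) \<Rightarrow> ('a \<Rightarrow> 'b \<Rightarrow> 'b) \<Rightarrow> ('a list \<Rightarrow> 'b::ab_group_add) \<Rightarrow> 'a list \<Rightarrow> 'b" where
  "ce SA br nb X [] = 0"
| "ce SA br nb X (a # as) = (if a \<in> SA then lie SA (br a) (nb a) X as - ce SA br nb (ins a X) as else 0)"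

lemma ins_ce: "a \<in> SA \<Longrightarrow> ins a (ce SA br nb X) = lie SA (br a) (nb a) X - ce SA br nb (ins a X)"
  by (rule ext) (simp add: ins_apply fa)

lemma hom_ce:
  assumes "subgrp \<Gamma>" "\<And>a. a \<in> SA \<Longrightarrow> hom \<Gamma> \<Gamma> (nb a)"
  shows "hom (VF SA \<Gamma>) (VF SA \<Gamma>) (ce SA br nb)"
proof -
  note homL = hom_lie'[OF assms(2) assms(1)]
  have "ce SA br nb X as \<in> \<Gamma>" if "X \<in> VF SA \<Gamma>" for X as
    using that
  proof (induction as arbitrary: X)
    case (Cons a as)
    then show ?case
      using VF_in[OF hom_in[OF homL]] subgrpD(1)[OF assms(1)]
      by (auto intro!: subgrpD(2)[OF assms(1)] ins_VF)
  qed (simp add: subgrpD(1)[OF assms(1)])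
  moreover have "ce SA br nb X as = 0" if "\<not> set as \<subseteq> SA" for X as
    using that by (induction as arbitrary: X) (auto simp: lie_out)
  moreover have "ce SA br nb (X + Y) as = ce SA br nb X as + ce SA br nb Y as"
    if "X \<in> VF SA \<Gamma>" "Y \<in> VF SA \<Gamma>" for X Y as
    using that
  proof (induction as arbitrary: X Y)
    case (Cons a as)
    then show ?case
      by (simp add: hom_plus[OF homL] ins_VF fa[where as = as])
  qed simp
  ultimately show ?thesis
    by (intro homI ext) (simp_all add: VF_def fa)
qed

text \<open>As in \<open>lie_shuf\<close>, \<open>\<Phi>\<close> enters through a defect. The
  subtracted shuffle is the contribution to d (\<open>\<Phi>\<close> v) of varying v; it is
  accounted for by the summand with the differential of \<open>X\<close>.\<close>

lemma ce_shuf: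
  assumes \<Gamma>: "subgrp \<Gamma>" "subgrp \<Gamma>'"
    and nb: "\<And>a. a \<in> SA \<Longrightarrow> hom \<Gamma> \<Gamma> (nb a)" "\<And>a. a \<in> SA \<Longrightarrow> hom \<Gamma>' \<Gamma>' (nb' a)"
    and "X \<in> VF SA \<Gamma>" "hom \<Gamma> (VF SA \<Gamma>') \<Phi>"
  shows "ce SA br nb' (shuf k X \<Phi>) = shuf (Suc k) (ce SA br nb X) \<Phi>
    + sg k (shuf k X (\<lambda>v. ce SA br nb' (\<Phi> v) - shuf (Suc 0) (ce SA br nb (form0 v)) \<Phi>))"
proof
  let ?d = "ce SA br nb'" and ?e = "ce SA br nb"
  let ?P = "\<lambda>\<Phi> v. ?d (\<Phi> v) - shuf (Suc 0) (?e (form0 v)) \<Phi>"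
  note homd = hom_ce[OF \<Gamma>(2) nb(2), where br = br] and homd0 = hom_ce[OF \<Gamma>(1) nb(1), where br = br]
  have form0: "hom \<Gamma> (VF SA \<Gamma>) form0"
    by (rule homI[OF form0_VF[OF \<Gamma>(1)]]) (simp_all add: fun_eq_iff form0_def fa)
  fix as
  show "?d (shuf k X \<Phi>) as = (shuf (Suc k) (?e X) \<Phi> + sg k (shuf k X (?P \<Phi>))) as"
    using assms(5-)
  proof (induction as arbitrary: k X \<Phi>)
    case Nil
    have "?e (form0 v) [] = 0" for v by simp
    with Nil show ?case by (simp add: fa[where as = "[]"] hom_VF_apply_0[OF _ \<Gamma>(1)])
  next
    case (Cons a as)
    note X = Cons.prems(1) and \<Phi> = Cons.prems(2)
    note sh = hom_shuf[OF \<Gamma> \<Phi>] and sh' = hom_shuf[OF \<Gamma> hom_ins_op[OF \<Phi>]]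
    note VF0 = subgrp_VF[OF \<Gamma>(1)] and VF1 = subgrp_VF[OF \<Gamma>(2)]
    have P: "hom \<Gamma> (VF SA \<Gamma>') (?P \<Phi>)"
      by (rule hom_op_diff[OF hom_comp[OF \<Phi> homd] hom_comp[OF form0 hom_comp[OF homd0 sh]] VF1])
    show ?case
    proof (cases "a \<in> SA")
      case True
      let ?L = "lie SA (br a) (nb' a)" and ?M = "lie SA (br a) (nb a)"
      have L0: "?M (form0 v) = form0 (nb a v)" for v
        by (rule lie_form0) (rule hom_0[OF nb(1)[OF True] \<Gamma>(1)])
      have d00: "?e 0 = 0" by (rule hom_0[OF homd0 VF0])
      \<comment> \<open>The contracted defect of d is the defect of L_a minus the defect of the
        contracted \<open>\<Phi>\<close>, a Cartan formula for defects.\<close>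
      have ins\<Phi>: "shuf k X (\<lambda>v. ins a (?P \<Phi> v))
        = shuf k X (\<lambda>v. ?L (\<Phi> v) - \<Phi> (nb a v)) - shuf k X (?P (\<lambda>v. ins a (\<Phi> v)))"
        unfolding shuf_op_diff[symmetric]
      proof (rule shuf_cong[OF X])
        fix v assume v: "v \<in> \<Gamma>"
        show "ins a (?P \<Phi> v) = ?L (\<Phi> v) - \<Phi> (nb a v) - ?P (\<lambda>v. ins a (\<Phi> v)) v"
          using shuf_form0[OF \<Gamma>(1) \<Phi>]
          by (simp add: ins_ce[OF True] ins_shuf L0 d00)
      qed
      have "ins a (?d (shuf k X \<Phi>)) = ?L (shuf k X \<Phi>) - ?d (ins a (shuf k X \<Phi>))"
        by (rule ins_ce[OF True])
      also have "?d (ins a (shuf k X \<Phi>)) = ?d (shuf (Suc k) (ins a X) \<Phi>) + sg k (?d (shuf k X (\<lambda>v. ins a (\<Phi> v))))"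
        using hom_in[OF sh ins_VF[OF X]] hom_in[OF sh' X]
        by (simp add: ins_shuf hom_plus[OF homd] hom_sg[OF homd VF1] subgrpD(5)[OF VF1])
      finally have "ins a (?d (shuf k X \<Phi>)) as = ?L (shuf k X \<Phi>) as
          - (?d (shuf (Suc k) (ins a X) \<Phi>) as + sg k (?d (shuf k X (\<lambda>v. ins a (\<Phi> v))) as))"
        by (simp add: fa[where as = as])
      also have "\<dots> = (shuf k (?M X) \<Phi> + shuf k X (\<lambda>v. ?L (\<Phi> v) - \<Phi> (nb a v))
          - (shuf k (?e (ins a X)) \<Phi> - sg k (shuf (Suc k) (ins a X) (?P \<Phi>)))
          - (sg k (shuf (Suc k) (?e X) (\<lambda>v. ins a (\<Phi> v))) + shuf k X (?P (\<lambda>v. ins a (\<Phi> v))))) as"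
        using Cons.IH[OF ins_VF[OF X] \<Phi>, of "Suc k" a] Cons.IH[OF X hom_ins_op[OF \<Phi>], of k a]
          lie_shuf[OF \<Gamma> nb(1)[OF True] nb(2)[OF True] X \<Phi>, where T = "br a" and k = k]
        by (simp add: fa[where as = as])
      also have "\<dots> = ins a (shuf (Suc k) (?e X) \<Phi> + sg k (shuf k X (?P \<Phi>))) as"
        using hom_diff[OF sh VF0 lie_VF[OF nb(1)[OF True] \<Gamma>(1) X] hom_in[OF homd0 ins_VF[OF X]]]
        unfolding ins_simps(1,4) ins_shuf[of a "Suc k"] ins_shuf[of a k X "?P \<Phi>"] ins_ce[OF True]
        unfolding ins\<Phi>
        by (simp add: fa[where as = as])
      finally show ?thesis by (simp only: ins_apply)
    next
      case False
      have "shuf (Suc k) (?e X) \<Phi> + sg k (shuf k X (?P \<Phi>)) \<in> VF SA \<Gamma>'"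
        by (rule subgrpD(4)[OF VF1 hom_in[OF sh hom_in[OF homd0 X]] subgrpD(5)[OF VF1 hom_in[OF hom_shuf[OF \<Gamma> P] X]]])
      from VF_out[OF this, of "a # as"] show ?thesis using False by simp
    qed
  qed
qed

section \<open>Multiplication of cochains by functions\<close>

definition sm :: "('r \<Rightarrow> 'b \<Rightarrow> 'b) \<Rightarrow> 'r \<Rightarrow> ('a list \<Rightarrow> 'b) \<Rightarrow> 'a list \<Rightarrow> 'b" where
  "sm sc f X = (\<lambda>as. sc f (X as))"

lemma sm_apply: "sm sc f X as = sc f (X as)"
  by (simp add: sm_def)

lemma ins_sm [simp]: "ins a (sm sc f X) = sm sc f (ins a X)"
  by (simp add: sm_def ins_def)

text \<open>Closure is relative to \<open>R\<close> and \<open>\<Gamma>\<close>, but the algebraic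
  laws are required on the whole types, where pointwise operations satisfy them. Rewriting with them
  then needs no membership conditions.\<close>

definition vmod :: "'r::comm_ring_1 set \<Rightarrow> ('r \<Rightarrow> 'b \<Rightarrow> 'b) \<Rightarrow> 'b::ab_group_add set \<Rightarrow> bool" where
  "vmod R sc \<Gamma> \<longleftrightarrow> subgrp \<Gamma> \<and> (\<forall>f\<in>R. \<forall>x\<in>\<Gamma>. sc f x \<in> \<Gamma>) \<and> (\<forall>f x y. sc f (x + y) = sc f x + sc f y) \<and>
     (\<forall>f g x. sc (f + g) x = sc f x + sc g x) \<and> (\<forall>f g x. sc f (sc g x) = sc (f * g) x)"

lemma
  assumes "vmod R sc \<Gamma>"
  shows vmod_subgrp: "subgrp \<Gamma>" and vmod_in: "f \<in> R \<Longrightarrow> x \<in> \<Gamma> \<Longrightarrow> sc f x \<in> \<Gamma>"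
    and vmod_add: "sc f (x + y) = sc f x + sc f y" and vmod_add_left: "sc (f + g) x = sc f x + sc g x"
    and vmod_mult: "sc f (sc g x) = sc (f * g) x"
    and vmod_zero: "sc f 0 = 0" and vmod_minus: "sc f (- x) = - sc f x"
    and vmod_diff: "sc f (x - y) = sc f x - sc f y"
    and vmod_sg: "sc f (sg k x) = sg k (sc f x)"
proof -
  show a: "sc f (x + y) = sc f x + sc f y" for f x y
    using assms by (simp add: vmod_def)
  show 0: "sc f 0 = 0" for f
    using a[of f 0 0] by simp
  show m: "sc f (- x) = - sc f x" for f x
    using a[of f x "- x"] 0[of f] by (simp add: eq_neg_iff_add_eq_0 add.commute)
  show "sc f (x - y) = sc f x - sc f y" "sc f (sg k x) = sg k (sc f x)"
    using a[of f x "- y"] m by (simp_all add: sg_def)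
qed (use assms in \<open>simp_all add: vmod_def mult.commute\<close>)

lemma
  fixes X :: "'a list \<Rightarrow> 'b::ab_group_add"
  assumes "vmod R sc \<Gamma>"
  shows sm_zero: "sm sc f (0 :: 'a list \<Rightarrow> 'b) = 0"
    and sm_add: "sm sc f (X + Y) = sm sc f X + sm sc f Y"
    and sm_diff: "sm sc f (X - Y) = sm sc f X - sm sc f Y"
    and sm_minus: "sm sc f (- X) = - sm sc f X"
    and sm_sg: "sm sc f (sg k X) = sg k (sm sc f X)"
    and sm_add_left: "sm sc (f + g) X = sm sc f X + sm sc g X"
    and sm_commute: "sm sc f (sm sc g X) = sm sc g (sm sc f X)"
    and sm_mult: "sm sc f (sm sc g X) = sm sc (f * g) X"
    and sm_VF: "f \<in> R \<Longrightarrow> X \<in> VF SA \<Gamma> \<Longrightarrow> sm sc f X \<in> VF SA \<Gamma>"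
  by (rule ext, simp add: sm_apply fa vmod_zero[OF assms] vmod_add[OF assms] vmod_diff[OF assms]
      vmod_minus[OF assms] vmod_add_left[OF assms] vmod_sg[OF assms] vmod_mult[OF assms] mult.commute)+
    (auto simp: VF_def sm_apply vmod_in[OF assms] vmod_zero[OF assms])

lemma hom_sm: "vmod R sc \<Gamma> \<Longrightarrow> X \<in> VF SA \<Gamma> \<Longrightarrow> hom R (VF SA \<Gamma>) (\<lambda>f. sm sc f X)"
  by (simp add: hom_def sm_VF sm_add_left)

lemma lie_sm:
  assumes V: "vmod R sc \<Gamma>" and "X \<in> VF SA \<Gamma>" "f \<in> R"
    and D: "\<And>x. x \<in> \<Gamma> \<Longrightarrow> D (sc f x) = sc (s f) x + sc f (D x)"
  shows "lie SA T D (sm sc f X) = sm sc (s f) X + sm sc f (lie SA T D X)"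
proof
  fix as
  have sum: "sc f (sum g I) = (\<Sum>i\<in>I. sc f (g i))" for g and I :: "nat set"
    by (induction I rule: infinite_finite_induct) (simp_all add: vmod_zero[OF V] vmod_add[OF V])
  show "lie SA T D (sm sc f X) as = (sm sc (s f) X + sm sc f (lie SA T D X)) as"
    using VF_in[OF assms(2)] VF_out[OF assms(2)]
    by (simp add: lie_def sm_apply[of sc f X] sm_apply[where as = as] fa[where as = as] D vmod_diff[OF V] vmod_zero[OF V] sum)
qed

lemma shuf_sm:
  assumes V: "vmod R sc' \<Gamma>'" and "X \<in> VF SA \<Gamma>"
    and \<Phi>: "\<And>v. v \<in> \<Gamma> \<Longrightarrow> \<Phi> (sc f v) = sm sc' f (\<Phi> v)"
  shows "shuf k (sm sc f X) \<Phi> = sm sc' f (shuf k X \<Phi>)"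
proof
  fix as show "shuf k (sm sc f X) \<Phi> as = sm sc' f (shuf k X \<Phi>) as"
    using assms(2) \<Phi>
  proof (induction as arbitrary: k X \<Phi>)
    case Nil
    then show ?case by (simp add: sm_apply VF_in)
  next
    case (Cons a as)
    show ?case
      using Cons.IH[OF ins_VF[OF Cons.prems(1)], of \<Phi>]
        Cons.IH[OF Cons.prems(1), of "\<lambda>v. ins a (\<Phi> v)"] Cons.prems(2)
      by (simp add: sm_apply[where as = as] sm_apply[where as = "a # as"] vmod_add[OF V] vmod_sg[OF V])
  qed
qed

lemma shuf_op_sm:
  assumes V: "vmod R sc \<Gamma>"
  shows "shuf k X (\<lambda>v. sm sc f (\<Phi> v)) = sm sc f (shuf k X \<Phi>)"
proof
  fix as show "shuf k X (\<lambda>v. sm sc f (\<Phi> v)) as = sm sc f (shuf k X \<Phi>) as"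
  proof (induction as arbitrary: k X \<Phi>)
    case (Cons a as)
    show ?case
      using Cons.IH[of "Suc k" "ins a X" \<Phi>] Cons.IH[of k X "\<lambda>v. ins a (\<Phi> v)"]
      by (simp add: sm_apply[where as = as] sm_apply[where as = "a # as"] vmod_add[OF V] vmod_sg[OF V])
  qed (simp add: sm_apply)
qed

section \<open>Lie-Rinehart algebras\<close>

text \<open>Free of axioms, because the axioms of \<open>lie_rinehart\<close> already mention
  \<open>conn\<close>, which has to be defined over this data first.\<close>

locale lie_rinehart_data =
  fixes SA :: "('m \<Rightarrow> 'v::ab_group_add) set" and R :: "('m \<Rightarrow> 'k::comm_ring_1) set"
    and fm :: "('m \<Rightarrow> 'k) \<Rightarrow> ('m \<Rightarrow> 'v) \<Rightarrow> 'm \<Rightarrow> 'v"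
    and br :: "('m \<Rightarrow> 'v) \<Rightarrow> ('m \<Rightarrow> 'v) \<Rightarrow> 'm \<Rightarrow> 'v"
    and rh :: "('m \<Rightarrow> 'v) \<Rightarrow> ('m \<Rightarrow> 'k) \<Rightarrow> 'm \<Rightarrow> 'k"
begin

text \<open>A flat connection, that is, a module over the Lie-Rinehart algebra. Both the functions,
  with the anchor, and the sections of B, with the Bott connection, are instances.\<close>

definition conn :: "(('m \<Rightarrow> 'k) \<Rightarrow> ('m \<Rightarrow> 'w) \<Rightarrow> 'm \<Rightarrow> 'w) \<Rightarrow> ('m \<Rightarrow> 'w::ab_group_add) set
    \<Rightarrow> (('m \<Rightarrow> 'v) \<Rightarrow> ('m \<Rightarrow> 'w) \<Rightarrow> 'm \<Rightarrow> 'w) \<Rightarrow> bool" where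
  "conn sc \<Gamma> nb \<longleftrightarrow> vmod R sc \<Gamma> \<and> (\<forall>a\<in>SA. hom \<Gamma> \<Gamma> (nb a)) \<and>
     (\<forall>a\<in>SA. \<forall>b\<in>SA. \<forall>x\<in>\<Gamma>. nb (a + b) x = nb a x + nb b x \<and> nb (br a b) x = nb a (nb b x) - nb b (nb a x)) \<and>
     (\<forall>f\<in>R. \<forall>a\<in>SA. \<forall>x\<in>\<Gamma>. nb (fm f a) x = sc f (nb a x) \<and> nb a (sc f x) = sc (rh a f) x + sc f (nb a x))"

text \<open>Alternating \<open>R\<close>-multilinear forms, described through contraction with the first argument.\<close>

primrec cf :: "(('m \<Rightarrow> 'k) \<Rightarrow> ('m \<Rightarrow> 'w) \<Rightarrow> 'm \<Rightarrow> 'w) \<Rightarrow> ('m \<Rightarrow> 'w::ab_group_add) set \<Rightarrow> nat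
    \<Rightarrow> (('m \<Rightarrow> 'v) list \<Rightarrow> 'm \<Rightarrow> 'w) \<Rightarrow> bool" where
  "cf sc \<Gamma> 0 X \<longleftrightarrow> (\<exists>v\<in>\<Gamma>. X = form0 v)"
| "cf sc \<Gamma> (Suc k) X \<longleftrightarrow> X [] = 0 \<and> (\<forall>a. a \<notin> SA \<longrightarrow> ins a X = 0) \<and>
     (\<forall>a\<in>SA. cf sc \<Gamma> k (ins a X) \<and> ins a (ins a X) = 0 \<and>
       (\<forall>b\<in>SA. ins (a + b) X = ins a X + ins b X) \<and> (\<forall>f\<in>R. ins (fm f a) X = sm sc f (ins a X)))"

end

locale lie_rinehart = lie_rinehart_data SA R fm br rh
  for SA :: "('m \<Rightarrow> 'v::ab_group_add) set" and R :: "('m \<Rightarrow> 'k::comm_ring_1) set" and fm br rh +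
  assumes fm: "vmod R fm SA"
    and rh: "conn (*) R rh"
    and br_in: "a \<in> SA \<Longrightarrow> b \<in> SA \<Longrightarrow> br a b \<in> SA"
    and br_add: "a \<in> SA \<Longrightarrow> b \<in> SA \<Longrightarrow> c \<in> SA \<Longrightarrow> br (a + b) c = br a c + br b c"
      "a \<in> SA \<Longrightarrow> b \<in> SA \<Longrightarrow> c \<in> SA \<Longrightarrow> br a (b + c) = br a b + br a c"
    and br_self: "a \<in> SA \<Longrightarrow> br a a = 0"
    and br_jacobi: "a \<in> SA \<Longrightarrow> b \<in> SA \<Longrightarrow> c \<in> SA \<Longrightarrow> br a (br b c) = br (br a b) c + br b (br a c)"
    and br_fm: "f \<in> R \<Longrightarrow> a \<in> SA \<Longrightarrow> b \<in> SA \<Longrightarrow> br a (fm f b) = fm (rh a f) b + fm f (br a b)"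
begin

lemma SA: "subgrp SA"
  using fm by (rule vmod_subgrp)

lemma fm_in: "f \<in> R \<Longrightarrow> a \<in> SA \<Longrightarrow> fm f a \<in> SA"
  using fm by (rule vmod_in)

lemma R: "subgrp R" "vmod R (*) R" and rh_in: "a \<in> SA \<Longrightarrow> f \<in> R \<Longrightarrow> rh a f \<in> R"
  using rh by (auto simp: conn_def vmod_def hom_def)

lemma br_anti: "a \<in> SA \<Longrightarrow> b \<in> SA \<Longrightarrow> br a b = - br b a"
  using br_self[of "a + b"] br_self[of a] br_self[of b] br_in
  by (simp add: br_add subgrpD[OF SA] eq_neg_iff_add_eq_0 add.commute)

lemma hom_br: "a \<in> SA \<Longrightarrow> hom SA SA (br a)"
  by (simp add: hom_def br_in br_add)

context
  fixes sc :: "('m \<Rightarrow> 'k) \<Rightarrow> ('m \<Rightarrow> 'w) \<Rightarrow> 'm \<Rightarrow> 'w::ab_group_add" and \<Gamma>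
  assumes V: "vmod R sc \<Gamma>"
begin

lemmas \<Gamma> = vmod_subgrp[OF V]

lemma cf_VF: "cf sc \<Gamma> k X \<Longrightarrow> X \<in> VF SA \<Gamma>"
proof -
  have "X as \<in> \<Gamma> \<and> (\<not> set as \<subseteq> SA \<longrightarrow> X as = 0)" if "cf sc \<Gamma> k X" for as
    using that
  proof (induction k arbitrary: X as)
    case 0
    then show ?case by (auto simp: form0_def subgrpD[OF \<Gamma>] split: if_splits)
  next
    case (Suc k)
    show ?case
    proof (cases as)
      case Nil
      then show ?thesis using Suc.prems by (simp add: subgrpD[OF \<Gamma>])
    next
      case (Cons a bs)
      show ?thesis
      proof (cases "a \<in> SA")
        case True
        then show ?thesis using Suc.IH[of "ins a X" bs] Suc.prems Cons by (simp add: ins_apply[where as = bs])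
      next
        case False
        then have "ins a X bs = 0" using Suc.prems by (simp add: fa)
        then show ?thesis using Cons by (simp add: subgrpD[OF \<Gamma>] ins_apply)
      qed
    qed
  qed
  then show "cf sc \<Gamma> k X \<Longrightarrow> X \<in> VF SA \<Gamma>" by (auto simp: VF_def)
qed

lemma cf_ins_out: "cf sc \<Gamma> k X \<Longrightarrow> a \<notin> SA \<Longrightarrow> ins a X = 0"
  by (cases k) auto

lemma cf_degree: "cf sc \<Gamma> k X \<Longrightarrow> length as \<noteq> k \<Longrightarrow> X as = 0"
proof (induction k arbitrary: X as)
  case 0
  then show ?case by (auto simp: form0_def)
next
  case (Suc k)
  show ?case
  proof (cases as)
    case Nil
    then show ?thesis using Suc.prems by simp
  next
    case (Cons a bs)
    show ?thesis
    proof (cases "a \<in> SA")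
      case True
      then show ?thesis using Suc.IH[of "ins a X" bs] Suc.prems Cons by (simp add: ins_apply[where as = bs])
    next
      case False
      then have "ins a X bs = 0" using Suc.prems by (simp add: fa)
      then show ?thesis using Cons by (simp add: ins_apply)
    qed
  qed
qed

lemma cf_zero: "cf sc \<Gamma> k 0"
proof (induction k)
  case 0
  have "(0 :: ('m \<Rightarrow> 'v) list \<Rightarrow> 'm \<Rightarrow> 'w) = form0 0" by (rule ext) (simp add: form0_def fa)
  then show ?case using subgrpD[OF \<Gamma>] by auto
next
  case (Suc k)
  then show ?case by (simp add: fa[where as = "[]"] sm_zero[OF V])
qed

lemma cf_add: "cf sc \<Gamma> k X \<Longrightarrow> cf sc \<Gamma> k Y \<Longrightarrow> cf sc \<Gamma> k (X + Y)"
proof (induction k arbitrary: X Y)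
  case 0
  then obtain v w where "v \<in> \<Gamma>" "w \<in> \<Gamma>" "X = form0 v" "Y = form0 w" by auto
  moreover have "form0 v + form0 w = form0 (v + w)" by (rule ext) (simp add: form0_def fa)
  ultimately show ?case using subgrpD[OF \<Gamma>] by auto
next
  case (Suc k)
  then show ?case by (simp add: fa[where as = "[]"] sm_add[OF V] add_ac)
qed

lemma cf_minus: "cf sc \<Gamma> k X \<Longrightarrow> cf sc \<Gamma> k (- X)"
proof (induction k arbitrary: X)
  case 0
  then obtain v where "v \<in> \<Gamma>" "X = form0 v" by auto
  moreover have "- form0 v = form0 (- v)" by (rule ext) (simp add: form0_def fa)
  ultimately show ?case using subgrpD[OF \<Gamma>] by auto
next
  case (Suc k)
  then show ?case by (simp add: fa[where as = "[]"] sm_minus[OF V])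
qed

lemma cf_diff: "cf sc \<Gamma> k X \<Longrightarrow> cf sc \<Gamma> k Y \<Longrightarrow> cf sc \<Gamma> k (X - Y)"
  using cf_add[of k X "- Y"] cf_minus[of k Y] by simp

lemma cf_sg: "cf sc \<Gamma> k X \<Longrightarrow> cf sc \<Gamma> k (sg l X)"
  using cf_minus by (simp add: sg_def)

lemma cf_sm: "f \<in> R \<Longrightarrow> cf sc \<Gamma> k X \<Longrightarrow> cf sc \<Gamma> k (sm sc f X)"
proof (induction k arbitrary: X)
  case 0
  then obtain v where "v \<in> \<Gamma>" "X = form0 v" by auto
  moreover have "sm sc f (form0 v) = form0 (sc f v)" by (rule ext) (simp add: form0_def sm_apply vmod_zero[OF V])
  ultimately show ?case using vmod_in[OF V] 0 by auto
next
  case (Suc k)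
  then show ?case
    by (simp add: sm_apply[where as = "[]"] sm_add[OF V] sm_zero[OF V] vmod_zero[OF V] sm_commute[OF V])
qed

text \<open>For k = 0 the contraction is 0, which is a form of degree 0 - 1 = 0; so one rule covers
  all degrees.\<close>

lemma cf_ins: "cf sc \<Gamma> k X \<Longrightarrow> a \<in> SA \<Longrightarrow> cf sc \<Gamma> (k - 1) (ins a X)"
  by (cases k) (auto simp: cf_zero[of 0, simplified])

lemma cf_ins_add: "cf sc \<Gamma> k X \<Longrightarrow> a \<in> SA \<Longrightarrow> b \<in> SA \<Longrightarrow> ins (a + b) X = ins a X + ins b X"
  and cf_ins_fm: "cf sc \<Gamma> k X \<Longrightarrow> f \<in> R \<Longrightarrow> a \<in> SA \<Longrightarrow> ins (fm f a) X = sm sc f (ins a X)"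
  and cf_ins_ins: "cf sc \<Gamma> k X \<Longrightarrow> a \<in> SA \<Longrightarrow> ins a (ins a X) = 0"
  by (cases k; auto simp: sm_zero[OF V])+

lemma hom_cf_ins: "cf sc \<Gamma> k X \<Longrightarrow> hom SA (VF SA \<Gamma>) (\<lambda>a. ins a X)"
  by (rule homI) (simp_all add: cf_ins_add cf_VF ins_VF)

text \<open>Polarisation of the vanishing of a double contraction, at a + b.\<close>

lemma cf_skew:
  assumes X: "cf sc \<Gamma> k X" and a: "a \<in> SA" and b: "b \<in> SA"
  shows "ins a (ins b X) = - ins b (ins a X)"
proof -
  have ab: "a + b \<in> SA" using a b by (rule subgrpD(4)[OF SA])
  have "ins (a + b) (ins (a + b) X) = 0"
    by (rule cf_ins_ins[OF X ab])
  then have "ins (a + b) (ins a X) + ins (a + b) (ins b X) = 0"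
    by (simp add: cf_ins_add[OF X a b])
  then have "ins a (ins b X) + ins b (ins a X) = 0"
    by (simp add: cf_ins_add[OF cf_ins[OF X a] a b] cf_ins_add[OF cf_ins[OF X b] a b]
        cf_ins_ins[OF X a] cf_ins_ins[OF X b] add.commute)
  then show ?thesis by (simp add: eq_neg_iff_add_eq_0)
qed

text \<open>Linearity over functions survives because \<open>T\<close> and \<open>D\<close> share
  the symbol \<open>s\<close>: the two terms containing \<open>s f\<close> cancel.\<close>

lemma cf_lie:
  assumes T: "hom SA SA T" and D: "hom \<Gamma> \<Gamma> D" and s: "\<And>f. f \<in> R \<Longrightarrow> s f \<in> R"
    and Tf: "\<And>f a. f \<in> R \<Longrightarrow> a \<in> SA \<Longrightarrow> T (fm f a) = fm (s f) a + fm f (T a)"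
    and Df: "\<And>f x. f \<in> R \<Longrightarrow> x \<in> \<Gamma> \<Longrightarrow> D (sc f x) = sc (s f) x + sc f (D x)"
    and X: "cf sc \<Gamma> k X"
  shows "cf sc \<Gamma> k (lie SA T D X)"
  using X
proof (induction k arbitrary: X)
  case 0
  then obtain v where "v \<in> \<Gamma>" "X = form0 v" by auto
  then show ?case using lie_form0[where D = D, OF hom_0[OF D \<Gamma>]] hom_in[OF D] by force
next
  case (Suc k)
  note X = cf_VF[OF Suc.prems] and L = hom_lie'[OF D \<Gamma>, of SA T]
  note Ta = hom_in[OF T]
  have X0: "X [] = 0" using Suc.prems by simp
  have insL: "ins a (lie SA T D X) = lie SA T D (ins a X) - ins (T a) X" if "a \<in> SA" for a
    by (rule ins_lie[OF X that])
  have out: "ins a (lie SA T D X) = 0" if "a \<notin> SA" for a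
    using that by (intro ext) (simp add: ins_apply lie_def fa)
  have L0: "lie SA T D 0 = 0" by (rule hom_0[OF L subgrp_VF[OF \<Gamma>]])
  show ?case
    unfolding cf.simps
  proof (intro conjI allI impI ballI)
    show "lie SA T D X [] = 0" by (simp add: X0 hom_0[OF D \<Gamma>])
    show "ins a (lie SA T D X) = 0" if "a \<notin> SA" for a using that by (rule out)
    fix a assume a: "a \<in> SA"
    show "cf sc \<Gamma> k (ins a (lie SA T D X))"
      using Suc.IH[of "ins a X"] Suc.prems a Ta[OF a] by (simp add: insL cf_diff)
    show "ins a (ins a (lie SA T D X)) = 0"
      using cf_skew[OF Suc.prems a Ta[OF a]]
      by (simp add: insL[OF a] ins_lie[OF ins_VF[OF X] a] cf_ins_ins[OF Suc.prems a] L0)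
    show "ins (a + b) (lie SA T D X) = ins a (lie SA T D X) + ins b (lie SA T D X)" if b: "b \<in> SA" for b
      using insL[OF subgrpD(4)[OF SA a b]]
      by (simp add: insL a b cf_ins_add[OF Suc.prems] Ta hom_plus[OF T] hom_plus[OF L] ins_VF X)
    show "ins (fm f a) (lie SA T D X) = sm sc f (ins a (lie SA T D X))" if f: "f \<in> R" for f
      using lie_sm[OF V ins_VF[OF X, of a] f, of D s T] insL[OF fm_in[OF f a]] f a
      by (simp add: insL Tf Df cf_ins_fm[OF Suc.prems] cf_ins_add[OF Suc.prems] fm_in Ta s sm_diff[OF V])
  qed
qed

end

lemma VF_ins_out: "X \<in> VF SA \<Gamma> \<Longrightarrow> a \<notin> SA \<Longrightarrow> ins a X = 0"
  by (intro ext) (simp add: ins_apply fa VF_out)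

lemma lie_cong:
  assumes "X \<in> VF SA \<Gamma>" "\<And>a. a \<in> SA \<Longrightarrow> T a = T' a" "\<And>x. x \<in> \<Gamma> \<Longrightarrow> D x = D' x"
  shows "lie SA T D X = lie SA T' D' X"
proof
  fix as
  have "T (as ! j) = T' (as ! j)" if "set as \<subseteq> SA" "j < length as" for j
    using that assms(2) by (meson nth_mem subsetD)
  then show "lie SA T D X as = lie SA T' D' X as"
    using VF_in[OF assms(1)] by (simp add: lie_def assms(3))
qed

text \<open>The induction is on the total degree, since a contraction lowers the degree of either
  factor. When the factor hit has degree 0, its contraction vanishes.\<close>

lemma cf_shuf:
  assumes V': "vmod R sc' \<Delta>" and V: "vmod R sc \<Gamma>"
    and "cf sc' \<Delta> k X" "hom \<Delta> (VF SA \<Gamma>) \<Phi>" "\<And>v. v \<in> \<Delta> \<Longrightarrow> cf sc \<Gamma> l (\<Phi> v)"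
    and "\<And>f v. f \<in> R \<Longrightarrow> v \<in> \<Delta> \<Longrightarrow> \<Phi> (sc' f v) = sm sc f (\<Phi> v)"
  shows "cf sc \<Gamma> (k + l) (shuf k X \<Phi>)"
  using assms(3-)
proof (induction "k + l" arbitrary: k l X \<Phi>)
  case 0
  then obtain v where "v \<in> \<Delta>" "X = form0 v" by auto
  then show ?case
    using 0 shuf_form0[OF vmod_subgrp[OF V'] 0(3)] by simp
next
  case (Suc n)
  note X = Suc.prems(1) and \<Phi> = Suc.prems(2) and cf\<Phi> = Suc.prems(3) and lin = Suc.prems(4)
  note XV = cf_VF[OF V' X] and G = vmod_subgrp[OF V] and G' = vmod_subgrp[OF V']
  note sh = hom_shuf[OF G' G \<Phi>] and sh' = hom_shuf[OF G' G hom_ins_op[OF \<Phi>]]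
  have ins\<Phi>: "\<And>f v. f \<in> R \<Longrightarrow> v \<in> \<Delta> \<Longrightarrow> ins a (\<Phi> (sc' f v)) = sm sc f (ins a (\<Phi> v))" for a
    by (simp add: lin)
  have "cf sc \<Gamma> (Suc n) (shuf k X \<Phi>)"
    unfolding cf.simps
  proof (intro conjI allI impI ballI)
    show "shuf k X \<Phi> [] = 0"
    proof (cases k)
      case 0
      then have "l \<noteq> 0" using Suc(2) by simp
      then show ?thesis using cf_degree[OF V cf\<Phi>[OF VF_in[OF XV]], of "[]"] by simp
    next
      case Suc
      then show ?thesis using X hom_VF_apply_0[OF \<Phi> G'] by simp
    qed
    show "ins a (shuf k X \<Phi>) = 0" if "a \<notin> SA" for a
      by (rule VF_ins_out[OF hom_in[OF sh XV] that])
    fix a assume a: "a \<in> SA"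
    show "cf sc \<Gamma> n (ins a (shuf k X \<Phi>))"
      unfolding ins_shuf
    proof (intro cf_add[OF V] cf_sg[OF V])
      show "cf sc \<Gamma> n (shuf (Suc k) (ins a X) \<Phi>)"
      proof (cases k)
        case 0
        then have "ins a X = 0" using X by auto
        then show ?thesis using cf_zero[OF V] shuf_zero[OF G' \<Phi>] by simp
      next
        case (Suc k')
        then show ?thesis
          using Suc.hyps(1)[of k' l "ins a X" \<Phi>] Suc.hyps(2) X \<Phi> cf\<Phi> lin a by simp
      qed
      show "cf sc \<Gamma> n (shuf k X (\<lambda>v. ins a (\<Phi> v)))"
      proof (cases l)
        case 0
        have "ins a (\<Phi> v) = 0" if "v \<in> \<Delta>" for v
          using cf\<Phi>[OF that] 0 by auto
        then have "shuf k X (\<lambda>v. ins a (\<Phi> v)) = shuf k X (\<lambda>v. 0)"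
          by (rule shuf_cong[OF XV])
        then show ?thesis using cf_zero[OF V] shuf_op_zero by metis
      next
        case (Suc l')
        show ?thesis
        proof (rule Suc.hyps(1)[OF _ X hom_ins_op[OF \<Phi>], of l', THEN back_subst[of "\<lambda>j. cf sc \<Gamma> j _"]])
          show "n = k + l'" "k + l' = n" using Suc Suc.hyps(2) by simp_all
          show "cf sc \<Gamma> l' (ins a (\<Phi> v))" if "v \<in> \<Delta>" for v
            using cf_ins[OF V cf\<Phi>[OF that] a] Suc by simp
        qed (rule ins\<Phi>)
      qed
    qed
    show "ins a (ins a (shuf k X \<Phi>)) = 0"
    proof -
      have "shuf k X (\<lambda>v. ins a (ins a (\<Phi> v))) = shuf k X (\<lambda>v. 0)"
        by (rule shuf_cong[OF XV cf_ins_ins[OF V cf\<Phi> a]])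
      then show ?thesis
        using cf_ins_ins[OF V' X a] shuf_zero[OF G' \<Phi>] by (simp add: ins_shuf shuf_op_zero)
    qed
    show "ins (a + b) (shuf k X \<Phi>) = ins a (shuf k X \<Phi>) + ins b (shuf k X \<Phi>)" if b: "b \<in> SA" for b
    proof -
      have "shuf k X (\<lambda>v. ins (a + b) (\<Phi> v)) = shuf k X (\<lambda>v. ins a (\<Phi> v) + ins b (\<Phi> v))"
        by (rule shuf_cong[OF XV cf_ins_add[OF V cf\<Phi> a b]])
      then show ?thesis
        using hom_plus[OF sh ins_VF[OF XV] ins_VF[OF XV]]
        by (simp add: ins_shuf cf_ins_add[OF V' X a b] shuf_op_add add_ac)
    qed
    show "ins (fm f a) (shuf k X \<Phi>) = sm sc f (ins a (shuf k X \<Phi>))" if f: "f \<in> R" for f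
    proof -
      have "shuf k X (\<lambda>v. ins (fm f a) (\<Phi> v)) = shuf k X (\<lambda>v. sm sc f (ins a (\<Phi> v)))"
        by (rule shuf_cong[OF XV cf_ins_fm[OF V cf\<Phi> f a]])
      moreover have "shuf (Suc k) (sm sc' f (ins a X)) \<Phi> = sm sc f (shuf (Suc k) (ins a X) \<Phi>)"
        by (rule shuf_sm[where sc = sc' and \<Phi> = \<Phi>, OF V ins_VF[OF XV]]) (rule lin[OF f])
      ultimately show ?thesis
        by (simp add: ins_shuf cf_ins_fm[OF V' X f a] shuf_op_sm[OF V] sm_add[OF V] sm_sg[OF V])
    qed
  qed
  then show ?case using Suc(2) by simp
qed

lemma lie_plus:
  assumes V: "vmod R sc \<Gamma>" and X: "cf sc \<Gamma> k X" and T: "hom SA SA T" "hom SA SA T'"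
  shows "lie SA (\<lambda>a. T a + T' a) (\<lambda>x. D x + D' x) X = lie SA T D X + lie SA T' D' X"
proof
  fix as
  show "lie SA (\<lambda>a. T a + T' a) (\<lambda>x. D x + D' x) X as = (lie SA T D X + lie SA T' D' X) as"
    using X
  proof (induction as arbitrary: k X)
    case Nil
    then show ?case by (simp add: fa)
  next
    case (Cons a as)
    show ?case
    proof (cases "a \<in> SA")
      case True
      note XV = cf_VF[OF V Cons.prems]
      have "ins a (lie SA (\<lambda>a. T a + T' a) (\<lambda>x. D x + D' x) X) as = ins a (lie SA T D X + lie SA T' D' X) as"
        using Cons.IH[OF cf_ins[OF V Cons.prems True]] hom_in[OF T(1) True] hom_in[OF T(2) True]
        by (simp add: ins_lie[OF XV True] cf_ins_add[OF V Cons.prems] fa[where as = as])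
      then show ?thesis by (simp only: ins_apply[where as = as])
    qed (simp add: lie_out fa)
  qed
qed

text \<open>After contraction, the mixed terms, in which one operator acts while the argument is
  moved by the other, are symmetric in the two operators and cancel.\<close>

lemma lie_commute:
  assumes V: "vmod R sc \<Gamma>" and X: "cf sc \<Gamma> k X" and T: "hom SA SA T" "hom SA SA T'"
    and D: "hom \<Gamma> \<Gamma> D" "hom \<Gamma> \<Gamma> D'"
  shows "lie SA T D (lie SA T' D' X) - lie SA T' D' (lie SA T D X)
    = lie SA (\<lambda>a. T (T' a) - T' (T a)) (\<lambda>x. D (D' x) - D' (D x)) X"
proof
  let ?T = "\<lambda>a. T (T' a) - T' (T a)" and ?D = "\<lambda>x. D (D' x) - D' (D x)"
  note G = vmod_subgrp[OF V]
  note L = hom_lie'[OF D(1) G, of SA T] and L' = hom_lie'[OF D(2) G, of SA T']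
  fix as
  show "(lie SA T D (lie SA T' D' X) - lie SA T' D' (lie SA T D X)) as = lie SA ?T ?D X as"
    using X
  proof (induction as arbitrary: k X)
    case Nil
    then show ?case by (simp add: fa)
  next
    case (Cons a as)
    show ?case
    proof (cases "a \<in> SA")
      case a: True
      note X = Cons.prems note XV = cf_VF[OF V X]
      note Ta = hom_in[OF T(1) a] hom_in[OF T(2) a]
      note LX = hom_in[OF L XV] hom_in[OF L' XV]
      have "ins a (lie SA T D (lie SA T' D' X) - lie SA T' D' (lie SA T D X)) as = ins a (lie SA ?T ?D X) as"
        using Cons.IH[OF cf_ins[OF V X a]] hom_in[OF T(1) Ta(2)] hom_in[OF T(2) Ta(1)]
        by (simp add: ins_lie[OF LX(1)] ins_lie[OF LX(2)] ins_lie[OF XV] a Ta ins_VF XV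
            hom_in[OF L] hom_in[OF L'] hom_diff[OF L subgrp_VF[OF G]] hom_diff[OF L' subgrp_VF[OF G]]
            hom_diff[OF hom_cf_ins[OF V X] SA] fa[where as = as])
      then show ?thesis by (simp only: ins_apply[where as = as])
    qed (simp add: lie_out fa)
  qed
qed

section \<open>Differential and product of forms with values in a flat connection\<close>

lemma
  assumes "conn sc \<Gamma> nb"
  shows conn_vmod: "vmod R sc \<Gamma>" and conn_hom: "a \<in> SA \<Longrightarrow> hom \<Gamma> \<Gamma> (nb a)"
    and conn_add: "a \<in> SA \<Longrightarrow> b \<in> SA \<Longrightarrow> x \<in> \<Gamma> \<Longrightarrow> nb (a + b) x = nb a x + nb b x"
    and conn_flat: "a \<in> SA \<Longrightarrow> b \<in> SA \<Longrightarrow> x \<in> \<Gamma> \<Longrightarrow> nb (br a b) x = nb a (nb b x) - nb b (nb a x)"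
    and conn_fm: "f \<in> R \<Longrightarrow> a \<in> SA \<Longrightarrow> x \<in> \<Gamma> \<Longrightarrow> nb (fm f a) x = sc f (nb a x)"
    and conn_sc: "f \<in> R \<Longrightarrow> a \<in> SA \<Longrightarrow> x \<in> \<Gamma> \<Longrightarrow> nb a (sc f x) = sc (rh a f) x + sc f (nb a x)"
  using assms by (auto simp: conn_def)

definition wd :: "(('m \<Rightarrow> 'k) \<Rightarrow> ('m \<Rightarrow> 'w) \<Rightarrow> 'm \<Rightarrow> 'w::ab_group_add) \<Rightarrow> nat
    \<Rightarrow> (('m \<Rightarrow> 'v) list \<Rightarrow> 'm \<Rightarrow> 'k) \<Rightarrow> (('m \<Rightarrow> 'v) list \<Rightarrow> 'm \<Rightarrow> 'w) \<Rightarrow> ('m \<Rightarrow> 'v) list \<Rightarrow> 'm \<Rightarrow> 'w" where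
  "wd sc k \<omega> X = shuf k \<omega> (\<lambda>f. sm sc f X)"

context
  fixes sc :: "('m \<Rightarrow> 'k) \<Rightarrow> ('m \<Rightarrow> 'w) \<Rightarrow> 'm \<Rightarrow> 'w::ab_group_add" and \<Gamma> nb
  assumes nb: "conn sc \<Gamma> nb"
begin

abbreviation "d \<equiv> ce SA br nb"
abbreviation "L a \<equiv> lie SA (br a) (nb a)"

lemmas V = conn_vmod[OF nb]
lemmas G = vmod_subgrp[OF V]
lemmas hom_d = hom_ce[OF G conn_hom[OF nb], where br = br]
lemmas hom_L = hom_lie'[OF conn_hom[OF nb] G]
lemmas VF0 = subgrp_VF[OF G]

lemma d_zero: "d 0 = 0"
  by (rule hom_0[OF hom_d VF0])

text \<open>The hypotheses say that (T, D) is a derivation of the bracket and of the connection, so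
  its Lie operator commutes with L_a up to L_{T a}. This is exactly the term left over by
  contraction. It serves both for L_a itself and for derivations of L.\<close>

lemma lie_ce_commute:
  assumes T: "hom SA SA T" "\<And>a b. a \<in> SA \<Longrightarrow> b \<in> SA \<Longrightarrow> T (br a b) = br (T a) b + br a (T b)"
    and D: "hom \<Gamma> \<Gamma> D" "\<And>a x. a \<in> SA \<Longrightarrow> x \<in> \<Gamma> \<Longrightarrow> D (nb a x) = nb (T a) x + nb a (D x)"
    and X: "cf sc \<Gamma> k X"
  shows "lie SA T D (d X) = d (lie SA T D X)"
proof
  fix as
  note LT = hom_lie'[OF D(1) G, of SA T]
  show "lie SA T D (d X) as = d (lie SA T D X) as"
    using X
  proof (induction as arbitrary: k X)
    case Nil
    then show ?case by (simp add: hom_0[OF D(1) G])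
  next
    case (Cons a as)
    show ?case
    proof (cases "a \<in> SA")
      case a: True
      note X = Cons.prems note XV = cf_VF[OF V X]
      note Ta = hom_in[OF T(1) a]
      have "lie SA T D (L a X) - L a (lie SA T D X) = L (T a) X"
        unfolding lie_commute[OF V X T(1) hom_br[OF a] D(1) conn_hom[OF nb a]]
        by (rule lie_cong[OF XV]) (simp_all add: T(2) D(2) a)
      then have *: "lie SA T D (L a X) = L (T a) X + L a (lie SA T D X)" by (simp add: algebra_simps)
      have "ins a (lie SA T D (d X)) as = ins a (d (lie SA T D X)) as"
        using Cons.IH[OF cf_ins[OF V X a]]
        by (simp add: ins_lie[OF hom_in[OF hom_d XV] a] ins_ce[OF a] ins_ce[OF Ta] ins_lie[OF XV a] *
            hom_diff[OF LT VF0] hom_diff[OF hom_d VF0] hom_in[OF hom_L] hom_in[OF hom_d] hom_in[OF LT] a XV ins_VF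
            fa[where as = as])
      then show ?thesis by (simp only: ins_apply[where as = as])
    qed (simp add: lie_out)
  qed
qed

lemma L_d: "a \<in> SA \<Longrightarrow> cf sc \<Gamma> k X \<Longrightarrow> L a (d X) = d (L a X)"
proof -
  assume a: "a \<in> SA" and X: "cf sc \<Gamma> k X"
  show "L a (d X) = d (L a X)"
  proof (rule lie_ce_commute[OF hom_br[OF a] _ conn_hom[OF nb a] _ X])
    show "br a (br b c) = br (br a b) c + br b (br a c)" if "b \<in> SA" "c \<in> SA" for b c
      using a that by (rule br_jacobi)
    show "nb a (nb b x) = nb (br a b) x + nb b (nb a x)" if "b \<in> SA" "x \<in> \<Gamma>" for b x
      using conn_flat[OF nb a that] by simp
  qed
qed

lemma cf_L:
  assumes "a \<in> SA" "cf sc \<Gamma> k X"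
  shows "cf sc \<Gamma> k (L a X)"
proof (rule cf_lie[where s = "rh a", OF V hom_br[OF assms(1)] conn_hom[OF nb assms(1)] _ _ _ assms(2)])
  show "rh a f \<in> R" if "f \<in> R" for f using assms(1) that by (rule rh_in)
  show "br a (fm f b) = fm (rh a f) b + fm f (br a b)" if "f \<in> R" "b \<in> SA" for f b
    using that(1) assms(1) that(2) by (rule br_fm)
  show "nb a (sc f x) = sc (rh a f) x + sc f (nb a x)" if "f \<in> R" "x \<in> \<Gamma>" for f x
    using nb that(1) assms(1) that(2) by (rule conn_sc)
qed

text \<open>Cartan's formula twice gives i_a d d = L_a d - d L_a + d d i_a, and L_a commutes with
  d.\<close>

lemma d_d: "cf sc \<Gamma> k X \<Longrightarrow> d (d X) = 0"
proof
  fix as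
  show "cf sc \<Gamma> k X \<Longrightarrow> d (d X) as = 0 as"
  proof (induction as arbitrary: k X)
    case (Cons a as)
    note X = Cons.prems note XV = cf_VF[OF V X]
    show ?case
    proof (cases "a \<in> SA")
      case a: True
      have "ins a (d (d X)) as = 0"
        using Cons.IH[OF cf_ins[OF V X a]] L_d[OF a X]
        by (simp add: ins_ce[OF a] hom_diff[OF hom_d VF0] hom_in[OF hom_L] hom_in[OF hom_d] a XV ins_VF
            fa[where as = as])
      then show ?thesis by (simp add: ins_apply[where as = as] fa)
    qed (simp add: fa)
  qed (simp add: fa)
qed

lemma ins_d_form0:
  assumes "a \<in> SA"
  shows "ins a (d (form0 v)) = form0 (nb a v)"
  using lie_form0[of "nb a" SA "br a" v] hom_0[OF conn_hom[OF nb] G] assms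
  by (simp add: ins_ce d_zero)

end

context
  fixes sc :: "('m \<Rightarrow> 'k) \<Rightarrow> ('m \<Rightarrow> 'w) \<Rightarrow> 'm \<Rightarrow> 'w::ab_group_add" and \<Gamma> nb
  assumes nb: "conn sc \<Gamma> nb"
begin

abbreviation "dB \<equiv> ce SA br nb"
abbreviation "LB a \<equiv> lie SA (br a) (nb a)"
abbreviation "dK \<equiv> ce SA br rh"

lemmas V' = conn_vmod[OF nb]
lemmas G' = vmod_subgrp[OF V']
lemmas hom_dB = hom_ce[OF G' conn_hom[OF nb], where br = br]
lemmas hom_LB = hom_lie'[OF conn_hom[OF nb] G']
lemmas VF0' = subgrp_VF[OF G']

lemma shuf_dK_form0:
  assumes "X \<in> VF SA \<Gamma>" "f \<in> R" "a \<in> SA"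
  shows "ins a (shuf (Suc 0) (dK (form0 f)) (\<lambda>g. sm sc g X))
    = sm sc (rh a f) X - shuf (Suc 0) (dK (form0 f)) (\<lambda>g. sm sc g (ins a X))"
  using shuf_form0[OF R(1) hom_sm[OF V' assms(1)]]
  by (simp add: ins_shuf ins_d_form0[OF rh assms(3)])

text \<open>The shuffle over \<open>dK (form0 f)\<close> is the product with df, so this is the
  Leibniz rule for the product with a function, valid even for cochains that are not forms.\<close>

lemma dB_sm:
  assumes "X \<in> VF SA \<Gamma>" "f \<in> R"
  shows "dB (sm sc f X) = shuf (Suc 0) (dK (form0 f)) (\<lambda>g. sm sc g X) + sm sc f (dB X)"
proof
  fix as
  show "dB (sm sc f X) as = (shuf (Suc 0) (dK (form0 f)) (\<lambda>g. sm sc g X) + sm sc f (dB X)) as"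
    using assms(1)
  proof (induction as arbitrary: X)
    case Nil
    then show ?case
      using hom_VF_apply_0[OF hom_sm[OF V' Nil] R(1)] by (simp add: fa sm_apply vmod_zero[OF V'])
  next
    case (Cons a as)
    note X = Cons.prems
    show ?case
    proof (cases "a \<in> SA")
      case a: True
      have "ins a (dB (sm sc f X)) as = ins a (shuf (Suc 0) (dK (form0 f)) (\<lambda>g. sm sc g X) + sm sc f (dB X)) as"
        using Cons.IH[OF ins_VF[OF X]]
        by (simp add: ins_ce[OF a] shuf_dK_form0 X a assms(2) sm_diff[OF V'] fa[where as = as]
            lie_sm[OF V' X assms(2), of _ "rh a"] conn_sc[OF nb])
      then show ?thesis by (simp only: ins_apply[where as = as])
    next
      case False
      have "dK (form0 f) \<in> VF SA R"
        by (rule hom_in[OF hom_d[OF rh] form0_VF[OF R(1) assms(2)]])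
      then have "shuf (Suc 0) (dK (form0 f)) (\<lambda>g. sm sc g X) + sm sc f (dB X) \<in> VF SA \<Gamma>"
        by (intro subgrpD(4)[OF VF0'] hom_in[OF hom_shuf[OF R(1) G' hom_sm[OF V' X]]] sm_VF[OF V' assms(2)]
            hom_in[OF hom_dB] X)
      from VF_out[OF this, of "a # as"] show ?thesis using False by simp
    qed
  qed
qed

text \<open>L fails to be linear over functions in its direction by df . i_a. The same term arises
  in d i_{f a}, by \<open>dB_sm\<close>, so that the contraction of dX is linear after all.\<close>

lemma LB_fm:
  assumes "cf sc \<Gamma> k X" "f \<in> R" "a \<in> SA"
  shows "LB (fm f a) X = sm sc f (LB a X) + shuf (Suc 0) (dK (form0 f)) (\<lambda>g. sm sc g (ins a X))"
proof
  fix as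
  note f = assms(2) and a = assms(3)
  show "LB (fm f a) X as = (sm sc f (LB a X) + shuf (Suc 0) (dK (form0 f)) (\<lambda>g. sm sc g (ins a X))) as"
    using assms(1)
  proof (induction as arbitrary: k X)
    case Nil
    note XV = cf_VF[OF V' Nil]
    show ?case
      using hom_VF_apply_0[OF hom_sm[OF V' ins_VF[OF XV]] R(1)] VF_in[OF XV]
      by (simp add: fa sm_apply conn_fm[OF nb f a])
  next
    case (Cons b as)
    note X = Cons.prems note XV = cf_VF[OF V' X]
    show ?case
    proof (cases "b \<in> SA")
      case b: True
      have "br (fm f a) b = fm f (br a b) - fm (rh b f) a"
        using br_anti[OF fm_in[OF f a] b] br_anti[OF b a] br_fm[OF f b a] by (simp add: vmod_minus[OF fm])
      then have *: "ins (br (fm f a) b) X = sm sc f (ins (br a b) X) - sm sc (rh b f) (ins a X)"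
        using f a b
        by (simp add: hom_diff[OF hom_cf_ins[OF V' X] SA] fm_in br_in rh_in cf_ins_fm[OF V' X])
      have **: "shuf (Suc 0) (dK (form0 f)) (\<lambda>g. sm sc g (ins a (ins b X)))
         = - shuf (Suc 0) (dK (form0 f)) (\<lambda>g. sm sc g (ins b (ins a X)))"
        by (simp add: cf_skew[OF V' X a b] sm_minus[OF V'] shuf_op_minus)
      have "ins b (LB (fm f a) X) as
          = ins b (sm sc f (LB a X) + shuf (Suc 0) (dK (form0 f)) (\<lambda>g. sm sc g (ins a X))) as"
        using Cons.IH[OF cf_ins[OF V' X b]]
        by (simp add: ins_lie[OF XV b] * ** shuf_dK_form0 ins_VF XV f b sm_diff[OF V'] fa[where as = as])
      then show ?thesis by (simp only: ins_apply[where as = as])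
    next
      case False
      have "dK (form0 f) \<in> VF SA R"
        by (rule hom_in[OF hom_d[OF rh] form0_VF[OF R(1) f]])
      then have "sm sc f (LB a X) + shuf (Suc 0) (dK (form0 f)) (\<lambda>g. sm sc g (ins a X)) \<in> VF SA \<Gamma>"
        by (intro subgrpD(4)[OF VF0'] hom_in[OF hom_shuf[OF R(1) G' hom_sm[OF V' ins_VF[OF XV]]]] sm_VF[OF V' f]
            hom_in[OF hom_LB] XV a)
      from VF_out[OF this, of "b # as"] show ?thesis using False by (simp add: lie_out)
    qed
  qed
qed

text \<open>The degree of d (i_a X) is a hypothesis here because it has two sources: the induction
  for k > 0, and the vanishing of i_a X for k = 0.\<close>

lemma cf_d_step:
  assumes X: "cf sc \<Gamma> k X" and "\<And>a. a \<in> SA \<Longrightarrow> cf sc \<Gamma> k (dB (ins a X))"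
  shows "cf sc \<Gamma> (Suc k) (dB X)"
  unfolding cf.simps
proof (intro conjI allI impI ballI)
  note XV = cf_VF[OF V' X]
  show "dB X [] = 0" by simp
  show "ins a (dB X) = 0" if "a \<notin> SA" for a
    by (rule VF_ins_out[OF hom_in[OF hom_dB XV] that]) simp
  fix a assume a: "a \<in> SA"
  show "cf sc \<Gamma> k (ins a (dB X))"
    unfolding ins_ce[OF a] by (intro cf_diff[OF V'] cf_L[OF nb a] assms a)
  show "ins a (ins a (dB X)) = 0"
    using hom_0[OF hom_cf_ins[OF V' X] SA]
    by (simp add: ins_ce[OF a] ins_lie[OF XV a] br_self[OF a] cf_ins_ins[OF V' X a] d_zero[OF nb])
  show "ins (a + b) (dB X) = ins a (dB X) + ins b (dB X)" if b: "b \<in> SA" for b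
  proof -
    have "LB (a + b) X = lie SA (\<lambda>c. br a c + br b c) (\<lambda>x. nb a x + nb b x) X"
      by (rule lie_cong[OF XV]) (simp_all add: br_add conn_add[OF nb] a b)
    also have "\<dots> = LB a X + LB b X"
      by (rule lie_plus[OF V' X hom_br[OF a] hom_br[OF b]])
    finally show ?thesis
      by (simp add: ins_ce a b subgrpD(4)[OF SA] cf_ins_add[OF V' X] hom_plus[OF hom_dB] ins_VF XV)
  qed
  show "ins (fm f a) (dB X) = sm sc f (ins a (dB X))" if f: "f \<in> R" for f
    using LB_fm[OF X f a] dB_sm[OF ins_VF[OF XV] f, of a]
    by (simp add: ins_ce a fm_in[OF f a] cf_ins_fm[OF V' X f a] sm_diff[OF V'])
qed

lemma cf_d: "cf sc \<Gamma> k X \<Longrightarrow> cf sc \<Gamma> (Suc k) (dB X)"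
proof (induction k arbitrary: X)
  case 0
  have "ins a X = 0" for a using 0 by auto
  then show ?case using cf_d_step[OF 0] cf_zero[OF V', of 0] d_zero[OF nb] by simp
next
  case (Suc k)
  show ?case by (rule cf_d_step[OF Suc.prems]) (use Suc in auto)
qed

lemma cf_wd: "cf (*) R k \<omega> \<Longrightarrow> cf sc \<Gamma> l X \<Longrightarrow> cf sc \<Gamma> (k + l) (wd sc k \<omega> X)"
  unfolding wd_def
  by (rule cf_shuf[OF R(2) V' _ hom_sm[OF V' cf_VF[OF V']]])
    (simp_all add: cf_sm[OF V'] sm_mult[OF V'])

text \<open>By \<open>dB_sm\<close>, the defect of f |-> f X in \<open>ce_shuf\<close> is f |-> f
  dX.\<close>

lemma dB_wd:
  assumes "\<omega> \<in> VF SA R" "X \<in> VF SA \<Gamma>"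
  shows "dB (wd sc k \<omega> X) = wd sc (Suc k) (dK \<omega>) X + sg k (wd sc k \<omega> (dB X))"
proof -
  have "shuf k \<omega> (\<lambda>f. dB (sm sc f X) - shuf (Suc 0) (dK (form0 f)) (\<lambda>g. sm sc g X))
      = shuf k \<omega> (\<lambda>f. sm sc f (dB X))"
    by (rule shuf_cong[OF assms(1)]) (simp add: dB_sm assms(2))
  then show ?thesis
    using ce_shuf[OF R(1) G' conn_hom[OF rh] conn_hom[OF nb] assms(1) hom_sm[OF V' assms(2)]]
    by (simp add: wd_def)
qed

lemma lie_wd:
  assumes "\<omega> \<in> VF SA R" "X \<in> VF SA \<Gamma>" "hom R R s" "hom \<Gamma> \<Gamma> D"
    and "\<And>f x. f \<in> R \<Longrightarrow> x \<in> \<Gamma> \<Longrightarrow> D (sc f x) = sc (s f) x + sc f (D x)"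
  shows "lie SA T D (wd sc k \<omega> X) = wd sc k (lie SA T s \<omega>) X + wd sc k \<omega> (lie SA T D X)"
proof -
  have "shuf k \<omega> (\<lambda>f. lie SA T D (sm sc f X) - sm sc (s f) X) = shuf k \<omega> (\<lambda>f. sm sc f (lie SA T D X))"
    by (rule shuf_cong[OF assms(1)]) (simp add: lie_sm[where s = s, OF V' assms(2)] assms(5))
  then show ?thesis
    using lie_shuf[OF R(1) G' assms(3,4,1) hom_sm[OF V' assms(2)]]
    by (simp add: wd_def)
qed

lemma
  assumes \<omega>: "\<omega> \<in> VF SA R"
  shows wd_add: "wd sc k \<omega> (X + Y) = wd sc k \<omega> X + wd sc k \<omega> Y"
    and wd_diff: "wd sc k \<omega> (X - Y) = wd sc k \<omega> X - wd sc k \<omega> Y"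
    and wd_sg: "wd sc k \<omega> (sg l X) = sg l (wd sc k \<omega> X)"
  unfolding wd_def by (simp_all add: sm_add[OF V'] sm_diff[OF V'] sm_sg[OF V'] shuf_op_add shuf_op_diff shuf_op_sg)

lemma
  assumes X: "X \<in> VF SA \<Gamma>" and "\<omega> \<in> VF SA R" "\<mu> \<in> VF SA R"
  shows wd_add_left: "wd sc k (\<omega> + \<mu>) X = wd sc k \<omega> X + wd sc k \<mu> X"
    and wd_sg_left: "wd sc k (sg l \<omega>) X = sg l (wd sc k \<omega> X)"
  unfolding wd_def
  by (rule hom_plus[OF hom_shuf[OF R(1) G' hom_sm[OF V' X]] assms(2,3)]
      hom_sg[OF hom_shuf[OF R(1) G' hom_sm[OF V' X]] subgrp_VF[OF R(1)] assms(2)])+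

lemma wd_form0: "X \<in> VF SA \<Gamma> \<Longrightarrow> wd sc 0 (form0 f) X = sm sc f X"
  unfolding wd_def by (rule shuf_form0[OF R(1) hom_sm[OF V']])

text \<open>Associativity of shuffles brings \<open>\<Phi>\<close> next to the product with a
  function, and its linearity over functions pulls that function out.\<close>

lemma shuf_wd:
  assumes U: "vmod R sc' \<Delta>" and "\<omega> \<in> VF SA R" "X \<in> VF SA \<Gamma>" "hom \<Gamma> (VF SA \<Delta>) \<Phi>"
    and lin: "\<And>f v. f \<in> R \<Longrightarrow> v \<in> \<Gamma> \<Longrightarrow> \<Phi> (sc f v) = sm sc' f (\<Phi> v)"
  shows "shuf (k + l) (wd sc k \<omega> X) \<Phi> = wd sc' k \<omega> (shuf l X \<Phi>)"
proof -
  have "shuf (k + l) (wd sc k \<omega> X) \<Phi> = shuf k \<omega> (\<lambda>f. shuf l (sm sc f X) \<Phi>)"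
    unfolding wd_def by (rule shuf_assoc[OF R(1) G' vmod_subgrp[OF U] assms(2) hom_sm[OF V' assms(3)] assms(4)])
  also have "\<dots> = shuf k \<omega> (\<lambda>f. sm sc' f (shuf l X \<Phi>))"
    by (rule shuf_cong[OF assms(2)], rule shuf_sm[where \<Phi> = \<Phi> and sc = sc, OF U assms(3)]) (rule lin)
  finally show ?thesis by (simp add: wd_def)
qed

end

end

section \<open>Split Lie pairs\<close>

locale split_pair =
  fixes P :: "('m::{t2_space, second_countable_topology}, 'k::real_normed_field, 'v::ab_group_add, 'z) lie_pair_scheme"
  assumes split: "split_lie_pair P"
begin

abbreviation "S \<equiv> sections P"
abbreviation "SA \<equiv> secA P"
abbreviation "SB \<equiv> secB P"
abbreviation R :: "('m \<Rightarrow> 'k) set" where "R \<equiv> smooth_funs P"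

end

sublocale split_pair \<subseteq> smooth_bundle P
  using split by unfold_locales (simp add: split_lie_pair_def lie_algebroid_def)

context split_pair
begin

lemma subA: "subbundle P (subA P)" "vs.subspace (subA P p)" "subA P p \<subseteq> fib P p"
  and subB: "subbundle P (subB P)" "vs.subspace (subB P p)" "subB P p \<subseteq> fib P p"
proof -
  show *: "subbundle P (subA P)" "subbundle P (subB P)"
    using split by (simp_all add: split_lie_pair_def)
  show "vs.subspace (subA P p)" "subA P p \<subseteq> fib P p" "vs.subspace (subB P p)" "subB P p \<subseteq> fib P p"
    using *[unfolded subbundle_def] by blast+
qed

lemma smooth_const: "(\<lambda>_. c) \<in> R"
  by (simp add: smooth_funs_def smooth_fun_on_const)

lemma R_plus: "f \<in> R \<Longrightarrow> g \<in> R \<Longrightarrow> f + g \<in> R"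
  and R_times: "f \<in> R \<Longrightarrow> g \<in> R \<Longrightarrow> f * g \<in> R"
  unfolding smooth_funs_def mem_Collect_eq plus_fun_def times_fun_def
  by (intro smooth_fun_on_add smooth_fun_on_mult open_UNIV; assumption)+

lemma R_minus: "f \<in> R \<Longrightarrow> - f \<in> R"
  using R_times[OF smooth_const[of "- 1"], of f] by (simp add: times_fun_def fun_Compl_def)

lemma subgrp_R: "subgrp R"
  unfolding subgrp_def
proof (intro conjI ballI)
  show "0 \<in> R" using smooth_const[of 0] by (simp add: zero_fun_def)
  show "f - g \<in> R" if "f \<in> R" "g \<in> R" for f g
    using R_plus[OF that(1) R_minus[OF that(2)]] by simp
qed

lemma vmod_R: "vmod R (*) R"
  unfolding vmod_def using subgrp_R by (simp add: R_times algebra_simps)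

lemma fmul_laws: "fmul P f (u + v) = fmul P f u + fmul P f v" "fmul P (f + g) u = fmul P f u + fmul P g u"
  "fmul P f (fmul P g u) = fmul P (f * g) u" "fmul P 1 u = u"
  by (auto simp: fmul_def fun_eq_iff plus_fun_apply times_fun_apply one_fun_apply
      vs.scale_right_distrib vs.scale_left_distrib)

lemma subgrp_sub:
  assumes "\<And>p. vs.subspace (F p)"
  shows "subgrp (subsections P F)"
  unfolding subgrp_def
proof (intro conjI ballI)
  show "0 \<in> subsections P F" by (rule subsections_zero[OF assms])
  fix u v assume u: "u \<in> subsections P F" and v: "v \<in> subsections P F"
  have "- v = fmul P (\<lambda>_. - 1) v"
    by (simp add: fmul_def fun_eq_iff uminus_apply)
  then have "- v \<in> subsections P F"
    using subsections_fmul[OF assms smooth_const v] by simp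
  from subsections_add[OF assms u this] show "u - v \<in> subsections P F" by simp
qed

lemma vmod_sub:
  assumes "\<And>p. vs.subspace (F p)"
  shows "vmod R (fmul P) (subsections P F)"
  unfolding vmod_def using subgrp_sub[OF assms] subsections_fmul[OF assms] by (simp add: fmul_laws)

lemmas vmod_SA = vmod_sub[OF subA(2)] and vmod_SB = vmod_sub[OF subB(2)]
lemmas subgrp_SA = subgrp_sub[OF subA(2)] and subgrp_SB = subgrp_sub[OF subB(2)]

lemma SA_S: "a \<in> SA \<Longrightarrow> a \<in> S" and SB_S: "b \<in> SB \<Longrightarrow> b \<in> S"
  by (simp_all add: subsections_def)

lemma S_eq: "S = subsections P (fib P)"
  by (auto simp: subsections_def section_in_fib)

lemma vmod_S: "vmod R (fmul P) S"
  unfolding S_eq by (rule vmod_sub[OF fib_subspace])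

lemmas subgrp_S = vmod_subgrp[OF vmod_S]

lemma algebroid: "lie_algebroid P"
  using split by (simp add: split_lie_pair_def)

lemma rho_in: "u \<in> S \<Longrightarrow> f \<in> R \<Longrightarrow> rho P u f \<in> R"
  using algebroid by (simp add: lie_algebroid_def)

lemma anchor_tangent: "u \<in> S \<Longrightarrow> anchor P p (u p) \<in> tangent P p"
  using algebroid section_in_fib by (simp add: lie_algebroid_def)

lemma rho_add: "u \<in> S \<Longrightarrow> f \<in> R \<Longrightarrow> g \<in> R \<Longrightarrow> rho P u (f + g) = rho P u f + rho P u g"
  using anchor_tangent[of u] by (simp add: rho_def fun_eq_iff tangent_def plus_fun_def)

lemma rho_mult: "u \<in> S \<Longrightarrow> f \<in> R \<Longrightarrow> g \<in> R \<Longrightarrow> rho P u (f * g) = rho P u f * g + f * rho P u g"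
  using anchor_tangent[of u] by (simp add: rho_def fun_eq_iff tangent_def plus_fun_def times_fun_def add.commute)

lemma rho_add_left: "u \<in> S \<Longrightarrow> v \<in> S \<Longrightarrow> f \<in> R \<Longrightarrow> rho P (u + v) f = rho P u f + rho P v f"
  using algebroid section_in_fib by (simp add: lie_algebroid_def rho_def fun_eq_iff plus_fun_apply)

lemma rho_fmul: "u \<in> S \<Longrightarrow> f \<in> R \<Longrightarrow> rho P (fmul P g u) f = g * rho P u f"
  using algebroid section_in_fib by (simp add: lie_algebroid_def rho_def fmul_def fun_eq_iff times_fun_apply)

lemma rho_lbr: "u \<in> S \<Longrightarrow> v \<in> S \<Longrightarrow> f \<in> R \<Longrightarrow> rho P (lbr P u v) f = rho P u (rho P v f) - rho P v (rho P u f)"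
  using algebroid by (simp add: lie_algebroid_def)

lemma lbr_alg: "lie_algebra_on (cmul P) S (lbr P)"
  using algebroid by (simp add: lie_algebroid_def)

lemma lbr_in: "u \<in> S \<Longrightarrow> v \<in> S \<Longrightarrow> lbr P u v \<in> S"
  and lbr_add_left: "u \<in> S \<Longrightarrow> v \<in> S \<Longrightarrow> w \<in> S \<Longrightarrow> lbr P (u + v) w = lbr P u w + lbr P v w"
  and lbr_add_right: "u \<in> S \<Longrightarrow> v \<in> S \<Longrightarrow> w \<in> S \<Longrightarrow> lbr P u (v + w) = lbr P u v + lbr P u w"
  and lbr_self: "u \<in> S \<Longrightarrow> lbr P u u = 0"
  and lbr_cyclic: "u \<in> S \<Longrightarrow> v \<in> S \<Longrightarrow> w \<in> S \<Longrightarrow>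
      lbr P u (lbr P v w) + lbr P v (lbr P w u) + lbr P w (lbr P u v) = 0"
  using lbr_alg by (simp_all add: lie_algebra_on_def)

lemma lbr_fmul: "u \<in> S \<Longrightarrow> v \<in> S \<Longrightarrow> f \<in> R \<Longrightarrow> lbr P u (fmul P f v) = fmul P (rho P u f) v + fmul P f (lbr P u v)"
  using algebroid by (simp add: lie_algebroid_def)

lemma hom_lbr: "u \<in> S \<Longrightarrow> hom S S (lbr P u)"
  by (simp add: hom_def lbr_in lbr_add_right)

lemma hom_lbr_left: "v \<in> S \<Longrightarrow> hom S S (\<lambda>u. lbr P u v)"
  by (simp add: hom_def lbr_in lbr_add_left)

lemma lbr_anti: "u \<in> S \<Longrightarrow> v \<in> S \<Longrightarrow> lbr P u v = - lbr P v u"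
  using lbr_self[of "u + v"] lbr_self[of u] lbr_self[of v]
  by (simp add: lbr_add_left lbr_add_right subgrpD[OF subgrp_S] eq_neg_iff_add_eq_0 add.commute)

lemma lbr_jacobi:
  assumes "u \<in> S" "v \<in> S" "w \<in> S"
  shows "lbr P u (lbr P v w) = lbr P (lbr P u v) w + lbr P v (lbr P u w)"
proof -
  have "lbr P w (lbr P u v) = - lbr P (lbr P u v) w"
    using assms by (intro lbr_anti lbr_in)
  moreover have "lbr P v (lbr P w u) = - lbr P v (lbr P u w)"
    using hom_minus[OF hom_lbr subgrp_S, of v "lbr P u w"] lbr_anti[OF assms(3,1)] assms by (simp add: lbr_in)
  ultimately show ?thesis
    using lbr_cyclic[OF assms] by (simp add: algebra_simps)
qed

lemma lbr_fmul_left: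
  assumes "u \<in> S" "v \<in> S" "f \<in> R"
  shows "lbr P (fmul P f u) v = fmul P f (lbr P u v) - fmul P (rho P v f) u"
  using lbr_anti[OF vmod_in[OF vmod_S assms(3,1)] assms(2)] lbr_anti[OF assms(2,1)] lbr_fmul[OF assms(2,1,3)]
  by (simp add: vmod_minus[OF vmod_S])

lemma decomp: "u \<in> S \<Longrightarrow> \<exists>a\<in>subA P p. \<exists>b\<in>subB P p. u p = a + b"
  using split section_in_fib[of u p] by (auto simp: split_lie_pair_def)

lemma decomp_unique:
  assumes "a \<in> subA P p" "b \<in> subB P p" "a' \<in> subA P p" "b' \<in> subB P p" "a + b = a' + b'"
  shows "a = a' \<and> b = b'"
proof -
  have "a - a' = b' - b" using assms(5) by (simp add: algebra_simps)
  moreover have "a - a' \<in> subA P p" "b' - b \<in> subB P p"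
    using vs.subspace_diff[OF subA(2) assms(1,3)] vs.subspace_diff[OF subB(2) assms(4,2)] by simp_all
  ultimately have "a - a' \<in> subA P p \<inter> subB P p" by simp
  also have "\<dots> = {0}" using split by (simp add: split_lie_pair_def)
  finally show ?thesis using assms(5) by simp
qed

lemma prA_point: "a \<in> subA P p \<Longrightarrow> b \<in> subB P p \<Longrightarrow> u p = a + b \<Longrightarrow> prA P u p = a"
  and prB_point: "a \<in> subA P p \<Longrightarrow> b \<in> subB P p \<Longrightarrow> u p = a + b \<Longrightarrow> prB P u p = b"
proof -
  assume *: "a \<in> subA P p" "b \<in> subB P p" "u p = a + b"
  show "prA P u p = a"
    unfolding prA_def
  proof (rule the_equality)
    show "a' = a" if "a' \<in> subA P p \<and> (\<exists>b\<in>subB P p. u p = a' + b)" for a'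
      using that * decomp_unique[of a' p _ a b] by auto
  qed (use * in auto)
  show "prB P u p = b"
    unfolding prB_def
  proof (rule the_equality)
    show "b' = b" if "b' \<in> subB P p \<and> (\<exists>a\<in>subA P p. u p = a + b')" for b'
      using that * decomp_unique[of _ p b' a b] by auto
  qed (use * in auto)
qed

lemma pr: assumes "u \<in> S"
  shows prA_in: "prA P u \<in> SA" and prB_in: "prB P u \<in> SB" and pr_sum: "prA P u + prB P u = u"
proof -
  have *: "prA P u p \<in> subA P p \<and> prB P u p \<in> subB P p \<and> u p = prA P u p + prB P u p" for p
  proof -
    obtain a b where "a \<in> subA P p" "b \<in> subB P p" "u p = a + b" using decomp[OF assms] by blast
    then show ?thesis using prA_point prB_point by simp
  qed
  moreover have "prA P u \<in> S" "prB P u \<in> S" using split assms by (auto simp: split_lie_pair_def)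
  ultimately show "prA P u \<in> SA" "prB P u \<in> SB" by (auto simp: subsections_def)
  show "prA P u + prB P u = u" using * by (simp add: fun_eq_iff plus_fun_apply)
qed

lemma prA_eqI: "a \<in> SA \<Longrightarrow> b \<in> SB \<Longrightarrow> prA P (a + b) = a"
  and prB_eqI: "a \<in> SA \<Longrightarrow> b \<in> SB \<Longrightarrow> prB P (a + b) = b"
  by (auto simp: fun_eq_iff subsections_def plus_fun_apply intro!: prA_point prB_point)

lemma prA_A: "a \<in> SA \<Longrightarrow> prA P a = a" and prB_A: "a \<in> SA \<Longrightarrow> prB P a = 0"
  using prA_eqI[of a 0] prB_eqI[of a 0] subgrpD(1)[OF subgrp_SB] by simp_all

lemma prA_B: "b \<in> SB \<Longrightarrow> prA P b = 0" and prB_B: "b \<in> SB \<Longrightarrow> prB P b = b"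
  using prA_eqI[of 0 b] prB_eqI[of 0 b] subgrpD(1)[OF subgrp_SA] by simp_all

lemma
  assumes "u \<in> S" "v \<in> S"
  shows prA_add: "prA P (u + v) = prA P u + prA P v" and prB_add: "prB P (u + v) = prB P u + prB P v"
proof -
  have "u + v = (prA P u + prA P v) + (prB P u + prB P v)"
    using pr_sum[OF assms(1)] pr_sum[OF assms(2)] by (metis add.assoc add.left_commute)
  moreover have "prA P u + prA P v \<in> SA" "prB P u + prB P v \<in> SB"
    using assms subgrpD(4)[OF subgrp_SA] subgrpD(4)[OF subgrp_SB] prA_in prB_in by auto
  ultimately show "prA P (u + v) = prA P u + prA P v" "prB P (u + v) = prB P u + prB P v"
    using prA_eqI prB_eqI by metis+
qed

lemma hom_prA: "hom S SA (prA P)" and hom_prB: "hom S SB (prB P)"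
  by (simp_all add: hom_def prA_in prB_in prA_add prB_add)

lemma
  assumes "f \<in> R" "u \<in> S"
  shows prA_fmul: "prA P (fmul P f u) = fmul P f (prA P u)" and prB_fmul: "prB P (fmul P f u) = fmul P f (prB P u)"
proof -
  have "fmul P f u = fmul P f (prA P u) + fmul P f (prB P u)"
    using pr_sum[OF assms(2)] fmul_laws(1) by metis
  moreover have "fmul P f (prA P u) \<in> SA" "fmul P f (prB P u) \<in> SB"
    using vmod_in[OF vmod_SA assms(1)] vmod_in[OF vmod_SB assms(1)] prA_in prB_in assms(2) by auto
  ultimately show "prA P (fmul P f u) = fmul P f (prA P u)" "prB P (fmul P f u) = fmul P f (prB P u)"
    using prA_eqI prB_eqI by metis+
qed

lemma lbr_A: "a \<in> SA \<Longrightarrow> b \<in> SA \<Longrightarrow> lbr P a b \<in> SA"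
  using split by (simp add: split_lie_pair_def)

lemma lr: "lie_rinehart SA R (fmul P) (lbr P) (rho P)"
proof unfold_locales
  show "vmod R (fmul P) SA" by (rule vmod_SA)
  show "lie_rinehart_data.conn SA R (fmul P) (lbr P) (rho P) (*) R (rho P)"
    unfolding lie_rinehart_data.conn_def
    by (auto simp: vmod_R SA_S hom_def rho_in rho_add rho_add_left rho_lbr rho_fmul rho_mult)
  show "lbr P a (lbr P b c) = lbr P (lbr P a b) c + lbr P b (lbr P a c)"
    if "a \<in> SA" "b \<in> SA" "c \<in> SA" for a b c
    using that by (intro lbr_jacobi SA_S)
qed (simp_all add: lbr_A SA_S lbr_add_left lbr_add_right lbr_self lbr_fmul)

end

sublocale split_pair \<subseteq> lie_rinehart "secA P" "smooth_funs P" "fmul P" "lbr P" "rho P"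
  by (rule lr)

context split_pair
begin

lemma nabla_in: "a \<in> S \<Longrightarrow> b \<in> S \<Longrightarrow> nabla P a b \<in> SB"
  and eth_in: "a \<in> S \<Longrightarrow> b \<in> S \<Longrightarrow> eth P b a \<in> SA"
  by (simp_all add: nabla_def eth_def prA_in prB_in lbr_in)

text \<open>Bracketing with a section of A preserves sections of A, hence acts on L/A: the A-part of
  \<open>u\<close> has no influence on the B-part of the result.\<close>

lemma prB_lbr_A:
  assumes "a \<in> SA" "u \<in> S"
  shows "prB P (lbr P a (prB P u)) = prB P (lbr P a u)"
proof -
  have "prB P (lbr P a u) = prB P (lbr P a (prA P u) + lbr P a (prB P u))"
    using lbr_add_right[OF SA_S[OF assms(1)] SA_S[OF prA_in] SB_S[OF prB_in], of u u] assms(2)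
    by (simp add: pr_sum)
  also have "\<dots> = prB P (lbr P a (prA P u)) + prB P (lbr P a (prB P u))"
    by (rule prB_add[OF lbr_in[OF SA_S[OF assms(1)] SA_S[OF prA_in[OF assms(2)]]]
          lbr_in[OF SA_S[OF assms(1)] SB_S[OF prB_in[OF assms(2)]]]])
  finally show ?thesis
    using prB_A[OF lbr_A[OF assms(1) prA_in[OF assms(2)]]] by simp
qed

text \<open>Flatness is the B-part of the Jacobi identity, since \<open>prB_lbr_A\<close> removes
  the inner projections of the iterated terms. Linearity in the direction holds because the
  derivative term of [f a, x] lies in A.\<close>

lemma conn_nabla: "conn (fmul P) SB (nabla P)"
  unfolding conn_def
proof (intro conjI ballI)
  show "vmod R (fmul P) SB" by (rule vmod_SB)
  fix a assume a: "a \<in> SA"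
  note aS = SA_S[OF a]
  show "hom SB SB (nabla P a)"
    using aS by (simp add: hom_def SB_S nabla_def lbr_add_right prB_add prB_in lbr_in)
  fix b x assume b: "b \<in> SA" and x: "x \<in> SB"
  note bS = SA_S[OF b] and xS = SB_S[OF x]
  show "nabla P (a + b) x = nabla P a x + nabla P b x"
    using aS bS xS by (simp add: nabla_def lbr_add_left prB_add lbr_in)
  show "nabla P (lbr P a b) x = nabla P a (nabla P b x) - nabla P b (nabla P a x)"
  proof -
    have "lbr P (lbr P a b) x = lbr P a (lbr P b x) - lbr P b (lbr P a x)"
      using lbr_jacobi[OF aS bS xS] by simp
    then show ?thesis
      using aS bS xS by (simp add: nabla_def prB_lbr_A a b lbr_in hom_diff[OF hom_prB subgrp_S])
  qed
next
  fix f a x assume f: "f \<in> R" and a: "a \<in> SA" and x: "x \<in> SB"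
  note aS = SA_S[OF a] and xS = SB_S[OF x]
  have "prB P (fmul P (rho P x f) a) = 0"
    using prB_A[OF vmod_in[OF vmod_SA rho_in[OF xS f] a]] .
  then show "nabla P (fmul P f a) x = fmul P f (nabla P a x)"
    using f aS xS
    by (simp add: nabla_def lbr_fmul_left hom_diff[OF hom_prB subgrp_S] vmod_in[OF vmod_S] lbr_in rho_in prB_fmul)
  show "nabla P a (fmul P f x) = fmul P (rho P a f) x + fmul P f (nabla P a x)"
    using f aS xS prB_B[OF vmod_in[OF vmod_SB rho_in[OF aS f] x]]
    by (simp add: nabla_def lbr_fmul prB_add vmod_in[OF vmod_S] lbr_in rho_in prB_fmul)
qed

end

section \<open>Slot-wise rules for forms and comparison with \<open>dBott\<close>\<close>

lemma del_simps: "del 0 (a # as) = as" "del (Suc i) (a # as) = a # del i as"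
  by (simp_all add: del_def)


context lie_rinehart
begin

context
  fixes sc :: "('m \<Rightarrow> 'k) \<Rightarrow> ('m \<Rightarrow> 'w) \<Rightarrow> 'm \<Rightarrow> 'w::ab_group_add" and \<Gamma>
  assumes V: "vmod R sc \<Gamma>"
begin

text \<open>Skew-symmetry carries \<open>a\<close> past the entries different from it until it meets
  its copy.\<close>

lemma cf_repeat_hd: "cf sc \<Gamma> k X \<Longrightarrow> a \<in> set as \<Longrightarrow> X (a # as) = 0"
proof (induction as arbitrary: k X)
  case (Cons b as)
  note X = Cons.prems(1)
  show ?case
  proof (cases "a \<in> SA \<and> b \<in> SA")
    case True
    then have a: "a \<in> SA" and b: "b \<in> SA" by auto
    show ?thesis
    proof (cases "a = b")
      case True
      then show ?thesis
        using fun_cong[OF cf_ins_ins[OF V X a], of as] by (simp add: ins_apply[of _ X] ins_apply[of _ "ins _ X"] fa[where as = as])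
    next
      case False
      have "ins b X (a # as) = 0"
        using False Cons.prems(2) by (intro Cons.IH[OF cf_ins[OF V X b]]) simp
      then show ?thesis
        using fun_cong[OF cf_skew[OF V X b a], of as]
        by (simp add: ins_apply[where as = as] ins_apply[where as = "a # as"] ins_apply[where as = "b # as"] fa)
    qed
  next
    case False
    then show ?thesis using VF_out[OF cf_VF[OF V X], of "a # b # as"] by auto
  qed
qed simp

lemma cf_alternating:
  assumes "cf sc \<Gamma> k X" "i < j" "j < length as" "as ! i = as ! j"
  shows "X as = 0"
  using assms
proof (induction as arbitrary: k X i j)
  case (Cons a as)
  obtain j' where j: "j = Suc j'" using Cons.prems(2) by (cases j) auto
  show ?case
  proof (cases i)
    case 0
    then have "a = as ! j'" "j' < length as" using Cons.prems j by simp_all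
    then have "a \<in> set as" by simp
    then show ?thesis by (rule cf_repeat_hd[OF Cons.prems(1)])
  next
    case (Suc i')
    show ?thesis
    proof (cases "a \<in> SA")
      case True
      from Cons.IH[OF cf_ins[OF V Cons.prems(1) True], of i' j'] show ?thesis
        using Cons.prems Suc j by (simp add: ins_apply[where as = as])
    next
      case False
      then show ?thesis using VF_out[OF cf_VF[OF V Cons.prems(1)], of "a # as"] by auto
    qed
  qed
qed simp

lemma cf_update_add:
  assumes "cf sc \<Gamma> k X" "i < length as" "a \<in> SA" "b \<in> SA"
  shows "X (as[i := a + b]) = X (as[i := a]) + X (as[i := b])"
  using assms(1,2)
proof (induction as arbitrary: k X i)
  case (Cons c as)
  show ?case
  proof (cases i)
    case 0
    then show ?thesis
      using fun_cong[OF cf_ins_add[OF V Cons.prems(1) assms(3,4)], of as] by (simp add: ins_apply[where as = as] fa)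
  next
    case (Suc j)
    show ?thesis
    proof (cases "c \<in> SA")
      case True
      from Cons.IH[OF cf_ins[OF V Cons.prems(1) True], of j] show ?thesis
        using Cons.prems Suc by (simp add: ins_apply[of c X])
    next
      case False
      then have "X (c # bs) = 0" for bs using VF_out[OF cf_VF[OF V Cons.prems(1)], of "c # bs"] by auto
      then show ?thesis using Suc by simp
    qed
  qed
qed simp

lemma cf_update_fm:
  assumes "cf sc \<Gamma> k X" "i < length as" "a \<in> SA" "f \<in> R"
  shows "X (as[i := fm f a]) = sc f (X (as[i := a]))"
  using assms(1,2)
proof (induction as arbitrary: k X i)
  case (Cons c as)
  show ?case
  proof (cases i)
    case 0
    then show ?thesis
      using fun_cong[OF cf_ins_fm[OF V Cons.prems(1) assms(4,3)], of as] by (simp add: ins_apply[where as = as] sm_apply)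
  next
    case (Suc j)
    show ?thesis
    proof (cases "c \<in> SA")
      case True
      from Cons.IH[OF cf_ins[OF V Cons.prems(1) True], of j] show ?thesis
        using Cons.prems Suc by (simp add: ins_apply[of c X])
    next
      case False
      then have "X (c # bs) = 0" for bs using VF_out[OF cf_VF[OF V Cons.prems(1)], of "c # bs"] by auto
      then show ?thesis using Suc by (simp add: vmod_zero[OF V])
    qed
  qed
qed simp

text \<open>\<open>dBott\<close> puts the bracket of two arguments in front, whereas L_a leaves it
  in the slot of the second one. The move passes \<open>j\<close> arguments, hence the sign.\<close>

lemma cf_move_hd:
  assumes "cf sc \<Gamma> k X" "j < length as" "b \<in> SA"
  shows "X (as[j := b]) = sg j (X (b # del j as))"
  using assms(1,2)
proof (induction as arbitrary: k X j)
  case (Cons a as)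
  note X = Cons.prems(1)
  show ?case
  proof (cases j)
    case 0
    then show ?thesis by (simp add: del_simps)
  next
    case (Suc i)
    show ?thesis
    proof (cases "a \<in> SA")
      case a: True
      have "ins a X (as[i := b]) = sg i (ins a X (b # del i as))"
        using Cons.prems Suc by (intro Cons.IH[OF cf_ins[OF V X a]]) simp
      then show ?thesis
        using fun_cong[OF cf_skew[OF V X assms(3) a], of "del i as"] Suc
        by (simp add: ins_apply[of a X] ins_apply[of b X] ins_apply[of _ "ins _ _"] fa[where as = "del i as"] del_simps)
    next
      case False
      then have "X bs = 0" if "a \<in> set bs" for bs using VF_out[OF cf_VF[OF V X], of bs] that by auto
      then show ?thesis using Suc by (simp add: del_simps)
    qed
  qed
qed simp

end

end

lemma cmul_sign: "module (scl P) \<Longrightarrow> fmul P (\<lambda>_. (- 1) ^ i) u = sg i u"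
  for P :: "('m, 'k::real_normed_field, 'v::ab_group_add, 'z) lie_pair_scheme"
  by (cases "even i") (auto simp: sg_def fmul_def fun_eq_iff uminus_apply module.scale_minus_left module.scale_one)

context split_pair
begin

lemma SA_point: "a \<in> SA \<Longrightarrow> a p \<in> subA P p" and SB_point: "b \<in> SB \<Longrightarrow> b p \<in> subB P p"
  by (simp_all add: subsections_def)

lemma module_scl: "module (scl P)"
  by unfold_locales

text \<open>Both sums are split by whether index 0 occurs. The terms with it make up L_a; the others
  give minus the differential of the contraction, the sign coming from the index shift in the single
  sum and from exchanging the bracket with \<open>a\<close> in the double sum.\<close>

lemma dBott_Cons:
  assumes X: "cf (fmul P) SB k X" and a: "a \<in> SA" and as: "set as \<subseteq> SA"
  shows "dBott P X (a # as) = lie SA (lbr P a) (nabla P a) X as - dBott P (ins a X) as"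
proof -
  let ?n = "length as"
  have set: "set (a # as) \<subseteq> SA" using a as by simp
  have nth: "as ! j \<in> SA" if "j < ?n" for j using as that by (meson nth_mem subsetD)
  have s1: "(\<Sum>i<length (a # as). cmul P ((-1) ^ i) (nabla P ((a # as) ! i) (X (del i (a # as)))))
    = nabla P a (X as) - (\<Sum>i<?n. cmul P ((-1) ^ i) (nabla P (as ! i) (ins a X (del i as))))"
    by (simp add: sum.lessThan_Suc_shift cmul_sign[OF module_scl] del_simps ins_apply[of a X] sum_negf del: sum.lessThan_Suc)
  let ?I = "{(i, j). i < j \<and> j < ?n}"
  let ?f = "\<lambda>(i, j). cmul P ((-1) ^ (i + j)) (X (lbr P ((a # as) ! i) ((a # as) ! j) # del i (del j (a # as))))"
  have I: "{(i, j). i < j \<and> j < length (a # as)} = (\<lambda>j. (0, Suc j)) ` {..<?n} \<union> (\<lambda>(i, j). (Suc i, Suc j)) ` ?I"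
  proof -
    have "(i, j) \<in> (\<lambda>j. (0, Suc j)) ` {..<?n} \<union> (\<lambda>(i, j). (Suc i, Suc j)) ` ?I"
      if "i < j" "j < Suc ?n" for i j
      using that by (cases i; cases j) auto
    then show ?thesis by auto
  qed
  have fin: "finite ?I" by (rule finite_subset[of _ "{..<?n} \<times> {..<?n}"]) auto
  have "sum ?f {(i, j). i < j \<and> j < length (a # as)}
    = sum ?f ((\<lambda>j. (0, Suc j)) ` {..<?n}) + sum ?f ((\<lambda>(i, j). (Suc i, Suc j)) ` ?I)"
    unfolding I using fin by (intro sum.union_disjoint) auto
  also have "sum ?f ((\<lambda>j. (0, Suc j)) ` {..<?n}) = (\<Sum>j<?n. - sg j (X (lbr P a (as ! j) # del j as)))"
    by (subst sum.reindex) (auto simp: inj_on_def cmul_sign[OF module_scl] del_simps simp del: power_Suc intro!: sum.cong)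
  also have "\<dots> = - (\<Sum>j<?n. X (as[j := lbr P a (as ! j)]))"
    unfolding sum_negf
    by (intro arg_cong[of _ _ uminus] sum.cong refl)
      (simp add: cf_move_hd[OF vmod_SB X] br_in[OF a nth])
  also have "sum ?f ((\<lambda>(i, j). (Suc i, Suc j)) ` ?I)
    = (\<Sum>(i, j)\<in>?I. - cmul P ((-1) ^ (i + j)) (ins a X (lbr P (as ! i) (as ! j) # del i (del j as))))"
  proof (subst sum.reindex, goal_cases)
    case 2
    show ?case
    proof (rule sum.cong[OF refl], clarsimp simp: cmul_sign[OF module_scl] del_simps simp del: power_Suc)
      fix i j assume ij: "i < j" "j < ?n"
      have b: "lbr P (as ! i) (as ! j) \<in> SA" using ij by (intro br_in nth) auto
      show "sg (i + j) (X (lbr P (as ! i) (as ! j) # a # del i (del j as)))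
        = - sg (i + j) (ins a X (lbr P (as ! i) (as ! j) # del i (del j as)))"
        using fun_cong[OF cf_skew[OF vmod_SB X a b], of "del i (del j as)"]
        by (simp add: ins_apply[of _ X] ins_apply[of _ "ins _ X"] fa[where as = "del i (del j as)"])
    qed
  qed (auto simp: inj_on_def)
  finally show ?thesis
    using set as s1
    by (simp add: dBott_def lie_def sum_negf split_def)
qed

lemma dBott_eq:
  assumes "cf (fmul P) SB k X"
  shows "dBott P X = ce SA (lbr P) (nabla P) X"
proof
  fix as show "dBott P X as = ce SA (lbr P) (nabla P) X as"
    using assms
  proof (induction as arbitrary: k X)
    case Nil
    then show ?case by (simp add: dBott_def)
  next
    case (Cons a as)
    show ?case
    proof (cases "set (a # as) \<subseteq> SA")
      case True
      then show ?thesis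
        using dBott_Cons[OF Cons.prems, of a as] Cons.IH[OF cf_ins[OF vmod_SB Cons.prems]] by simp
    next
      case False
      have "ce SA (lbr P) (nabla P) X \<in> VF SA SB"
        by (rule hom_in[OF hom_d[OF conn_nabla] cf_VF[OF vmod_SB Cons.prems]])
      from VF_out[OF this False] show ?thesis
        unfolding dBott_def if_not_P[OF False] by simp
    qed
  qed
qed

lemma eth_form_eq: "eth_form P b \<omega> = lie SA (eth P b) (rho P b) \<omega>"
  by (simp add: fun_eq_iff eth_form_def lie_def)

lemma act_eq: "act P \<delta> X = lie SA (\<lambda>a. prA P (\<delta> a)) (\<lambda>u. prB P (\<delta> u)) X"
  by (simp add: fun_eq_iff act_def lie_def)

end

section \<open>The wedge product as a recursive shuffle\<close>

text \<open>An index 0 belonging to the first factor is in order with every other index, so it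
  creates no inversion.\<close>

lemma shuffle_sign_0: "shuffle_sign (Suc n) (insert 0 (Suc ` T)) = (shuffle_sign n T :: 'r::ring_1)"
proof -
  have "{(i, j). i \<in> insert 0 (Suc ` T) \<and> j \<in> {..<Suc n} - insert 0 (Suc ` T) \<and> j < i}
    = map_prod Suc Suc ` {(i, j). i \<in> T \<and> j \<in> {..<n} - T \<and> j < i}"
  proof (intro equalityI subsetI, goal_cases)
    case (1 x)
    obtain i j where x: "x = (i, j)" by (cases x)
    with 1 show ?case by (cases i; cases j) auto
  qed auto
  moreover have "inj_on (map_prod Suc Suc) A" for A
    by (auto simp: inj_on_def)
  ultimately show ?thesis
    unfolding shuffle_sign_def by (simp add: card_image)
qed

text \<open>When index 0 belongs to the second factor, each of the \<open>card T\<close> indices of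
  the first factor is inverted with it once.\<close>

lemma shuffle_sign_Suc:
  assumes "T \<subseteq> {..<n}"
  shows "shuffle_sign (Suc n) (Suc ` T) = (-1) ^ card T * (shuffle_sign n T :: 'r::ring_1)"
proof -
  let ?A = "{(i, j). i \<in> T \<and> j \<in> {..<n} - T \<and> j < i}"
  have "{(i, j). i \<in> Suc ` T \<and> j \<in> {..<Suc n} - Suc ` T \<and> j < i}
    = (\<lambda>i. (Suc i, 0)) ` T \<union> map_prod Suc Suc ` ?A"
  proof (intro equalityI subsetI, goal_cases)
    case (1 x)
    obtain i j where x: "x = (i, j)" by (cases x)
    with 1 show ?case by (cases j) auto
  qed auto
  moreover have "card ((\<lambda>i. (Suc i, 0::nat)) ` T \<union> map_prod Suc Suc ` ?A) = card T + card ?A"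
  proof -
    have T: "finite T" using assms finite_lessThan by (rule finite_subset)
    have "?A \<subseteq> T \<times> {..<n}" by auto
    then have "finite ?A" using T by (rule finite_subset[OF _ finite_cartesian_product]) simp
    moreover have "(\<lambda>i. (Suc i, 0)) ` T \<inter> map_prod Suc Suc ` ?A = {}" by auto
    moreover have "inj_on (\<lambda>i. (Suc i, 0::nat)) T" "inj_on (map_prod Suc Suc) ?A" by (auto simp: inj_on_def)
    ultimately show ?thesis
      using T by (subst card_Un_disjoint) (simp_all add: card_image)
  qed
  ultimately have "card {(i, j). i \<in> Suc ` T \<and> j \<in> {..<Suc n} - Suc ` T \<and> j < i} = card T + card ?A"
    by simp
  then show ?thesis by (simp add: shuffle_sign_def power_add)
qed

lemma Pow_lessThan_Suc:
  "Pow {..<Suc n} = (\<lambda>T. insert 0 (Suc ` T)) ` Pow {..<n} \<union> (`) Suc ` Pow {..<n}"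
proof (intro set_eqI iffI)
  fix S assume S: "S \<in> Pow {..<Suc n}"
  define T where "T = {i. Suc i \<in> S}"
  have T: "T \<in> Pow {..<n}" using S by (auto simp: T_def)
  have "S = (if 0 \<in> S then insert 0 (Suc ` T) else Suc ` T)"
    unfolding T_def by (auto simp: image_iff) (metis not0_implies_Suc)+
  then show "S \<in> (\<lambda>T. insert 0 (Suc ` T)) ` Pow {..<n} \<union> (`) Suc ` Pow {..<n}"
    using T by (auto split: if_splits)
qed auto

lemma nths_shift:
  "nths (a # as) (insert 0 (Suc ` T)) = a # nths as T" "nths (a # as) (Suc ` T) = nths as T"
  "nths (a # as) (- insert 0 (Suc ` T)) = nths as (- T)" "nths (a # as) (- (Suc ` T)) = a # nths as (- T)"
  by (simp_all add: nths_Cons) (auto intro!: arg_cong[of _ _ "nths as"])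

text \<open>Subsets are split by membership of index 0. Only subsets of cardinality \<open>k\<close>
  contribute, as \<open>\<omega>\<close> has degree \<open>k\<close>, and this turns the sign
  (-1)^(card T) into the fixed \<open>sg k\<close>.\<close>

lemma wedge_Cons:
  assumes m: "module m" and deg: "\<And>bs. length bs \<noteq> k \<Longrightarrow> \<omega> bs = 0"
  shows "wedge m \<omega> X (a # as) = wedge m (ins a \<omega>) X as + sg k (wedge m \<omega> (ins a X) as)"
proof
  fix p
  let ?n = "length as"
  let ?t = "\<lambda>n S u v. m (shuffle_sign n S) (m u v)"
  interpret module m by (rule m)
  have "wedge m \<omega> X (a # as) p = (\<Sum>S\<in>Pow {..<Suc ?n}. ?t (Suc ?n) S (\<omega> (nths (a # as) S) p) (X (nths (a # as) (- S)) p))"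
    by (simp add: wedge_def)
  also have "\<dots> = (\<Sum>S\<in>(\<lambda>T. insert 0 (Suc ` T)) ` Pow {..<?n}. ?t (Suc ?n) S (\<omega> (nths (a # as) S) p) (X (nths (a # as) (- S)) p))
     + (\<Sum>S\<in>(`) Suc ` Pow {..<?n}. ?t (Suc ?n) S (\<omega> (nths (a # as) S) p) (X (nths (a # as) (- S)) p))"
    unfolding Pow_lessThan_Suc by (rule sum.union_disjoint) auto
  also have "(\<Sum>S\<in>(\<lambda>T. insert 0 (Suc ` T)) ` Pow {..<?n}. ?t (Suc ?n) S (\<omega> (nths (a # as) S) p) (X (nths (a # as) (- S)) p))
    = wedge m (ins a \<omega>) X as p"
  proof (subst sum.reindex)
    show "inj_on (\<lambda>T. insert 0 (Suc ` T)) (Pow {..<?n})" by (auto simp: inj_on_def)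
  qed (simp add: wedge_def nths_shift shuffle_sign_0 ins_apply[of a \<omega>])
  also have "(\<Sum>S\<in>(`) Suc ` Pow {..<?n}. ?t (Suc ?n) S (\<omega> (nths (a # as) S) p) (X (nths (a # as) (- S)) p))
    = (\<Sum>T\<in>Pow {..<?n}. sg k (?t ?n T (\<omega> (nths as T) p) (ins a X (nths as (- T)) p)))"
  proof (subst sum.reindex, goal_cases)
    case 2
    show ?case
    proof (rule sum.cong[OF refl], simp only: o_def nths_shift ins_apply[of a X])
      fix T assume T: "T \<in> Pow {..<?n}"
      then have T': "T \<subseteq> {..<?n}" by simp
      have "{i. i < ?n \<and> i \<in> T} = T" using T' by auto
      then have len: "length (nths as T) = card T" by (simp add: length_nths)
      show "?t (Suc ?n) (Suc ` T) (\<omega> (nths as T) p) (X (a # nths as (- T)) p)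
        = sg k (?t ?n T (\<omega> (nths as T) p) (X (a # nths as (- T)) p))"
      proof (cases "card T = k")
        case True
        then show ?thesis
          unfolding shuffle_sign_Suc[OF T'] by (cases "even k") (simp_all add: sg_def)
      next
        case False
        then have "\<omega> (nths as T) p = 0" using deg len by (simp add: zero_fun_apply)
        then show ?thesis by simp
      qed
    qed
  qed (auto simp: inj_on_def)
  also have "\<dots> = sg k (wedge m \<omega> (ins a X) as p)"
    by (simp add: wedge_def sg_def sum_negf)
  also have "wedge m (ins a \<omega>) X as p + \<dots> = (wedge m (ins a \<omega>) X as + sg k (wedge m \<omega> (ins a X) as)) p"
    by (simp add: plus_fun_apply sg_def uminus_apply)
  finally show "wedge m \<omega> X (a # as) p = (wedge m (ins a \<omega>) X as + sg k (wedge m \<omega> (ins a X) as)) p" .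
qed

text \<open>For k = 0 the contraction of \<open>\<omega>\<close> is 0 and fits any degree; for k > 0
  its degree k - 1 has the parity of \<open>Suc k\<close>.\<close>

lemma wedge_eq_shuf:
  assumes m: "module m" and deg: "\<And>bs. length bs \<noteq> k \<Longrightarrow> \<omega> bs = 0"
    and sc: "\<And>f u p. sc f u p = m (f p) (u p)"
  shows "wedge m \<omega> X = shuf k \<omega> (\<lambda>f. sm sc f X)"
proof
  fix as show "wedge m \<omega> X as = shuf k \<omega> (\<lambda>f. sm sc f X) as"
    using deg
  proof (induction as arbitrary: k \<omega> X)
    case Nil
    have "m (shuffle_sign 0 {}) u = u" for u
      using module.scale_one[OF m] by (simp add: shuffle_sign_def)
    then show ?case by (simp add: fun_eq_iff wedge_def sm_apply sc)
  next
    case (Cons a as)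
    have "wedge m (ins a \<omega>) X as = shuf (Suc k) (ins a \<omega>) (\<lambda>f. sm sc f X) as"
    proof (cases k)
      case 0
      then show ?thesis
        using Cons.prems by (intro Cons.IH) (simp add: ins_apply)
    next
      case (Suc l)
      have "wedge m (ins a \<omega>) X as = shuf l (ins a \<omega>) (\<lambda>f. sm sc f X) as"
        by (rule Cons.IH) (simp add: ins_apply Cons.prems Suc)
      then show ?thesis by (simp add: Suc)
    qed
    then show ?case
      using Cons.IH[OF Cons.prems, where X = "ins a X"] wedge_Cons[OF m Cons.prems, where X = X and a = a and as = as] by simp
  qed
qed

section \<open>Forms as alternating multilinear operators on sections\<close>

context split_pair
begin

lemma SA_surj:
  assumes "v \<in> subA P p"
  shows "\<exists>a\<in>SA. a p = v"
  by (rule dual_basis_at[OF subA(1), where p = p]) (use assms in blast)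

context
  fixes sW :: "'k \<Rightarrow> 'w \<Rightarrow> 'w::ab_group_add" and F \<Gamma> and sc :: "('m \<Rightarrow> 'k) \<Rightarrow> ('m \<Rightarrow> 'w) \<Rightarrow> 'm \<Rightarrow> 'w"
  assumes sc: "\<And>f u p. sc f u p = sW (f p) (u p)" and V: "vmod R sc \<Gamma>" and F: "\<And>u p. u \<in> \<Gamma> \<Longrightarrow> u p \<in> F p"
begin

lemma forms_ins:
  assumes X: "X \<in> forms P sW F \<Gamma> (Suc k)" and a: "a \<in> SA"
  shows "ins a X \<in> forms P sW F \<Gamma> k"
proof -
  from X obtain \<xi> where \<xi>: "\<And>p. alt_multilinear (scl P) sW (subA P p) (F p) (Suc k) (\<xi> p)"
    "\<And>as p. length as = Suc k \<Longrightarrow> set as \<subseteq> SA \<Longrightarrow> X as p = \<xi> p (map (\<lambda>a. a p) as)"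
    unfolding forms_def by blast
  have "alt_multilinear (scl P) sW (subA P p) (F p) k (\<lambda>vs. \<xi> p (a p # vs))" for p
    unfolding alt_multilinear_def
  proof (intro allI impI)
    fix vs assume vs: "length vs = k \<and> set vs \<subseteq> subA P p"
    have "length (a p # vs) = Suc k \<and> set (a p # vs) \<subseteq> subA P p"
      using vs SA_point[OF a] by simp
    from \<xi>(1)[of p, unfolded alt_multilinear_def, rule_format, OF this]
    have 1: "\<xi> p (a p # vs) \<in> F p"
      and 2: "\<And>i v w. i < Suc k \<Longrightarrow> v \<in> subA P p \<Longrightarrow> w \<in> subA P p \<Longrightarrow>
        \<xi> p ((a p # vs)[i := v + w]) = \<xi> p ((a p # vs)[i := v]) + \<xi> p ((a p # vs)[i := w])"
      and 3: "\<And>i c v. i < Suc k \<Longrightarrow> v \<in> subA P p \<Longrightarrow>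
        \<xi> p ((a p # vs)[i := scl P c v]) = sW c (\<xi> p ((a p # vs)[i := v]))"
      and 4: "\<And>i j. i < Suc k \<Longrightarrow> j < Suc k \<Longrightarrow> i \<noteq> j \<Longrightarrow> (a p # vs) ! i = (a p # vs) ! j \<Longrightarrow> \<xi> p (a p # vs) = 0"
      by blast+
    show "\<xi> p (a p # vs) \<in> F p \<and>
      (\<forall>i<k. \<forall>v\<in>subA P p. \<forall>w\<in>subA P p. \<xi> p (a p # vs[i := v + w]) = \<xi> p (a p # vs[i := v]) + \<xi> p (a p # vs[i := w])) \<and>
      (\<forall>i<k. \<forall>c. \<forall>v\<in>subA P p. \<xi> p (a p # vs[i := scl P c v]) = sW c (\<xi> p (a p # vs[i := v]))) \<and>
      (\<forall>i<k. \<forall>j<k. i \<noteq> j \<and> vs ! i = vs ! j \<longrightarrow> \<xi> p (a p # vs) = 0)"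
    proof (intro conjI allI impI ballI)
      fix i v w assume "i < k" "v \<in> subA P p" "w \<in> subA P p"
      with 2[of "Suc i" v w] show "\<xi> p (a p # vs[i := v + w]) = \<xi> p (a p # vs[i := v]) + \<xi> p (a p # vs[i := w])" by simp
    next
      fix i c v assume "i < k" "v \<in> subA P p"
      with 3[of "Suc i" v c] show "\<xi> p (a p # vs[i := scl P c v]) = sW c (\<xi> p (a p # vs[i := v]))" by simp
    next
      fix i j assume "i < k" "j < k" "i \<noteq> j \<and> vs ! i = vs ! j"
      with 4[of "Suc i" "Suc j"] show "\<xi> p (a p # vs) = 0" by simp
    qed (rule 1)
  qed
  moreover have "ins a X as p = \<xi> p (a p # map (\<lambda>a. a p) as)" if "length as = k" "set as \<subseteq> SA" for as p
    using \<xi>(2)[of "a # as" p] that a by (simp add: ins_apply)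
  moreover have "ins a X as = 0" if "\<not> (length as = k \<and> set as \<subseteq> SA)" for as
    using X that unfolding forms_def by (auto simp: ins_apply)
  moreover have "ins a X as \<in> \<Gamma>" if "length as = k \<and> set as \<subseteq> SA" for as
    using X that a unfolding forms_def by (auto simp: ins_apply)
  ultimately show ?thesis
    unfolding forms_def mem_Collect_eq
    by (intro conjI allI impI exI[of _ "\<lambda>p vs. \<xi> p (a p # vs)"]) auto
qed

lemma forms_cf: "X \<in> forms P sW F \<Gamma> k \<Longrightarrow> cf sc \<Gamma> k X"
proof (induction k arbitrary: X)
  case 0
  then have "X [] \<in> \<Gamma>" "\<And>as. as \<noteq> [] \<Longrightarrow> X as = 0" by (auto simp: forms_def)
  then show ?case by (auto simp: form0_def fun_eq_iff intro!: bexI[of _ "X []"])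
next
  case (Suc k)
  note X = Suc.prems
  from X obtain \<xi> where \<xi>: "\<And>p. alt_multilinear (scl P) sW (subA P p) (F p) (Suc k) (\<xi> p)"
    "\<And>as p. length as = Suc k \<Longrightarrow> set as \<subseteq> SA \<Longrightarrow> X as p = \<xi> p (map (\<lambda>a. a p) as)"
    unfolding forms_def by blast
  have out: "X as = 0" if "\<not> (length as = Suc k \<and> set as \<subseteq> SA)" for as
    using X that unfolding forms_def by auto
  show ?case
    unfolding cf.simps
  proof (intro conjI allI impI ballI)
    show "X [] = 0" by (rule out) simp
    show "ins a X = 0" if "a \<notin> SA" for a
      by (rule ext) (use that in \<open>simp add: ins_apply fa out\<close>)
    fix a assume a: "a \<in> SA"
    show "cf sc \<Gamma> k (ins a X)" by (rule Suc.IH[OF forms_ins[OF X a]])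
    have alt: "ins a (ins a X) as = 0 as" for as
    proof (cases "length (a # a # as) = Suc k \<and> set as \<subseteq> SA")
      case True
      have "X (a # a # as) p = 0" for p
      proof -
        let ?vs = "map (\<lambda>a. a p) (a # a # as)"
        have "length ?vs = Suc k \<and> set ?vs \<subseteq> subA P p"
          using True a SA_point by auto
        from \<xi>(1)[of p, unfolded alt_multilinear_def, rule_format, OF this]
        have "\<forall>i<Suc k. \<forall>j<Suc k. i \<noteq> j \<and> ?vs ! i = ?vs ! j \<longrightarrow> \<xi> p ?vs = 0" by blast
        then have "\<xi> p ?vs = 0"
          using True by (elim allE[of _ 0] impE[of "0 < Suc k"] allE[of _ "Suc 0"] impE[of "Suc 0 < Suc k"]) auto
        then show ?thesis using \<xi>(2)[of "a # a # as" p] True a by simp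
      qed
      then show ?thesis by (simp add: ins_apply fa) (simp add: fun_eq_iff zero_fun_apply)
    next
      case False
      then show ?thesis by (simp add: ins_apply fa out)
    qed
    from alt show "ins a (ins a X) = 0" by (rule ext)
    have slot: "\<xi> p ((v + w) # map (\<lambda>a. a p) as) = \<xi> p (v # map (\<lambda>a. a p) as) + \<xi> p (w # map (\<lambda>a. a p) as)
        \<and> \<xi> p (scl P c v # map (\<lambda>a. a p) as) = sW c (\<xi> p (v # map (\<lambda>a. a p) as))"
      if "length as = k" "set as \<subseteq> SA" "v \<in> subA P p" "w \<in> subA P p" for as v w c p
    proof -
      have "length (v # map (\<lambda>a. a p) as) = Suc k \<and> set (v # map (\<lambda>a. a p) as) \<subseteq> subA P p"
        using that SA_point by auto
      from \<xi>(1)[of p, unfolded alt_multilinear_def, rule_format, OF this]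
      have "\<forall>i<Suc k. \<forall>v'\<in>subA P p. \<forall>w\<in>subA P p. \<xi> p ((v # map (\<lambda>a. a p) as)[i := v' + w])
          = \<xi> p ((v # map (\<lambda>a. a p) as)[i := v']) + \<xi> p ((v # map (\<lambda>a. a p) as)[i := w])"
        "\<forall>i<Suc k. \<forall>c. \<forall>v'\<in>subA P p. \<xi> p ((v # map (\<lambda>a. a p) as)[i := scl P c v']) = sW c (\<xi> p ((v # map (\<lambda>a. a p) as)[i := v']))"
        by blast+
      from this(1)[rule_format, of 0 v w] this(2)[rule_format, of 0 v c] that show ?thesis by simp
    qed
    have add: "ins (a + b) X as = (ins a X + ins b X) as" if b: "b \<in> SA" for b as
    proof (cases "length as = k \<and> set as \<subseteq> SA")
      case True
      have "X ((a + b) # as) p = X (a # as) p + X (b # as) p" for p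
        using \<xi>(2)[of "(a + b) # as" p] \<xi>(2)[of "a # as" p] \<xi>(2)[of "b # as" p] True a b
          slot[OF _ _ SA_point[OF a] SA_point[OF b], of as p] SA_point subgrpD(4)[OF subgrp_SA a b]
        by (simp add: plus_fun_apply)
      then show ?thesis by (simp add: ins_apply[where as = as] fa[where as = as] fun_eq_iff plus_fun_apply)
    next
      case False
      then show ?thesis by (auto simp: ins_apply[where as = as] fa[where as = as] out)
    qed
    from add show "ins (a + b) X = ins a X + ins b X" if "b \<in> SA" for b
      by (rule ext) (rule that)
    have fm: "ins (fmul P f a) X as = sm sc f (ins a X) as" if f: "f \<in> R" for f as
    proof (cases "length as = k \<and> set as \<subseteq> SA")
      case True
      have "X (fmul P f a # as) p = sW (f p) (X (a # as) p)" for p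
        using \<xi>(2)[of "fmul P f a # as" p] \<xi>(2)[of "a # as" p] True a
          slot[OF _ _ SA_point[OF a] SA_point[OF a], of as p "f p"] SA_point vmod_in[OF vmod_SA f a]
        by (simp add: fmul_def)
      then show ?thesis by (simp add: ins_apply[where as = as] sm_apply fun_eq_iff sc)
    next
      case False
      then show ?thesis by (auto simp: ins_apply[where as = as] sm_apply out vmod_zero[OF V])
    qed
    from fm show "ins (fmul P f a) X = sm sc f (ins a X)" if "f \<in> R" for f
      by (rule ext) (rule that)
  qed
qed

lemma sc_zero_left: "f p = 0 \<Longrightarrow> sc f u p = 0"
proof -
  have "sc 0 u = 0" using vmod_add_left[OF V, of 0 0 u] by simp
  then have "sW 0 (u p) = 0" using sc[of 0 u p] by (simp add: zero_fun_apply)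
  then show "f p = 0 \<Longrightarrow> sc f u p = 0" by (simp add: sc)
qed

text \<open>Expand \<open>a\<close> in the dual basis at \<open>p\<close>: its coefficients and
  \<open>g\<close> all vanish at \<open>p\<close>, and linearity over functions takes them out of
  \<open>X\<close>.\<close>

lemma cf_tensorial:
  assumes X: "cf sc \<Gamma> k X" and a: "a \<in> SA" "a p = 0"
  shows "X (a # as) p = 0"
proof -
  obtain n :: nat and e c g where e: "\<And>i. i < n \<Longrightarrow> e i \<in> SA" and g: "g \<in> R" "g p = 0"
    and c: "\<And>i u. i < n \<Longrightarrow> u \<in> SA \<Longrightarrow> c i u \<in> R"
    and exp: "\<And>u. u \<in> SA \<Longrightarrow> u = (\<Sum>i<n. fmul P (c i u) (e i)) + fmul P g u"
    and "\<And>i u v. i < n \<Longrightarrow> u \<in> SA \<Longrightarrow> v \<in> SA \<Longrightarrow> c i (u + v) = c i u + c i v"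
    and "\<And>i f u. i < n \<Longrightarrow> u \<in> SA \<Longrightarrow> c i (fmul P f u) = f * c i u"
    and c0: "\<And>i u. i < n \<Longrightarrow> u p = 0 \<Longrightarrow> c i u p = 0"
    and "\<And>v. v \<in> subA P p \<Longrightarrow> \<exists>u\<in>SA. u p = v"
    by (rule dual_basis_at[OF subA(1), where p = p]) blast
  let ?s = "\<Sum>i<n. fmul P (c i a) (e i)"
  have ce: "fmul P (c i a) (e i) \<in> SA" if "i < n" for i
    using vmod_in[OF vmod_SA c[OF that a(1)] e[OF that]] .
  have s: "?s \<in> SA" by (rule subgrp_sum[OF subgrp_SA]) (simp add: ce)
  note h = hom_cf_ins[OF V X]
  have "X (a # as) p = ins (?s + fmul P g a) X as p"
    using exp[OF a(1)] by (simp add: ins_apply)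
  also have "ins (?s + fmul P g a) X = (\<Sum>i<n. ins (fmul P (c i a) (e i)) X) + ins (fmul P g a) X"
    using hom_plus[OF h s vmod_in[OF vmod_SA g(1) a(1)]] hom_sum[OF h subgrp_SA, of "{..<n}"] ce by simp
  also have "\<dots> = (\<Sum>i<n. sm sc (c i a) (ins (e i) X)) + sm sc g (ins a X)"
    using cf_ins_fm[OF V X] c e a(1) g(1) by simp
  also have "\<dots> as p = 0"
    using sc_zero_left[of g p] sc_zero_left[of "c _ a" p] g c0 a(2)
    by (simp add: fa[where as = as] sum_fun_apply sm_apply plus_fun_apply)
  finally show ?thesis .
qed

text \<open>The arguments are exchanged one at a time; the difference of two sections with the same
  value at \<open>p\<close> contributes nothing there.\<close>

lemma cf_pointwise:
  assumes "cf sc \<Gamma> k X" "set as \<subseteq> SA" "set as' \<subseteq> SA" "map (\<lambda>a. a p) as = map (\<lambda>a. a p) as'"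
  shows "X as p = X as' p"
  using assms
proof (induction as arbitrary: k X as')
  case (Cons a as)
  from Cons.prems(4) obtain a' bs where as': "as' = a' # bs" "a p = a' p" "map (\<lambda>a. a p) as = map (\<lambda>a. a p) bs"
    by auto
  note X = Cons.prems(1)
  have aa: "a \<in> SA" "a' \<in> SA" "a - a' \<in> SA" using Cons.prems(2,3) as' subgrpD(2)[OF subgrp_SA] by auto
  have "X ((a - a') # as) p = 0"
    by (rule cf_tensorial[OF X aa(3)]) (simp add: as'(2) minus_apply)
  moreover have "X ((a - a') # as) = X (a # as) - X (a' # as)"
    using fun_cong[OF hom_diff[OF hom_cf_ins[OF V X] subgrp_SA aa(1,2)], of as]
    by (simp add: ins_apply[where as = as] fa[where as = as])
  moreover have "ins a' X as p = ins a' X bs p"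
    using Cons.prems as' by (intro Cons.IH[OF cf_ins[OF V X aa(2)]]) auto
  ultimately show ?case
    by (simp add: as'(1) minus_apply ins_apply[of a' X])
qed simp

text \<open>The pointwise map evaluates \<open>X\<close> on sections through the given vectors. By
  \<open>cf_pointwise\<close> any other sections with the same values would do, so each law at
  \<open>p\<close> can be checked on sections for which it is evident.\<close>

lemma cf_forms:
  assumes X: "cf sc \<Gamma> k X"
  shows "X \<in> forms P sW F \<Gamma> k"
proof -
  \<comment> \<open>A choice of a section through the vector \<open>v\<close> at \<open>p\<close>,
    with no regularity in \<open>v\<close> or \<open>p\<close>.\<close>
  define ev where "ev p v = (SOME a. a \<in> SA \<and> a p = v)" for p v
  have ev: "ev p v \<in> SA" "ev p v p = v" if "v \<in> subA P p" for p v
  proof -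
    have "\<exists>a. a \<in> SA \<and> a p = v"
      using SA_surj[OF that] by blast
    from someI_ex[OF this] show "ev p v \<in> SA" "ev p v p = v" by (simp_all add: ev_def)
  qed
  define \<xi> where "\<xi> p vs = X (map (ev p) vs) p" for p vs
  have "alt_multilinear (scl P) sW (subA P p) (F p) k (\<xi> p)" for p
    unfolding alt_multilinear_def
  proof (intro allI impI)
    fix vs assume vs: "length vs = k \<and> set vs \<subseteq> subA P p"
    let ?as = "map (ev p) vs"
    have as: "set ?as \<subseteq> SA" using vs ev by auto
    have ptw: "map (\<lambda>a. a p) (map (ev p) ws) = ws" if "set ws \<subseteq> subA P p" for ws
      using that ev by (induction ws) auto
    have upd: "\<xi> p (vs[i := v]) = X (?as[i := a]) p" if "a \<in> SA" "a p = v" for i a v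
    proof -
      have "set (vs[i := v]) \<subseteq> subA P p"
        using vs that SA_point set_update_subset_insert by fastforce
      then have "map (\<lambda>a. a p) (map (ev p) (vs[i := v])) = map (\<lambda>a. a p) (?as[i := a])"
        unfolding ptw[OF \<open>set (vs[i := v]) \<subseteq> subA P p\<close>]
        unfolding map_update[of _ ?as] ptw[OF conjunct2[OF vs]] that(2) by (simp only:)
      moreover have "set (map (ev p) (vs[i := v])) \<subseteq> SA"
        using \<open>set (vs[i := v]) \<subseteq> subA P p\<close> ev by auto
      moreover have "set (?as[i := a]) \<subseteq> SA"
        using as that set_update_subset_insert by fastforce
      ultimately show ?thesis unfolding \<xi>_def by (intro cf_pointwise[OF X])
    qed
    show "\<xi> p vs \<in> F p \<and>
      (\<forall>i<k. \<forall>v\<in>subA P p. \<forall>w\<in>subA P p. \<xi> p (vs[i := v + w]) = \<xi> p (vs[i := v]) + \<xi> p (vs[i := w])) \<and>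
      (\<forall>i<k. \<forall>c. \<forall>v\<in>subA P p. \<xi> p (vs[i := scl P c v]) = sW c (\<xi> p (vs[i := v]))) \<and>
      (\<forall>i<k. \<forall>j<k. i \<noteq> j \<and> vs ! i = vs ! j \<longrightarrow> \<xi> p vs = 0)"
    proof (intro conjI allI impI ballI)
      show "\<xi> p vs \<in> F p" unfolding \<xi>_def by (rule F[OF VF_in[OF cf_VF[OF V X]]])
    next
      fix i v w assume i: "i < k" and v: "v \<in> subA P p" and w: "w \<in> subA P p"
      have "X (?as[i := ev p v + ev p w]) = X (?as[i := ev p v]) + X (?as[i := ev p w])"
        using i vs by (intro cf_update_add[OF V X] ev v w) simp
      then show "\<xi> p (vs[i := v + w]) = \<xi> p (vs[i := v]) + \<xi> p (vs[i := w])"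
        using upd[of "ev p v + ev p w" "v + w" i] upd[of "ev p v" v i] upd[of "ev p w" w i]
          ev[OF v] ev[OF w] subgrpD(4)[OF subgrp_SA] by (simp add: plus_fun_apply)
    next
      fix i c v assume i: "i < k" and v: "v \<in> subA P p"
      have "X (?as[i := fmul P (\<lambda>_. c) (ev p v)]) = sc (\<lambda>_. c) (X (?as[i := ev p v]))"
        using i vs by (intro cf_update_fm[OF V X] ev v smooth_const) simp
      then show "\<xi> p (vs[i := scl P c v]) = sW c (\<xi> p (vs[i := v]))"
        using upd[of "fmul P (\<lambda>_. c) (ev p v)" "scl P c v" i] upd[of "ev p v" v i]
          ev[OF v] vmod_in[OF vmod_SA smooth_const] by (simp add: fmul_def sc)
    next
      fix i j assume i: "i < k" and j: "j < k" and eq: "i \<noteq> j \<and> vs ! i = vs ! j"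
      have "X ?as = 0"
      proof (cases "i < j")
        case True
        then show ?thesis using eq vs i j by (intro cf_alternating[OF V X, of i j]) auto
      next
        case False
        then show ?thesis using eq vs i j by (intro cf_alternating[OF V X, of j i]) auto
      qed
      then show "\<xi> p vs = 0" by (simp add: \<xi>_def zero_fun_apply)
    qed
  qed
  moreover have "X as p = \<xi> p (map (\<lambda>a. a p) as)" if "set as \<subseteq> SA" for as p
  proof -
    have pt: "a p \<in> subA P p" if "a \<in> set as" for a using that \<open>set as \<subseteq> SA\<close> SA_point by blast
    show ?thesis
      unfolding \<xi>_def
    proof (rule cf_pointwise[OF X that])
      show "set (map (ev p) (map (\<lambda>a. a p) as)) \<subseteq> SA" using ev(1) pt by auto
      show "map (\<lambda>a. a p) as = map (\<lambda>a. a p) (map (ev p) (map (\<lambda>a. a p) as))" using ev(2) pt by simp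
    qed
  qed
  moreover have "X as \<in> \<Gamma>" for as by (rule VF_in[OF cf_VF[OF V X]])
  moreover have "X as = 0" if "\<not> (length as = k \<and> set as \<subseteq> SA)" for as
    using that VF_out[OF cf_VF[OF V X], of as] cf_degree[OF V X, of as] by auto
  ultimately show ?thesis
    unfolding forms_def mem_Collect_eq by (intro conjI allI impI exI[of _ \<xi>]) auto
qed

lemma forms_iff: "X \<in> forms P sW F \<Gamma> k \<longleftrightarrow> cf sc \<Gamma> k X"
  using forms_cf cf_forms by blast

end

lemma OmegaB_iff: "X \<in> OmegaB P k \<longleftrightarrow> cf (fmul P) SB k X"
  unfolding OmegaB_def by (rule forms_iff[OF _ vmod_SB]) (simp_all add: fmul_def SB_point)

lemma Omega_iff: "\<omega> \<in> Omega P k \<longleftrightarrow> cf (*) R k \<omega>"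
  unfolding Omega_def by (rule forms_iff[OF _ vmod_R]) (simp_all add: times_fun_apply)

lemma wedgeB_eq: "\<omega> \<in> Omega P k \<Longrightarrow> wedgeB P \<omega> X = wd (fmul P) k \<omega> X"
  unfolding wd_def Omega_iff
  by (rule wedge_eq_shuf[OF module_scl]) (simp_all add: cf_degree[OF vmod_R] fmul_def)

lemma wedgeK_eq: "\<omega> \<in> Omega P k \<Longrightarrow> wedgeK \<omega> X = wd (*) k \<omega> X"
  unfolding wd_def Omega_iff
  by (rule wedge_eq_shuf) (unfold_locales, simp_all add: cf_degree[OF vmod_R] times_fun_apply algebra_simps)

lemma cmulB_eq: "cmulB P c X = sm (fmul P) (\<lambda>_. c) X"
  by (simp add: cmulB_def sm_def)

lemma cmulB_sign: "cmulB P ((-1) ^ n) X = sg n X"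
  by (rule ext) (simp add: cmulB_def cmul_sign[OF module_scl] sg_apply)

end

section \<open>Reduction to products of scalar forms and sections of B\<close>

context lie_rinehart
begin

lemma lie_scale:
  assumes V: "vmod R sc \<Gamma>" and f: "f \<in> R" and X: "cf sc \<Gamma> k X" and T: "hom SA SA T"
  shows "lie SA (\<lambda>a. fm f (T a)) (\<lambda>x. sc f (D x)) X = sm sc f (lie SA T D X)"
proof
  fix as
  show "lie SA (\<lambda>a. fm f (T a)) (\<lambda>x. sc f (D x)) X as = sm sc f (lie SA T D X) as"
    using X
  proof (induction as arbitrary: k X)
    case Nil
    then show ?case by (simp add: sm_apply)
  next
    case (Cons a as)
    show ?case
    proof (cases "a \<in> SA")
      case True
      note XV = cf_VF[OF V Cons.prems]
      have "ins a (lie SA (\<lambda>a. fm f (T a)) (\<lambda>x. sc f (D x)) X) as = ins a (sm sc f (lie SA T D X)) as"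
        using Cons.IH[OF cf_ins[OF V Cons.prems True]] hom_in[OF T True] f
        by (simp add: ins_lie[OF XV True] cf_ins_fm[OF V Cons.prems] fa[where as = as] sm_diff[OF V])
      then show ?thesis by (simp only: ins_apply[where as = as])
    qed (simp add: lie_out sm_apply vmod_zero[OF V])
  qed
qed

text \<open>Meant for a coefficient map of the dual basis, which turns a form with values in B into
  a scalar form.\<close>

lemma cf_map:
  assumes V: "vmod R sc \<Gamma>" and c: "hom \<Gamma> \<Delta> c" "\<And>f x. f \<in> R \<Longrightarrow> x \<in> \<Gamma> \<Longrightarrow> c (sc f x) = sc' f (c x)"
    and X: "cf sc \<Gamma> k X"
  shows "cf sc' \<Delta> k (\<lambda>as. c (X as))"
  using X
proof (induction k arbitrary: X)
  case 0
  then obtain v where "v \<in> \<Gamma>" "X = form0 v" by auto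
  moreover have "(\<lambda>as. c (form0 v as)) = form0 (c v)"
    by (rule ext) (simp add: form0_def hom_0[OF c(1) vmod_subgrp[OF V]])
  ultimately show ?case using hom_in[OF c(1)] by auto
next
  case (Suc k)
  note XV = cf_VF[OF V Suc.prems] and c0 = hom_0[OF c(1) vmod_subgrp[OF V]]
  have ins: "ins a (\<lambda>as. c (X as)) = (\<lambda>as. c (ins a X as))" for X a by (simp add: ins_def)
  have zero: "(\<lambda>as. c ((0 :: ('m \<Rightarrow> 'v) list \<Rightarrow> 'm \<Rightarrow> 'a) as)) = 0"
    by (rule ext) (simp add: fa c0)
  show ?case
    unfolding cf.simps
  proof (intro conjI allI impI ballI)
    show "c (X []) = 0" using Suc.prems c0 by simp
    show "ins a (\<lambda>as. c (X as)) = 0" if "a \<notin> SA" for a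
      unfolding ins cf_ins_out[OF V Suc.prems that] by (rule zero)
    fix a assume a: "a \<in> SA"
    show "cf sc' \<Delta> k (ins a (\<lambda>as. c (X as)))"
      unfolding ins using Suc a by simp
    show "ins a (ins a (\<lambda>as. c (X as))) = 0"
      unfolding ins cf_ins_ins[OF V Suc.prems a] by (rule zero)
    show "ins (a + b) (\<lambda>as. c (X as)) = ins a (\<lambda>as. c (X as)) + ins b (\<lambda>as. c (X as))" if b: "b \<in> SA" for b
      unfolding ins cf_ins_add[OF V Suc.prems a b]
      by (rule ext) (simp add: fa hom_plus[OF c(1)] VF_in[OF ins_VF[OF XV]])
    show "ins (fm f a) (\<lambda>as. c (X as)) = sm sc' f (ins a (\<lambda>as. c (X as)))" if f: "f \<in> R" for f
      unfolding ins cf_ins_fm[OF V Suc.prems f a]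
      by (rule ext) (simp add: sm_apply c(2)[OF f] VF_in[OF ins_VF[OF XV]])
  qed
qed

lemma wd_form0_right:
  assumes V: "vmod R sc \<Gamma>"
  shows "wd sc k \<omega> (form0 b) as = sc (\<omega> as) b"
  unfolding wd_def
proof (induction as arbitrary: k \<omega>)
  case (Cons a as)
  have "shuf k \<omega> (\<lambda>f. ins a (sm sc f (form0 b))) as = 0"
    by (simp add: sm_zero[OF V] shuf_op_zero fa)
  then show ?case using Cons.IH[of "Suc k" "ins a \<omega>"] by (simp add: ins_apply[of a \<omega> as])
qed (simp add: sm_apply)

lemma wd_zero: "vmod R sc \<Gamma> \<Longrightarrow> wd sc k \<omega> 0 = 0"
  by (simp add: wd_def sm_zero shuf_op_zero)

end

context split_pair
begin

abbreviation "cB \<equiv> cf (fmul P) SB"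
abbreviation "cK \<equiv> cf (*) R"
abbreviation "dN \<equiv> ce SA (lbr P) (nabla P)"
abbreviation "dR \<equiv> ce SA (lbr P) (rho P)"
abbreviation "wB \<equiv> wd (fmul P)"
abbreviation "wK \<equiv> wd (*)"

lemmas cB_VF = cf_VF[OF vmod_SB] and cK_VF = cf_VF[OF vmod_R]

lemma cB_form0: "b \<in> SB \<Longrightarrow> cB 0 (form0 b)" and cK_form0: "f \<in> R \<Longrightarrow> cK 0 (form0 f)"
  by (auto intro: bexI[of _ f])

text \<open>At a point \<open>p\<close>, the dual basis writes \<open>X\<close> as a sum of products
  \<open>\<mu> i\<close> . \<open>e i\<close> plus g X with g p = 0. The hypothesis
  \<open>sm\<close> asks less than linearity over functions and concerns the given \<open>X\<close>
  only.\<close>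

lemma local_zero:
  fixes Fn :: "(('m \<Rightarrow> 'v) list \<Rightarrow> 'm \<Rightarrow> 'v) \<Rightarrow> ('m \<Rightarrow> 'v) list \<Rightarrow> 'm \<Rightarrow> 'u::ab_group_add"
  assumes X: "cB k X"
    and add: "\<And>X Y. cB k X \<Longrightarrow> cB k Y \<Longrightarrow> Fn (X + Y) = Fn X + Fn Y"
    and sm: "\<And>f p as. f \<in> R \<Longrightarrow> f p = 0 \<Longrightarrow> Fn (sm (fmul P) f X) as p = 0"
    and gen: "\<And>\<mu> b. cK k \<mu> \<Longrightarrow> b \<in> SB \<Longrightarrow> Fn (wB k \<mu> (form0 b)) = 0"
  shows "Fn X = 0"
proof (intro ext)
  fix as p
  obtain n :: nat and e c g where e: "\<And>i. i < n \<Longrightarrow> e i \<in> SB" and g: "g \<in> R" "g p = 0"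
    and c: "\<And>i u. i < n \<Longrightarrow> u \<in> SB \<Longrightarrow> c i u \<in> R"
    and exp: "\<And>u. u \<in> SB \<Longrightarrow> u = (\<Sum>i<n. fmul P (c i u) (e i)) + fmul P g u"
    and c_add: "\<And>i u v. i < n \<Longrightarrow> u \<in> SB \<Longrightarrow> v \<in> SB \<Longrightarrow> c i (u + v) = c i u + c i v"
    and c_fm: "\<And>i f u. i < n \<Longrightarrow> u \<in> SB \<Longrightarrow> c i (fmul P f u) = f * c i u"
    and "\<And>i u. i < n \<Longrightarrow> u p = 0 \<Longrightarrow> c i u p = 0"
    and "\<And>v. v \<in> subB P p \<Longrightarrow> \<exists>u\<in>SB. u p = v"
    by (rule dual_basis_at[OF subB(1), where p = p]) blast
  define \<mu> where "\<mu> i = (\<lambda>as. c i (X as))" for i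
  have \<mu>: "cK k (\<mu> i)" if "i < n" for i
    unfolding \<mu>_def
    by (rule cf_map[OF vmod_SB _ _ X]) (simp_all add: hom_def c c_add c_fm that)
  have w: "cB k (wB k (\<mu> i) (form0 (e i)))" if "i < n" for i
    using cf_wd[OF conn_nabla \<mu>[OF that] cB_form0[OF e[OF that]]] by simp
  have X_eq: "X = (\<Sum>i<n. wB k (\<mu> i) (form0 (e i))) + sm (fmul P) g X"
  proof
    fix as
    show "X as = ((\<Sum>i<n. wB k (\<mu> i) (form0 (e i))) + sm (fmul P) g X) as"
      using exp[OF VF_in[OF cB_VF[OF X]], of as]
      by (simp add: fa[where as = as] sum_fun_apply wd_form0_right[OF vmod_SB] \<mu>_def sm_apply)
  qed
  have sum: "cB k (\<Sum>i\<in>I. wB k (\<mu> i) (form0 (e i))) \<and> Fn (\<Sum>i\<in>I. wB k (\<mu> i) (form0 (e i))) = 0"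
    if "finite I" "I \<subseteq> {..<n}" for I
    using that
  proof (induction I rule: finite_induct)
    case empty
    have "Fn (0 + 0) = Fn 0 + Fn 0" by (rule add) (rule cf_zero[OF vmod_SB])+
    then show ?case using cf_zero[OF vmod_SB] by simp
  next
    case (insert i I)
    then show ?case
      using w[of i] gen[OF \<mu> e, of i i] add[of "wB k (\<mu> i) (form0 (e i))"]
      by (simp add: cf_add[OF vmod_SB])
  qed
  have "Fn X = Fn ((\<Sum>i<n. wB k (\<mu> i) (form0 (e i))) + sm (fmul P) g X)"
    using X_eq by simp
  also have "\<dots> = 0 + Fn (sm (fmul P) g X)"
    using add[OF _ cf_sm[OF vmod_SB g(1) X]] sum[of "{..<n}"] by simp
  finally show "Fn X as p = 0 as p"
    using sm[OF g] by (simp add: zero_fun_apply)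
qed

text \<open>With the first argument fixed, \<open>local_zero\<close> reduces the second one to
  sections of B; skew-symmetry exchanges the arguments, and the same reduction treats the other. The
  sign in \<open>lin\<close> may depend on the degrees, since only vanishing is at stake.\<close>

lemma bracket_zero:
  fixes Gn :: "nat \<Rightarrow> nat \<Rightarrow> (('m \<Rightarrow> 'v) list \<Rightarrow> 'm \<Rightarrow> 'v) \<Rightarrow> (('m \<Rightarrow> 'v) list \<Rightarrow> 'm \<Rightarrow> 'v) \<Rightarrow> ('m \<Rightarrow> 'v) list \<Rightarrow> 'm \<Rightarrow> 'v"
  assumes VF: "\<And>k l X Y. cB k X \<Longrightarrow> cB l Y \<Longrightarrow> Gn k l X Y \<in> VF SA SB"
    and add: "\<And>k l X Y Z. cB k X \<Longrightarrow> cB l Y \<Longrightarrow> cB l Z \<Longrightarrow> Gn k l X (Y + Z) = Gn k l X Y + Gn k l X Z"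
    and skew: "\<And>k l X Y. cB k X \<Longrightarrow> cB l Y \<Longrightarrow> Gn k l X Y = - sg (k * l) (Gn l k Y X)"
    and lin: "\<And>k j l X \<omega> Y. cB k X \<Longrightarrow> cK j \<omega> \<Longrightarrow> cB l Y \<Longrightarrow>
        \<exists>n. Gn k (j + l) X (wB j \<omega> Y) = sg n (wB j \<omega> (Gn k l X Y))"
    and gen: "\<And>b b'. b \<in> SB \<Longrightarrow> b' \<in> SB \<Longrightarrow> Gn 0 0 (form0 b) (form0 b') = 0"
    and X: "cB k X" and Y: "cB l Y"
  shows "Gn k l X Y = 0"
proof -
  have step: "Gn k l X Y = 0" if X: "cB k X" and Y: "cB l Y" and b: "\<And>b. b \<in> SB \<Longrightarrow> Gn k 0 X (form0 b) = 0" for k l X Y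
  proof (rule local_zero[OF Y])
    show "Gn k l X (Y + Z) = Gn k l X Y + Gn k l X Z" if "cB l Y" "cB l Z" for Y Z
      by (rule add[OF X that])
    show "Gn k l X (sm (fmul P) f Y) as p = 0" if f: "f \<in> R" "f p = 0" for f p as
    proof -
      obtain n where "Gn k l X (sm (fmul P) f Y) = sg n (sm (fmul P) f (Gn k l X Y))"
        using lin[OF X cK_form0[OF f(1)] Y]
        by (auto simp: wd_form0[OF conn_nabla] cB_VF[OF Y] VF[OF X Y])
      then show ?thesis
        using f(2) by (simp add: fa[where as = as] sm_apply fmul_def sg_def uminus_apply)
    qed
    show "Gn k l X (wB l \<mu> (form0 b)) = 0" if "cK l \<mu>" "b \<in> SB" for \<mu> b
      using lin[OF X that(1) cB_form0[OF that(2)]] by (auto simp: b[OF that(2)] wd_zero[OF vmod_SB])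
  qed
  show ?thesis
  proof (rule step[OF X Y])
    fix b assume b: "b \<in> SB"
    have "Gn 0 k (form0 b) X = 0"
      by (rule step[OF cB_form0[OF b] X gen[OF b]])
    then show "Gn k 0 X (form0 b) = 0"
      using skew[OF X cB_form0[OF b]] by simp
  qed
qed

text \<open>Insertion of the \<open>A\<close>-valued one-form \<open>a \<mapsto> h (\<nabla>\<^sub>a b)\<close>.\<close>

lemma insertion:
  assumes V: "vmod R sc \<Gamma>" and Y: "cf sc \<Gamma> k Y" and h: "hom SB SA h" and b: "b \<in> SB"
  shows "shuf (Suc 0) (dN (form0 b)) (\<lambda>v. ins (h v) Y) = - lie SA (\<lambda>a. h (nabla P a b)) (\<lambda>_. 0) Y"
proof
  fix as
  have db: "dN (form0 b) \<in> VF SA SB"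
    by (rule hom_in[OF hom_d[OF conn_nabla] form0_VF[OF subgrp_SB b]])
  show "shuf (Suc 0) (dN (form0 b)) (\<lambda>v. ins (h v) Y) as = (- lie SA (\<lambda>a. h (nabla P a b)) (\<lambda>_. 0) Y) as"
    using Y
  proof (induction as arbitrary: k Y)
    case Nil
    have "ins (h 0) Y = 0"
      using hom_0[OF h subgrp_SB] hom_0[OF hom_cf_ins[OF V Nil] subgrp_SA] by simp
    then show ?case by (simp add: fa)
  next
    case (Cons a as)
    note Y = Cons.prems
    have \<Phi>: "hom SB (VF SA \<Gamma>) (\<lambda>v. ins (h v) Y)"
      by (rule hom_comp[OF h hom_cf_ins[OF V Y]])
    show ?case
    proof (cases "a \<in> SA")
      case a: True
      have "shuf (Suc 0) (dN (form0 b)) (\<lambda>v. ins a (ins (h v) Y)) = shuf (Suc 0) (dN (form0 b)) (\<lambda>v. - ins (h v) (ins a Y))"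
        by (rule shuf_cong[OF db]) (rule cf_skew[OF V Y a hom_in[OF h]])
      then have "ins a (shuf (Suc 0) (dN (form0 b)) (\<lambda>v. ins (h v) Y)) as
          = ins a (- lie SA (\<lambda>a. h (nabla P a b)) (\<lambda>_. 0) Y) as"
        using Cons.IH[OF cf_ins[OF V Y a]]
        by (simp add: ins_shuf shuf_op_minus ins_d_form0[OF conn_nabla a] shuf_form0[OF subgrp_SB \<Phi>]
            ins_lie[OF cf_VF[OF V Y] a] fa[where as = as])
      then show ?thesis by (simp only: ins_apply[where as = as])
    next
      case False
      have "shuf (Suc 0) (dN (form0 b)) (\<lambda>v. ins (h v) Y) \<in> VF SA \<Gamma>"
        by (rule hom_in[OF hom_shuf[OF subgrp_SB vmod_subgrp[OF V] \<Phi>] db])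
      from VF_out[OF this, of "a # as"] show ?thesis using False by (simp add: lie_out fa)
    qed
  qed
qed

end

section \<open>The Jacobi identity split into A- and B-parts; \<open>eth\<close> and the
  differential\<close>

context split_pair
begin

abbreviation "eK b \<equiv> lie SA (eth P b) (rho P b)"
abbreviation "eB b \<equiv> lie SA (eth P b) (brB P b)"

lemma hom_eth: "b \<in> S \<Longrightarrow> hom SA SA (eth P b)"
  by (simp add: hom_def eth_in SA_S eth_def lbr_add_right prA_add lbr_in prA_in)

lemma eth_fm: "b \<in> S \<Longrightarrow> f \<in> R \<Longrightarrow> a \<in> SA \<Longrightarrow> eth P b (fmul P f a) = fmul P (rho P b f) a + fmul P f (eth P b a)"
  using prA_A[OF vmod_in[OF vmod_SA rho_in, of b f a]]
  by (simp add: eth_def lbr_fmul SA_S prA_add vmod_in[OF vmod_S] rho_in lbr_in prA_fmul)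

text \<open>The derivative term of [f b, a] is a multiple of b, so the projection to A removes
  it.\<close>

lemma eth_fm_left: "b \<in> SB \<Longrightarrow> f \<in> R \<Longrightarrow> a \<in> SA \<Longrightarrow> eth P (fmul P f b) a = fmul P f (eth P b a)"
  using prA_B[OF vmod_in[OF vmod_SB rho_in, of a f b]]
  by (simp add: eth_def lbr_fmul_left SA_S SB_S hom_diff[OF hom_prA subgrp_S] vmod_in[OF vmod_S] rho_in lbr_in prA_fmul)

lemma hom_brB: "b \<in> S \<Longrightarrow> hom SB SB (brB P b)"
  by (simp add: hom_def SB_S brB_def lbr_add_right prB_add lbr_in prB_in)

lemma brB_fm: "b \<in> S \<Longrightarrow> f \<in> R \<Longrightarrow> x \<in> SB \<Longrightarrow> brB P b (fmul P f x) = fmul P (rho P b f) x + fmul P f (brB P b x)"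
  using prB_B[OF vmod_in[OF vmod_SB rho_in, of b f x]]
  by (simp add: brB_def lbr_fmul SB_S prB_add vmod_in[OF vmod_S] rho_in lbr_in prB_fmul)

lemma brB_anti: "b \<in> SB \<Longrightarrow> b' \<in> SB \<Longrightarrow> brB P b b' = - brB P b' b"
  using lbr_anti[of b b'] by (simp add: brB_def SB_S hom_minus[OF hom_prB subgrp_S] lbr_in)

lemma hom_rho: "b \<in> S \<Longrightarrow> hom R R (rho P b)"
  by (simp add: hom_def rho_in rho_add)

lemma hom_rho_left: "f \<in> R \<Longrightarrow> hom S R (\<lambda>u. rho P u f)"
  by (simp add: hom_def rho_in rho_add_left)

text \<open>The two parts of the bracket across the splitting; the A-part gets a minus sign since
  \<open>eth\<close> takes the bracket in the opposite order.\<close>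

lemma lbr_AB: "a \<in> SA \<Longrightarrow> b \<in> SB \<Longrightarrow> lbr P a b = nabla P a b - eth P b a"
proof -
  assume a: "a \<in> SA" and b: "b \<in> SB"
  have "lbr P a b = prA P (lbr P a b) + prB P (lbr P a b)"
    using a b by (simp add: pr_sum lbr_in SA_S SB_S)
  moreover have "prA P (lbr P a b) = - eth P b a"
    using a b lbr_anti[of a b] by (simp add: eth_def SA_S SB_S hom_minus[OF hom_prA subgrp_S] lbr_in)
  ultimately show ?thesis by (simp add: nabla_def)
qed

lemma cK_eK: "b \<in> S \<Longrightarrow> cK k \<omega> \<Longrightarrow> cK k (eK b \<omega>)"
  by (rule cf_lie[where s = "rho P b", OF vmod_R hom_eth hom_rho])
    (simp_all add: rho_in eth_fm rho_mult)

lemma hom_eK: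
  assumes \<omega>: "cK k \<omega>"
  shows "hom SB (VF SA R) (\<lambda>b. eK b \<omega>)"
proof (rule homI)
  fix b b' assume b: "b \<in> SB" and b': "b' \<in> SB"
  show "eK b \<omega> \<in> VF SA R" using cK_VF[OF cK_eK[OF SB_S[OF b] \<omega>]] .
  have "eK (b + b') \<omega> = lie SA (\<lambda>a. eth P b a + eth P b' a) (\<lambda>f. rho P b f + rho P b' f) \<omega>"
    using b b' by (intro lie_cong[OF cK_VF[OF \<omega>]])
      (simp_all add: eth_def lbr_add_left prA_add lbr_in SA_S SB_S rho_add_left)
  also have "\<dots> = eK b \<omega> + eK b' \<omega>"
    using b b' by (intro lie_plus[OF vmod_R \<omega>] hom_eth SB_S)
  finally show "eK (b + b') \<omega> = eK b \<omega> + eK b' \<omega>" .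
qed

lemma eK_fm:
  assumes \<omega>: "cK k \<omega>" and f: "f \<in> R" and b: "b \<in> SB"
  shows "eK (fmul P f b) \<omega> = sm (*) f (eK b \<omega>)"
proof -
  have "eK (fmul P f b) \<omega> = lie SA (\<lambda>a. fmul P f (eth P b a)) (\<lambda>x. f * rho P b x) \<omega>"
    using f b by (intro lie_cong[OF cK_VF[OF \<omega>]]) (simp_all add: eth_fm_left rho_fmul SB_S)
  also have "\<dots> = sm (*) f (eK b \<omega>)"
    by (rule lie_scale[OF vmod_R f \<omega> hom_eth[OF SB_S[OF b]]])
  finally show ?thesis .
qed

text \<open>The A-part of the Jacobi identity for b, a, a', after splitting [b, a] and
  [b, a'].\<close>

lemma eth_jacobi:
  assumes a: "a \<in> SA" and a': "a' \<in> SA" and b: "b \<in> SB"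
  shows "lbr P a (eth P b a') - eth P b (lbr P a a') + lbr P (eth P b a) a'
    = eth P (nabla P a b) a' - eth P (nabla P a' b) a"
proof -
  note S = SA_S[OF a] SA_S[OF a'] SB_S[OF b]
  note e = eth_in[OF S(1,3)] eth_in[OF S(2,3)] and n = nabla_in[OF S(1,3)] nabla_in[OF S(2,3)]
  note S' = SA_S[OF e(1)] SA_S[OF e(2)] SB_S[OF n(1)] SB_S[OF n(2)]
  note minus = hom_minus[OF hom_lbr subgrp_S] hom_minus[OF hom_lbr_left subgrp_S]
    hom_diff[OF hom_lbr subgrp_S] hom_diff[OF hom_lbr_left subgrp_S] hom_diff[OF hom_prA subgrp_S]
  have "lbr P b a = eth P b a - nabla P a b" "lbr P b a' = eth P b a' - nabla P a' b"
    using lbr_anti[OF S(3,1)] lbr_anti[OF S(3,2)] lbr_AB[OF a b] lbr_AB[OF a' b] by simp_all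
  then have "lbr P b (lbr P a a') = lbr P (eth P b a - nabla P a b) a' + lbr P a (eth P b a' - nabla P a' b)"
    using lbr_jacobi[OF S(3,1,2)] by simp
  then have "eth P b (lbr P a a') = prA P (lbr P (eth P b a - nabla P a b) a' + lbr P a (eth P b a' - nabla P a' b))"
    by (simp add: eth_def)
  also have "\<dots> = prA P (lbr P (eth P b a) a') - prA P (lbr P (nabla P a b) a')
      + (prA P (lbr P a (eth P b a')) - prA P (lbr P a (nabla P a' b)))"
    using S S' by (simp add: minus prA_add lbr_in subgrpD(2)[OF subgrp_S])
  also have "prA P (lbr P (eth P b a) a') = lbr P (eth P b a) a'" by (rule prA_A[OF lbr_A[OF e(1) a']])
  also have "prA P (lbr P a (eth P b a')) = lbr P a (eth P b a')" by (rule prA_A[OF lbr_A[OF a e(2)]])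
  also have "prA P (lbr P (nabla P a b) a') = eth P (nabla P a b) a'" by (simp add: eth_def)
  also have "prA P (lbr P a (nabla P a' b)) = - eth P (nabla P a' b) a"
    using lbr_anti[OF S(1) S'(4)] S S' by (simp add: eth_def hom_minus[OF hom_prA subgrp_S] lbr_in)
  finally show ?thesis by (simp add: algebra_simps)
qed

text \<open>The commutator of two Lie operators is computed on arguments and values separately:
  \<open>eth_jacobi\<close> treats the arguments, the anchor the values. One term of
  \<open>eth_jacobi\<close> depends on the argument a' through nabla_{a'} b, so it appears as a
  shuffle over d b.\<close>

lemma L_eK:
  assumes \<omega>: "cK k \<omega>" and a: "a \<in> SA" and b: "b \<in> SB"
  shows "lie SA (lbr P a) (rho P a) (eK b \<omega>) - eK b (lie SA (lbr P a) (rho P a) \<omega>)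
      + lie SA (lbr P (eth P b a)) (rho P (eth P b a)) \<omega>
    = eK (nabla P a b) \<omega> + shuf (Suc 0) (dN (form0 b)) (\<lambda>v. ins (eth P v a) \<omega>)"
proof -
  note S = SA_S[OF a] SB_S[OF b]
  note e = eth_in[OF S] and n = nabla_in[OF S]
  let ?T = "\<lambda>a'. lbr P a (eth P b a') - eth P b (lbr P a a')"
  let ?D = "\<lambda>f. rho P a (rho P b f) - rho P b (rho P a f)"
  have hT: "hom SA SA ?T"
    by (rule hom_op_diff[OF hom_comp[OF hom_eth[OF S(2)] hom_br[OF a]] hom_comp[OF hom_br[OF a] hom_eth[OF S(2)]] subgrp_SA])
  have h: "hom SB SB (\<lambda>v. v)" by (simp add: hom_def)
  have hv: "hom SB SA (\<lambda>v. eth P v a)"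
    using S(1) by (simp add: hom_def eth_in SB_S) (simp add: eth_def lbr_add_left prA_add lbr_in SB_S)
  have hn: "hom SA SA (\<lambda>a'. - eth P (nabla P a' b) a)"
    using S a b by (auto simp: hom_def eth_in SB_S nabla_in SA_S conn_add[OF conn_nabla] subgrpD(3)[OF subgrp_SA]
        hom_plus[OF hv])
  let ?N = "lie SA (lbr P (eth P b a)) (rho P (eth P b a)) \<omega>"
  have comm: "lie SA (lbr P a) (rho P a) (eK b \<omega>) - eK b (lie SA (lbr P a) (rho P a) \<omega>) = lie SA ?T ?D \<omega>"
    by (rule lie_commute[OF vmod_R \<omega> hom_br[OF a] hom_eth[OF S(2)] hom_rho[OF S(1)] hom_rho[OF S(2)]])
  have "lie SA ?T ?D \<omega> + ?N
     = lie SA (\<lambda>a'. ?T a' + lbr P (eth P b a) a') (\<lambda>f. ?D f + rho P (eth P b a) f) \<omega>"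
    by (rule lie_plus[OF vmod_R \<omega> hT hom_br[OF e], symmetric])
  also have "\<dots> = lie SA (\<lambda>a'. eth P (nabla P a b) a' + - eth P (nabla P a' b) a) (\<lambda>f. rho P (nabla P a b) f + 0) \<omega>"
  proof (rule lie_cong[OF cK_VF[OF \<omega>]])
    show "?T a' + lbr P (eth P b a) a' = eth P (nabla P a b) a' + - eth P (nabla P a' b) a" if "a' \<in> SA" for a'
      unfolding eth_jacobi[OF a that b] by simp
    show "?D f + rho P (eth P b a) f = rho P (nabla P a b) f + 0" if "f \<in> R" for f
    proof -
      have "?D f = rho P (nabla P a b) f - rho P (eth P b a) f"
        using rho_lbr[OF S that] hom_diff[OF hom_rho_left[OF that] subgrp_S SB_S[OF n] SA_S[OF e]]
        by (simp add: lbr_AB[OF a b])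
      then show ?thesis by simp
    qed
  qed
  also have "\<dots> = eK (nabla P a b) \<omega> + lie SA (\<lambda>a'. - eth P (nabla P a' b) a) (\<lambda>_. 0) \<omega>"
    by (rule lie_plus[OF vmod_R \<omega> hom_eth[OF SB_S[OF n]] hn])
  finally have "lie SA ?T ?D \<omega> + ?N = eK (nabla P a b) \<omega> + lie SA (\<lambda>a'. - eth P (nabla P a' b) a) (\<lambda>_. 0) \<omega>" .
  \<comment> \<open>In \<open>insertion\<close> the minus sign stands outside the Lie operator, here
    inside it. Additivity in the pair of maps, together with the vanishing of \<open>lie\<close> for
    zero maps, moves it.\<close>
  moreover have "lie SA (\<lambda>a'. - eth P (nabla P a' b) a) (\<lambda>_. 0) \<omega> = shuf (Suc 0) (dN (form0 b)) (\<lambda>v. ins (eth P v a) \<omega>)"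
  proof -
    have "hom SA SA (\<lambda>a'. eth P (nabla P a' b) a)"
      using S a b by (auto simp: hom_def eth_in SB_S nabla_in SA_S conn_add[OF conn_nabla] hom_plus[OF hv])
    then have "lie SA (\<lambda>a'. - eth P (nabla P a' b) a + eth P (nabla P a' b) a) (\<lambda>_. 0 + 0) \<omega>
       = lie SA (\<lambda>a'. - eth P (nabla P a' b) a) (\<lambda>_. 0) \<omega> + lie SA (\<lambda>a'. eth P (nabla P a' b) a) (\<lambda>_. 0) \<omega>"
      by (rule lie_plus[OF vmod_R \<omega> hn])
    moreover have "lie SA (\<lambda>a'. - eth P (nabla P a' b) a + eth P (nabla P a' b) a) (\<lambda>_. 0 + 0) \<omega> = 0"
    proof -
      have "lie SA (\<lambda>_. 0) (\<lambda>_. 0) X = 0" if "cK j X" for j X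
      proof
        fix as show "lie SA (\<lambda>_. 0) (\<lambda>_. 0) X as = 0 as"
          using that
        proof (induction as arbitrary: j X)
          case (Cons c as)
          show ?case
          proof (cases "c \<in> SA")
            case True
            have "ins 0 X = 0" by (rule hom_0[OF hom_cf_ins[OF vmod_R Cons.prems] subgrp_SA])
            then have "ins c (lie SA (\<lambda>_. 0) (\<lambda>_. 0) X) as = 0"
              using Cons.IH[OF cf_ins[OF vmod_R Cons.prems True]]
              by (simp add: ins_lie[OF cK_VF[OF Cons.prems] True] fa[where as = as])
            then show ?thesis by (simp add: ins_apply[where as = as] fa)
          qed (simp add: lie_out fa)
        qed (simp add: fa)
      qed
      from this[OF \<omega>] show ?thesis by simp
    qed
    ultimately show ?thesis
      unfolding insertion[OF vmod_R \<omega> hv b] by (simp add: eq_neg_iff_add_eq_0)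
  qed
  ultimately show ?thesis unfolding comm by simp
qed

text \<open>The failure of \<open>eth\<close> at b to commute with d comes only from the covariant
  derivative of b. The proof contracts both sides and lands on \<open>L_eK\<close>.\<close>

lemma dR_eK:
  assumes \<omega>: "cK k \<omega>" and b: "b \<in> SB"
  shows "dR (eK b \<omega>) - eK b (dR \<omega>) = shuf (Suc 0) (dN (form0 b)) (\<lambda>v. eK v \<omega>)"
proof
  fix as
  have db: "dN (form0 b) \<in> VF SA SB"
    by (rule hom_in[OF hom_d[OF conn_nabla] form0_VF[OF subgrp_SB b]])
  note hd = hom_d[OF rh] and he = hom_lie'[OF hom_rho[OF SB_S[OF b]] subgrp_R, of SA "eth P b"]
  note VFR = subgrp_VF[OF subgrp_R]
  show "(dR (eK b \<omega>) - eK b (dR \<omega>)) as = shuf (Suc 0) (dN (form0 b)) (\<lambda>v. eK v \<omega>) as"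
    using \<omega>
  proof (induction as arbitrary: k \<omega>)
    case Nil
    have 0: "eK 0 \<omega> = 0" by (rule hom_0[OF hom_eK[OF Nil] subgrp_SB])
    show ?case
      using fun_cong[OF 0, of "[]"] by (simp add: fa hom_0[OF hom_rho[OF SB_S[OF b]] subgrp_R])
  next
    case (Cons a as)
    note \<omega> = Cons.prems
    show ?case
    proof (cases "a \<in> SA")
      case a: True
      note ea = eth_in[OF SA_S[OF a] SB_S[OF b]]
      have \<Phi>: "shuf (Suc 0) (dN (form0 b)) (\<lambda>v. ins a (eK v \<omega>))
        = shuf (Suc 0) (dN (form0 b)) (\<lambda>v. eK v (ins a \<omega>)) - shuf (Suc 0) (dN (form0 b)) (\<lambda>v. ins (eth P v a) \<omega>)"
        unfolding shuf_op_diff[symmetric] by (simp add: ins_lie[OF cK_VF[OF \<omega>] a])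
      have 1: "ins a (dR (eK b \<omega>)) = lie SA (lbr P a) (rho P a) (eK b \<omega>) - (dR (eK b (ins a \<omega>)) - dR (ins (eth P b a) \<omega>))"
        by (simp add: ins_ce[OF a] ins_lie[OF cK_VF[OF \<omega>] a] hom_diff[OF hd VFR] hom_in[OF he] ins_VF cK_VF[OF \<omega>])
      have 2: "ins a (eK b (dR \<omega>)) = eK b (lie SA (lbr P a) (rho P a) \<omega>) - eK b (dR (ins a \<omega>))
          - (lie SA (lbr P (eth P b a)) (rho P (eth P b a)) \<omega> - dR (ins (eth P b a) \<omega>))"
        by (simp add: ins_lie[OF hom_in[OF hd cK_VF[OF \<omega>]] a] ins_ce[OF a] ins_ce[OF ea] hom_diff[OF he VFR]
            hom_in[OF hd] hom_in[OF hom_L[OF rh]] ins_VF cK_VF[OF \<omega>] a)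
      have "ins a (dR (eK b \<omega>) - eK b (dR \<omega>)) as = ins a (shuf (Suc 0) (dN (form0 b)) (\<lambda>v. eK v \<omega>)) as"
        using Cons.IH[OF cf_ins[OF vmod_R \<omega> a]] fun_cong[OF L_eK[OF \<omega> a b], of as]
        unfolding ins_simps(2) 1 2 ins_shuf \<Phi> ins_d_form0[OF conn_nabla a] shuf_Suc_Suc
          shuf_form0[OF subgrp_SB hom_eK[OF \<omega>]]
        by (simp add: fa[where as = as] algebra_simps)
      then show ?thesis by (simp only: ins_apply[where as = as])
    next
      case False
      have "shuf (Suc 0) (dN (form0 b)) (\<lambda>v. eK v \<omega>) \<in> VF SA R"
        by (rule hom_in[OF hom_shuf[OF subgrp_SB subgrp_R hom_eK[OF \<omega>]] db])
      from VF_out[OF this, of "a # as"] show ?thesis using False by (simp add: lie_out fa)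
    qed
  qed
qed

text \<open>The B-part of the Jacobi identity for a, b, b'; the inner projection in nabla_a
  [b, b']_B may be dropped by \<open>prB_lbr_A\<close>.\<close>

lemma brB_jacobi:
  assumes a: "a \<in> SA" and b: "b \<in> SB" and b': "b' \<in> SB"
  shows "nabla P a (brB P b b') = brB P (nabla P a b) b' - nabla P (eth P b a) b'
    + (brB P b (nabla P a b') + nabla P (eth P b' a) b)"
proof -
  note S = SA_S[OF a] SB_S[OF b] SB_S[OF b']
  note e = eth_in[OF S(1,2)] eth_in[OF S(1,3)] and n = nabla_in[OF S(1,2)] nabla_in[OF S(1,3)]
  note S' = SA_S[OF e(1)] SA_S[OF e(2)] SB_S[OF n(1)] SB_S[OF n(2)]
  note minus = hom_diff[OF hom_lbr subgrp_S] hom_diff[OF hom_lbr_left subgrp_S] hom_diff[OF hom_prB subgrp_S]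
  have "lbr P a (lbr P b b') = lbr P (nabla P a b - eth P b a) b' + lbr P b (nabla P a b' - eth P b' a)"
    using lbr_jacobi[OF S] lbr_AB[OF a b] lbr_AB[OF a b'] by simp
  then have "nabla P a (brB P b b') = prB P (lbr P (nabla P a b - eth P b a) b' + lbr P b (nabla P a b' - eth P b' a))"
    using prB_lbr_A[OF a lbr_in[OF S(2,3)]] by (simp add: nabla_def brB_def)
  also have "\<dots> = prB P (lbr P (nabla P a b) b') - prB P (lbr P (eth P b a) b')
      + (prB P (lbr P b (nabla P a b')) - prB P (lbr P b (eth P b' a)))"
    using S S' by (simp add: minus prB_add lbr_in subgrpD(2)[OF subgrp_S])
  also have "prB P (lbr P b (eth P b' a)) = - nabla P (eth P b' a) b"
    using lbr_anti[OF S(2) S'(2)] S S' by (simp add: nabla_def hom_minus[OF hom_prB subgrp_S] lbr_in)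
  finally show ?thesis by (simp add: nabla_def brB_def)
qed

end

context split_pair
begin

lemma subgrp_cB: "subgrp {X. cB k X}"
  by (simp add: subgrp_def cf_zero[OF vmod_SB] cf_diff[OF vmod_SB])

lemma cB_dN: "cB k X \<Longrightarrow> cB (Suc k) (dN X)" and cK_dR: "cK k \<omega> \<Longrightarrow> cK (Suc k) (dR \<omega>)"
  by (rule cf_d[OF conn_nabla], assumption) (rule cf_d[OF rh])

lemma cB_wB: "cK k \<omega> \<Longrightarrow> cB l X \<Longrightarrow> cB (k + l) (wB k \<omega> X)"
  by (rule cf_wd[OF conn_nabla])

lemma shuf_gen:
  assumes V: "vmod R sc \<Gamma>" and \<mu>: "cK k \<mu>" and b: "b \<in> SB"
    and \<Phi>: "hom SB (VF SA \<Gamma>) \<Phi>" "\<And>f v. f \<in> R \<Longrightarrow> v \<in> SB \<Longrightarrow> \<Phi> (fmul P f v) = sm sc f (\<Phi> v)"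
  shows "shuf k (wB k \<mu> (form0 b)) \<Phi> = wd sc k \<mu> (\<Phi> b)"
  using shuf_wd[OF conn_nabla V cK_VF[OF \<mu>] form0_VF[OF subgrp_SB b] \<Phi>, of k 0]
  by (simp add: shuf_form0[OF subgrp_SB \<Phi>(1)])

end

section \<open>The operation \<open>rho1\<close>, the binary bracket and the differential\<close>

locale pair_bracket = split_pair P
  for P :: "('m::{t2_space, second_countable_topology}, 'k::real_normed_field, 'v::ab_group_add, 'z) lie_pair_scheme" +
  fixes rho1 :: "(('m \<Rightarrow> 'v) list \<Rightarrow> 'm \<Rightarrow> 'v) \<Rightarrow> (('m \<Rightarrow> 'v) list \<Rightarrow> 'm \<Rightarrow> 'k) \<Rightarrow> ('m \<Rightarrow> 'v) list \<Rightarrow> 'm \<Rightarrow> 'k"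
    and brk :: "(('m \<Rightarrow> 'v) list \<Rightarrow> 'm \<Rightarrow> 'v) \<Rightarrow> (('m \<Rightarrow> 'v) list \<Rightarrow> 'm \<Rightarrow> 'v) \<Rightarrow> ('m \<Rightarrow> 'v) list \<Rightarrow> 'm \<Rightarrow> 'v"
  assumes rho1: "is_rho1 P rho1" and brk: "is_binary_bracket P rho1 brk"
begin

lemma rho1_in: "cB k X \<Longrightarrow> cK l \<omega> \<Longrightarrow> cK (k + l) (rho1 X \<omega>)"
  and rho1_add: "cB k X \<Longrightarrow> cB k Y \<Longrightarrow> cK l \<omega> \<Longrightarrow> rho1 (X + Y) \<omega> = rho1 X \<omega> + rho1 Y \<omega>"
  using rho1 unfolding is_rho1_def OmegaB_iff[symmetric] Omega_iff[symmetric] by blast+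

lemma rho1_sm:
  assumes "f \<in> R" "cB k X" "cK l \<omega>"
  shows "rho1 (sm (fmul P) f X) \<omega> = sm (*) f (rho1 X \<omega>)"
proof -
  have "rho1 (wedgeB P (form0 f) X) \<omega> = wedgeK (form0 f) (rho1 X \<omega>)"
    using rho1 assms unfolding is_rho1_def OmegaB_iff[symmetric] Omega_iff[symmetric] by blast
  moreover have "form0 f \<in> Omega P 0" using cK_form0[OF assms(1)] by (simp add: Omega_iff)
  ultimately show ?thesis
    using wd_form0[OF conn_nabla cB_VF[OF assms(2)]] wd_form0[OF rh cK_VF[OF rho1_in[OF assms(2,3)]]]
    by (simp add: wedgeB_eq wedgeK_eq)
qed

lemma rho1_gen:
  assumes "cK k \<mu>" "b \<in> SB" "cK l \<omega>"
  shows "rho1 (wB k \<mu> (form0 b)) \<omega> = wK k \<mu> (eK b \<omega>)"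
proof -
  have "rho1 (wedgeB P \<mu> (form0 b)) \<omega> = wedgeK \<mu> (eth_form P b \<omega>)"
    using rho1 assms unfolding is_rho1_def Omega_iff[symmetric] by blast
  then show ?thesis
    using assms(1) by (simp add: wedgeB_eq wedgeK_eq Omega_iff[symmetric] eth_form_eq)
qed

text \<open>Written as a shuffle, \<open>rho1\<close> becomes accessible to the Leibniz rules
  \<open>ce_shuf\<close> and \<open>lie_shuf\<close>. The right side is linear over functions in
  \<open>X\<close> by \<open>eK_fm\<close>, and the two sides agree on products by the generating
  rule.\<close>

lemma rho1_eq:
  assumes X: "cB k X" and \<omega>: "cK l \<omega>"
  shows "rho1 X \<omega> = shuf k X (\<lambda>v. eK v \<omega>)"
proof -
  note sh = hom_shuf[OF subgrp_SB subgrp_R hom_eK[OF \<omega>], of k]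
  have "rho1 X \<omega> - shuf k X (\<lambda>v. eK v \<omega>) = 0"
  proof (rule local_zero[OF X])
    show "rho1 (X + Y) \<omega> - shuf k (X + Y) (\<lambda>v. eK v \<omega>) =
        rho1 X \<omega> - shuf k X (\<lambda>v. eK v \<omega>) + (rho1 Y \<omega> - shuf k Y (\<lambda>v. eK v \<omega>))" if "cB k X" "cB k Y" for X Y
      by (simp add: rho1_add[OF that \<omega>] hom_plus[OF sh cB_VF[OF that(1)] cB_VF[OF that(2)]])
    show "(rho1 (sm (fmul P) f X) \<omega> - shuf k (sm (fmul P) f X) (\<lambda>v. eK v \<omega>)) as p = 0"
      if "f \<in> R" "f p = 0" for f p as
    proof -
      have "shuf k (sm (fmul P) f X) (\<lambda>v. eK v \<omega>) = sm (*) f (shuf k X (\<lambda>v. eK v \<omega>))"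
        by (rule shuf_sm[where sc = "fmul P" and \<Phi> = "\<lambda>v. eK v \<omega>", OF vmod_R cB_VF[OF X]])
          (rule eK_fm[OF \<omega> that(1)])
      then show ?thesis
        using that by (simp add: rho1_sm[OF that(1) X \<omega>] fa[where as = as] sm_apply minus_apply times_fun_apply)
    qed
    show "rho1 (wB k \<mu> (form0 b)) \<omega> - shuf k (wB k \<mu> (form0 b)) (\<lambda>v. eK v \<omega>) = 0" if "cK k \<mu>" "b \<in> SB" for \<mu> b
      using shuf_gen[OF vmod_R that hom_eK[OF \<omega>] eK_fm[OF \<omega>]] by (simp add: rho1_gen[OF that \<omega>])
  qed
  then show ?thesis by simp
qed

lemma brk_in: "cB k X \<Longrightarrow> cB l Y \<Longrightarrow> cB (k + l) (brk X Y)"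
  and brk_add: "cB k X \<Longrightarrow> cB l Y \<Longrightarrow> cB l Z \<Longrightarrow> brk X (Y + Z) = brk X Y + brk X Z"
  and brk_form0: "b \<in> SB \<Longrightarrow> b' \<in> SB \<Longrightarrow> brk (form0 b) (form0 b') = form0 (brB P b b')"
proof -
  note b = brk[unfolded is_binary_bracket_def]
  show "cB k X \<Longrightarrow> cB l Y \<Longrightarrow> cB (k + l) (brk X Y)"
    using conjunct1[OF b] unfolding OmegaB_iff[symmetric] by blast
  show "cB k X \<Longrightarrow> cB l Y \<Longrightarrow> cB l Z \<Longrightarrow> brk X (Y + Z) = brk X Y + brk X Z"
    using conjunct1[OF conjunct2[OF b]] unfolding OmegaB_iff[symmetric] by blast
  show "b \<in> SB \<Longrightarrow> b' \<in> SB \<Longrightarrow> brk (form0 b) (form0 b') = form0 (brB P b b')"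
    using conjunct1[OF conjunct2[OF conjunct2[OF conjunct2[OF conjunct2[OF b]]]]] by blast
qed

lemma brk_skew:
  assumes "cB k X" "cB l Y"
  shows "brk X Y = - sg (k * l) (brk Y X)"
proof -
  have "brk X Y = cmulB P (- ((-1) ^ (k * l))) (brk Y X)"
    using brk assms unfolding is_binary_bracket_def OmegaB_iff[symmetric] by blast
  also have "\<dots> = - cmulB P ((-1) ^ (k * l)) (brk Y X)"
    by (rule ext) (simp add: cmulB_def fmul_def fa fun_eq_iff uminus_apply)
  finally show ?thesis by (simp add: cmulB_sign)
qed

lemma brk_wd:
  assumes X: "cB k X" and \<omega>: "cK l \<omega>" and Y: "cB m Y"
  shows "brk X (wB l \<omega> Y) = wB (k + l) (rho1 X \<omega>) Y + sg (l * k) (wB l \<omega> (brk X Y))"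
proof -
  have "brk X (wedgeB P \<omega> Y) = wedgeB P (rho1 X \<omega>) Y + cmulB P ((-1) ^ (l * k)) (wedgeB P \<omega> (brk X Y))"
    using brk assms unfolding is_binary_bracket_def OmegaB_iff[symmetric] Omega_iff[symmetric] by blast
  then show ?thesis
    using \<omega> rho1_in[OF X \<omega>] by (simp add: wedgeB_eq Omega_iff[symmetric] cmulB_sign)
qed

lemma hom_brk: "cB k X \<Longrightarrow> hom {Y. cB l Y} {Y. cB (k + l) Y} (brk X)"
  by (simp add: hom_def brk_in brk_add)

lemma hom_brk_left:
  assumes Y: "cB l Y"
  shows "hom {X. cB k X} {X. cB (k + l) X} (\<lambda>X. brk X Y)"
proof (rule homI)
  show "brk X Y \<in> {X. cB (k + l) X}" if "X \<in> {X. cB k X}" for X using brk_in[OF _ Y] that by simp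
  show "brk (X + X') Y = brk X Y + brk X' Y" if "X \<in> {X. cB k X}" "X' \<in> {X. cB k X}" for X X'
    using that brk_skew[OF _ Y, of k] brk_add[OF Y, of k] cf_add[OF vmod_SB] by simp
qed

text \<open>Needed because the differential of a section of B is a one-form: checking an identity
  with d on pairs of sections still involves brackets of a section with forms.\<close>

lemma brk_eB:
  assumes b: "b \<in> SB" and Y: "cB l Y"
  shows "brk (form0 b) Y = eB b Y"
proof -
  note bS = SB_S[OF b] and cb = cB_form0[OF b]
  note he = hom_lie'[OF hom_brB[OF SB_S[OF b]] subgrp_SB, of SA "eth P b"]
  have "brk (form0 b) Y - eB b Y = 0"
  proof (rule local_zero[OF Y])
    show "brk (form0 b) (Y + Z) - eB b (Y + Z) = brk (form0 b) Y - eB b Y + (brk (form0 b) Z - eB b Z)"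
      if "cB l Y" "cB l Z" for Y Z
      by (simp add: brk_add[OF cb that] hom_plus[OF he cB_VF[OF that(1)] cB_VF[OF that(2)]])
    show "(brk (form0 b) (sm (fmul P) f Y) - eB b (sm (fmul P) f Y)) as p = 0" if f: "f \<in> R" "f p = 0" for f p as
    proof -
      have "rho1 (form0 b) (form0 f) = form0 (rho P b f)"
        using rho1_eq[OF cb cK_form0[OF f(1)]] shuf_form0[OF subgrp_SB hom_eK[OF cK_form0[OF f(1)]]]
          lie_form0[of "rho P b" SA "eth P b" f] hom_0[OF hom_rho[OF bS] subgrp_R] by simp
      then have "brk (form0 b) (sm (fmul P) f Y) = sm (fmul P) (rho P b f) Y + sm (fmul P) f (brk (form0 b) Y)"
        using brk_wd[OF cb cK_form0[OF f(1)] Y] brk_in[OF cb Y]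
        by (simp add: wd_form0[OF conn_nabla] cB_VF[OF Y] cB_VF)
      moreover have "eB b (sm (fmul P) f Y) = sm (fmul P) (rho P b f) Y + sm (fmul P) f (eB b Y)"
        by (rule lie_sm[where s = "rho P b", OF vmod_SB cB_VF[OF Y] f(1)]) (simp add: brB_fm bS f(1))
      ultimately show ?thesis
        using f(2) by (simp add: fa[where as = as] sm_apply fmul_def minus_apply plus_fun_apply)
    qed
    show "brk (form0 b) (wB l \<mu> (form0 b')) - eB b (wB l \<mu> (form0 b')) = 0" if \<mu>: "cK l \<mu>" and b': "b' \<in> SB" for \<mu> b'
    proof -
      have "rho1 (form0 b) \<mu> = eK b \<mu>"
        using rho1_eq[OF cb \<mu>] shuf_form0[OF subgrp_SB hom_eK[OF \<mu>]] by simp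
      moreover have "eB b (wB l \<mu> (form0 b')) = wB l (eK b \<mu>) (form0 b') + wB l \<mu> (eB b (form0 b'))"
        by (rule lie_wd[OF conn_nabla cK_VF[OF \<mu>] form0_VF[OF subgrp_SB b'] hom_rho[OF bS] hom_brB[OF bS]])
          (simp add: brB_fm bS)
      moreover have "eB b (form0 b') = form0 (brB P b b')"
        by (rule lie_form0[where D = "brB P b"]) (rule hom_0[OF hom_brB[OF bS] subgrp_SB])
      ultimately show ?thesis
        using brk_wd[OF cb \<mu> cB_form0[OF b']] by (simp add: brk_form0[OF b b'])
    qed
  qed
  then show ?thesis by simp
qed

text \<open>By \<open>dR_eK\<close>, the defect of v |-> \<open>eK v\<close> in
  \<open>ce_shuf\<close> is the same operator applied to d \<open>\<omega>\<close>.\<close>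

lemma dR_rho1:
  assumes X: "cB k X" and \<omega>: "cK l \<omega>"
  shows "dR (rho1 X \<omega>) = rho1 (dN X) \<omega> + sg k (rho1 X (dR \<omega>))"
proof -
  have "shuf k X (\<lambda>v. dR (eK v \<omega>) - shuf (Suc 0) (dN (form0 v)) (\<lambda>v. eK v \<omega>)) = shuf k X (\<lambda>v. eK v (dR \<omega>))"
    by (rule shuf_cong[OF cB_VF[OF X]]) (simp add: dR_eK[OF \<omega>, symmetric])
  then show ?thesis
    using ce_shuf[OF subgrp_SB subgrp_R conn_hom[OF conn_nabla] conn_hom[OF rh] cB_VF[OF X] hom_eK[OF \<omega>]]
    by (simp add: rho1_eq[OF X \<omega>] rho1_eq[OF cB_dN[OF X] \<omega>] rho1_eq[OF X cK_dR[OF \<omega>]])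
qed

lemma dN_brk:
  assumes X: "cB k X" and Y: "cB l Y"
  shows "dN (brk X Y) = brk (dN X) Y + sg k (brk X (dN Y))"
proof -
  \<comment> \<open>The defect of the Leibniz rule, to be fed into
    \<open>bracket_zero\<close>.\<close>
  define Gn where "Gn k l X Y = dN (brk X Y) - brk (dN X) Y - sg k (brk X (dN Y))" for k l :: nat and X Y
  note hd = hom_d[OF conn_nabla] and VFB = subgrp_VF[OF subgrp_SB]
  have "Gn k l X Y = 0"
  proof (rule bracket_zero[of Gn, OF _ _ _ _ _ X Y])
    fix k l X Y assume X: "cB k X" and Y: "cB l Y"
    note XY = brk_in[OF X Y] and dXY = brk_in[OF cB_dN[OF X] Y] and XdY = brk_in[OF X cB_dN[OF Y]]
    show "Gn k l X Y \<in> VF SA SB"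
      unfolding Gn_def
      by (intro subgrpD(2,5)[OF VFB] hom_in[OF hd] cB_VF[OF XY] cB_VF[OF dXY] cB_VF[OF XdY])
    show "Gn k l X (Y + Z) = Gn k l X Y + Gn k l X Z" if Z: "cB l Z" for Z
      by (simp add: Gn_def brk_add[OF X Y Z] brk_add[OF cB_dN[OF X] Y Z] hom_plus[OF hd] cB_VF[OF Y] cB_VF[OF Z]
          brk_add[OF X cB_dN[OF Y] cB_dN[OF Z]] cB_VF[OF XY] cB_VF[OF brk_in[OF X Z]])
    show "Gn k l X Y = - sg (k * l) (Gn l k Y X)"
    proof -
      have 1: "dN (brk X Y) = - sg (k * l) (dN (brk Y X))"
        unfolding brk_skew[OF X Y] using cB_VF[OF brk_in[OF Y X]]
        by (simp add: hom_minus[OF hd VFB] hom_sg[OF hd VFB] subgrpD(5)[OF VFB])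
      show ?thesis
        unfolding Gn_def 1 brk_skew[OF cB_dN[OF X] Y] brk_skew[OF X cB_dN[OF Y]]
        by (cases "even k"; cases "even l") (simp_all add: sg_def algebra_simps)
    qed
    fix j \<omega> assume \<omega>: "cK j \<omega>"
    note \<omega>V = cK_VF[OF \<omega>] and d\<omega> = cK_dR[OF \<omega>] and dX = cB_dN[OF X] and dY = cB_dN[OF Y]
    note r = rho1_in[OF X \<omega>] and rd = rho1_in[OF dX \<omega>] and rw = rho1_in[OF X d\<omega>]
    have "dN (brk X (wB j \<omega> Y)) = dN (wB (k + j) (rho1 X \<omega>) Y) + sg (j * k) (dN (wB j \<omega> (brk X Y)))"
      unfolding brk_wd[OF X \<omega> Y]
      using cB_VF[OF cB_wB[OF r Y]] cB_VF[OF cB_wB[OF \<omega> XY]]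
      by (simp add: hom_plus[OF hd] hom_sg[OF hd VFB] subgrpD(5)[OF VFB])
    also have "dN (wB (k + j) (rho1 X \<omega>) Y)
        = wB (Suc (k + j)) (rho1 (dN X) \<omega>) Y + sg k (wB (Suc (k + j)) (rho1 X (dR \<omega>)) Y)
          + sg (k + j) (wB (k + j) (rho1 X \<omega>) (dN Y))"
      using wd_add_left[OF conn_nabla cB_VF[OF Y] cK_VF[OF rd] cK_VF[OF cf_sg[OF vmod_R rw]]]
        wd_sg_left[OF conn_nabla cB_VF[OF Y] cK_VF[OF rw] cK_VF[OF rw]]
      by (simp add: dB_wd[OF conn_nabla cK_VF[OF r] cB_VF[OF Y]] dR_rho1[OF X \<omega>])
    also have "dN (wB j \<omega> (brk X Y)) = wB (Suc j) (dR \<omega>) (brk X Y) + sg j (wB j \<omega> (dN (brk X Y)))"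
      by (rule dB_wd[OF conn_nabla \<omega>V cB_VF[OF XY]])
    finally have 1: "dN (brk X (wB j \<omega> Y)) = wB (Suc (k + j)) (rho1 (dN X) \<omega>) Y
        + sg k (wB (Suc (k + j)) (rho1 X (dR \<omega>)) Y) + sg (k + j) (wB (k + j) (rho1 X \<omega>) (dN Y))
        + sg (j * k) (wB (Suc j) (dR \<omega>) (brk X Y) + sg j (wB j \<omega> (dN (brk X Y))))" .
    have 2: "brk (dN X) (wB j \<omega> Y) = wB (Suc (k + j)) (rho1 (dN X) \<omega>) Y + sg (j * Suc k) (wB j \<omega> (brk (dN X) Y))"
      using brk_wd[OF dX \<omega> Y] by simp
    have "brk X (dN (wB j \<omega> Y)) = brk X (wB (Suc j) (dR \<omega>) Y) + sg j (brk X (wB j \<omega> (dN Y)))"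
      unfolding dB_wd[OF conn_nabla \<omega>V cB_VF[OF Y]]
      using brk_add[OF X cB_wB[OF d\<omega> Y] , of "sg j (wB j \<omega> (dN Y))"] cf_sg[OF vmod_SB cB_wB[OF \<omega> dY], of j]
        hom_sg[OF hom_brk[OF X] subgrp_cB, of "wB j \<omega> (dN Y)" "j + Suc l" j] cB_wB[OF \<omega> dY] by simp
    then have 3: "brk X (dN (wB j \<omega> Y)) = wB (Suc (k + j)) (rho1 X (dR \<omega>)) Y + sg (Suc j * k) (wB (Suc j) (dR \<omega>) (brk X Y))
        + sg j (wB (k + j) (rho1 X \<omega>) (dN Y) + sg (j * k) (wB j \<omega> (brk X (dN Y))))"
      using brk_wd[OF X d\<omega> Y] brk_wd[OF X \<omega> dY] by simp
    \<comment> \<open>The terms with \<open>rho1\<close> cancel thanks to \<open>dR_rho1\<close>,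
      those with d \<open>\<omega>\<close> cancel each other, and only \<open>\<omega>\<close> times
      the defect of \<open>X\<close> and \<open>Y\<close> remains.\<close>
    have "Gn k (j + l) X (wB j \<omega> Y) = sg (Suc k * j) (wB j \<omega> (Gn k l X Y))"
      unfolding Gn_def 1 2 3 wd_diff[OF conn_nabla \<omega>V] wd_sg[OF conn_nabla \<omega>V]
      by (cases "even k"; cases "even j") (simp_all add: sg_def algebra_simps)
    then show "\<exists>n. Gn k (j + l) X (wB j \<omega> Y) = sg n (wB j \<omega> (Gn k l X Y))" by blast
  next
    fix b b' assume b: "b \<in> SB" and b': "b' \<in> SB"
    note db = cB_dN[OF cB_form0[OF b]] and db' = cB_dN[OF cB_form0[OF b']]
    note S = SB_S[OF b] SB_S[OF b']
    \<comment> \<open>Skew-symmetry brings the sections to the front, where \<open>brk_eB\<close>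
      applies. Contraction with \<open>a\<close> then turns the vanishing of this one-form into
      \<open>brB_jacobi\<close>.\<close>
    have G: "Gn 0 0 (form0 b) (form0 b') = dN (form0 (brB P b b')) + eB b' (dN (form0 b)) - eB b (dN (form0 b'))"
      using brk_skew[OF db cB_form0[OF b']] brk_eB[OF b' db] brk_eB[OF b db'] by (simp add: Gn_def brk_form0[OF b b'])
    have "ins a (dN (form0 (brB P b b')) + eB b' (dN (form0 b)) - eB b (dN (form0 b'))) = 0" if a: "a \<in> SA" for a
    proof -
      note e = eth_in[OF SA_S[OF a] S(1)] eth_in[OF SA_S[OF a] S(2)]
      have eB0: "eB x (form0 v) = form0 (brB P x v)" if "x \<in> S" for x v
        by (rule lie_form0[where D = "brB P x"]) (rule hom_0[OF hom_brB[OF that] subgrp_SB])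
      have "nabla P a (brB P b b') + (brB P b' (nabla P a b) - nabla P (eth P b' a) b)
          - (brB P b (nabla P a b') - nabla P (eth P b a) b') = 0"
        unfolding brB_jacobi[OF a b b'] brB_anti[OF b' nabla_in[OF SA_S[OF a] S(1)]] by simp
      then have "form0 (nabla P a (brB P b b')) + (form0 (brB P b' (nabla P a b)) - form0 (nabla P (eth P b' a) b))
          - (form0 (brB P b (nabla P a b')) - form0 (nabla P (eth P b a) b')) = 0"
        by (intro ext) (simp add: form0_def fa)
      then show ?thesis
        by (simp add: ins_d_form0[OF conn_nabla] a ins_lie[OF cB_VF[OF db]] ins_lie[OF cB_VF[OF db']] e eB0 S)
    qed
    then have "Gn 0 0 (form0 b) (form0 b') as = 0" for as
    proof (cases as)
      case Nil
      then show ?thesis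
        unfolding G by (simp add: fa hom_0[OF hom_brB subgrp_SB] S)
    next
      case (Cons a bs)
      show ?thesis
      proof (cases "a \<in> SA")
        case True
        from \<open>\<And>a. a \<in> SA \<Longrightarrow> _\<close>[OF this] show ?thesis
          unfolding G Cons using ins_apply[of a _ bs] by (metis list_fun_apply(4))
      next
        case False
        then show ?thesis unfolding G Cons by (simp add: fa lie_out)
      qed
    qed
    then show "Gn 0 0 (form0 b) (form0 b') = 0" by (intro ext) (simp add: fa)
  qed
  then show ?thesis by (simp add: Gn_def algebra_simps)
qed

end

section \<open>The action of a derivation\<close>

locale pair_derivation = split_pair P
  for P :: "('m::{t2_space, second_countable_topology}, 'k::real_normed_field, 'v::ab_group_add, 'z) lie_pair_scheme" +
  fixes \<delta> :: "('m \<Rightarrow> 'v) \<Rightarrow> 'm \<Rightarrow> 'v" and s :: "('m \<Rightarrow> 'k) \<Rightarrow> 'm \<Rightarrow> 'k"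
  assumes hom_\<delta>: "hom S S \<delta>" and \<delta>_A: "a \<in> SA \<Longrightarrow> \<delta> a \<in> SA"
    and hom_s: "hom R R s" and s_mult: "f \<in> R \<Longrightarrow> g \<in> R \<Longrightarrow> s (f * g) = s f * g + f * s g"
    and \<delta>_fm: "f \<in> R \<Longrightarrow> u \<in> S \<Longrightarrow> \<delta> (fmul P f u) = fmul P (s f) u + fmul P f (\<delta> u)"
    and \<delta>_rho: "u \<in> S \<Longrightarrow> f \<in> R \<Longrightarrow> s (rho P u f) - rho P u (s f) = rho P (\<delta> u) f"
    and \<delta>_br: "u \<in> S \<Longrightarrow> v \<in> S \<Longrightarrow> \<delta> (lbr P u v) = lbr P (\<delta> u) v + lbr P u (\<delta> v)"
begin

text \<open>With respect to A and B, \<open>\<delta>\<close> is block triangular: diagonal blocks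
  \<open>\<delta>\<close> on A and \<open>\<delta>B\<close> on B, and the off-diagonal block
  \<open>h\<close> from B to A.\<close>

abbreviation "h b \<equiv> prA P (\<delta> b)"
abbreviation "\<delta>B b \<equiv> prB P (\<delta> b)"
abbreviation "aB \<equiv> lie SA \<delta> \<delta>B"
abbreviation "aK \<equiv> lie SA \<delta> s"

lemma \<delta>_in: "u \<in> S \<Longrightarrow> \<delta> u \<in> S"
  using hom_in[OF hom_\<delta>] .

lemma s_in: "f \<in> R \<Longrightarrow> s f \<in> R"
  using hom_in[OF hom_s] .

lemma hom_\<delta>A: "hom SA SA \<delta>"
  by (simp add: hom_def \<delta>_A hom_plus[OF hom_\<delta>] SA_S)

lemma hom_h: "hom SB SA h"
  by (simp add: hom_def prA_in \<delta>_in SB_S hom_plus[OF hom_\<delta>] prA_add)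

lemma hom_\<delta>B: "hom SB SB \<delta>B"
  by (simp add: hom_def prB_in \<delta>_in SB_S hom_plus[OF hom_\<delta>] prB_add)

text \<open>The symbol term of \<open>\<delta>\<close> (f b) is a multiple of b and is killed by the
  projection to A. So \<open>h\<close> is a bundle map, and inserting it into forms makes
  sense.\<close>

lemma h_fm: "f \<in> R \<Longrightarrow> b \<in> SB \<Longrightarrow> h (fmul P f b) = fmul P f (h b)"
  using prA_B[OF vmod_in[OF vmod_SB s_in, of f b]]
  by (simp add: \<delta>_fm SB_S prA_add vmod_in[OF vmod_S] s_in \<delta>_in prA_fmul)

lemma \<delta>B_fm: "f \<in> R \<Longrightarrow> b \<in> SB \<Longrightarrow> \<delta>B (fmul P f b) = fmul P (s f) b + fmul P f (\<delta>B b)"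
  using prB_B[OF vmod_in[OF vmod_SB s_in, of f b]]
  by (simp add: \<delta>_fm SB_S prB_add vmod_in[OF vmod_S] s_in \<delta>_in prB_fmul)

lemma \<delta>_decomp: "u \<in> S \<Longrightarrow> \<delta> u = \<delta> (prA P u) + (h (prB P u) + \<delta>B (prB P u))"
proof -
  assume u: "u \<in> S"
  have "\<delta> u = \<delta> (prA P u + prB P u)" using pr_sum[OF u] by simp
  also have "\<dots> = \<delta> (prA P u) + \<delta> (prB P u)"
    by (rule hom_plus[OF hom_\<delta> SA_S[OF prA_in[OF u]] SB_S[OF prB_in[OF u]]])
  finally show ?thesis using pr_sum[OF \<delta>_in[OF SB_S[OF prB_in[OF u]]]] by simp
qed

text \<open>Triangularity: as \<open>\<delta>\<close> preserves A it acts on L/A, and its value on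
  the A-part of \<open>u\<close> can be recovered by removing the effect of
  \<open>h\<close>.\<close>

lemma
  assumes u: "u \<in> S"
  shows \<delta>B_prB: "\<delta>B (prB P u) = \<delta>B u" and \<delta>_prA: "\<delta> (prA P u) = h u - h (prB P u)"
proof -
  note A = \<delta>_A[OF prA_in[OF u]] prA_in[OF \<delta>_in[OF SB_S[OF prB_in[OF u]]]]
  note B = prB_in[OF \<delta>_in[OF SB_S[OF prB_in[OF u]]]]
  have d: "\<delta> u = (\<delta> (prA P u) + h (prB P u)) + \<delta>B (prB P u)"
    using \<delta>_decomp[OF u] by (simp add: add.assoc)
  show "\<delta>B (prB P u) = \<delta>B u" using prB_eqI[OF subgrpD(4)[OF subgrp_SA A] B] d by simp
  show "\<delta> (prA P u) = h u - h (prB P u)" using prA_eqI[OF subgrpD(4)[OF subgrp_SA A] B] d by simp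
qed

lemma act_aB: "cB k X \<Longrightarrow> act P \<delta> X = aB X"
  unfolding act_eq by (rule lie_cong[OF cB_VF]) (simp_all add: prA_A \<delta>_A)

lemma cB_aB: "cB k X \<Longrightarrow> cB k (aB X)"
  by (rule cf_lie[where s = s, OF vmod_SB hom_\<delta>A hom_\<delta>B])
    (simp_all add: s_in \<delta>_fm SA_S \<delta>B_fm)

lemma cK_aK: "cK k \<omega> \<Longrightarrow> cK k (aK \<omega>)"
  by (rule cf_lie[where s = s, OF vmod_R hom_\<delta>A hom_s])
    (simp_all add: s_in \<delta>_fm SA_S s_mult)

text \<open>The diagonal blocks form a derivation of the A-module structure of B; \<open>h\<close>
  does not enter, since the Bott connection only uses B as L/A.\<close>

lemma aB_dN: "cB k X \<Longrightarrow> aB (dN X) = dN (aB X)"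
proof (rule lie_ce_commute[OF conn_nabla hom_\<delta>A _ hom_\<delta>B])
  show "\<delta> (lbr P a b) = lbr P (\<delta> a) b + lbr P a (\<delta> b)" if "a \<in> SA" "b \<in> SA" for a b
    using that by (simp add: \<delta>_br SA_S)
  show "\<delta>B (nabla P a x) = nabla P (\<delta> a) x + nabla P a (\<delta>B x)" if a: "a \<in> SA" and x: "x \<in> SB" for a x
    using prB_lbr_A[OF a \<delta>_in[OF SB_S[OF x]]] SA_S[OF a] SB_S[OF x]
    by (simp add: nabla_def \<delta>B_prB lbr_in \<delta>_br prB_add \<delta>_in)
qed

text \<open>The homotopy between the two sides of the Leibniz rule involves \<open>L\<^sub>h\<^sub>b\<close>, corrected by the insertion
  of \<open>h (\<nabla> b)\<close> so that it becomes linear over functions in \<open>b\<close>.\<close>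

abbreviation "Tm b \<equiv> \<lambda>a. lbr P (h b) a + h (nabla P a b)"
abbreviation "Mo nb b \<equiv> lie SA (Tm b) (nb (h b))"
abbreviation "MB \<equiv> Mo (nabla P)"
abbreviation "MK \<equiv> Mo (rho P)"

lemma hom_nabla_left: "b \<in> SB \<Longrightarrow> hom SA SB (\<lambda>a. nabla P a b)"
  by (simp add: hom_def nabla_in SA_S SB_S conn_add[OF conn_nabla])

lemma h_in: "b \<in> SB \<Longrightarrow> h b \<in> SA"
  using hom_in[OF hom_h] .

lemma hom_Tm: "b \<in> SB \<Longrightarrow> hom SA SA (Tm b)"
  using hom_op_add[OF hom_br[OF h_in] hom_comp[OF hom_nabla_left hom_h] subgrp_SA] .

context
  fixes sc :: "('m \<Rightarrow> 'k) \<Rightarrow> ('m \<Rightarrow> 'w) \<Rightarrow> 'm \<Rightarrow> 'w::ab_group_add" and \<Gamma> nb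
  assumes nb: "conn sc \<Gamma> nb"
begin

lemma Mo_VF: "b \<in> SB \<Longrightarrow> Y \<in> VF SA \<Gamma> \<Longrightarrow> Mo nb b Y \<in> VF SA \<Gamma>"
  using lie_VF[OF conn_hom[OF nb h_in] vmod_subgrp[OF conn_vmod[OF nb]]] .

lemma hom_Mo:
  assumes Y: "cf sc \<Gamma> k Y"
  shows "hom SB (VF SA \<Gamma>) (\<lambda>b. Mo nb b Y)"
proof (rule homI)
  note V = conn_vmod[OF nb]
  show "Mo nb b Y \<in> VF SA \<Gamma>" if "b \<in> SB" for b using Mo_VF[OF that cf_VF[OF V Y]] .
  fix b b' assume b: "b \<in> SB" and b': "b' \<in> SB"
  have "Mo nb (b + b') Y = lie SA (\<lambda>a. Tm b a + Tm b' a) (\<lambda>x. nb (h b) x + nb (h b') x) Y"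
  proof (rule lie_cong[OF cf_VF[OF V Y]])
    show "Tm (b + b') a = Tm b a + Tm b' a" if "a \<in> SA" for a
      using that b b' hom_plus[OF conn_hom[OF conn_nabla that] b b'] hom_plus[OF hom_h] nabla_in[OF SA_S[OF that] SB_S]
      by (simp add: br_add h_in add_ac)
    show "nb (h (b + b')) x = nb (h b) x + nb (h b') x" if "x \<in> \<Gamma>" for x
      using that b b' by (simp add: hom_plus[OF hom_h] conn_add[OF nb] h_in)
  qed
  also have "\<dots> = Mo nb b Y + Mo nb b' Y"
    by (rule lie_plus[OF V Y hom_Tm[OF b] hom_Tm[OF b']])
  finally show "Mo nb (b + b') Y = Mo nb b Y + Mo nb b' Y" .
qed

lemma Mo_fm:
  assumes Y: "cf sc \<Gamma> k Y" and f: "f \<in> R" and b: "b \<in> SB"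
  shows "Mo nb (fmul P f b) Y = sm sc f (Mo nb b Y)"
proof -
  note V = conn_vmod[OF nb]
  have "Mo nb (fmul P f b) Y = lie SA (\<lambda>a. fmul P f (Tm b a)) (\<lambda>x. sc f (nb (h b) x)) Y"
  proof (rule lie_cong[OF cf_VF[OF V Y]])
    \<comment> \<open>The bracket [h (f b), a] contributes minus (rho(a) f) h b, and h (nabla_a (f
      b)) contributes the same with a plus sign.\<close>
    show "Tm (fmul P f b) a = fmul P f (Tm b a)" if a: "a \<in> SA" for a
    proof -
      note n = nabla_in[OF SA_S[OF a] SB_S[OF b]] and ra = rho_in[OF SA_S[OF a] f]
      have "h (nabla P a (fmul P f b)) = fmul P (rho P a f) (h b) + fmul P f (h (nabla P a b))"
        using hom_plus[OF hom_h vmod_in[OF vmod_SB ra b] vmod_in[OF vmod_SB f n]]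
        by (simp add: conn_sc[OF conn_nabla f a b] h_fm[OF f n] h_fm[OF ra b])
      then show ?thesis
        using lbr_fmul_left[OF SA_S[OF h_in[OF b]] SA_S[OF a] f] by (simp add: h_fm[OF f b] fmul_laws(1))
    qed
    show "nb (h (fmul P f b)) x = sc f (nb (h b) x)" if "x \<in> \<Gamma>" for x
      using that conn_fm[OF nb f h_in[OF b]] by (simp add: h_fm[OF f b])
  qed
  also have "\<dots> = sm sc f (Mo nb b Y)"
    by (rule lie_scale[OF V f Y hom_Tm[OF b]])
  finally show ?thesis .
qed

lemma Mo_wd:
  assumes b: "b \<in> SB" and \<omega>: "\<omega> \<in> VF SA R" and X: "X \<in> VF SA \<Gamma>"
  shows "Mo nb b (wd sc k \<omega> X) = wd sc k (MK b \<omega>) X + wd sc k \<omega> (Mo nb b X)"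
  by (rule lie_wd[OF nb \<omega> X hom_rho[OF SA_S[OF h_in[OF b]]] conn_hom[OF nb h_in[OF b]]])
    (rule conn_sc[OF nb _ h_in[OF b]])

end

text \<open>Splitting \<open>\<delta> b\<close> into its parts gives the bracket with
  \<open>h b\<close> and \<open>eth\<close> at \<open>\<delta>B b\<close>. The extra h (nabla_a b)
  appears because eth_b a is only the A-part of [b, a], and \<open>h\<close> acts on the discarded
  B-part.\<close>

lemma aK_eK:
  assumes \<omega>: "cK k \<omega>" and b: "b \<in> SB"
  shows "aK (eK b \<omega>) - eK (\<delta>B b) \<omega> = eK b (aK \<omega>) + MK b \<omega>"
proof -
  note bS = SB_S[OF b] and d = \<delta>_in[OF SB_S[OF b]] and hb = h_in[OF b] and Bb = hom_in[OF hom_\<delta>B b]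
  have "aK (eK b \<omega>) - eK b (aK \<omega>) = lie SA (\<lambda>a. \<delta> (eth P b a) - eth P b (\<delta> a)) (\<lambda>f. s (rho P b f) - rho P b (s f)) \<omega>"
    by (rule lie_commute[OF vmod_R \<omega> hom_\<delta>A hom_eth[OF bS] hom_s hom_rho[OF bS]])
  also have "\<dots> = lie SA (\<lambda>a. eth P (\<delta>B b) a + Tm b a) (\<lambda>f. rho P (\<delta>B b) f + rho P (h b) f) \<omega>"
  proof (rule lie_cong[OF cK_VF[OF \<omega>]])
    show "s (rho P b f) - rho P b (s f) = rho P (\<delta>B b) f + rho P (h b) f" if f: "f \<in> R" for f
      using \<delta>_rho[OF bS f] rho_add_left[OF SB_S[OF Bb] SA_S[OF hb] f] pr_sum[OF d] by (simp add: add.commute)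
    show "\<delta> (eth P b a) - eth P b (\<delta> a) = eth P (\<delta>B b) a + Tm b a" if a: "a \<in> SA" for a
    proof -
      note aS = SA_S[OF a] and da = \<delta>_in[OF SA_S[OF a]]
      have "prB P (lbr P b a) = - nabla P a b"
        using lbr_anti[OF bS aS] by (simp add: nabla_def hom_minus[OF hom_prB subgrp_S] lbr_in aS bS)
      then have "\<delta> (eth P b a) = h (lbr P b a) + h (nabla P a b)"
        using \<delta>_prA[OF lbr_in[OF bS aS]] hom_minus[OF hom_h subgrp_SB nabla_in[OF aS bS]] by (simp add: eth_def)
      also have "h (lbr P b a) = prA P (lbr P (\<delta> b) a) + eth P b (\<delta> a)"
        using aS bS d da by (simp add: \<delta>_br prA_add lbr_in eth_def)
      also have "lbr P (\<delta> b) a = lbr P (h b) a + lbr P (\<delta>B b) a"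
        using lbr_add_left[OF SA_S[OF hb] SB_S[OF Bb] aS] pr_sum[OF d] by simp
      also have "prA P \<dots> = lbr P (h b) a + eth P (\<delta>B b) a"
        using prA_add[OF lbr_in[OF SA_S[OF hb] aS] lbr_in[OF SB_S[OF Bb] aS]] prA_A[OF lbr_A[OF hb a]]
        by (simp add: eth_def)
      finally show ?thesis by simp
    qed
  qed
  also have "\<dots> = eK (\<delta>B b) \<omega> + MK b \<omega>"
    by (rule lie_plus[OF vmod_R \<omega> hom_eth[OF SB_S[OF Bb]] hom_Tm[OF b]])
  finally show ?thesis by (simp add: algebra_simps)
qed

text \<open>The homotopy formula. In \<open>ce_shuf\<close>, Cartan's formula for the contraction
  with h v yields L_{h v}, and the term removed for the variation of v is the insertion of h (nabla
  v); together they are \<open>MB v\<close>.\<close>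

lemma d_insertion:
  assumes X: "cB k X" and Y: "cB l Y"
  shows "dN (shuf k X (\<lambda>v. ins (h v) Y)) = shuf (Suc k) (dN X) (\<lambda>v. ins (h v) Y)
    + sg k (shuf k X (\<lambda>v. MB v Y) - shuf k X (\<lambda>v. ins (h v) (dN Y)))"
proof -
  have \<Phi>: "hom SB (VF SA SB) (\<lambda>v. ins (h v) Y)"
    by (rule hom_comp[OF hom_h hom_cf_ins[OF vmod_SB Y]])
  have "dN (ins (h v) Y) - shuf (Suc 0) (dN (form0 v)) (\<lambda>v. ins (h v) Y) = MB v Y - ins (h v) (dN Y)"
    if v: "v \<in> SB" for v
  proof -
    have "MB v Y = lie SA (Tm v) (\<lambda>x. nabla P (h v) x + 0) Y" by simp
    also have "\<dots> = lie SA (lbr P (h v)) (nabla P (h v)) Y + lie SA (\<lambda>a. h (nabla P a v)) (\<lambda>_. 0) Y"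
      by (rule lie_plus[OF vmod_SB Y hom_br[OF h_in[OF v]] hom_comp[OF hom_nabla_left[OF v] hom_h]])
    finally show ?thesis
      using ins_ce[OF h_in[OF v], of "lbr P" "nabla P" Y] insertion[OF vmod_SB Y hom_h v] by simp
  qed
  then have eq: "shuf k X (\<lambda>v. dN (ins (h v) Y) - shuf (Suc 0) (dN (form0 v)) (\<lambda>v. ins (h v) Y))
      = shuf k X (\<lambda>v. MB v Y - ins (h v) (dN Y))"
    by (rule shuf_cong[OF cB_VF[OF X]])
  have "dN (shuf k X (\<lambda>v. ins (h v) Y)) = shuf (Suc k) (dN X) (\<lambda>v. ins (h v) Y)
      + sg k (shuf k X (\<lambda>v. dN (ins (h v) Y) - shuf (Suc 0) (dN (form0 v)) (\<lambda>v. ins (h v) Y)))"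
    by (rule ce_shuf[OF subgrp_SB subgrp_SB conn_hom[OF conn_nabla] conn_hom[OF conn_nabla] cB_VF[OF X] \<Phi>])
  then show ?thesis unfolding eq unfolding shuf_op_diff .
qed

lemma cB_insertion:
  assumes X: "cB k X" and Y: "cB (Suc l) Y"
  shows "cB (k + l) (shuf k X (\<lambda>v. ins (h v) Y))"
proof (rule cf_shuf[OF vmod_SB vmod_SB X hom_comp[OF hom_h hom_cf_ins[OF vmod_SB Y]]])
  show "cB l (ins (h v) Y)" if "v \<in> SB" for v using Y h_in[OF that] by simp
  show "ins (h (fmul P f v)) Y = sm (fmul P) f (ins (h v) Y)" if "f \<in> R" "v \<in> SB" for f v
    using cf_ins_fm[OF vmod_SB Y that(1) h_in[OF that(2)]] by (simp add: h_fm[OF that])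
qed

text \<open>Since \<open>\<delta> b\<close> leaves B, the brackets of \<open>h b\<close> with b' and
  of b with \<open>h b'\<close> also have B-parts, and these are the two Bott terms.\<close>

lemma \<delta>B_brB:
  assumes b: "b \<in> SB" and b': "b' \<in> SB"
  shows "\<delta>B (brB P b b') = brB P (\<delta>B b) b' + brB P b (\<delta>B b') + nabla P (h b) b' - nabla P (h b') b"
proof -
  note S = SB_S[OF b] SB_S[OF b'] and d = \<delta>_in[OF SB_S[OF b]] \<delta>_in[OF SB_S[OF b']]
  note H = SA_S[OF h_in[OF b]] SA_S[OF h_in[OF b']]
  note B = SB_S[OF hom_in[OF hom_\<delta>B b]] SB_S[OF hom_in[OF hom_\<delta>B b']]
  have 1: "\<delta> b = h b + \<delta>B b" and 2: "\<delta> b' = h b' + \<delta>B b'"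
    using pr_sum d by simp_all
  have "lbr P (h b + \<delta>B b) b' = lbr P (h b) b' + lbr P (\<delta>B b) b'"
    by (rule lbr_add_left[OF H(1) B(1) S(2)])
  moreover have "lbr P b (h b' + \<delta>B b') = - lbr P (h b') b + lbr P b (\<delta>B b')"
    using lbr_add_right[OF S(1) H(2) B(2)] lbr_anti[OF S(1) H(2)] by simp
  ultimately have "lbr P (\<delta> b) b' + lbr P b (\<delta> b') = (lbr P (h b) b' + lbr P (\<delta>B b) b') + (lbr P b (\<delta>B b') - lbr P (h b') b)"
    using 1 2 by simp
  then have "\<delta>B (brB P b b') = prB P ((lbr P (h b) b' + lbr P (\<delta>B b) b') + (lbr P b (\<delta>B b') - lbr P (h b') b))"
    using \<delta>B_prB[OF lbr_in[OF S]] \<delta>_br[OF S] by (simp add: brB_def)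
  also have "\<dots> = (nabla P (h b) b' + brB P (\<delta>B b) b') + (brB P b (\<delta>B b') - nabla P (h b') b)"
    using S H B by (simp add: prB_add hom_diff[OF hom_prB subgrp_S] lbr_in subgrpD[OF subgrp_S] nabla_def brB_def)
  finally show ?thesis by (simp add: algebra_simps)
qed

end

section \<open>The Leibniz rule for the bracket and its defect\<close>

locale pair_bracket_derivation = pair_bracket P rho1 brk + pair_derivation P \<delta> s
  for P :: "('m::{t2_space, second_countable_topology}, 'k::real_normed_field, 'v::ab_group_add, 'z) lie_pair_scheme"
    and rho1 brk \<delta> s
begin

text \<open>\<open>lie_shuf\<close> for the shuffle formula of \<open>rho1\<close>, its defect being
  supplied by \<open>aK_eK\<close>.\<close>

lemma aK_rho1:
  assumes X: "cB k X" and \<omega>: "cK l \<omega>"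
  shows "aK (rho1 X \<omega>) = rho1 (aB X) \<omega> + rho1 X (aK \<omega>) + shuf k X (\<lambda>v. MK v \<omega>)"
proof -
  have "shuf k X (\<lambda>v. aK (eK v \<omega>) - eK (\<delta>B v) \<omega>) = shuf k X (\<lambda>v. eK v (aK \<omega>) + MK v \<omega>)"
    by (rule shuf_cong[OF cB_VF[OF X] aK_eK[OF \<omega>]])
  then show ?thesis
    using lie_shuf[OF subgrp_SB subgrp_R hom_\<delta>B hom_s cB_VF[OF X] hom_eK[OF \<omega>]]
    by (simp add: rho1_eq[OF X \<omega>] rho1_eq[OF cB_aB[OF X] \<omega>] rho1_eq[OF X cK_aK[OF \<omega>]] shuf_op_add add.assoc)
qed

text \<open>The form of the correction is dictated by products: for a second argument
  \<open>\<omega>\<close> . Y, \<open>aK_rho1\<close> produces a term with \<open>MK\<close>, which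
  the shuffle of \<open>MB\<close> reproduces by \<open>Mo_wd\<close>. Antisymmetrising keeps the
  identity compatible with skew-symmetry.\<close>

lemma aB_brk:
  assumes X: "cB k X" and Y: "cB l Y"
  shows "aB (brk X Y) = brk (aB X) Y + brk X (aB Y) + (shuf k X (\<lambda>v. MB v Y) - sg (k * l) (shuf l Y (\<lambda>v. MB v X)))"
proof -
  define Gn where "Gn k l X Y = aB (brk X Y) - brk (aB X) Y - brk X (aB Y)
     - shuf k X (\<lambda>v. MB v Y) + sg (k * l) (shuf l Y (\<lambda>v. MB v X))" for k l :: nat and X Y
  note ha = hom_lie'[OF hom_\<delta>B subgrp_SB, of SA \<delta>] and VFB = subgrp_VF[OF subgrp_SB]
  note M_in = hom_in[OF hom_shuf[OF subgrp_SB subgrp_SB hom_Mo[OF conn_nabla]]]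
  have M_add: "shuf k X (\<lambda>v. MB v (Y + Z)) = shuf k X (\<lambda>v. MB v Y) + shuf k X (\<lambda>v. MB v Z)"
    if "X \<in> VF SA SB" "cB l Y" "cB l Z" for k l X Y Z
  proof -
    have "shuf k X (\<lambda>v. MB v (Y + Z)) = shuf k X (\<lambda>v. MB v Y + MB v Z)"
      by (rule shuf_cong[OF that(1)])
        (rule hom_plus[OF hom_lie'[OF conn_hom[OF conn_nabla h_in] subgrp_SB] cB_VF[OF that(2)] cB_VF[OF that(3)]])
    then show ?thesis by (simp add: shuf_op_add)
  qed
  have "Gn k l X Y = 0"
  proof (rule bracket_zero[of Gn, OF _ _ _ _ _ X Y])
    fix k l X Y assume X: "cB k X" and Y: "cB l Y"
    note XV = cB_VF[OF X] and YV = cB_VF[OF Y] and aX = cB_aB[OF X] and aY = cB_aB[OF Y]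
    note XY = brk_in[OF X Y] and aXY = brk_in[OF aX Y] and XaY = brk_in[OF X aY]
    show "Gn k l X Y \<in> VF SA SB"
      unfolding Gn_def
      by (intro subgrpD(2,4,5)[OF VFB] hom_in[OF ha] cB_VF[OF XY] cB_VF[OF aXY] cB_VF[OF XaY] M_in[OF X YV] M_in[OF Y XV])
    show "Gn k l X (Y + Z) = Gn k l X Y + Gn k l X Z" if Z: "cB l Z" for Z
    proof -
      have "shuf l (Y + Z) (\<lambda>v. MB v X) = shuf l Y (\<lambda>v. MB v X) + shuf l Z (\<lambda>v. MB v X)"
        by (rule hom_plus[OF hom_shuf[OF subgrp_SB subgrp_SB hom_Mo[OF conn_nabla X]] YV cB_VF[OF Z]])
      moreover have "aB (brk X (Y + Z)) = aB (brk X Y) + aB (brk X Z)"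
        using hom_plus[OF ha cB_VF[OF XY] cB_VF[OF brk_in[OF X Z]]] by (simp add: brk_add[OF X Y Z])
      moreover have "brk X (aB (Y + Z)) = brk X (aB Y) + brk X (aB Z)"
        using brk_add[OF X aY cB_aB[OF Z]] by (simp add: hom_plus[OF ha YV cB_VF[OF Z]])
      ultimately show ?thesis
        by (simp add: Gn_def brk_add[OF aX Y Z] M_add[OF XV Y Z])
    qed
    show "Gn k l X Y = - sg (k * l) (Gn l k Y X)"
    proof -
      have 1: "aB (brk X Y) = - sg (k * l) (aB (brk Y X))"
        unfolding brk_skew[OF X Y] using cB_VF[OF brk_in[OF Y X]]
        by (simp add: hom_minus[OF ha VFB] hom_sg[OF ha VFB] subgrpD(5)[OF VFB])
      show ?thesis
        unfolding Gn_def 1 brk_skew[OF aX Y] brk_skew[OF X aY]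
        by (cases "even k"; cases "even l") (simp_all add: sg_def algebra_simps)
    qed
    fix j \<omega> assume \<omega>: "cK j \<omega>"
    note \<omega>V = cK_VF[OF \<omega>] and a\<omega> = cK_aK[OF \<omega>]
    note r = rho1_in[OF X \<omega>] and ra = rho1_in[OF aX \<omega>] and rw = rho1_in[OF X a\<omega>]
    have Df: "\<delta>B (fmul P f x) = fmul P (s f) x + fmul P f (\<delta>B x)" if "f \<in> R" "x \<in> SB" for f x
      using that by (rule \<delta>B_fm)
    note aw = lie_wd[where s = s, OF conn_nabla _ _ hom_s hom_\<delta>B Df]
    have MK_in: "shuf k X (\<lambda>v. MK v \<omega>) \<in> VF SA R"
      by (rule hom_in[OF hom_shuf[OF subgrp_SB subgrp_R hom_Mo[OF rh \<omega>]] XV])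
    have "aB (brk X (wB j \<omega> Y)) = aB (wB (k + j) (rho1 X \<omega>) Y) + sg (j * k) (aB (wB j \<omega> (brk X Y)))"
      unfolding brk_wd[OF X \<omega> Y]
      using cB_VF[OF cB_wB[OF r Y]] cB_VF[OF cB_wB[OF \<omega> XY]]
      by (simp add: hom_plus[OF ha] hom_sg[OF ha VFB] subgrpD(5)[OF VFB])
    also have "aB (wB (k + j) (rho1 X \<omega>) Y) = wB (k + j) (aK (rho1 X \<omega>)) Y + wB (k + j) (rho1 X \<omega>) (aB Y)"
      by (rule aw[OF cK_VF[OF r] YV])
    also have "aB (wB j \<omega> (brk X Y)) = wB j (aK \<omega>) (brk X Y) + wB j \<omega> (aB (brk X Y))"
      by (rule aw[OF \<omega>V cB_VF[OF XY]])
    also have "wB (k + j) (aK (rho1 X \<omega>)) Y = wB (k + j) (rho1 (aB X) \<omega>) Y + wB (k + j) (rho1 X (aK \<omega>)) Y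
        + wB (k + j) (shuf k X (\<lambda>v. MK v \<omega>)) Y"
      using cK_VF[OF ra] cK_VF[OF rw] MK_in
      by (simp add: aK_rho1[OF X \<omega>] wd_add_left[OF conn_nabla YV] subgrpD(4)[OF subgrp_VF[OF subgrp_R]])
    finally have 1: "aB (brk X (wB j \<omega> Y)) = wB (k + j) (rho1 (aB X) \<omega>) Y + wB (k + j) (rho1 X (aK \<omega>)) Y
        + wB (k + j) (shuf k X (\<lambda>v. MK v \<omega>)) Y + wB (k + j) (rho1 X \<omega>) (aB Y)
        + sg (j * k) (wB j (aK \<omega>) (brk X Y) + wB j \<omega> (aB (brk X Y)))" .
    have 2: "brk (aB X) (wB j \<omega> Y) = wB (k + j) (rho1 (aB X) \<omega>) Y + sg (j * k) (wB j \<omega> (brk (aB X) Y))"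
      by (rule brk_wd[OF aX \<omega> Y])
    have aw\<omega>: "aB (wB j \<omega> Y) = wB j (aK \<omega>) Y + wB j \<omega> (aB Y)"
      by (rule aw[OF \<omega>V YV])
    have 3: "brk X (aB (wB j \<omega> Y)) = wB (k + j) (rho1 X (aK \<omega>)) Y + sg (j * k) (wB j (aK \<omega>) (brk X Y))
        + (wB (k + j) (rho1 X \<omega>) (aB Y) + sg (j * k) (wB j \<omega> (brk X (aB Y))))"
      unfolding aw\<omega> brk_add[OF X cB_wB[OF a\<omega> Y] cB_wB[OF \<omega> aY]] brk_wd[OF X a\<omega> Y] brk_wd[OF X \<omega> aY] by (rule refl)
    have "shuf k X (\<lambda>v. MB v (wB j \<omega> Y)) = shuf k X (\<lambda>v. wB j (MK v \<omega>) Y + wB j \<omega> (MB v Y))"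
      by (rule shuf_cong[OF XV]) (rule Mo_wd[OF conn_nabla _ \<omega>V YV])
    also have "\<dots> = shuf k X (\<lambda>v. wB j (MK v \<omega>) Y) + shuf k X (\<lambda>v. wB j \<omega> (MB v Y))"
      by (rule shuf_op_add)
    also have "shuf k X (\<lambda>v. wB j (MK v \<omega>) Y) = wB (k + j) (shuf k X (\<lambda>v. MK v \<omega>)) Y"
      unfolding wd_def
      by (rule shuf_assoc[OF subgrp_SB subgrp_R subgrp_SB XV hom_Mo[OF rh \<omega>] hom_sm[OF vmod_SB YV], symmetric])
    \<comment> \<open>Here the arguments of \<open>X\<close> and \<open>\<omega>\<close> are taken
      in the opposite order, so \<open>shuf_swap\<close> gives the sign.\<close>
    also have "shuf k X (\<lambda>v. wB j \<omega> (MB v Y)) = sg (k * j) (wB j \<omega> (shuf k X (\<lambda>v. MB v Y)))"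
    proof -
      have M0: "MB 0 Y = 0" by (rule hom_0[OF hom_Mo[OF conn_nabla Y] subgrp_SB])
      have "shuf k X (\<lambda>v. wB j \<omega> (MB v Y)) = sg (k * j) (shuf j \<omega> (\<lambda>f. shuf k X (\<lambda>v. sm (fmul P) f (MB v Y))))"
        unfolding wd_def
      proof (rule shuf_swap)
        show "sm (fmul P) w (MB v Y) = 0" if "v = 0" for v w
          unfolding that M0 by (rule sm_zero[OF vmod_SB])
        show "X as = 0" if "odd k" "even (length as)" for as
          using that by (intro cf_degree[OF vmod_SB X]) auto
        show "X as = 0" if "even k" "odd (length as)" for as
          using that by (intro cf_degree[OF vmod_SB X]) auto
      qed
      then show ?thesis by (simp add: wd_def shuf_op_sm[OF vmod_SB])
    qed
    finally have 4: "shuf k X (\<lambda>v. MB v (wB j \<omega> Y)) = wB (k + j) (shuf k X (\<lambda>v. MK v \<omega>)) Y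
       + sg (k * j) (wB j \<omega> (shuf k X (\<lambda>v. MB v Y)))" .
    have 5: "shuf (j + l) (wB j \<omega> Y) (\<lambda>v. MB v X) = wB j \<omega> (shuf l Y (\<lambda>v. MB v X))"
      by (rule shuf_wd[OF conn_nabla vmod_SB \<omega>V YV hom_Mo[OF conn_nabla X]]) (rule Mo_fm[OF conn_nabla X])
    have "Gn k (j + l) X (wB j \<omega> Y) = sg (k * j) (wB j \<omega> (Gn k l X Y))"
      unfolding Gn_def 1 2 3 4 5 wd_diff[OF conn_nabla \<omega>V] wd_add[OF conn_nabla \<omega>V] wd_sg[OF conn_nabla \<omega>V]
      by (cases "even k"; cases "even j"; cases "even l") (simp_all add: sg_def algebra_simps)
    then show "\<exists>n. Gn k (j + l) X (wB j \<omega> Y) = sg n (wB j \<omega> (Gn k l X Y))" by blast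
  next
    fix b b' assume b: "b \<in> SB" and b': "b' \<in> SB"
    note B = hom_in[OF hom_\<delta>B b] hom_in[OF hom_\<delta>B b']
    have a0: "aB (form0 v) = form0 (\<delta>B v)" for v
      by (rule lie_form0[where D = \<delta>B]) (rule hom_0[OF hom_\<delta>B subgrp_SB])
    \<comment> \<open>On sections of B the correction reduces to the two Bott terms of
      \<open>\<delta>B_brB\<close>.\<close>
    have M0: "shuf 0 (form0 v) (\<lambda>v. MB v (form0 w)) = form0 (nabla P (h v) w)" if "v \<in> SB" "w \<in> SB" for v w
      using shuf_form0[OF subgrp_SB hom_Mo[OF conn_nabla cB_form0[OF that(2)]]]
        lie_form0[of "nabla P (h v)" SA "Tm v" w] hom_0[OF conn_hom[OF conn_nabla h_in[OF that(1)]] subgrp_SB]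
      by simp
    have eq0: "form0 (\<delta>B (brB P b b')) = form0 (brB P (\<delta>B b) b') + form0 (brB P b (\<delta>B b'))
        + form0 (nabla P (h b) b') - form0 (nabla P (h b') b)"
      unfolding \<delta>B_brB[OF b b'] by (rule ext) (simp add: form0_def fa)
    show "Gn 0 0 (form0 b) (form0 b') = 0"
      unfolding Gn_def
      by (simp add: a0 M0 b b' B brk_form0 eq0)
  qed
  then show ?thesis by (simp add: Gn_def algebra_simps)
qed

end

section \<open>The Lie algebra of derivations\<close>

context split_pair
begin

text \<open>A vector field seen as an operator on functions; the family of tangent vectors is
  recovered by evaluating at points. Sums and commutators are easier to form in this shape.\<close>

definition vfop :: "(('m \<Rightarrow> 'k) \<Rightarrow> 'm \<Rightarrow> 'k) \<Rightarrow> bool" where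
  "vfop t \<longleftrightarrow> hom R R t \<and> (\<forall>c. \<forall>f\<in>R. t ((\<lambda>_. c) * f) = (\<lambda>_. c) * t f) \<and>
     (\<forall>f\<in>R. \<forall>g\<in>R. t (f * g) = t f * g + f * t g)"

lemma vfop_vector_field: "vfop (vf_app s) \<longleftrightarrow> s \<in> vector_fields P"
  unfolding vfop_def hom_def vector_fields_def tangent_def vf_app_def plus_fun_def times_fun_def fun_eq_iff
  by (auto simp: add.commute)

text \<open>A derivation with its symbol as explicit data, so that each operation on derivations can
  be paired with the matching operation on symbols.\<close>

definition der :: "(('m \<Rightarrow> 'v) \<Rightarrow> 'm \<Rightarrow> 'v) \<Rightarrow> (('m \<Rightarrow> 'k) \<Rightarrow> 'm \<Rightarrow> 'k) \<Rightarrow> bool" where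
  "der \<delta> t \<longleftrightarrow> (\<forall>u. u \<notin> S \<longrightarrow> \<delta> u = 0) \<and> hom S S \<delta> \<and> (\<forall>c. \<forall>u\<in>S. \<delta> (cmul P c u) = cmul P c (\<delta> u)) \<and> vfop t \<and>
     (\<forall>f\<in>R. \<forall>u\<in>S. \<delta> (fmul P f u) = fmul P (t f) u + fmul P f (\<delta> u)) \<and>
     (\<forall>u\<in>S. \<forall>f\<in>R. t (rho P u f) - rho P u (t f) = rho P (\<delta> u) f) \<and>
     (\<forall>u\<in>S. \<forall>v\<in>S. \<delta> (lbr P u v) = lbr P (\<delta> u) v + lbr P u (\<delta> v))"

lemma Der_iff: "\<delta> \<in> Der P \<longleftrightarrow> (\<exists>t. der \<delta> t)"
proof
  assume "\<delta> \<in> Der P"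
  then obtain s where "s \<in> vector_fields P" and "der \<delta> (vf_app s) \<or> \<not> vfop (vf_app s)"
    unfolding Der_def der_def hom_def by blast
  then show "\<exists>t. der \<delta> t" using vfop_vector_field by blast
next
  assume "\<exists>t. der \<delta> t"
  then obtain t where t: "der \<delta> t" by blast
  define s where "s = (\<lambda>p f. t f p)"
  have st: "vf_app s = t" by (rule ext) (simp add: s_def vf_app_def)
  have "s \<in> vector_fields P" using t by (simp add: vfop_vector_field[symmetric] st der_def)
  with t show "\<delta> \<in> Der P"
    unfolding Der_def der_def hom_def mem_Collect_eq st[symmetric] by blast
qed

lemma
  assumes "der \<delta> t"
  shows der_out: "u \<notin> S \<Longrightarrow> \<delta> u = 0" and der_hom: "hom S S \<delta>"
    and der_cmul: "u \<in> S \<Longrightarrow> \<delta> (cmul P c u) = cmul P c (\<delta> u)" and der_vfop: "vfop t"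
    and der_fmul: "f \<in> R \<Longrightarrow> u \<in> S \<Longrightarrow> \<delta> (fmul P f u) = fmul P (t f) u + fmul P f (\<delta> u)"
    and der_rho: "u \<in> S \<Longrightarrow> f \<in> R \<Longrightarrow> t (rho P u f) = rho P u (t f) + rho P (\<delta> u) f"
    and der_lbr: "u \<in> S \<Longrightarrow> v \<in> S \<Longrightarrow> \<delta> (lbr P u v) = lbr P (\<delta> u) v + lbr P u (\<delta> v)"
    and der_in: "u \<in> S \<Longrightarrow> \<delta> u \<in> S" and der_t_hom: "hom R R t"
proof -
  show "u \<in> S \<Longrightarrow> f \<in> R \<Longrightarrow> t (rho P u f) = rho P u (t f) + rho P (\<delta> u) f"
    using assms unfolding der_def by (metis add.commute diff_add_cancel)
qed (use assms in \<open>auto simp: der_def vfop_def hom_def\<close>)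

lemma cmul_in: "u \<in> S \<Longrightarrow> cmul P c u \<in> S"
  using vmod_in[OF vmod_S smooth_const] .

lemma cmul_laws: "cmul P c (u + v) = cmul P c u + cmul P c v" "cmul P (c + e) u = cmul P c u + cmul P e u"
  "cmul P c (cmul P e u) = cmul P (c * e) u" "cmul P 1 u = u" "cmul P c 0 = 0" "cmul P c (- u) = - cmul P c u"
  "cmul P c (u - v) = cmul P c u - cmul P c v" "fmul P f (cmul P c u) = cmul P c (fmul P f u)"
  by (auto simp: fmul_def fun_eq_iff plus_fun_apply zero_fun_apply uminus_apply minus_apply
      vs.scale_right_distrib vs.scale_left_distrib vs.scale_right_diff_distrib mult.commute)

lemma der_zero: "der 0 0"
  unfolding der_def vfop_def hom_def
  using hom_0[OF hom_lbr subgrp_S] hom_0[OF hom_lbr_left subgrp_S] hom_0[OF hom_rho_left subgrp_S] hom_0[OF hom_rho subgrp_R]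
    subgrpD(1)[OF subgrp_S] subgrpD(1)[OF subgrp_R] fmul_laws(2)[of 0 0]
  by (simp add: zero_fun_apply cmul_laws vmod_zero[OF vmod_S])

lemma der_add:
  assumes d: "der \<delta> t" "der \<delta>' t'"
  shows "der (\<delta> + \<delta>') (t + t')"
proof -
  note h = der_hom[OF d(1)] der_hom[OF d(2)] and th = der_t_hom[OF d(1)] der_t_hom[OF d(2)]
  have v: "vfop (t + t')"
    using der_vfop[OF d(1)] der_vfop[OF d(2)] unfolding vfop_def
    by (auto simp: plus_fun_apply[of t] hom_def subgrpD(4)[OF subgrp_R] algebra_simps)
  show ?thesis
    unfolding der_def
  proof (intro conjI allI impI ballI)
    show "hom S S (\<delta> + \<delta>')"
      unfolding plus_fun_def[of \<delta>] by (rule hom_op_add[OF h subgrp_S])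
    fix u assume u: "u \<in> S"
    show "(\<delta> + \<delta>') (cmul P c u) = cmul P c ((\<delta> + \<delta>') u)" for c
      using u by (simp add: plus_fun_apply[of \<delta>] der_cmul[OF d(1)] der_cmul[OF d(2)] cmul_laws)
    show "(\<delta> + \<delta>') (fmul P f u) = fmul P ((t + t') f) u + fmul P f ((\<delta> + \<delta>') u)" if "f \<in> R" for f
      using u that by (simp add: plus_fun_apply[of \<delta>] plus_fun_apply[of t] der_fmul[OF d(1)] der_fmul[OF d(2)] fmul_laws algebra_simps)
    show "(t + t') (rho P u f) - rho P u ((t + t') f) = rho P ((\<delta> + \<delta>') u) f" if f: "f \<in> R" for f
      using u f hom_in[OF th(1) f] hom_in[OF th(2) f]
      by (simp add: plus_fun_apply[of \<delta>] plus_fun_apply[of t] der_rho[OF d(1)] der_rho[OF d(2)] rho_add rho_add_left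
          der_in[OF d(1)] der_in[OF d(2)])
    show "(\<delta> + \<delta>') (lbr P u v) = lbr P ((\<delta> + \<delta>') u) v + lbr P u ((\<delta> + \<delta>') v)" if v: "v \<in> S" for v
      using u v by (simp add: plus_fun_apply[of \<delta>] der_lbr[OF d(1)] der_lbr[OF d(2)] lbr_add_left lbr_add_right
          der_in[OF d(1)] der_in[OF d(2)] algebra_simps)
  qed (simp_all add: v plus_fun_apply[of \<delta>] der_out[OF d(1)] der_out[OF d(2)])
qed

lemma rho_cmul: "u \<in> S \<Longrightarrow> f \<in> R \<Longrightarrow> rho P u ((\<lambda>_. c) * f) = (\<lambda>_. c) * rho P u f"
  using anchor_tangent[of u] by (simp add: rho_def fun_eq_iff tangent_def times_fun_def)

lemma lbr_cmul: "u \<in> S \<Longrightarrow> v \<in> S \<Longrightarrow> lbr P (cmul P c u) v = cmul P c (lbr P u v)"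
  "u \<in> S \<Longrightarrow> v \<in> S \<Longrightarrow> lbr P u (cmul P c v) = cmul P c (lbr P u v)"
  using lbr_alg by (simp_all add: lie_algebra_on_def)

lemma der_scale:
  assumes d: "der \<delta> t"
  shows "der (op_scale P c \<delta>) (\<lambda>f. (\<lambda>_. c) * t f)"
proof -
  note h = der_hom[OF d] and th = der_t_hom[OF d]
  have v: "vfop (\<lambda>f. (\<lambda>_. c) * t f)"
    using der_vfop[OF d] unfolding vfop_def
    by (auto simp: hom_def R_times smooth_const algebra_simps)
  show ?thesis
    unfolding der_def
  proof (intro conjI allI impI ballI)
    show "hom S S (op_scale P c \<delta>)"
      by (simp add: hom_def op_scale_def cmul_in der_in[OF d] hom_plus[OF h] cmul_laws)
    show "op_scale P c \<delta> u = 0" if "u \<notin> S" for u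
      using der_out[OF d that] by (simp add: op_scale_def cmul_laws)
    fix u assume u: "u \<in> S"
    show "op_scale P c \<delta> (cmul P e u) = cmul P e (op_scale P c \<delta> u)" for e
      using u by (simp add: op_scale_def der_cmul[OF d] cmul_laws mult.commute)
    show "op_scale P c \<delta> (fmul P f u) = fmul P ((\<lambda>_. c) * t f) u + fmul P f (op_scale P c \<delta> u)" if "f \<in> R" for f
      using u that by (simp add: op_scale_def der_fmul[OF d] cmul_laws fmul_laws(3)[symmetric])
    show "(\<lambda>_. c) * t (rho P u f) - rho P u ((\<lambda>_. c) * t f) = rho P (op_scale P c \<delta> u) f" if f: "f \<in> R" for f
      using u f hom_in[OF th f]
      by (simp add: op_scale_def der_rho[OF d] rho_cmul rho_fmul der_in[OF d] algebra_simps)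
    show "op_scale P c \<delta> (lbr P u v) = lbr P (op_scale P c \<delta> u) v + lbr P u (op_scale P c \<delta> v)" if v: "v \<in> S" for v
      using u v by (simp add: op_scale_def der_lbr[OF d] lbr_cmul der_in[OF d] cmul_laws)
  qed (rule v)
qed

text \<open>The mixed terms, one symbol acting on the function and the other derivation on the
  section, are symmetric in the two derivations and cancel.\<close>

lemma der_commutator:
  assumes d: "der \<delta> t" and d': "der \<delta>' t'"
  shows "der (commutator \<delta> \<delta>') (\<lambda>f. t (t' f) - t' (t f))"
proof -
  note h = der_hom[OF d] and th = der_t_hom[OF d] and h' = der_hom[OF d'] and th' = der_t_hom[OF d']
  note i = der_in[OF d] der_in[OF d'] hom_in[OF th] hom_in[OF th']
  note z = hom_0[OF h subgrp_S] hom_0[OF h' subgrp_S]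
  have v: "vfop (\<lambda>f. t (t' f) - t' (t f))"
    unfolding vfop_def
  proof (intro conjI allI ballI)
    show "hom R R (\<lambda>f. t (t' f) - t' (t f))"
      by (rule hom_op_diff[OF hom_comp[OF th' th] hom_comp[OF th th'] subgrp_R])
    have c: "t ((\<lambda>_. c) * f) = (\<lambda>_. c) * t f" "t' ((\<lambda>_. c) * f) = (\<lambda>_. c) * t' f"
      "t (f * g) = t f * g + f * t g" "t' (f * g) = t' f * g + f * t' g" if "f \<in> R" "g \<in> R" for c f g
      using der_vfop[OF d, unfolded vfop_def] der_vfop[OF d', unfolded vfop_def] that by simp_all
    fix f assume f: "f \<in> R"
    show "t (t' ((\<lambda>_. c) * f)) - t' (t ((\<lambda>_. c) * f)) = (\<lambda>_. c) * (t (t' f) - t' (t f))" for c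
      using f i by (simp add: c right_diff_distrib)
    show "t (t' (f * g)) - t' (t (f * g)) = (t (t' f) - t' (t f)) * g + f * (t (t' g) - t' (t g))" if g: "g \<in> R" for g
      using f g i by (simp add: c hom_plus[OF th] hom_plus[OF th'] R_times algebra_simps)
  qed
  show ?thesis
    unfolding der_def
  proof (intro conjI allI impI ballI)
    show "hom S S (commutator \<delta> \<delta>')"
      unfolding commutator_def by (rule hom_op_diff[OF hom_comp[OF h' h] hom_comp[OF h h'] subgrp_S])
    show "commutator \<delta> \<delta>' u = 0" if "u \<notin> S" for u
      using der_out[OF d that] der_out[OF d' that] z by (simp add: commutator_def)
    fix u assume u: "u \<in> S"
    show "commutator \<delta> \<delta>' (cmul P e u) = cmul P e (commutator \<delta> \<delta>' u)" for e
      using u by (simp add: commutator_def der_cmul[OF d] der_cmul[OF d'] i cmul_laws)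
    show "commutator \<delta> \<delta>' (fmul P f u) = fmul P (t (t' f) - t' (t f)) u + fmul P f (commutator \<delta> \<delta>' u)" if f: "f \<in> R" for f
    proof -
      have "fmul P (t (t' f)) u = fmul P (t (t' f) - t' (t f)) u + fmul P (t' (t f)) u"
        using fmul_laws(2)[of "t (t' f) - t' (t f)" "t' (t f)" u] by simp
      then show ?thesis
        using u f by (simp add: commutator_def der_fmul[OF d] der_fmul[OF d'] i hom_plus[OF h] hom_plus[OF h']
          vmod_in[OF vmod_S] vmod_diff[OF vmod_S] algebra_simps)
    qed
    show "t (t' (rho P u f)) - t' (t (rho P u f)) - rho P u (t (t' f) - t' (t f)) = rho P (commutator \<delta> \<delta>' u) f" if f: "f \<in> R" for f
      using u f i
      by (simp add: commutator_def der_rho[OF d] der_rho[OF d'] hom_plus[OF th] hom_plus[OF th'] rho_in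
          hom_diff[OF hom_rho subgrp_R] hom_diff[OF hom_rho_left subgrp_S] algebra_simps)
    show "commutator \<delta> \<delta>' (lbr P u v) = lbr P (commutator \<delta> \<delta>' u) v + lbr P u (commutator \<delta> \<delta>' v)" if v: "v \<in> S" for v
      using u v i
      by (simp add: commutator_def der_lbr[OF d] der_lbr[OF d'] hom_plus[OF h] hom_plus[OF h'] lbr_in
          hom_diff[OF hom_lbr subgrp_S] hom_diff[OF hom_lbr_left subgrp_S] algebra_simps)
  qed (rule v)
qed

lemma DerLA_eq: "DerLA P = {\<delta>\<in>Der P. \<delta> ` SA \<subseteq> SA}"
proof -
  have "kappa P \<delta> = 0 \<longleftrightarrow> \<delta> ` SA \<subseteq> SA" if D: "\<delta> \<in> Der P" for \<delta>
  proof -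
    obtain t where t: "der \<delta> t" using Der_iff[THEN iffD1, OF D] by (elim exE)
    have "kappa P \<delta> = 0 \<longleftrightarrow> (\<forall>a\<in>SA. prB P (\<delta> a) = 0)"
    proof
      assume k: "kappa P \<delta> = 0"
      have "prB P (\<delta> a) = 0" if "a \<in> SA" for a
        using fun_cong[OF k, of "[a]"] that by (simp add: kappa_def fa[where as = "[a]"])
      then show "\<forall>a\<in>SA. prB P (\<delta> a) = 0" by blast
    next
      assume 0: "\<forall>a\<in>SA. prB P (\<delta> a) = 0"
      show "kappa P \<delta> = 0"
      proof
        fix as show "kappa P \<delta> as = 0 as"
          unfolding list_fun_apply(4) using 0 by (cases as) (simp_all add: kappa_def)
      qed
    qed
    also have "\<dots> \<longleftrightarrow> \<delta> ` SA \<subseteq> SA"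
    proof
      assume 0: "\<forall>a\<in>SA. prB P (\<delta> a) = 0"
      have "\<delta> a \<in> SA" if "a \<in> SA" for a
        using pr_sum[OF der_in[OF t SA_S[OF that]]] prA_in[OF der_in[OF t SA_S[OF that]]] 0 that by simp
      then show "\<delta> ` SA \<subseteq> SA" by (rule image_subsetI)
    next
      assume A: "\<delta> ` SA \<subseteq> SA"
      then have "\<delta> a \<in> SA" if "a \<in> SA" for a using that by (rule subsetD[OF _ imageI])
      then show "\<forall>a\<in>SA. prB P (\<delta> a) = 0" by (simp add: prB_A)
    qed
    finally show ?thesis .
  qed
  then show ?thesis by (auto simp: DerLA_def)
qed

lemma DerLA_iff: "\<delta> \<in> DerLA P \<longleftrightarrow> (\<exists>t. der \<delta> t) \<and> (\<forall>a\<in>SA. \<delta> a \<in> SA)"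
  unfolding DerLA_eq by (auto simp: Der_iff)

lemma DerLAE:
  assumes "\<delta> \<in> DerLA P"
  obtains t where "der \<delta> t" "\<And>a. a \<in> SA \<Longrightarrow> \<delta> a \<in> SA"
  using assms DerLA_iff by blast

lemma DerLAI: "der \<delta> t \<Longrightarrow> (\<And>a. a \<in> SA \<Longrightarrow> \<delta> a \<in> SA) \<Longrightarrow> \<delta> \<in> DerLA P"
  using DerLA_iff by blast

lemma DerLA_add:
  assumes "\<delta> \<in> DerLA P" "\<delta>' \<in> DerLA P"
  shows "\<delta> + \<delta>' \<in> DerLA P"
proof -
  obtain t t' where t: "der \<delta> t" "\<And>a. a \<in> SA \<Longrightarrow> \<delta> a \<in> SA" "der \<delta>' t'" "\<And>a. a \<in> SA \<Longrightarrow> \<delta>' a \<in> SA"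
    using DerLAE[OF assms(1)] DerLAE[OF assms(2)] by metis
  show ?thesis
    by (rule DerLAI[OF der_add[OF t(1,3)]]) (simp add: plus_fun_apply[of \<delta>] subgrpD(4)[OF subgrp_SA] t)
qed

lemma DerLA_scale:
  assumes "\<delta> \<in> DerLA P"
  shows "op_scale P c \<delta> \<in> DerLA P"
proof -
  obtain t where t: "der \<delta> t" "\<And>a. a \<in> SA \<Longrightarrow> \<delta> a \<in> SA" using DerLAE[OF assms] by metis
  show ?thesis
    by (rule DerLAI[OF der_scale[OF t(1)]]) (simp add: op_scale_def vmod_in[OF vmod_SA smooth_const] t)
qed

lemma DerLA_zero: "0 \<in> DerLA P"
  by (rule DerLAI[OF der_zero]) (simp add: zero_fun_apply[where 'a = "'m \<Rightarrow> 'v"] subgrpD(1)[OF subgrp_SA])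

lemma DerLA_commutator:
  assumes "\<delta> \<in> DerLA P" "\<delta>' \<in> DerLA P"
  shows "commutator \<delta> \<delta>' \<in> DerLA P"
proof -
  obtain t t' where t: "der \<delta> t" "\<And>a. a \<in> SA \<Longrightarrow> \<delta> a \<in> SA" "der \<delta>' t'" "\<And>a. a \<in> SA \<Longrightarrow> \<delta>' a \<in> SA"
    using DerLAE[OF assms(1)] DerLAE[OF assms(2)] by metis
  show ?thesis
    by (rule DerLAI[OF der_commutator[OF t(1,3)]]) (simp add: commutator_def subgrpD(2)[OF subgrp_SA] t)
qed

lemma DerLA_props:
  assumes "\<delta> \<in> DerLA P"
  shows "hom S S \<delta>" "u \<in> S \<Longrightarrow> \<delta> (cmul P c u) = cmul P c (\<delta> u)" "u \<notin> S \<Longrightarrow> \<delta> u = 0" "u \<in> S \<Longrightarrow> \<delta> u \<in> S"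
    "\<delta> 0 = 0"
proof -
  obtain t where t: "der \<delta> t" using assms DerLA_iff by blast
  show "hom S S \<delta>" "u \<in> S \<Longrightarrow> \<delta> (cmul P c u) = cmul P c (\<delta> u)" "u \<notin> S \<Longrightarrow> \<delta> u = 0" "u \<in> S \<Longrightarrow> \<delta> u \<in> S"
    "\<delta> 0 = 0"
    using der_hom[OF t] der_cmul[OF t] der_out[OF t] der_in[OF t] hom_0[OF der_hom[OF t] subgrp_S] by auto
qed

lemma vector_space_op_scale: "vector_space (op_scale P)"
  by unfold_locales (auto simp: op_scale_def fun_eq_iff[where 'a = "'m \<Rightarrow> 'v"] cmul_laws plus_fun_apply[where 'a = "'m \<Rightarrow> 'v"])

lemma lie_algebra_DerLA: "lie_algebra_on (op_scale P) (DerLA P) commutator"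
proof -
  interpret op: vector_space "op_scale P" by (rule vector_space_op_scale)
  \<comment> \<open>Additivity of derivations is known on sections only, while off the sections all
    operators are 0; so identities of operators are checked in these two cases.\<close>
  have ext: "F = G" if "\<And>u. u \<in> S \<Longrightarrow> F u = G u" "\<And>u. u \<notin> S \<Longrightarrow> F u = G u" for F G :: "('m \<Rightarrow> 'v) \<Rightarrow> 'm \<Rightarrow> 'v"
    using that by blast
  have app: "(F + G) u = F u + G u" "(0 :: ('m \<Rightarrow> 'v) \<Rightarrow> 'm \<Rightarrow> 'v) u = 0" for F G :: "('m \<Rightarrow> 'v) \<Rightarrow> 'm \<Rightarrow> 'v" and u
    by (simp_all add: plus_fun_apply zero_fun_apply)
  show ?thesis
    unfolding lie_algebra_on_def
  proof (intro conjI ballI allI)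
    show "op.subspace (DerLA P)"
      unfolding op.subspace_def using DerLA_zero DerLA_add DerLA_scale by blast
    fix x assume x: "x \<in> DerLA P"
    note px = DerLA_props[OF x]
    show "commutator x x = 0" by (rule ext) (simp_all add: commutator_def app(2))
    fix y assume y: "y \<in> DerLA P"
    note py = DerLA_props[OF y]
    show "commutator x y \<in> DerLA P" by (rule DerLA_commutator[OF x y])
    show "commutator (op_scale P c x) y = op_scale P c (commutator x y)"
      "commutator x (op_scale P c y) = op_scale P c (commutator x y)" for c
      by (rule ext; simp add: commutator_def op_scale_def px py cmul_laws)+
    fix z assume z: "z \<in> DerLA P"
    note pz = DerLA_props[OF z]
    note homs = hom_plus[OF px(1)] hom_plus[OF py(1)] hom_plus[OF pz(1)]
      hom_diff[OF px(1) subgrp_S] hom_diff[OF py(1) subgrp_S] hom_diff[OF pz(1) subgrp_S]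
    show "commutator (x + y) z = commutator x z + commutator y z"
      by (rule ext; simp add: commutator_def app px py pz homs algebra_simps)
    show "commutator x (y + z) = commutator x y + commutator x z"
      by (rule ext; simp add: commutator_def app px py pz homs algebra_simps)
    show "commutator x (commutator y z) + commutator y (commutator z x) + commutator z (commutator x y) = 0"
      by (rule ext; simp add: commutator_def app px py pz homs algebra_simps)
  qed (rule vector_space_op_scale)
qed

lemma DerLA_pair_derivation:
  assumes "\<delta> \<in> DerLA P"
  obtains s where "pair_derivation P \<delta> s"
proof -
  obtain t where t: "der \<delta> t" and A: "\<forall>a\<in>SA. \<delta> a \<in> SA" using assms DerLA_iff by blast
  have "pair_derivation P \<delta> t"
  proof unfold_locales
    show "t (rho P u f) - rho P u (t f) = rho P (\<delta> u) f" if "u \<in> S" "f \<in> R" for u f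
      using der_rho[OF t that] by simp
    show "t (f * g) = t f * g + f * t g" if "f \<in> R" "g \<in> R" for f g
      using der_vfop[OF t] that by (simp add: vfop_def)
  qed (use A der_hom[OF t] der_t_hom[OF t] der_fmul[OF t] der_lbr[OF t] in auto)
  then show thesis by (rule that)
qed

end

section \<open>Cohomology classes and the action on them\<close>

context split_pair
begin

lemma closed_iff: "X \<in> closed_forms P k \<longleftrightarrow> cB k X \<and> dN X = 0"
  unfolding closed_forms_def by (auto simp: OmegaB_iff dBott_eq)

lemma exact_Suc: "Z \<in> exact_forms P (Suc l) \<longleftrightarrow> (\<exists>W. cB l W \<and> Z = dN W)"
  by (auto simp: exact_forms_def OmegaB_iff dBott_eq image_iff)

lemma exact_0: "exact_forms P 0 = {0}"
  by (simp add: exact_forms_def)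

lemma exact_closed: "Z \<in> exact_forms P k \<Longrightarrow> cB k Z \<and> dN Z = 0"
proof (cases k)
  case 0
  then show "Z \<in> exact_forms P k \<Longrightarrow> cB k Z \<and> dN Z = 0"
    using cf_zero[OF vmod_SB, where k = 0] d_zero[OF conn_nabla] by (simp add: exact_0)
next
  case (Suc l)
  assume "Z \<in> exact_forms P k"
  then obtain W where "cB l W" "Z = dN W" unfolding Suc exact_Suc by auto
  then show ?thesis using cB_dN d_d[OF conn_nabla] Suc by simp
qed

lemma subgrp_exact: "subgrp (exact_forms P k)"
proof (cases k)
  case (Suc l)
  note hd = hom_d[OF conn_nabla]
  show ?thesis
    unfolding subgrp_def Suc
  proof (intro conjI ballI)
    show "0 \<in> exact_forms P (Suc l)"
      unfolding exact_Suc
      by (intro exI[of _ 0] conjI cf_zero[OF vmod_SB] d_zero[OF conn_nabla, symmetric])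
    fix X Y assume "X \<in> exact_forms P (Suc l)" "Y \<in> exact_forms P (Suc l)"
    then obtain V W where V: "cB l V" "X = dN V" and W: "cB l W" "Y = dN W" unfolding exact_Suc by auto
    have "X - Y = dN (V - W)"
      unfolding V(2) W(2) by (rule hom_diff[OF hd subgrp_VF[OF subgrp_SB] cB_VF[OF V(1)] cB_VF[OF W(1)], symmetric])
    then show "X - Y \<in> exact_forms P (Suc l)"
      unfolding exact_Suc by (intro exI[of _ "V - W"] conjI cf_diff[OF vmod_SB V(1) W(1)])
  qed
qed (simp add: subgrp_def exact_0)

abbreviation "smc z \<equiv> sm (fmul P) (\<lambda>_. z)"

lemma cB_smc: "cB k X \<Longrightarrow> cB k (smc z X)"
  by (rule cf_sm[OF vmod_SB smooth_const])

text \<open>The anchor kills constants: the Leibniz rule for 1 = 1 * 1 kills the function 1, and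
  scalars pass through.\<close>

lemma dN_smc:
  assumes X: "cB k X"
  shows "dN (smc z X) = smc z (dN X)"
proof -
  have "rho P a (\<lambda>_. z) = 0" if a: "a \<in> SA" for a
  proof -
    have one: "(1 :: 'm \<Rightarrow> 'k) \<in> R" using smooth_const[of 1] by (simp add: one_fun_def)
    have "rho P a 1 = 0" using rho_mult[OF SA_S[OF a] one one] by simp
    then show ?thesis using rho_cmul[OF SA_S[OF a] one, of z] by simp
  qed
  then have "dR (form0 (\<lambda>_. z)) as = 0" for as
  proof (induction as)
    case (Cons a as)
    show ?case
    proof (cases "a \<in> SA")
      case True
      have "ins a (dR (form0 (\<lambda>_. z))) as = 0"
        using Cons.prems[OF True] by (simp add: ins_d_form0[OF rh True] form0_def)
      then show ?thesis by (simp only: ins_apply[where as = as])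
    qed simp
  qed simp
  then have "dR (form0 (\<lambda>_. z)) = 0" by (intro ext) (simp only: list_fun_apply(4))
  then show ?thesis
    using dB_sm[OF conn_nabla cB_VF[OF X] smooth_const, of z] shuf_zero[OF subgrp_R hom_sm[OF vmod_SB cB_VF[OF X]]]
    by simp
qed

lemma exact_smc: "Z \<in> exact_forms P k \<Longrightarrow> smc z Z \<in> exact_forms P k"
proof (cases k)
  case 0
  then show "Z \<in> exact_forms P k \<Longrightarrow> smc z Z \<in> exact_forms P k" by (simp add: exact_0 sm_zero[OF vmod_SB])
next
  case (Suc l)
  assume "Z \<in> exact_forms P k"
  then obtain W where W: "cB l W" "Z = dN W" unfolding Suc exact_Suc by auto
  then show ?thesis
    unfolding Suc exact_Suc by (intro exI[of _ "smc z W"] conjI cB_smc[OF W(1)]) (simp add: dN_smc[OF W(1)])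
qed

lemma cls_eqI:
  assumes "X - Y \<in> exact_forms P k"
  shows "cls P k X = cls P k Y"
proof -
  have "Z - X \<in> exact_forms P k \<longleftrightarrow> Z - Y \<in> exact_forms P k" for Z
    using subgrpD(4)[OF subgrp_exact _ assms, of "Z - X"] subgrpD(2)[OF subgrp_exact _ assms, of "Z - Y"] by auto
  then show ?thesis by (simp add: cls_def)
qed

text \<open>Operations on classes are defined through an arbitrary representative. All of them are
  evaluated by knowing that it differs from the given form by an exact one.\<close>

lemma rep_cls:
  assumes "cB k X"
  shows "cB k (rep (cls P k X))" "rep (cls P k X) - X \<in> exact_forms P k"
proof -
  have "X \<in> cls P k X" using assms subgrpD(1)[OF subgrp_exact] by (simp add: cls_def OmegaB_iff)
  then have "rep (cls P k X) \<in> cls P k X" unfolding rep_def by (rule someI[of "\<lambda>Z. Z \<in> cls P k X"])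
  then show "cB k (rep (cls P k X))" "rep (cls P k X) - X \<in> exact_forms P k" by (simp_all add: cls_def OmegaB_iff)
qed

lemma cls_add_cls:
  assumes "cB k X" "cB k Y"
  shows "cls_add P k (cls P k X) (cls P k Y) = cls P k (X + Y)"
  unfolding cls_add_def
proof (rule cls_eqI)
  have "rep (cls P k X) + rep (cls P k Y) - (X + Y) = (rep (cls P k X) - X) + (rep (cls P k Y) - Y)" by simp
  also have "\<dots> \<in> exact_forms P k" by (rule subgrpD(4)[OF subgrp_exact rep_cls(2)[OF assms(1)] rep_cls(2)[OF assms(2)]])
  finally show "rep (cls P k X) + rep (cls P k Y) - (X + Y) \<in> exact_forms P k" .
qed

lemma cls_scale_cls:
  assumes "cB k X"
  shows "cls_scale P k z (cls P k X) = cls P k (smc z X)"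
  unfolding cls_scale_def cmulB_eq
  by (rule cls_eqI) (simp only: sm_diff[OF vmod_SB, symmetric] exact_smc[OF rep_cls(2)[OF assms]])

lemma smc_minus_one: "smc (- 1) X = - X"
  by (rule ext) (simp add: sm_apply fa fmul_def fun_eq_iff uminus_apply)

context
  fixes \<delta> assumes \<delta>: "\<delta> \<in> DerLA P"
begin

lemma act_cB: "cB k X \<Longrightarrow> cB k (act P \<delta> X)"
proof -
  assume X: "cB k X"
  obtain s where s: "pair_derivation P \<delta> s" by (rule DerLA_pair_derivation[OF \<delta>])
  show ?thesis unfolding pair_derivation.act_aB[OF s X] by (rule pair_derivation.cB_aB[OF s X])
qed

lemma act_add: "cB k X \<Longrightarrow> cB k Y \<Longrightarrow> act P \<delta> (X + Y) = act P \<delta> X + act P \<delta> Y"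
proof -
  assume X: "cB k X" and Y: "cB k Y"
  obtain s where s: "pair_derivation P \<delta> s" by (rule DerLA_pair_derivation[OF \<delta>])
  show ?thesis
    unfolding pair_derivation.act_aB[OF s X] pair_derivation.act_aB[OF s Y] pair_derivation.act_aB[OF s cf_add[OF vmod_SB X Y]]
    by (rule hom_plus[OF hom_lie'[OF pair_derivation.hom_\<delta>B[OF s] subgrp_SB] cB_VF[OF X] cB_VF[OF Y]])
qed

lemma hom_act: "hom {X. cB k X} {X. cB k X} (act P \<delta>)"
  by (simp add: hom_def act_cB act_add)

lemma act_dN: "cB k X \<Longrightarrow> act P \<delta> (dN X) = dN (act P \<delta> X)"
proof -
  assume X: "cB k X"
  obtain s where s: "pair_derivation P \<delta> s" by (rule DerLA_pair_derivation[OF \<delta>])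
  show ?thesis
    unfolding pair_derivation.act_aB[OF s X] pair_derivation.act_aB[OF s cB_dN[OF X]] by (rule pair_derivation.aB_dN[OF s X])
qed

lemma act_exact: "Z \<in> exact_forms P k \<Longrightarrow> act P \<delta> Z \<in> exact_forms P k"
proof (cases k)
  case 0
  assume "Z \<in> exact_forms P k"
  then have "Z = 0" using 0 by (simp add: exact_0)
  then show ?thesis using hom_0[OF hom_act[of 0] subgrp_cB] 0 by (simp add: exact_0)
next
  case (Suc l)
  assume "Z \<in> exact_forms P k"
  then obtain W where W: "cB l W" "Z = dN W" unfolding Suc exact_Suc by auto
  then show ?thesis
    unfolding Suc exact_Suc by (intro exI[of _ "act P \<delta> W"] conjI act_cB[OF W(1)]) (simp add: act_dN[OF W(1)])
qed

lemma act_smc: "cB k X \<Longrightarrow> act P \<delta> (smc z X) = smc z (act P \<delta> X)"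
proof -
  assume X: "cB k X"
  note p = DerLA_props[OF \<delta>]
  \<comment> \<open>The Leibniz rule for products with functions, used with 0 as the derivative of
    the constant: \<open>\<delta>\<close> commutes with constant multiples.\<close>
  have "act P \<delta> (smc z X) = sm (fmul P) 0 X + smc z (act P \<delta> X)"
    unfolding act_eq
  proof (rule lie_sm[OF vmod_SB cB_VF[OF X] smooth_const])
    fix x assume "x \<in> SB"
    then show "prB P (\<delta> (cmul P z x)) = fmul P 0 x + cmul P z (prB P (\<delta> x))"
      using fmul_laws(2)[of 0 0 x] by (simp add: p(2,4) SB_S prB_fmul smooth_const)
  qed
  also have "sm (fmul P) 0 X = 0"
    using sm_add_left[OF vmod_SB, of 0 0 X] by simp
  finally show ?thesis by simp
qed

lemma act_closed: "cB k X \<Longrightarrow> dN X = 0 \<Longrightarrow> dN (act P \<delta> X) = 0"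
  using act_dN[of k X] hom_0[OF hom_act subgrp_cB] by simp

lemma cls_act_cls:
  assumes X: "cB k X"
  shows "cls_act P k \<delta> (cls P k X) = cls P k (act P \<delta> X)"
  unfolding cls_act_def
proof (rule cls_eqI)
  have "act P \<delta> (rep (cls P k X)) - act P \<delta> X = act P \<delta> (rep (cls P k X) - X)"
    using hom_diff[OF hom_act subgrp_cB, of "rep (cls P k X)" k X] rep_cls(1)[OF X] X by simp
  also have "\<dots> \<in> exact_forms P k" by (rule act_exact[OF rep_cls(2)[OF X]])
  finally show "act P \<delta> (rep (cls P k X)) - act P \<delta> X \<in> exact_forms P k" .
qed

end

lemma act_op_scale:
  assumes \<delta>: "\<delta> \<in> DerLA P" and X: "cB k X"
  shows "act P (op_scale P z \<delta>) X = smc z (act P \<delta> X)"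
proof -
  obtain s where s: "pair_derivation P \<delta> s" by (rule DerLA_pair_derivation[OF \<delta>])
  note p = DerLA_props[OF \<delta>]
  have "act P (op_scale P z \<delta>) X = lie SA (\<lambda>a. cmul P z (\<delta> a)) (\<lambda>u. cmul P z (prB P (\<delta> u))) X"
    unfolding act_eq
    by (rule lie_cong[OF cB_VF[OF X]])
      (simp_all add: op_scale_def prB_fmul prA_fmul smooth_const p(4) SA_S SB_S prA_A pair_derivation.\<delta>_A[OF s])
  also have "\<dots> = smc z (act P \<delta> X)"
    unfolding pair_derivation.act_aB[OF s X]
    by (rule lie_scale[OF vmod_SB smooth_const X pair_derivation.hom_\<delta>A[OF s]])
  finally show ?thesis .
qed

lemma act_plus:
  assumes \<delta>: "\<delta> \<in> DerLA P" "\<delta>' \<in> DerLA P" and X: "cB k X"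
  shows "act P (\<delta> + \<delta>') X = act P \<delta> X + act P \<delta>' X"
proof -
  obtain s s' where s: "pair_derivation P \<delta> s" "pair_derivation P \<delta>' s'" using DerLA_pair_derivation[OF \<delta>(1)] DerLA_pair_derivation[OF \<delta>(2)] by metis
  note p = DerLA_props(4)[OF \<delta>(1)] DerLA_props(4)[OF \<delta>(2)]
  have "act P (\<delta> + \<delta>') X = lie SA (\<lambda>a. \<delta> a + \<delta>' a) (\<lambda>u. prB P (\<delta> u) + prB P (\<delta>' u)) X"
    unfolding act_eq
    by (rule lie_cong[OF cB_VF[OF X]])
      (simp_all add: plus_fun_apply[of \<delta>] prB_add prA_add p SA_S SB_S prA_A pair_derivation.\<delta>_A[OF s(1)] pair_derivation.\<delta>_A[OF s(2)])
  also have "\<dots> = act P \<delta> X + act P \<delta>' X"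
    unfolding pair_derivation.act_aB[OF s(1) X] pair_derivation.act_aB[OF s(2) X]
    by (rule lie_plus[OF vmod_SB X pair_derivation.hom_\<delta>A[OF s(1)] pair_derivation.hom_\<delta>A[OF s(2)]])
  finally show ?thesis .
qed

text \<open>The operators pr_B o \<open>\<delta>\<close> compose like the derivations themselves
  because both preserve A, so the inner projection may be dropped
  (\<open>\<delta>B_prB\<close>).\<close>

lemma act_commutator:
  assumes \<delta>: "\<delta> \<in> DerLA P" "\<delta>' \<in> DerLA P" and X: "cB k X"
  shows "act P (commutator \<delta> \<delta>') X = act P \<delta> (act P \<delta>' X) - act P \<delta>' (act P \<delta> X)"
proof -
  obtain s s' where s: "pair_derivation P \<delta> s" "pair_derivation P \<delta>' s'" using DerLA_pair_derivation[OF \<delta>(1)] DerLA_pair_derivation[OF \<delta>(2)] by metis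
  note p = DerLA_props(4)[OF \<delta>(1)] DerLA_props(4)[OF \<delta>(2)]
  note A = pair_derivation.\<delta>_A[OF s(1)] pair_derivation.\<delta>_A[OF s(2)]
  have "act P \<delta> (act P \<delta>' X) - act P \<delta>' (act P \<delta> X)
    = lie SA (\<lambda>a. \<delta> (\<delta>' a) - \<delta>' (\<delta> a)) (\<lambda>u. prB P (\<delta> (prB P (\<delta>' u))) - prB P (\<delta>' (prB P (\<delta> u)))) X"
    unfolding pair_derivation.act_aB[OF s(1) X] pair_derivation.act_aB[OF s(2) X]
      pair_derivation.act_aB[OF s(1) pair_derivation.cB_aB[OF s(2) X]] pair_derivation.act_aB[OF s(2) pair_derivation.cB_aB[OF s(1) X]]
    by (rule lie_commute[OF vmod_SB X pair_derivation.hom_\<delta>A[OF s(1)] pair_derivation.hom_\<delta>A[OF s(2)]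
          pair_derivation.hom_\<delta>B[OF s(1)] pair_derivation.hom_\<delta>B[OF s(2)]])
  also have "\<dots> = act P (commutator \<delta> \<delta>') X"
    unfolding act_eq
    by (rule lie_cong[OF cB_VF[OF X]])
      (simp_all add: commutator_def prA_A A subgrpD(2)[OF subgrp_SA] pair_derivation.\<delta>B_prB[OF s(1)] pair_derivation.\<delta>B_prB[OF s(2)] p SB_S
        hom_diff[OF hom_prB subgrp_S])
  finally show ?thesis by simp
qed

end

section \<open>Bracket and Leibniz rule on cohomology\<close>

context pair_derivation
begin

text \<open>For closed \<open>X\<close> and \<open>Y\<close> only one term of
  \<open>d_insertion\<close> survives, so the insertion \<open>?j\<close> is a primitive up to
  sign.\<close>

lemma shuf_MB_exact:
  assumes X: "cB k X" "dN X = 0" and Y: "cB l Y" "dN Y = 0"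
  shows "shuf k X (\<lambda>v. MB v Y) \<in> exact_forms P (k + l)"
proof -
  let ?j = "shuf k X (\<lambda>v. ins (h v) Y)"
  have \<Phi>: "hom SB (VF SA SB) (\<lambda>v. ins (h v) Y)"
    by (rule hom_comp[OF hom_h hom_cf_ins[OF vmod_SB Y(1)]])
  have "dN ?j = sg k (shuf k X (\<lambda>v. MB v Y))"
    using d_insertion[OF X(1) Y(1)] shuf_zero[OF subgrp_SB \<Phi>, of "Suc k"] by (simp add: X(2) Y(2) shuf_op_zero)
  then have eq: "shuf k X (\<lambda>v. MB v Y) = sg k (dN ?j)" by simp
  show ?thesis
  \<comment> \<open>In degree l = 0 contractions of \<open>Y\<close> vanish, so \<open>?j\<close> is
    0 and the form itself is 0. For l > 0, \<open>?j\<close> is a form of degree k + l - 1, as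
    exactness demands.\<close>
  proof (cases l)
    case 0
    have "shuf k X (\<lambda>v. ins (h v) Y) = shuf k X (\<lambda>v. 0)"
      using Y(1) 0 by (intro shuf_cong[OF cB_VF[OF X(1)]]) auto
    then have "?j = 0" using shuf_op_zero by metis
    then show ?thesis
      using eq d_zero[OF conn_nabla] subgrpD(1)[OF subgrp_exact] by simp
  next
    case (Suc l')
    have "dN ?j \<in> exact_forms P (k + l)"
      using cB_insertion[OF X(1), of l' Y] Y(1) Suc exact_Suc[of "dN ?j" "k + l'"] by auto
    then show ?thesis unfolding eq by (rule subgrpD(5)[OF subgrp_exact])
  qed
qed

end

context pair_bracket
begin

lemma brk_closed: "cB k X \<Longrightarrow> dN X = 0 \<Longrightarrow> cB l Y \<Longrightarrow> dN Y = 0 \<Longrightarrow> dN (brk X Y) = 0"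
  using dN_brk[of k X l Y] hom_0[OF hom_brk[of k X] subgrp_cB] hom_0[OF hom_brk_left[of l Y] subgrp_cB]
  by simp

text \<open>For closed \<open>X\<close>, the Leibniz rule for d makes the bracket of
  \<open>X\<close> with dW equal, up to sign, to the differential of the bracket of \<open>X\<close>
  with W.\<close>

lemma brk_exact_right:
  assumes X: "cB k X" "dN X = 0" and Z: "Z \<in> exact_forms P l"
  shows "brk X Z \<in> exact_forms P (k + l)"
proof (cases l)
  case 0
  then have "Z = 0" using Z by (simp add: exact_0)
  then show ?thesis using hom_0[OF hom_brk[OF X(1)] subgrp_cB] subgrpD(1)[OF subgrp_exact] by simp
next
  case (Suc m)
  then obtain W where W: "cB m W" "Z = dN W" using Z unfolding Suc exact_Suc by auto
  have "dN (brk X W) = sg k (brk X Z)"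
    using dN_brk[OF X(1) W(1)] hom_0[OF hom_brk_left[OF W(1)] subgrp_cB] by (simp add: X(2) W(2))
  then have "brk X Z = sg k (dN (brk X W))" by simp
  moreover have "dN (brk X W) \<in> exact_forms P (k + l)"
    using brk_in[OF X(1) W(1)] Suc exact_Suc[of "dN (brk X W)" "k + m"] by auto
  ultimately show ?thesis using subgrpD(5)[OF subgrp_exact] by simp
qed

lemma brk_exact_left:
  assumes Y: "cB l Y" "dN Y = 0" and Z: "Z \<in> exact_forms P k"
  shows "brk Z Y \<in> exact_forms P (k + l)"
  using brk_exact_right[OF Y Z] exact_closed[OF Z] brk_skew[of k Z l Y] Y(1)
  by (simp add: subgrpD[OF subgrp_exact] add.commute)

lemma cls_br_cls:
  assumes X: "cB k X" "dN X = 0" and Y: "cB l Y" "dN Y = 0"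
  shows "cls_br P brk k l (cls P k X) (cls P l Y) = cls P (k + l) (brk X Y)"
  unfolding cls_br_def
proof (rule cls_eqI)
  let ?X = "rep (cls P k X)" and ?Y = "rep (cls P l Y)"
  note rX = rep_cls[OF X(1)] and rY = rep_cls[OF Y(1)]
  have "dN ?X = 0"
    using exact_closed[OF rX(2)] hom_diff[OF hom_d[OF conn_nabla] subgrp_VF[OF subgrp_SB] cB_VF[OF rX(1)] cB_VF[OF X(1)]] X(2)
    by simp
  \<comment> \<open>The representatives are changed one after the other. The first change needs the
    new representative \<open>?X\<close> to be closed, the second uses that \<open>Y\<close>
    is.\<close>
  have "brk ?X ?Y - brk X Y = brk ?X (?Y - Y) + brk (?X - X) Y"
    using hom_diff[OF hom_brk[OF rX(1)] subgrp_cB, of ?Y l Y] hom_diff[OF hom_brk_left[OF Y(1)] subgrp_cB, of ?X k X]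
      rX(1) rY(1) X(1) Y(1) by simp
  also have "\<dots> \<in> exact_forms P (k + l)"
    by (rule subgrpD(4)[OF subgrp_exact brk_exact_right[OF rX(1) \<open>dN ?X = 0\<close> rY(2)] brk_exact_left[OF Y rX(2)]])
  finally show "brk ?X ?Y - brk X Y \<in> exact_forms P (k + l)" .
qed

text \<open>The defect in \<open>aB_brk\<close> consists of two shuffles of \<open>MB\<close> with
  the roles of \<open>X\<close> and \<open>Y\<close> exchanged, each of which is exact.\<close>

lemma act_brk_exact:
  assumes \<delta>: "\<delta> \<in> DerLA P" and X: "cB k X" "dN X = 0" and Y: "cB l Y" "dN Y = 0"
  shows "act P \<delta> (brk X Y) - (brk (act P \<delta> X) Y + brk X (act P \<delta> Y)) \<in> exact_forms P (k + l)"
proof -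
  obtain s where "pair_derivation P \<delta> s" by (rule DerLA_pair_derivation[OF \<delta>])
  then interpret D: pair_derivation P \<delta> s .
  interpret DB: pair_bracket_derivation P rho1 brk \<delta> s ..
  have "act P \<delta> (brk X Y) - (brk (act P \<delta> X) Y + brk X (act P \<delta> Y))
    = shuf k X (\<lambda>v. D.MB v Y) - sg (k * l) (shuf l Y (\<lambda>v. D.MB v X))"
    using DB.aB_brk[OF X(1) Y(1)] by (simp add: D.act_aB[OF X(1)] D.act_aB[OF Y(1)] D.act_aB[OF brk_in[OF X(1) Y(1)]])
  also have "\<dots> \<in> exact_forms P (k + l)"
    using D.shuf_MB_exact[OF X Y] D.shuf_MB_exact[OF Y X] by (simp add: subgrpD[OF subgrp_exact] add.commute)
  finally show ?thesis .
qed

end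

theorem corollary4p6:
  fixes P :: "('m::{t2_space, second_countable_topology}, 'k::{real_normed_field, euclidean_space},
               'v::ab_group_add) lie_pair"
    and \<rho>\<^sub>1 :: "(('m \<Rightarrow> 'v) list \<Rightarrow> 'm \<Rightarrow> 'v) \<Rightarrow> (('m \<Rightarrow> 'v) list \<Rightarrow> 'm \<Rightarrow> 'k)
               \<Rightarrow> ('m \<Rightarrow> 'v) list \<Rightarrow> 'm \<Rightarrow> 'k"
    and br :: "(('m \<Rightarrow> 'v) list \<Rightarrow> 'm \<Rightarrow> 'v) \<Rightarrow> (('m \<Rightarrow> 'v) list \<Rightarrow> 'm \<Rightarrow> 'v)
               \<Rightarrow> ('m \<Rightarrow> 'v) list \<Rightarrow> 'm \<Rightarrow> 'v"
  assumes "split_lie_pair P"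
    and "is_rho1 P \<rho>\<^sub>1"
    and "is_binary_bracket P \<rho>\<^sub>1 br"
  shows "DerLA P = {\<delta>\<in>Der P. \<delta> ` secA P \<subseteq> secA P} \<and>
    lie_algebra_on (op_scale P) (DerLA P) commutator \<and>
    (\<forall>\<delta>\<in>DerLA P. \<forall>k. \<forall>X\<in>closed_forms P k.
       act P \<delta> X \<in> closed_forms P k \<and> cls_act P k \<delta> (cls P k X) = cls P k (act P \<delta> X)) \<and>
    (\<forall>\<delta>\<in>DerLA P. \<forall>k. \<forall>c\<in>HCE P k. \<forall>c'\<in>HCE P k. \<forall>z.
       cls_act P k \<delta> (cls_add P k c c') = cls_add P k (cls_act P k \<delta> c) (cls_act P k \<delta> c') \<and>
       cls_act P k \<delta> (cls_scale P k z c) = cls_scale P k z (cls_act P k \<delta> c)) \<and>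
    (\<forall>\<delta>\<in>DerLA P. \<forall>\<delta>'\<in>DerLA P. \<forall>k. \<forall>c\<in>HCE P k. \<forall>z.
       cls_act P k (\<delta> + \<delta>') c = cls_add P k (cls_act P k \<delta> c) (cls_act P k \<delta>' c) \<and>
       cls_act P k (op_scale P z \<delta>) c = cls_scale P k z (cls_act P k \<delta> c) \<and>
       cls_act P k (commutator \<delta> \<delta>') c =
         cls_add P k (cls_act P k \<delta> (cls_act P k \<delta>' c))
           (cls_scale P k (-1) (cls_act P k \<delta>' (cls_act P k \<delta> c)))) \<and>
    (\<forall>k l. \<forall>X\<in>closed_forms P k. \<forall>Y\<in>closed_forms P l.
       br X Y \<in> closed_forms P (k + l) \<and> cls_br P br k l (cls P k X) (cls P l Y) = cls P (k + l) (br X Y)) \<and>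
    (\<forall>\<delta>\<in>DerLA P. \<forall>k l. \<forall>c\<^sub>1\<in>HCE P k. \<forall>c\<^sub>2\<in>HCE P l.
       cls_act P (k + l) \<delta> (cls_br P br k l c\<^sub>1 c\<^sub>2) =
         cls_add P (k + l) (cls_br P br k l (cls_act P k \<delta> c\<^sub>1) c\<^sub>2)
           (cls_br P br k l c\<^sub>1 (cls_act P l \<delta> c\<^sub>2)))"
proof -
  interpret pair_bracket P \<rho>\<^sub>1 br
    by unfold_locales (rule assms)+
  have HCE: "\<exists>X. c = cls P k X \<and> cB k X \<and> dN X = 0" if "c \<in> HCE P k" for c k
    using that unfolding HCE_def by (auto simp: closed_iff)
  show ?thesis
  proof (intro conjI ballI allI)
    show "DerLA P = {\<delta>\<in>Der P. \<delta> ` secA P \<subseteq> secA P}" by (rule DerLA_eq)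
    show "lie_algebra_on (op_scale P) (DerLA P) commutator" by (rule lie_algebra_DerLA)
  next
    fix \<delta> k X assume \<delta>: "\<delta> \<in> DerLA P" and X: "X \<in> closed_forms P k"
    from X have X': "cB k X" "dN X = 0" by (simp_all add: closed_iff)
    show "act P \<delta> X \<in> closed_forms P k"
      using act_cB[OF \<delta> X'(1)] act_closed[OF \<delta> X'] by (simp add: closed_iff)
    show "cls_act P k \<delta> (cls P k X) = cls P k (act P \<delta> X)"
      using X by (intro cls_act_cls[OF \<delta>]) (simp add: closed_iff)
  next
    fix \<delta> k c c' z assume \<delta>: "\<delta> \<in> DerLA P" and "c \<in> HCE P k" "c' \<in> HCE P k"
    then obtain X Y where c: "c = cls P k X" "c' = cls P k Y" and X: "cB k X" and Y: "cB k Y" using HCE by metis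
    show "cls_act P k \<delta> (cls_add P k c c') = cls_add P k (cls_act P k \<delta> c) (cls_act P k \<delta> c')"
      unfolding c by (simp add: cls_add_cls cls_act_cls[OF \<delta>] X Y act_cB[OF \<delta>] cf_add[OF vmod_SB] act_add[OF \<delta> X Y])
    show "cls_act P k \<delta> (cls_scale P k z c) = cls_scale P k z (cls_act P k \<delta> c)"
      unfolding c by (simp add: cls_scale_cls cls_act_cls[OF \<delta>] X act_cB[OF \<delta>] cB_smc act_smc[OF \<delta> X])
  next
    fix \<delta> \<delta>' k c z assume \<delta>: "\<delta> \<in> DerLA P" and \<delta>': "\<delta>' \<in> DerLA P" and "c \<in> HCE P k"
    then obtain X where c: "c = cls P k X" and X: "cB k X" using HCE by metis
    show "cls_act P k (\<delta> + \<delta>') c = cls_add P k (cls_act P k \<delta> c) (cls_act P k \<delta>' c)"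
      unfolding c by (simp add: cls_add_cls cls_act_cls[OF \<delta>] cls_act_cls[OF \<delta>'] cls_act_cls[OF DerLA_add[OF \<delta> \<delta>']]
          X act_cB[OF \<delta>] act_cB[OF \<delta>'] act_plus[OF \<delta> \<delta>' X])
    show "cls_act P k (op_scale P z \<delta>) c = cls_scale P k z (cls_act P k \<delta> c)"
      unfolding c by (simp add: cls_scale_cls cls_act_cls[OF \<delta>] cls_act_cls[OF DerLA_scale[OF \<delta>]] X act_cB[OF \<delta>]
          act_op_scale[OF \<delta> X])
    show "cls_act P k (commutator \<delta> \<delta>') c = cls_add P k (cls_act P k \<delta> (cls_act P k \<delta>' c))
           (cls_scale P k (-1) (cls_act P k \<delta>' (cls_act P k \<delta> c)))"
      unfolding c by (simp add: cls_add_cls cls_scale_cls cls_act_cls[OF \<delta>] cls_act_cls[OF \<delta>']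
          cls_act_cls[OF DerLA_commutator[OF \<delta> \<delta>']] X act_cB[OF \<delta>] act_cB[OF \<delta>'] cB_smc
          act_commutator[OF \<delta> \<delta>' X] smc_minus_one cf_minus[OF vmod_SB])
  next
    fix k l X Y assume "X \<in> closed_forms P k" "Y \<in> closed_forms P l"
    then have X: "cB k X" "dN X = 0" and Y: "cB l Y" "dN Y = 0" by (simp_all add: closed_iff)
    show "br X Y \<in> closed_forms P (k + l)"
      using brk_in[OF X(1) Y(1)] brk_closed[OF X Y] by (simp add: closed_iff)
    show "cls_br P br k l (cls P k X) (cls P l Y) = cls P (k + l) (br X Y)"
      by (rule cls_br_cls[OF X Y])
  next
    fix \<delta> k l c\<^sub>1 c\<^sub>2 assume \<delta>: "\<delta> \<in> DerLA P" and "c\<^sub>1 \<in> HCE P k" "c\<^sub>2 \<in> HCE P l"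
    then obtain X Y where c: "c\<^sub>1 = cls P k X" "c\<^sub>2 = cls P l Y" and X: "cB k X" "dN X = 0" and Y: "cB l Y" "dN Y = 0"
      using HCE by metis
    note aX = act_cB[OF \<delta> X(1)] act_closed[OF \<delta> X] and aY = act_cB[OF \<delta> Y(1)] act_closed[OF \<delta> Y]
    have "cls P (k + l) (act P \<delta> (br X Y)) = cls P (k + l) (br (act P \<delta> X) Y + br X (act P \<delta> Y))"
      by (rule cls_eqI[OF act_brk_exact[OF \<delta> X Y]])
    then show "cls_act P (k + l) \<delta> (cls_br P br k l c\<^sub>1 c\<^sub>2) =
         cls_add P (k + l) (cls_br P br k l (cls_act P k \<delta> c\<^sub>1) c\<^sub>2)
           (cls_br P br k l c\<^sub>1 (cls_act P l \<delta> c\<^sub>2))"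
      unfolding c
      by (simp add: cls_act_cls[OF \<delta>] X(1) Y(1) cls_br_cls[OF X Y] cls_br_cls[OF aX Y] cls_br_cls[OF X aY]
          brk_in[OF X(1) Y(1)] cls_add_cls brk_in[OF aX(1) Y(1)] brk_in[OF X(1) aY(1)])
  qed
qed

end
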